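(* Let $\kappa\in(0,\frac12)$. For every probability measure $\mu$ on $(-1,1)$ and every $s\ge0$, $$\lim_{t\to\infty}\frac1t\int_s^t\mathbb{P}_{\mu,s}(X_u\in\cdot\mid\tau_X>t)\,du=\beta_{Bm}.$$
   Context: For $s\ge 0$ and $x\in\mathbb{R}$, let $\mathbb{P}_{x,s}$ be a probability measure under which $(X_t)_{t\ge s}$ is given by $X_t=\frac{x(s+1)^\kappa+W_{t-s}}{(t+1)^\kappa}$, with $W$ a standard Brownian motion started at $0$; $\tau_X:=\inf\{t\ge s:|X_t|=1\}$; $\mathbb{P}_{\mu,s}=\int\mathbb{P}_{x,s}\mu(dx)$. Let $\tilde B$ be a standard Brownian motion and $\tau_{\tilde B}=\inf\{t\ge0:|\tilde B_t|=1\}$. $\alpha_{Bm}$ is the unique quasi-stationary distribution of $\tilde B$ absorbed at $\pm1$, $\lambda_{Bm}=\pi^2/8$ satisfies $\mathbb{P}^{\tilde B}_{\alpha_{Bm}}(\tau_{\tilde B}>t)=e^{-\lambda_{Bm}t}$, $\eta_{Bm}(x):=\lim_{t\to\infty}e^{\lambda_{Bm}t}\mathbb{P}^{\tilde B}_x(\tau_{\tilde B}>t)$ (so $\int\eta_{Bm}d\alpha_{Bm}=1$), and $\beta_{Bm}(dx):=\eta_{Bm}(x)\alpha_{Bm}(dx)$. The limit is in the sense of weak convergence of measures. *)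

theory Defs
  imports "HOL-Probability.Probability"
begin

definition std_BM :: "'a measure \<Rightarrow> (real \<Rightarrow> 'a \<Rightarrow> real) \<Rightarrow> bool" where
  "std_BM M W \<longleftrightarrow> prob_space M
     \<and> (\<forall>t\<ge>0. W t \<in> borel_measurable M)
     \<and> (\<forall>\<omega>\<in>space M. W 0 \<omega> = 0)
     \<and> (\<forall>\<omega>\<in>space M. continuous_on {0..} (\<lambda>t. W t \<omega>))
     \<and> (\<forall>s t. 0 \<le> s \<longrightarrow> s < t \<longrightarrow>
          distributed M lborel (\<lambda>\<omega>. W t \<omega> - W s \<omega>) (\<lambda>x. ennreal (normal_density 0 (sqrt (t - s)) x)))
     \<and> (\<forall>(ts :: nat \<Rightarrow> real) n. 0 \<le> ts 0 \<longrightarrow> (\<forall>i<n. ts i < ts (Suc i)) \<longrightarrow>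
          prob_space.indep_vars M (\<lambda>_. borel) (\<lambda>i \<omega>. W (ts (Suc i)) \<omega> - W (ts i) \<omega>) {..<n})"

definition Xproc :: "real \<Rightarrow> (real \<Rightarrow> 'a \<Rightarrow> real) \<Rightarrow> real \<Rightarrow> real \<Rightarrow> real \<Rightarrow> 'a \<Rightarrow> real" where
  "Xproc \<kappa> W s x t \<omega> = (x * (s + 1) powr \<kappa> + W (t - s) \<omega>) / (t + 1) powr \<kappa>"

text \<open>tau_X = inf {t \<ge> s. |X_t| = 1} (in the extended reals, inf of the empty set = \<infinity>).\<close>
definition tauX :: "real \<Rightarrow> (real \<Rightarrow> 'a \<Rightarrow> real) \<Rightarrow> real \<Rightarrow> real \<Rightarrow> 'a \<Rightarrow> ereal" where
  "tauX \<kappa> W s x \<omega> = Inf (ereal ` {t. s \<le> t \<and> \<bar>Xproc \<kappa> W s x t \<omega>\<bar> = 1})"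

text \<open>E_{mu,s}[f(X_u); tau_X > t] and P_{mu,s}(tau_X > t), with P_{mu,s} = \<integral> P_{x,s} mu(dx).\<close>
definition Emu_surv :: "'a measure \<Rightarrow> real measure \<Rightarrow> real \<Rightarrow> (real \<Rightarrow> 'a \<Rightarrow> real) \<Rightarrow> real
    \<Rightarrow> (real \<Rightarrow> real) \<Rightarrow> real \<Rightarrow> real \<Rightarrow> real" where
  "Emu_surv M \<mu> \<kappa> W s f u t =
     (\<integral>x. (\<integral>\<omega>. f (Xproc \<kappa> W s x u \<omega>) * indicator {\<omega>. tauX \<kappa> W s x \<omega> > ereal t} \<omega> \<partial>M) \<partial>\<mu>)"

definition Pmu_surv :: "'a measure \<Rightarrow> real measure \<Rightarrow> real \<Rightarrow> (real \<Rightarrow> 'a \<Rightarrow> real) \<Rightarrow> real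
    \<Rightarrow> real \<Rightarrow> real" where
  "Pmu_surv M \<mu> \<kappa> W s t =
     (\<integral>x. measure M {\<omega>\<in>space M. tauX \<kappa> W s x \<omega> > ereal t} \<partial>\<mu>)"

definition tauB :: "(real \<Rightarrow> 'a \<Rightarrow> real) \<Rightarrow> real \<Rightarrow> 'a \<Rightarrow> ereal" where
  "tauB W x \<omega> = Inf (ereal ` {t. 0 \<le> t \<and> \<bar>x + W t \<omega>\<bar> = 1})"

definition is_QSD_Bm :: "'a measure \<Rightarrow> (real \<Rightarrow> 'a \<Rightarrow> real) \<Rightarrow> real measure \<Rightarrow> bool" where
  "is_QSD_Bm M W \<alpha> \<longleftrightarrow> sets \<alpha> = sets borel \<and> prob_space \<alpha> \<and> emeasure \<alpha> {-1<..<1} = 1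
     \<and> (\<forall>t\<ge>0. (\<integral>x. measure M {\<omega>\<in>space M. tauB W x \<omega> > ereal t} \<partial>\<alpha>) > 0
         \<and> (\<forall>A\<in>sets borel.
             (\<integral>x. measure M {\<omega>\<in>space M. x + W t \<omega> \<in> A \<and> tauB W x \<omega> > ereal t} \<partial>\<alpha>)
             / (\<integral>x. measure M {\<omega>\<in>space M. tauB W x \<omega> > ereal t} \<partial>\<alpha>) = measure \<alpha> A))"

definition alpha_Bm :: "'a measure \<Rightarrow> (real \<Rightarrow> 'a \<Rightarrow> real) \<Rightarrow> real measure" where
  "alpha_Bm M W = (THE \<alpha>. is_QSD_Bm M W \<alpha>)"

definition lambda_Bm :: real where
  "lambda_Bm = pi\<^sup>2 / 8"

definition eta_Bm :: "'a measure \<Rightarrow> (real \<Rightarrow> 'a \<Rightarrow> real) \<Rightarrow> real \<Rightarrow> real" where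
  "eta_Bm M W x = Lim at_top (\<lambda>t. exp (lambda_Bm * t) * measure M {\<omega>\<in>space M. tauB W x \<omega> > ereal t})"

definition beta_Bm :: "'a measure \<Rightarrow> (real \<Rightarrow> 'a \<Rightarrow> real) \<Rightarrow> real measure" where
  "beta_Bm M W = density (alpha_Bm M W) (\<lambda>x. ennreal (eta_Bm M W x))"

end

theory Submission
  imports Defs
begin

text \<open>On \<open>|X| < 1\<close> up to time \<open>t\<close> the Brownian path stays below the barrier \<open>g r = (r + 1)^\<kappa>\<close>.
  Rescaling the path by \<open>g\<close> and running the clock \<open>dr / g^2\<close> turns this into a Brownian motion killed
  at \<open>\<plusminus>1\<close>, up to a Girsanov factor. That factor is controlled by \<open>g' g\<close> and by the integral of \<open>g'^2\<close>
  beyond the starting time \<open>U\<close>, both of order \<open>U^(2\<kappa>-1)\<close>, so for \<open>\<kappa> < 1/2\<close> it tends to 1 uniformly in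
  the horizon. On a time grid the comparison is a change of variables in Gaussian kernels, carried out one
  step at a time, so no stochastic integration is needed.

  Cut at \<open>s < U < u < t\<close>. Up to factors near 1 and a constant independent of \<open>f\<close>, the numerator is the law
  at \<open>U\<close> integrated against \<open>kill a (f * kill b 1)\<close>. When \<open>(u - U) / (g u)^2\<close> and \<open>(t - u) / (g t)^2\<close> are
  large, so are the clock durations \<open>a\<close> and \<open>b\<close>, and convergence of the killed semigroup to its ground
  state makes the ratio with the same expression for \<open>f = 1\<close> close to the integral of \<open>f * cos(\<pi> x / 2)^2\<close>,
  which is the \<open>\<beta>\<close>-mean. Since \<open>(g t)^2 = o(t)\<close>, the times \<open>u\<close> excluded by this contribute nothing
  to the Cesaro average.

  The spectral decomposition is obtained by reflection: the heat flow preserves functions that are odd about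
  both end points and, by optional stopping, agrees on them with the killed semigroup. This
  applies to the sines, which are dense in \<open>L^1\<close> of the interval.\<close>

text \<open>Three obstacles shape the argument. Time grids see a path only through weak
  inequalities, whereas hitting times are governed by strict ones; for the moving barrier the gap is
  closed by shrinking the barrier by factors tending to 1, for the constant barrier 1 by a null-set
  argument. The clock duration is never evaluated: a subsequential limit of grid clocks is used, of
  which only bounds are known, and this is harmless because the spectral limit controls all large
  durations at once. Finally, the comparison error is not small from time \<open>s\<close> on; hence
  \<open>U\<close> is chosen first, according to the tolerated error, and stays fixed while
  \<open>u\<close> and \<open>t\<close> grow. Of the law at \<open>U\<close> the limit uses that its
  mass is at most 1, that after rescaling it lives on the open unit interval, and that it integrates
  the ground state to a positive number, which cancels in the ratio. The square of the cosine has
  two origins: survival after \<open>u\<close> contributes one factor as the limit shape of the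
  survival probability, and the killed passage from \<open>U\<close> to \<open>u\<close> pairs the
  result with the other.\<close>

locale brownian =
  fixes M :: "'a measure" and W :: "real \<Rightarrow> 'a \<Rightarrow> real"
  assumes std_BM: "std_BM M W"

sublocale brownian \<subseteq> prob_space M
  using std_BM by (simp add: std_BM_def)

context brownian
begin

lemma W_measurable [measurable]: "t \<ge> 0 \<Longrightarrow> W t \<in> borel_measurable M"
  and W_0: "\<omega> \<in> space M \<Longrightarrow> W 0 \<omega> = 0"
  and W_continuous: "\<omega> \<in> space M \<Longrightarrow> continuous_on {0..} (\<lambda>t. W t \<omega>)"
  and W_increment: "0 \<le> s \<Longrightarrow> s < t \<Longrightarrow>
    distributed M lborel (\<lambda>\<omega>. W t \<omega> - W s \<omega>) (\<lambda>x. ennreal (normal_density 0 (sqrt (t - s)) x))"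
  and W_indep: "0 \<le> ts 0 \<Longrightarrow> (\<And>i. i < n \<Longrightarrow> ts i < ts (Suc i)) \<Longrightarrow>
    indep_vars (\<lambda>_. borel) (\<lambda>i \<omega>. W (ts (Suc i)) \<omega> - W (ts i) \<omega>) {..<n}"
  using std_BM by (auto simp: std_BM_def)

lemma W_continuous_shift: "\<omega> \<in> space M \<Longrightarrow> continuous_on {s..t} (\<lambda>r. W (r - s) \<omega>)"
  by (rule continuous_on_compose2[OF W_continuous]) (auto intro!: continuous_intros)

end

section \<open>Gaussian kernels and the Markov property at the last grid step\<close>

definition nn_gauss :: "real \<Rightarrow> (real \<Rightarrow> ennreal) \<Rightarrow> real \<Rightarrow> ennreal" where
  "nn_gauss \<delta> v x = (\<integral>\<^sup>+y. ennreal (normal_density x (sqrt \<delta>) y) * v y \<partial>lborel)"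

lemma nn_gauss_shift:
  assumes [measurable]: "v \<in> borel_measurable borel"
  shows "nn_gauss \<delta> v x = (\<integral>\<^sup>+y. ennreal (normal_density 0 (sqrt \<delta>) y) * v (x + y) \<partial>lborel)"
proof -
  have "nn_gauss \<delta> v x = (\<integral>\<^sup>+y. ennreal (normal_density x (sqrt \<delta>) (x + 1 * y)) * v (x + 1 * y) \<partial>lborel)"
    unfolding nn_gauss_def by (subst nn_integral_real_affine[where c=1 and t=x]) auto
  then show ?thesis by (simp add: normal_density_def)
qed

lemma nn_gauss_measurable [measurable]:
  assumes [measurable]: "v \<in> borel_measurable borel"
  shows "nn_gauss \<delta> v \<in> borel_measurable borel"
proof -
  have "(\<lambda>x. \<integral>\<^sup>+y. ennreal (normal_density 0 (sqrt \<delta>) y) * v (x + y) \<partial>lborel) \<in> borel_measurable borel"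
    by measurable
  then show ?thesis by (subst measurable_cong[OF nn_gauss_shift]) auto
qed

context brownian
begin

text \<open>The weights up to index \<open>k\<close> are functions of the first \<open>k\<close>
  increments, which are independent of the last one; Fubini integrates the last increment out as a
  Gaussian kernel. Values in \<open>ennreal\<close> avoid every integrability condition.\<close>

lemma nn_markov_step:
  fixes \<tau> :: "nat \<Rightarrow> real" and w :: "nat \<Rightarrow> real \<Rightarrow> ennreal" and v :: "real \<Rightarrow> ennreal"
  assumes \<tau>0: "\<tau> 0 = 0" and \<tau>: "\<And>i. i \<le> k \<Longrightarrow> \<tau> i < \<tau> (Suc i)"
    and w[measurable]: "\<And>i. w i \<in> borel_measurable borel" and v[measurable]: "v \<in> borel_measurable borel"
  shows "(\<integral>\<^sup>+\<omega>. (\<Prod>j\<le>k. w j (x + W (\<tau> j) \<omega>)) * v (x + W (\<tau> (Suc k)) \<omega>) \<partial>M) =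
    (\<integral>\<^sup>+\<omega>. (\<Prod>j\<le>k. w j (x + W (\<tau> j) \<omega>)) * nn_gauss (\<tau> (Suc k) - \<tau> k) v (x + W (\<tau> k) \<omega>) \<partial>M)"
proof -
  let ?I = "\<lambda>i \<omega>. W (\<tau> (Suc i)) \<omega> - W (\<tau> i) \<omega>"
  let ?X = "\<lambda>\<omega>. restrict (\<lambda>i. ?I i \<omega>) {..<k}"
  let ?Y = "\<lambda>\<omega>. restrict (\<lambda>i. ?I i \<omega>) {k}"
  let ?N = "PiM {..<k} (\<lambda>_. borel :: real measure)"
  \<comment> \<open>Positions are recovered from increments by telescoping, since the path starts at
    0; this is what makes independence of increments applicable.\<close>
  define p where "p j z = (\<Sum>i<j. z i)" for j :: nat and z :: "nat \<Rightarrow> real"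
  define \<Psi> where "\<Psi> z = (\<Prod>j\<le>k. w j (x + p j z))" for z
  have pos: "0 \<le> \<tau> i" if "i \<le> Suc k" for i
    using that by (induction i) (use \<tau>0 \<tau> in \<open>auto intro: order_trans less_imp_le\<close>)
  have [measurable]: "W (\<tau> i) \<in> borel_measurable M" if "i \<le> Suc k" for i
    using W_measurable pos that by auto
  have pm[measurable]: "p j \<in> borel_measurable ?N" if "j \<le> k" for j
    unfolding p_def using that by (intro borel_measurable_sum measurable_component_singleton) auto
  have [measurable]: "\<Psi> \<in> borel_measurable ?N"
    unfolding \<Psi>_def by measurable
  have pX: "p j (?X \<omega>) = W (\<tau> j) \<omega>" if "j \<le> k" "\<omega> \<in> space M" for j \<omega>
  proof -
    have "p j (?X \<omega>) = (\<Sum>i<j. ?I i \<omega>)" unfolding p_def using that by (intro sum.cong) auto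
    then show ?thesis using that by (simp add: sum_lessThan_telescope[of "\<lambda>i. W (\<tau> i) \<omega>"] \<tau>0 W_0)
  qed
  let ?K = "PiM {k} (\<lambda>_. borel :: real measure)"
  have ind: "indep_var ?N ?X ?K ?Y"
    by (rule indep_var_restrict[OF W_indep[of \<tau> "Suc k"]]) (use \<tau>0 \<tau> in auto)
  then have X[measurable]: "?X \<in> measurable M ?N" and Y[measurable]: "?Y \<in> measurable M ?K"
    by (auto dest: indep_var_rv1 indep_var_rv2)
  have I[measurable]: "?I k \<in> borel_measurable M" by measurable
  have eq: "distr M (?N \<Otimes>\<^sub>M ?K) (\<lambda>\<omega>. (?X \<omega>, ?Y \<omega>)) = distr M ?N ?X \<Otimes>\<^sub>M distr M ?K ?Y"
    using ind by (simp add: indep_var_distribution_eq)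
  have dk: "distr M lborel (?I k) = density lborel (\<lambda>x. ennreal (normal_density 0 (sqrt (\<tau> (Suc k) - \<tau> k)) x))"
    using W_increment[of "\<tau> k" "\<tau> (Suc k)"] pos[of k] \<tau>[of k] by (auto simp: distributed_def)
  interpret Y: prob_space "distr M ?K ?Y" by (rule prob_space_distr) measurable
  let ?G = "\<lambda>(z, y). \<Psi> z * v (x + p k z + y k)"
  have G[measurable]: "?G \<in> borel_measurable (?N \<Otimes>\<^sub>M ?K)" by measurable
  have inner: "(\<integral>\<^sup>+y. ?G (z, y) \<partial>distr M ?K ?Y) = \<Psi> z * nn_gauss (\<tau> (Suc k) - \<tau> k) v (x + p k z)"
    if z: "z \<in> space ?N" for z
  proof -
    have "(\<integral>\<^sup>+y. ?G (z, y) \<partial>distr M ?K ?Y) = (\<integral>\<^sup>+\<omega>. \<Psi> z * v (x + p k z + ?I k \<omega>) \<partial>M)"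
      by (subst nn_integral_distr) (auto simp: z)
    also have "\<dots> = (\<integral>\<^sup>+y. \<Psi> z * v (x + p k z + y) \<partial>distr M lborel (?I k))"
      by (subst nn_integral_distr) auto
    also have "\<dots> = \<Psi> z * nn_gauss (\<tau> (Suc k) - \<tau> k) v (x + p k z)"
      unfolding dk by (subst nn_gauss_shift)
        (auto simp: nn_integral_density nn_integral_cmult[symmetric] ac_simps)
    finally show ?thesis .
  qed
  have "(\<integral>\<^sup>+\<omega>. (\<Prod>j\<le>k. w j (x + W (\<tau> j) \<omega>)) * v (x + W (\<tau> (Suc k)) \<omega>) \<partial>M)
      = (\<integral>\<^sup>+\<omega>. ?G (?X \<omega>, ?Y \<omega>) \<partial>M)"
    unfolding \<Psi>_def by (intro nn_integral_cong) (auto simp: pX algebra_simps intro!: arg_cong2[where f="(*)"] prod.cong)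
  also have "\<dots> = (\<integral>\<^sup>+zy. ?G zy \<partial>(distr M ?N ?X \<Otimes>\<^sub>M distr M ?K ?Y))"
    unfolding eq[symmetric] by (subst nn_integral_distr) (use G in auto)
  also have "\<dots> = (\<integral>\<^sup>+z. \<integral>\<^sup>+y. ?G (z, y) \<partial>distr M ?K ?Y \<partial>distr M ?N ?X)"
    by (subst Y.nn_integral_fst[symmetric]) auto
  also have "\<dots> = (\<integral>\<^sup>+z. \<Psi> z * nn_gauss (\<tau> (Suc k) - \<tau> k) v (x + p k z) \<partial>distr M ?N ?X)"
    by (intro nn_integral_cong inner) auto
  also have "\<dots> = (\<integral>\<^sup>+\<omega>. \<Psi> (?X \<omega>) * nn_gauss (\<tau> (Suc k) - \<tau> k) v (x + p k (?X \<omega>)) \<partial>M)"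
    by (subst nn_integral_distr) auto
  also have "\<dots> = (\<integral>\<^sup>+\<omega>. (\<Prod>j\<le>k. w j (x + W (\<tau> j) \<omega>)) * nn_gauss (\<tau> (Suc k) - \<tau> k) v (x + W (\<tau> k) \<omega>) \<partial>M)"
    unfolding \<Psi>_def by (intro nn_integral_cong) (auto simp: pX intro!: arg_cong2[where f="(*)"] prod.cong)
  finally show ?thesis .
qed

end

section \<open>Survival below a barrier\<close>

text \<open>The first grid point beyond \<open>r1\<close> has its predecessor at or before
  \<open>r1\<close>; a step shorter than \<open>r2 - r1\<close> cannot carry it past
  \<open>r2\<close>.\<close>

lemma grid_hits_interval:
  fixes a :: "nat \<Rightarrow> real"
  assumes "a 0 \<le> r1" "r1 < a N" "\<And>j. j < N \<Longrightarrow> a (Suc j) - a j < r2 - r1"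
  shows "\<exists>j\<le>N. r1 < a j \<and> a j < r2"
proof -
  define j where "j = (LEAST j. r1 < a j)"
  have j: "r1 < a j" "j \<le> N" unfolding j_def using assms(2) by (auto intro: LeastI Least_le)
  then obtain i where i: "j = Suc i" using assms(1) by (cases j) auto
  have "a i \<le> r1" using not_less_Least[of i "\<lambda>j. r1 < a j"] i by (auto simp: j_def[symmetric])
  then show ?thesis using assms(3)[of i] i j by force
qed

text \<open>A single violating time could be missed by every grid; continuity turns it into an
  interval of violations, which every fine grid meets.\<close>

lemma interval_above_barrier:
  fixes y b :: "real \<Rightarrow> real"
  assumes "continuous_on {s..t} y" "continuous_on {s..t} b" "s < t" "r \<in> {s..t}" "b r < \<bar>y r\<bar>"
  shows "\<exists>r1 r2. s \<le> r1 \<and> r1 < r2 \<and> r2 \<le> t \<and> (\<forall>r\<in>{r1<..<r2}. b r < \<bar>y r\<bar>)"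
proof -
  have "continuous_on {s..t} (\<lambda>r. \<bar>y r\<bar> - b r)" using assms by (intro continuous_intros)
  then obtain d where d: "d > 0" "\<forall>r'\<in>{s..t}. dist r' r < d \<longrightarrow> dist (\<bar>y r'\<bar> - b r') (\<bar>y r\<bar> - b r) < \<bar>y r\<bar> - b r"
    using assms unfolding continuous_on_iff by (metis diff_gt_0_iff_gt)
  have "b r' < \<bar>y r'\<bar>" if "r' \<in> {max s (r - d) <..< min t (r + d)}" for r'
  proof -
    have "dist r' r < d" "r' \<in> {s..t}" using that by (auto simp: dist_real_def)
    then have "dist (\<bar>y r'\<bar> - b r') (\<bar>y r\<bar> - b r) < \<bar>y r\<bar> - b r" using d by blast
    then show ?thesis by (auto simp: dist_real_def)
  qed
  then show ?thesis using assms d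
    by (intro exI[of _ "max s (r - d)"] exI[of _ "min t (r + d)"]) auto
qed

text \<open>Factors below 1 that tend to 1, through which strict survival below \<open>b\<close>
  becomes the limit of weak survival below \<open>shrink m * b\<close>. The offset 2 keeps the first
  factor positive.\<close>

definition shrink :: "nat \<Rightarrow> real" where "shrink m = 1 - 1 / real (m + 2)"

lemma shrink_bounds: "0 < shrink m" "shrink m < 1"
  by (auto simp: shrink_def)

lemma shrink_tendsto: "shrink \<longlonglongrightarrow> 1"
  unfolding shrink_def by real_asymp

lemma shrink_eventually: "q < 1 \<Longrightarrow> \<forall>\<^sub>F m in sequentially. q < shrink m"
  using order_tendstoD(1)[OF shrink_tendsto] .

text \<open>By compactness the ratio of path to barrier attains its maximum, which is below 1 and is
  therefore exceeded by all late factors \<open>shrink m\<close>.\<close>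

lemma strict_barrier_eventually:
  fixes y b :: "real \<Rightarrow> real"
  assumes "continuous_on {s..t} y" "continuous_on {s..t} b" "\<And>r. r \<in> {s..t} \<Longrightarrow> 0 < b r"
    and "s \<le> t" "\<And>r. r \<in> {s..t} \<Longrightarrow> \<bar>y r\<bar> < b r"
  shows "\<forall>\<^sub>F m in sequentially. \<forall>r\<in>{s..t}. \<bar>y r\<bar> \<le> shrink m * b r"
proof -
  have "continuous_on {s..t} (\<lambda>r. \<bar>y r\<bar> / b r)"
    using assms by (intro continuous_intros) force+
  then obtain r0 where r0: "r0 \<in> {s..t}" "\<forall>r\<in>{s..t}. \<bar>y r\<bar> / b r \<le> \<bar>y r0\<bar> / b r0"
    using continuous_attains_sup[of "{s..t}" "\<lambda>r. \<bar>y r\<bar> / b r"] assms(4) by auto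
  have "\<bar>y r0\<bar> / b r0 < 1" using assms(3,5) r0 by (simp add: divide_simps)
  from shrink_eventually[OF this] show ?thesis
  proof eventually_elim
    case (elim m)
    show ?case
    proof
      fix r assume r: "r \<in> {s..t}"
      then have "\<bar>y r\<bar> / b r \<le> shrink m" using r0 elim by force
      then show "\<bar>y r\<bar> \<le> shrink m * b r" using assms(3)[OF r] by (simp add: divide_simps)
    qed
  qed
qed

section \<open>Survival events and their approximation by time grids\<close>

context brownian
begin

text \<open>Barrier times are absolute, path times start afresh at \<open>s\<close>. The strict
  version is the one that hitting times see; the weak version \<open>csurv\<close> is the limit of
  the finite-dimensional events \<open>cgrid\<close>, which cannot detect that a path touches the
  barrier without crossing it.\<close>

definition surv :: "(real \<Rightarrow> real) \<Rightarrow> real \<Rightarrow> real \<Rightarrow> real \<Rightarrow> 'a set" where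
  "surv b s t y = {\<omega>\<in>space M. \<forall>r\<in>{s..t}. \<bar>y + W (r - s) \<omega>\<bar> < b r}"

definition csurv :: "(real \<Rightarrow> real) \<Rightarrow> real \<Rightarrow> real \<Rightarrow> real \<Rightarrow> 'a set" where
  "csurv b s t y = {\<omega>\<in>space M. \<forall>r\<in>{s..t}. \<bar>y + W (r - s) \<omega>\<bar> \<le> b r}"

definition cgrid :: "(nat \<Rightarrow> real) \<Rightarrow> (nat \<Rightarrow> real) \<Rightarrow> nat \<Rightarrow> real \<Rightarrow> 'a set" where
  "cgrid c \<tau> n y = {\<omega>\<in>space M. \<forall>j\<le>n. \<bar>y + W (\<tau> j) \<omega>\<bar> \<le> c j}"

text \<open>With \<open>Suc n\<close> cells the end point \<open>T\<close> has index
  \<open>Suc n\<close>, and the denominator never vanishes.\<close>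

definition ugrid :: "real \<Rightarrow> nat \<Rightarrow> nat \<Rightarrow> real" where
  "ugrid T n j = T * real j / real (Suc n)"

lemma ugrid_simps [simp]: "ugrid T n 0 = 0" "ugrid T n (Suc n) = T"
  by (auto simp: ugrid_def divide_simps)

lemma ugrid_step: "ugrid T n (Suc j) - ugrid T n j = T / real (Suc n)"
  by (simp add: ugrid_def add_divide_distrib[symmetric] diff_divide_distrib[symmetric] algebra_simps)

lemma ugrid_mono: "T > 0 \<Longrightarrow> ugrid T n j < ugrid T n (Suc j)"
  using ugrid_step[of T n j] by (simp add: field_simps) (metis ugrid_step diff_gt_0_iff_gt divide_pos_pos of_nat_0_less_iff zero_less_Suc)

lemma ugrid_nonneg: "T \<ge> 0 \<Longrightarrow> 0 \<le> ugrid T n j"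
  by (simp add: ugrid_def)

lemma ugrid_le: "T \<ge> 0 \<Longrightarrow> j \<le> Suc n \<Longrightarrow> ugrid T n j \<le> T"
  by (simp add: ugrid_def divide_simps mult_left_mono)

text \<open>Stronger than convergence of indicators: for each path the two memberships agree from
  some grid on. A weak survivor passes every grid, a violator fails on an interval that fine grids
  hit.\<close>

lemma cgrid_eventually_csurv:
  assumes \<omega>: "\<omega> \<in> space M" and b: "continuous_on {s..t} b" and st: "s < t"
    and c: "\<And>n j. j \<le> Suc n \<Longrightarrow> c n j = b (s + ugrid (t - s) n j)"
  shows "\<forall>\<^sub>F n in sequentially. \<omega> \<in> cgrid (c n) (ugrid (t - s) n) (Suc n) y \<longleftrightarrow> \<omega> \<in> csurv b s t y"
proof (cases "\<omega> \<in> csurv b s t y")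
  case True
  have "\<omega> \<in> cgrid (c n) (ugrid (t - s) n) (Suc n) y" for n
    using \<omega> unfolding cgrid_def
  proof (intro CollectI conjI allI impI)
    fix j assume j: "j \<le> Suc n"
    have "s + ugrid (t - s) n j \<in> {s..t}" using ugrid_nonneg[of "t-s" n j] ugrid_le[OF _ j, of "t-s"] st by auto
    then show "\<bar>y + W (ugrid (t - s) n j) \<omega>\<bar> \<le> c n j"
      using True c[OF j] unfolding csurv_def by (auto dest!: bspec[where x="s + ugrid (t - s) n j"])
  qed
  then show ?thesis using True by simp
next
  case False
  then obtain r where r: "r \<in> {s..t}" "b r < \<bar>y + W (r - s) \<omega>\<bar>" using \<omega> by (force simp: csurv_def)
  have cy: "continuous_on {s..t} (\<lambda>r. y + W (r - s) \<omega>)"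
    by (intro continuous_intros W_continuous_shift \<omega>)
  obtain r1 r2 where r12: "s \<le> r1" "r1 < r2" "r2 \<le> t" "\<forall>r\<in>{r1<..<r2}. b r < \<bar>y + W (r - s) \<omega>\<bar>"
    using interval_above_barrier[OF cy b st r] by auto
  have "(\<lambda>n. (t - s) / real (Suc n)) \<longlonglongrightarrow> 0" by real_asymp
  then have "\<forall>\<^sub>F n in sequentially. (t - s) / real (Suc n) < r2 - r1"
    by (rule order_tendstoD) (use r12 in auto)
  then show ?thesis
  proof eventually_elim
    case (elim n)
    obtain j where j: "j \<le> Suc n" "r1 < s + ugrid (t - s) n j" "s + ugrid (t - s) n j < r2"
      using grid_hits_interval[of "\<lambda>j. s + ugrid (t - s) n j" r1 "Suc n" r2] r12 elim
      by (auto simp: ugrid_step)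
    then have "c n j < \<bar>y + W (ugrid (t - s) n j) \<omega>\<bar>" using r12(4) c[OF j(1)] by force
    then show ?case using False j(1) by (auto simp: cgrid_def not_le intro!: exI[of _ j])
  qed
qed

lemma csurv_eventually_surv:
  assumes \<omega>: "\<omega> \<in> space M" and b: "continuous_on {s..t} b" "\<And>r. r \<in> {s..t} \<Longrightarrow> 0 < b r" and st: "s \<le> t"
  shows "\<forall>\<^sub>F m in sequentially. \<omega> \<in> csurv (\<lambda>r. shrink m * b r) s t y \<longleftrightarrow> \<omega> \<in> surv b s t y"
proof (cases "\<omega> \<in> surv b s t y")
  case True
  have cy: "continuous_on {s..t} (\<lambda>r. y + W (r - s) \<omega>)"
    by (intro continuous_intros W_continuous_shift \<omega>)
  have "\<forall>\<^sub>F m in sequentially. \<forall>r\<in>{s..t}. \<bar>y + W (r - s) \<omega>\<bar> \<le> shrink m * b r"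
    by (rule strict_barrier_eventually[OF cy b st]) (use True in \<open>auto simp: surv_def\<close>)
  then show ?thesis by eventually_elim (use True \<omega> in \<open>auto simp: csurv_def\<close>)
next
  case False
  have "csurv (\<lambda>r. shrink m * b r) s t y \<subseteq> surv b s t y" for m
  proof -
    have "shrink m * b r < b r" if "r \<in> {s..t}" for r using shrink_bounds[of m] b(2)[OF that] by simp
    then show ?thesis by (force simp: surv_def csurv_def)
  qed
  then have "\<omega> \<notin> csurv (\<lambda>r. shrink m * b r) s t y" for m using False by blast
  then show ?thesis using False by simp
qed

text \<open>The product form is what the Markov steps accept as weights.\<close>

lemma indicator_cgrid_prod:
  assumes "\<omega> \<in> space M"
  shows "(\<Prod>j\<le>n. indicator {-c j..c j} (y + W (\<tau> j) \<omega>)) = (indicator (cgrid c \<tau> n y) \<omega> :: 'b :: linordered_idom)"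
proof (cases "\<omega> \<in> cgrid c \<tau> n y")
  case True
  then show ?thesis by (auto simp: cgrid_def abs_le_iff minus_le_iff intro!: prod.neutral)
next
  case False
  then obtain j where "j \<le> n" "\<not> \<bar>y + W (\<tau> j) \<omega>\<bar> \<le> c j" using assms by (auto simp: cgrid_def)
  then show ?thesis using False
    by (auto simp: abs_le_iff minus_le_iff indicator_def intro!: prod_zero bexI[of _ j])
qed

text \<open>The starting point is a variable as well, since killed expectations are later integrated
  as functions of it.\<close>

lemma cgrid_pair_measurable:
  assumes "\<And>j. j \<le> n \<Longrightarrow> 0 \<le> \<tau> j"
  shows "(\<lambda>z. indicator (cgrid c \<tau> n (fst z)) (snd z) :: real) \<in> borel_measurable (borel \<Otimes>\<^sub>M M)"
proof -
  have [measurable]: "W (\<tau> j) \<in> borel_measurable M" if "j \<le> n" for j using assms that by simp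
  have "(\<lambda>z. (\<Prod>j\<le>n. indicator {-c j..c j} (fst z + W (\<tau> j) (snd z))) :: real) \<in> borel_measurable (borel \<Otimes>\<^sub>M M)"
  proof (rule borel_measurable_prod)
    fix j assume "j \<in> {..n}"
    then have [measurable]: "W (\<tau> j) \<in> borel_measurable M" by simp
    show "(\<lambda>z. indicator {-c j..c j} (fst z + W (\<tau> j) (snd z)) :: real) \<in> borel_measurable (borel \<Otimes>\<^sub>M M)"
      by measurable
  qed
  then show ?thesis
    by (subst measurable_cong[where g="\<lambda>z. \<Prod>j\<le>n. indicator {-c j..c j} (fst z + W (\<tau> j) (snd z))"])
      (auto simp: space_pair_measure indicator_cgrid_prod)
qed

lemma csurv_pair_measurable:
  assumes "continuous_on {s..t} b" "s < t"
  shows "(\<lambda>z. indicator (csurv b s t (fst z)) (snd z) :: real) \<in> borel_measurable (borel \<Otimes>\<^sub>M M)"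
proof (rule borel_measurable_LIMSEQ_real)
  let ?c = "\<lambda>n j. b (s + ugrid (t - s) n j)"
  show "(\<lambda>z. indicator (cgrid (?c n) (ugrid (t - s) n) (Suc n) (fst z)) (snd z) :: real) \<in> borel_measurable (borel \<Otimes>\<^sub>M M)" for n
    by (rule cgrid_pair_measurable) (use assms in \<open>auto intro: ugrid_nonneg\<close>)
  show "(\<lambda>n. (indicator (cgrid (?c n) (ugrid (t - s) n) (Suc n) (fst z)) (snd z) :: real))
     \<longlonglongrightarrow> (indicator (csurv b s t (fst z)) (snd z) :: real)" if z: "z \<in> space (borel \<Otimes>\<^sub>M M)" for z
  proof -
    obtain y \<omega> where [simp]: "z = (y, \<omega>)" by (cases z)
    have \<omega>: "\<omega> \<in> space M" using z by (auto simp: space_pair_measure)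
    show ?thesis using cgrid_eventually_csurv[OF \<omega> assms(1,2), of ?c y]
      by (intro tendsto_eventually) (auto elim!: eventually_mono simp: indicator_def)
  qed
qed

lemma surv_pair_measurable:
  assumes "continuous_on {s..t} b" "\<And>r. r \<in> {s..t} \<Longrightarrow> 0 < b r" "s < t"
  shows "(\<lambda>z. indicator (surv b s t (fst z)) (snd z) :: real) \<in> borel_measurable (borel \<Otimes>\<^sub>M M)"
proof (rule borel_measurable_LIMSEQ_real)
  show "(\<lambda>z. indicator (csurv (\<lambda>r. shrink m * b r) s t (fst z)) (snd z) :: real) \<in> borel_measurable (borel \<Otimes>\<^sub>M M)" for m
    by (rule csurv_pair_measurable) (use assms in \<open>auto intro!: continuous_intros\<close>)
  show "(\<lambda>m. (indicator (csurv (\<lambda>r. shrink m * b r) s t (fst z)) (snd z) :: real))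
     \<longlonglongrightarrow> (indicator (surv b s t (fst z)) (snd z) :: real)" if z: "z \<in> space (borel \<Otimes>\<^sub>M M)" for z
  proof -
    obtain y \<omega> where [simp]: "z = (y, \<omega>)" by (cases z)
    have \<omega>: "\<omega> \<in> space M" using z by (auto simp: space_pair_measure)
    show ?thesis using csurv_eventually_surv[OF \<omega> assms(1,2), of y] assms(3)
      by (intro tendsto_eventually) (auto elim!: eventually_mono simp: indicator_def)
  qed
qed

lemma sets_from_pair:
  assumes "(\<lambda>z. indicator (S (fst z)) (snd z) :: real) \<in> borel_measurable (borel \<Otimes>\<^sub>M M)" and S: "S y \<subseteq> space M"
  shows "S y \<in> sets M"
proof -
  have "(\<lambda>\<omega>. indicator (S y) \<omega> :: real) \<in> borel_measurable M"
    using measurable_compose[OF measurable_Pair1' assms(1), of y] by simp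
  then have "{\<omega>\<in>space M. indicator (S y) \<omega> = (1::real)} \<in> sets M" by measurable
  also have "{\<omega>\<in>space M. indicator (S y) \<omega> = (1::real)} = S y" using S by (auto simp: indicator_def split: if_splits)
  finally show ?thesis .
qed

lemma csurv_sets [measurable]: "continuous_on {s..t} b \<Longrightarrow> s < t \<Longrightarrow> csurv b s t y \<in> sets M"
  by (rule sets_from_pair[OF csurv_pair_measurable]) (auto simp: csurv_def)

lemma surv_sets [measurable]:
  "continuous_on {s..t} b \<Longrightarrow> (\<And>r. r \<in> {s..t} \<Longrightarrow> 0 < b r) \<Longrightarrow> s < t \<Longrightarrow> surv b s t y \<in> sets M"
  by (rule sets_from_pair[OF surv_pair_measurable]) (auto simp: surv_def)


lemma nn_bounded_convergence:
  fixes F :: "nat \<Rightarrow> 'a \<Rightarrow> ennreal"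
  assumes [measurable]: "\<And>n. F n \<in> borel_measurable M" "G \<in> borel_measurable M"
    and bound: "\<And>n \<omega>. \<omega> \<in> space M \<Longrightarrow> F n \<omega> \<le> B" "B < top"
    and lim: "\<And>\<omega>. \<omega> \<in> space M \<Longrightarrow> (\<lambda>n. F n \<omega>) \<longlonglongrightarrow> G \<omega>"
  shows "(\<lambda>n. \<integral>\<^sup>+\<omega>. F n \<omega> \<partial>M) \<longlonglongrightarrow> (\<integral>\<^sup>+\<omega>. G \<omega> \<partial>M)"
  by (rule nn_integral_dominated_convergence[where w="\<lambda>_. B"])
    (use bound lim in \<open>auto simp: emeasure_space_1\<close>)

text \<open>The grids may be irregular and may end slightly off the target time: the final value of
  the clock grids depends on \<open>n\<close> and merely converges. It suffices that the mesh is
  small and that the grid passes the start of the violating interval.\<close>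

lemma cgrid_eventually_fails:
  assumes \<omega>: "\<omega> \<in> space M" and b: "continuous_on {s..t} b" and st: "s < t"
    and fails: "\<omega> \<notin> csurv b s t y"
    and a0: "\<And>n. a n 0 = 0" and aN: "(\<lambda>n. a n (N n)) \<longlonglongrightarrow> t - s"
    and mesh: "\<And>d. d > 0 \<Longrightarrow> \<forall>\<^sub>F n in sequentially. \<forall>j<N n. a n (Suc j) - a n j < d"
  shows "\<forall>\<^sub>F n in sequentially. \<omega> \<notin> cgrid (\<lambda>j. b (s + a n j)) (a n) (N n) y"
proof -
  obtain r where r: "r \<in> {s..t}" "b r < \<bar>y + W (r - s) \<omega>\<bar>" using \<omega> fails by (force simp: csurv_def)
  have cy: "continuous_on {s..t} (\<lambda>r. y + W (r - s) \<omega>)"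
    by (intro continuous_intros W_continuous_shift \<omega>)
  obtain r1 r2 where r12: "s \<le> r1" "r1 < r2" "r2 \<le> t" "\<forall>r\<in>{r1<..<r2}. b r < \<bar>y + W (r - s) \<omega>\<bar>"
    using interval_above_barrier[OF cy b st r] by auto
  have "\<forall>\<^sub>F n in sequentially. r1 - s < a n (N n)"
    by (rule order_tendstoD[OF aN]) (use r12 in auto)
  moreover have "\<forall>\<^sub>F n in sequentially. \<forall>j<N n. a n (Suc j) - a n j < r2 - r1"
    using mesh[of "r2 - r1"] r12 by auto
  ultimately show ?thesis
  proof eventually_elim
    case (elim n)
    obtain j where j: "j \<le> N n" "r1 < s + a n j" "s + a n j < r2"
      using grid_hits_interval[of "\<lambda>j. s + a n j" r1 "N n" r2] r12 elim a0 by auto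
    then have "b (s + a n j) < \<bar>y + W (a n j) \<omega>\<bar>" using r12(4) by force
    then show ?case using j(1) by (auto simp: cgrid_def not_le intro!: exI[of _ j])
  qed
qed

lemma csurv_imp_cgrid:
  assumes "\<omega> \<in> csurv b s t y" "\<And>j. j \<le> N \<Longrightarrow> 0 \<le> a j \<and> a j \<le> t - s"
  shows "\<omega> \<in> cgrid (\<lambda>j. b (s + a j)) a N y"
  unfolding cgrid_def
proof (intro CollectI conjI allI impI)
  show "\<omega> \<in> space M" using assms by (simp add: csurv_def)
  fix j assume j: "j \<le> N"
  show "\<bar>y + W (a j) \<omega>\<bar> \<le> b (s + a j)"
    using assms(1) assms(2)[OF j] unfolding csurv_def by (auto dest!: bspec[where x="s + a j"])
qed

lemma cgrid_mesh_eventually_csurv: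
  assumes \<omega>: "\<omega> \<in> space M" and b: "continuous_on {s..t} b" and st: "s < t"
    and a: "\<And>n. a n 0 = 0" "\<And>n. a n (N n) = t - s" "\<And>n j. j \<le> N n \<Longrightarrow> 0 \<le> a n j \<and> a n j \<le> t - s"
    and mesh: "\<And>d. d > 0 \<Longrightarrow> \<forall>\<^sub>F n in sequentially. \<forall>j<N n. a n (Suc j) - a n j < d"
  shows "\<forall>\<^sub>F n in sequentially. \<omega> \<in> cgrid (\<lambda>j. b (s + a n j)) (a n) (N n) y \<longleftrightarrow> \<omega> \<in> csurv b s t y"
proof (cases "\<omega> \<in> csurv b s t y")
  case True
  then show ?thesis using csurv_imp_cgrid[OF True] a(3) by simp
next
  case False
  have "\<forall>\<^sub>F n in sequentially. \<omega> \<notin> cgrid (\<lambda>j. b (s + a n j)) (a n) (N n) y"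
    by (rule cgrid_eventually_fails[OF \<omega> b st False]) (use a mesh in auto)
  then show ?thesis using False by simp
qed

text \<open>Induction on the number of steps after \<open>m\<close>: the last step is replaced by
  its Gaussian kernel, the hypothesis is applied, and the step is restored inside the inner
  expectation. The weight at index \<open>m\<close> is charged to the outer product, hence the
  factor 1 at inner index 0.\<close>

lemma nn_markov_grid:
  fixes \<tau> :: "nat \<Rightarrow> real" and w :: "nat \<Rightarrow> real \<Rightarrow> ennreal" and v :: "real \<Rightarrow> ennreal"
  assumes \<tau>0: "\<tau> 0 = 0" and \<tau>: "\<And>i. i < m + k \<Longrightarrow> \<tau> i < \<tau> (Suc i)"
    and w[measurable]: "\<And>i. w i \<in> borel_measurable borel" and v[measurable]: "v \<in> borel_measurable borel"
  shows "(\<integral>\<^sup>+\<omega>. (\<Prod>j\<le>m + k. w j (x + W (\<tau> j) \<omega>)) * v (x + W (\<tau> (m + k)) \<omega>) \<partial>M) =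
    (\<integral>\<^sup>+\<omega>. (\<Prod>j\<le>m. w j (x + W (\<tau> j) \<omega>)) *
      (\<integral>\<^sup>+\<omega>'. (\<Prod>i\<le>k. (if i = 0 then (\<lambda>_. 1) else w (m + i)) (x + W (\<tau> m) \<omega> + W (\<tau> (m + i) - \<tau> m) \<omega>'))
          * v (x + W (\<tau> m) \<omega> + W (\<tau> (m + k) - \<tau> m) \<omega>') \<partial>M) \<partial>M)"
  using \<tau> v
proof (induction k arbitrary: v)
  case 0
  have "(\<integral>\<^sup>+\<omega>'. v (z + W 0 \<omega>') \<partial>M) = (\<integral>\<^sup>+\<omega>'. v z \<partial>M)" for z
    by (intro nn_integral_cong) (simp add: W_0)
  then show ?case by (auto intro!: nn_integral_cong simp: emeasure_space_1)
next
  case (Suc k)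
  note [measurable] = Suc.prems(2)
  let ?v = "nn_gauss (\<tau> (Suc (m + k)) - \<tau> (m + k)) (\<lambda>z. w (Suc (m + k)) z * v z)"
  let ?w = "\<lambda>i. if i = 0 then (\<lambda>_. 1) else w (m + i)"
  have "(\<integral>\<^sup>+\<omega>. (\<Prod>j\<le>m + Suc k. w j (x + W (\<tau> j) \<omega>)) * v (x + W (\<tau> (m + Suc k)) \<omega>) \<partial>M)
    = (\<integral>\<^sup>+\<omega>. (\<Prod>j\<le>m + k. w j (x + W (\<tau> j) \<omega>)) *
        (\<lambda>z. w (Suc (m + k)) z * v z) (x + W (\<tau> (Suc (m + k))) \<omega>) \<partial>M)"
    by (intro nn_integral_cong) (simp add: mult.assoc)
  also have "\<dots> = (\<integral>\<^sup>+\<omega>. (\<Prod>j\<le>m + k. w j (x + W (\<tau> j) \<omega>)) * ?v (x + W (\<tau> (m + k)) \<omega>) \<partial>M)"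
    by (rule nn_markov_step) (use \<tau>0 Suc.prems in auto)
  also have "\<dots> = (\<integral>\<^sup>+\<omega>. (\<Prod>j\<le>m. w j (x + W (\<tau> j) \<omega>)) *
      (\<integral>\<^sup>+\<omega>'. (\<Prod>i\<le>k. ?w i (x + W (\<tau> m) \<omega> + W (\<tau> (m + i) - \<tau> m) \<omega>'))
          * ?v (x + W (\<tau> m) \<omega> + W (\<tau> (m + k) - \<tau> m) \<omega>') \<partial>M) \<partial>M)"
    by (rule Suc.IH) (use Suc.prems in auto)
  also have "\<dots> = (\<integral>\<^sup>+\<omega>. (\<Prod>j\<le>m. w j (x + W (\<tau> j) \<omega>)) *
      (\<integral>\<^sup>+\<omega>'. (\<Prod>i\<le>Suc k. ?w i (x + W (\<tau> m) \<omega> + W (\<tau> (m + i) - \<tau> m) \<omega>'))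
          * v (x + W (\<tau> m) \<omega> + W (\<tau> (m + Suc k) - \<tau> m) \<omega>') \<partial>M) \<partial>M)"
  proof (rule nn_integral_cong, rule arg_cong2[where f="(*)", OF refl])
    fix \<omega>
    let ?z = "x + W (\<tau> m) \<omega>" and ?\<sigma> = "\<lambda>i. \<tau> (m + i) - \<tau> m"
    have "(\<integral>\<^sup>+\<omega>'. (\<Prod>i\<le>k. ?w i (?z + W (?\<sigma> i) \<omega>')) *
        nn_gauss (?\<sigma> (Suc k) - ?\<sigma> k) (\<lambda>z. w (Suc (m + k)) z * v z) (?z + W (?\<sigma> k) \<omega>') \<partial>M) =
      (\<integral>\<^sup>+\<omega>'. (\<Prod>i\<le>k. ?w i (?z + W (?\<sigma> i) \<omega>')) * (\<lambda>z. w (Suc (m + k)) z * v z) (?z + W (?\<sigma> (Suc k)) \<omega>') \<partial>M)"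
      by (rule nn_markov_step[symmetric]) (use Suc.prems in auto)
    then show "(\<integral>\<^sup>+\<omega>'. (\<Prod>i\<le>k. ?w i (?z + W (?\<sigma> i) \<omega>')) * ?v (?z + W (?\<sigma> k) \<omega>') \<partial>M) =
      (\<integral>\<^sup>+\<omega>'. (\<Prod>i\<le>Suc k. ?w i (?z + W (?\<sigma> i) \<omega>')) * v (?z + W (?\<sigma> (Suc k)) \<omega>') \<partial>M)"
      by (simp add: mult.assoc)
  qed
  finally show ?case .
qed

definition nn_closed :: "(real \<Rightarrow> real) \<Rightarrow> real \<Rightarrow> real \<Rightarrow> (real \<Rightarrow> ennreal) \<Rightarrow> real \<Rightarrow> ennreal" where
  "nn_closed b s t h y = (\<integral>\<^sup>+\<omega>. h (y + W (t - s) \<omega>) * indicator (csurv b s t y) \<omega> \<partial>M)"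

definition nn_surv :: "(real \<Rightarrow> real) \<Rightarrow> real \<Rightarrow> real \<Rightarrow> (real \<Rightarrow> ennreal) \<Rightarrow> real \<Rightarrow> ennreal" where
  "nn_surv b s t h y = (\<integral>\<^sup>+\<omega>. h (y + W (t - s) \<omega>) * indicator (surv b s t y) \<omega> \<partial>M)"

lemma pair_indicator_ennreal:
  assumes "(\<lambda>z. indicator (S (fst z)) (snd z) :: real) \<in> borel_measurable (borel \<Otimes>\<^sub>M M)"
  shows "(\<lambda>z. indicator (S (fst z)) (snd z) :: ennreal) \<in> borel_measurable (borel \<Otimes>\<^sub>M M)"
proof -
  have "(\<lambda>z. ennreal (indicator (S (fst z)) (snd z))) \<in> borel_measurable (borel \<Otimes>\<^sub>M M)"
    using assms by measurable
  then show ?thesis by (simp add: ennreal_indicator)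
qed

lemma nn_closed_measurable:
  assumes [measurable]: "h \<in> borel_measurable borel" and b: "continuous_on {s..t} b" "s < t"
  shows "nn_closed b s t h \<in> borel_measurable borel"
proof -
  note [measurable] = pair_indicator_ennreal[OF csurv_pair_measurable[OF b]]
  have [measurable]: "W (t - s) \<in> borel_measurable M" using b by simp
  show ?thesis unfolding nn_closed_def by measurable
qed

lemma nn_surv_measurable:
  assumes [measurable]: "h \<in> borel_measurable borel"
    and b: "continuous_on {s..t} b" "\<And>r. r \<in> {s..t} \<Longrightarrow> 0 < b r" "s < t"
  shows "nn_surv b s t h \<in> borel_measurable borel"
proof -
  note [measurable] = pair_indicator_ennreal[OF surv_pair_measurable[OF b]]
  have [measurable]: "W (t - s) \<in> borel_measurable M" using b by simp
  show ?thesis unfolding nn_surv_def by measurable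
qed

lemma cgrid_sets: "(\<And>j. j \<le> n \<Longrightarrow> 0 \<le> \<tau> j) \<Longrightarrow> cgrid c \<tau> n y \<in> sets M"
  by (rule sets_from_pair[OF cgrid_pair_measurable]) (auto simp: cgrid_def)

lemma indicator_tendsto:
  assumes "\<forall>\<^sub>F n in F. \<omega> \<in> A n \<longleftrightarrow> \<omega> \<in> B"
  shows "((\<lambda>n. c * indicator (A n) \<omega> :: 'b :: {topological_space, semiring_1}) \<longlongrightarrow> c * indicator B \<omega>) F"
  by (rule tendsto_eventually) (use assms in eventually_elim, auto simp: indicator_def)

lemma ennreal_mult_bounded:
  fixes a b :: ennreal
  assumes "a \<le> A" "b \<le> B" shows "a * b \<le> A * B"
  using assms by (rule mult_mono) auto

lemma indicator_le_one_ennreal: "(indicator A x :: ennreal) \<le> 1"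
  by (simp add: indicator_def)

lemma nn_closed_grid_limit:
  assumes h[measurable]: "h \<in> borel_measurable borel" and hB: "\<And>z. h z \<le> B" "B < top"
    and b: "continuous_on {s..t} b" "s < t"
  shows "(\<lambda>n. \<integral>\<^sup>+\<omega>. h (y + W (t - s) \<omega>) *
     indicator (cgrid (\<lambda>j. b (s + ugrid (t - s) n j)) (ugrid (t - s) n) (Suc n) y) \<omega> \<partial>M)
    \<longlonglongrightarrow> nn_closed b s t h y"
  unfolding nn_closed_def
proof (rule nn_bounded_convergence[where B="B"])
  have [measurable]: "W (t - s) \<in> borel_measurable M" using b by simp
  note [measurable] = csurv_sets[OF b]
  show "(\<lambda>\<omega>. h (y + W (t - s) \<omega>) * indicator (cgrid (\<lambda>j. b (s + ugrid (t - s) n j)) (ugrid (t - s) n) (Suc n) y) \<omega>)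
    \<in> borel_measurable M" for n
  proof -
    have [measurable]: "cgrid (\<lambda>j. b (s + ugrid (t - s) n j)) (ugrid (t - s) n) (Suc n) y \<in> sets M"
      by (rule cgrid_sets) (use b in \<open>auto intro: ugrid_nonneg\<close>)
    show ?thesis by measurable
  qed
  show "(\<lambda>\<omega>. h (y + W (t - s) \<omega>) * indicator (csurv b s t y) \<omega>) \<in> borel_measurable M" by measurable
  show "h (y + W (t - s) \<omega>) * indicator (cgrid (\<lambda>j. b (s + ugrid (t - s) n j)) (ugrid (t - s) n) (Suc n) y) \<omega> \<le> B" for n \<omega>
    using ennreal_mult_bounded[OF hB(1) indicator_le_one_ennreal] by simp
  show "B < top" by fact
  show "(\<lambda>n. h (y + W (t - s) \<omega>) * indicator (cgrid (\<lambda>j. b (s + ugrid (t - s) n j)) (ugrid (t - s) n) (Suc n) y) \<omega>)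
    \<longlonglongrightarrow> h (y + W (t - s) \<omega>) * indicator (csurv b s t y) \<omega>" if "\<omega> \<in> space M" for \<omega>
    by (rule indicator_tendsto, rule cgrid_eventually_csurv[OF that b]) auto
qed

lemma nn_closed_bound:
  assumes "\<And>z. h z \<le> B"
  shows "nn_closed b s t h y \<le> B" "nn_surv b s t h y \<le> B"
proof -
  have "h z * indicator A \<omega> \<le> B" for z A and \<omega> :: 'a
    using ennreal_mult_bounded[OF assms indicator_le_one_ennreal] by simp
  then have "(\<integral>\<^sup>+\<omega>. h (y + W (t - s) \<omega>) * indicator A \<omega> \<partial>M) \<le> (\<integral>\<^sup>+\<omega>. B \<partial>M)" for A
    by (intro nn_integral_mono) 
  then show "nn_closed b s t h y \<le> B" "nn_surv b s t h y \<le> B"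
    by (auto simp: nn_closed_def nn_surv_def emeasure_space_1)
qed

text \<open>Two uniform grids are glued at \<open>u\<close>, so that \<open>u\<close> is itself a
  grid point. The Markov property then holds exactly on the grid, and both sides converge along
  refinements.\<close>

lemma nn_closed_markov:
  assumes f[measurable]: "f \<in> borel_measurable borel" and fB: "\<And>z. f z \<le> B"
    and h[measurable]: "h \<in> borel_measurable borel" and hB: "\<And>z. h z \<le> B" and B: "B < top"
    and b: "continuous_on {s..t} b" and sut: "s < u" "u < t"
  shows "(\<integral>\<^sup>+\<omega>. f (y + W (u - s) \<omega>) * h (y + W (t - s) \<omega>) * indicator (csurv b s t y) \<omega> \<partial>M)
    = nn_closed b s u (\<lambda>z. f z * nn_closed b u t h z) y"
proof -
  define \<tau> where "\<tau> n j = (if j \<le> Suc n then ugrid (u - s) n j else (u - s) + ugrid (t - u) n (j - Suc n))" for n j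
  define c where "c n j = b (s + \<tau> n j)" for n j
  \<comment> \<open>Inserting \<open>f\<close> as an extra weight at the index of time
    \<open>u\<close> brings the intermediate factor under the grid Markov property.\<close>
  define w where "w n j z = (if j = Suc n then f z else 1) * indicator {-c n j..c n j} z" for n j and z :: real
  let ?N = "\<lambda>n. Suc n + Suc n"
  let ?cg = "\<lambda>n z. cgrid (\<lambda>j. b (u + ugrid (t - u) n j)) (ugrid (t - u) n) (Suc n) z"
  have \<tau>_lo: "\<tau> n j = ugrid (u - s) n j" if "j \<le> Suc n" for n j using that by (simp add: \<tau>_def)
  have \<tau>_hi: "\<tau> n (Suc n + i) = (u - s) + ugrid (t - u) n i" for n i by (cases i) (simp_all add: \<tau>_def)
  have \<tau>_end: "\<tau> n (?N n) = t - s" for n by (subst \<tau>_hi) simp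
  have step: "\<tau> n (Suc j) - \<tau> n j = (u - s) / real (Suc n) \<or> \<tau> n (Suc j) - \<tau> n j = (t - u) / real (Suc n)" for n j
  proof (cases "j < Suc n")
    case True
    then show ?thesis using \<tau>_lo[of j n] \<tau>_lo[of "Suc j" n] by (simp add: ugrid_step)
  next
    case False
    then obtain i where i: "j = Suc n + i" using le_Suc_ex not_less by blast
    show ?thesis using \<tau>_hi[of n i] \<tau>_hi[of n "Suc i"] by (simp add: i ugrid_step)
  qed
  have \<tau>_mono: "\<tau> n j < \<tau> n (Suc j)" for n j
  proof -
    have "0 < (u - s) / real (Suc n)" "0 < (t - u) / real (Suc n)" using sut by auto
    then show ?thesis using step[of n j] by linarith
  qed
  have \<tau>_0: "\<tau> n 0 = 0" for n by (simp add: \<tau>_def)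
  have \<tau>_bounds: "0 \<le> \<tau> n j \<and> \<tau> n j \<le> t - s" if "j \<le> ?N n" for n j
  proof -
    have "mono (\<tau> n)" by (rule incseq_SucI) (use \<tau>_mono less_imp_le in auto)
    then have "\<tau> n 0 \<le> \<tau> n j" "\<tau> n j \<le> \<tau> n (?N n)" using that by (auto dest: monoD)
    then show ?thesis using \<tau>_0 \<tau>_end by auto
  qed
  have mesh: "\<forall>\<^sub>F n in sequentially. \<forall>j<?N n. \<tau> n (Suc j) - \<tau> n j < d" if "d > 0" for d
  proof -
    have "(\<lambda>n. (u - s) / real (Suc n)) \<longlonglongrightarrow> 0" "(\<lambda>n. (t - u) / real (Suc n)) \<longlonglongrightarrow> 0" by real_asymp+
    from order_tendstoD(2)[OF this(1) that] order_tendstoD(2)[OF this(2) that]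
    show ?thesis by eventually_elim (metis step)
  qed
  have [measurable]: "w n j \<in> borel_measurable borel" for n j unfolding w_def by measurable
  have [measurable]: "W (t - s) \<in> borel_measurable M" "W (u - s) \<in> borel_measurable M" "W (t - u) \<in> borel_measurable M"
    using sut by auto
  have b1: "continuous_on {s..u} b" "continuous_on {u..t} b"
    using b sut by (auto elim: continuous_on_subset)
  have cgm[measurable]: "cgrid (c n) (\<tau> n) (?N n) y \<in> sets M" "cgrid (c n) (\<tau> n) (Suc n) y \<in> sets M" "?cg n z \<in> sets M" for n z
    using \<tau>_bounds sut by (auto intro!: cgrid_sets ugrid_nonneg)
  have prod_w: "(\<Prod>j\<le>k. w n j (x + W (\<sigma> j) \<omega>)) =
      (if Suc n \<le> k then f (x + W (\<sigma> (Suc n)) \<omega>) else 1) * indicator (cgrid (c n) \<sigma> k x) \<omega>"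
    if "\<omega> \<in> space M" for n k x \<sigma> \<omega>
  proof -
    have "(\<Prod>j\<le>k. w n j (x + W (\<sigma> j) \<omega>)) = (\<Prod>j\<le>k. if j = Suc n then f (x + W (\<sigma> j) \<omega>) else 1) *
        (\<Prod>j\<le>k. indicator {-c n j..c n j} (x + W (\<sigma> j) \<omega>))"
      unfolding w_def prod.distrib ..
    also have "(\<Prod>j\<le>k. indicator {-c n j..c n j} (x + W (\<sigma> j) \<omega>)) = (indicator (cgrid (c n) \<sigma> k x) \<omega> :: ennreal)"
    proof -
      have "ennreal (\<Prod>j\<le>k. indicator {-c n j..c n j} (x + W (\<sigma> j) \<omega>)) = ennreal (indicator (cgrid (c n) \<sigma> k x) \<omega>)"
        by (subst indicator_cgrid_prod[OF that]) simp
      then show ?thesis by (simp add: prod_ennreal[symmetric] ennreal_indicator)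
    qed
    finally show ?thesis by (simp add: prod.delta)
  qed
  define H where "H n z = (\<integral>\<^sup>+\<omega>'. h (z + W (t - u) \<omega>') * indicator (?cg n z) \<omega>' \<partial>M)" for n z
  have H_lim: "(\<lambda>n. H n z) \<longlonglongrightarrow> nn_closed b u t h z" for z
    unfolding H_def by (rule nn_closed_grid_limit[OF h hB B b1(2) sut(2)])
  have H_bound: "H n z \<le> B" for n z
  proof -
    have "H n z \<le> (\<integral>\<^sup>+\<omega>'. B \<partial>M)" unfolding H_def
      by (intro nn_integral_mono) (use ennreal_mult_bounded[OF hB indicator_le_one_ennreal] in auto)
    then show ?thesis by (simp add: emeasure_space_1)
  qed
  have H_meas[measurable]: "H n \<in> borel_measurable borel" for n
  proof -
    have [measurable]: "(\<lambda>z. indicator (?cg n (fst z)) (snd z) :: ennreal) \<in> borel_measurable (borel \<Otimes>\<^sub>M M)"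
      by (rule pair_indicator_ennreal, rule cgrid_pair_measurable) (use sut in \<open>auto intro: ugrid_nonneg\<close>)
    show ?thesis unfolding H_def by measurable
  qed
  have BB: "B * B < top" using B by (simp add: ennreal_mult_less_top)
  have grid: "(\<integral>\<^sup>+\<omega>. f (y + W (u - s) \<omega>) * h (y + W (t - s) \<omega>) * indicator (cgrid (c n) (\<tau> n) (?N n) y) \<omega> \<partial>M)
    = (\<integral>\<^sup>+\<omega>. f (y + W (u - s) \<omega>) * H n (y + W (u - s) \<omega>) * indicator (cgrid (c n) (\<tau> n) (Suc n) y) \<omega> \<partial>M)" for n
  proof -
    let ?w = "\<lambda>i. if i = 0 then (\<lambda>_. 1) else w n (Suc n + i)"
    have \<tau>m: "\<tau> n (Suc n) = u - s" by (simp add: \<tau>_def)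
    have "(\<integral>\<^sup>+\<omega>. f (y + W (u - s) \<omega>) * h (y + W (t - s) \<omega>) * indicator (cgrid (c n) (\<tau> n) (?N n) y) \<omega> \<partial>M)
      = (\<integral>\<^sup>+\<omega>. (\<Prod>j\<le>Suc n + Suc n. w n j (y + W (\<tau> n j) \<omega>)) * h (y + W (\<tau> n (Suc n + Suc n)) \<omega>) \<partial>M)"
      by (intro nn_integral_cong, subst prod_w) (auto simp: \<tau>_end[simplified] \<tau>m ac_simps)
    also have "\<dots> = (\<integral>\<^sup>+\<omega>. (\<Prod>j\<le>Suc n. w n j (y + W (\<tau> n j) \<omega>)) *
      (\<integral>\<^sup>+\<omega>'. (\<Prod>i\<le>Suc n. ?w i (y + W (\<tau> n (Suc n)) \<omega> + W (\<tau> n (Suc n + i) - \<tau> n (Suc n)) \<omega>'))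
          * h (y + W (\<tau> n (Suc n)) \<omega> + W (\<tau> n (Suc n + Suc n) - \<tau> n (Suc n)) \<omega>') \<partial>M) \<partial>M)"
      by (rule nn_markov_grid) (use \<tau>_0 \<tau>_mono in auto)
    also have "\<dots> = (\<integral>\<^sup>+\<omega>. f (y + W (u - s) \<omega>) * H n (y + W (u - s) \<omega>) * indicator (cgrid (c n) (\<tau> n) (Suc n) y) \<omega> \<partial>M)"
    proof (rule nn_integral_cong)
      fix \<omega> assume \<omega>: "\<omega> \<in> space M"
      let ?z = "y + W (u - s) \<omega>"
      have "(\<integral>\<^sup>+\<omega>'. (\<Prod>i\<le>Suc n. ?w i (?z + W (\<tau> n (Suc n + i) - \<tau> n (Suc n)) \<omega>'))
          * h (?z + W (\<tau> n (Suc n + Suc n) - \<tau> n (Suc n)) \<omega>') \<partial>M) = H n ?z"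
        if in_cg: "\<omega> \<in> cgrid (c n) (\<tau> n) (Suc n) y"
        unfolding H_def
      proof (rule nn_integral_cong)
        fix \<omega>' assume \<omega>': "\<omega>' \<in> space M"
        \<comment> \<open>The inner grid event tests \<open>?z\<close> against \<open>b u\<close>,
          while the inner product has weight 1 there; the outer event supplies this test. Off the
          outer event both sides vanish.\<close>
        have zb: "\<bar>?z\<bar> \<le> b u" using in_cg by (auto simp: cgrid_def c_def \<tau>m dest!: spec[of _ "Suc n"])
        let ?b = "\<lambda>i. b (u + ugrid (t - u) n i)"
        have "(\<Prod>i\<le>Suc n. ?w i (?z + W (\<tau> n (Suc n + i) - \<tau> n (Suc n)) \<omega>'))
           = (\<Prod>i\<le>Suc n. indicator {- ?b i..?b i} (?z + W (ugrid (t - u) n i) \<omega>'))"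
        proof (rule prod.cong[OF refl])
          fix i
          have "\<tau> n (Suc n + i) - \<tau> n (Suc n) = ugrid (t - u) n i" by (simp only: \<tau>_hi \<tau>m)
          moreover have "c n (Suc n + i) = ?b i" by (simp only: \<tau>_hi c_def) (simp add: algebra_simps)
          ultimately show "?w i (?z + W (\<tau> n (Suc n + i) - \<tau> n (Suc n)) \<omega>') =
            indicator {- ?b i..?b i} (?z + W (ugrid (t - u) n i) \<omega>')"
            using zb \<omega>' by (cases "i = 0") (auto simp: w_def W_0 indicator_def abs_le_iff)
        qed
        also have "\<dots> = indicator (?cg n ?z) \<omega>'"
        proof -
          have "ennreal (\<Prod>j\<le>Suc n. indicator {- ?b j..?b j} (?z + W (ugrid (t - u) n j) \<omega>')) = ennreal (indicator (?cg n ?z) \<omega>')"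
            by (subst indicator_cgrid_prod[OF \<omega>']) simp
          then show ?thesis by (simp add: prod_ennreal[symmetric] ennreal_indicator del: prod.atMost_Suc)
        qed
        finally show "(\<Prod>i\<le>Suc n. ?w i (?z + W (\<tau> n (Suc n + i) - \<tau> n (Suc n)) \<omega>'))
          * h (?z + W (\<tau> n (Suc n + Suc n) - \<tau> n (Suc n)) \<omega>') = h (?z + W (t - u) \<omega>') * indicator (?cg n ?z) \<omega>'"
          by (simp only: \<tau>_hi \<tau>m) (simp add: mult.commute)
      qed
      then show "(\<Prod>j\<le>Suc n. w n j (y + W (\<tau> n j) \<omega>)) *
        (\<integral>\<^sup>+\<omega>'. (\<Prod>i\<le>Suc n. ?w i (y + W (\<tau> n (Suc n)) \<omega> + W (\<tau> n (Suc n + i) - \<tau> n (Suc n)) \<omega>'))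
          * h (y + W (\<tau> n (Suc n)) \<omega> + W (\<tau> n (Suc n + Suc n) - \<tau> n (Suc n)) \<omega>') \<partial>M) =
        f ?z * H n ?z * indicator (cgrid (c n) (\<tau> n) (Suc n) y) \<omega>"
        unfolding prod_w[OF \<omega>] \<tau>m
        by (cases "\<omega> \<in> cgrid (c n) (\<tau> n) (Suc n) y") (simp_all del: prod.atMost_Suc)
    qed
    finally show ?thesis .
  qed
  have L1: "(\<lambda>n. \<integral>\<^sup>+\<omega>. f (y + W (u - s) \<omega>) * h (y + W (t - s) \<omega>) * indicator (cgrid (c n) (\<tau> n) (?N n) y) \<omega> \<partial>M)
    \<longlonglongrightarrow> (\<integral>\<^sup>+\<omega>. f (y + W (u - s) \<omega>) * h (y + W (t - s) \<omega>) * indicator (csurv b s t y) \<omega> \<partial>M)"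
  proof (rule nn_bounded_convergence[where B="B * B"])
    have [measurable]: "csurv b s t y \<in> sets M" by (rule csurv_sets[OF b]) (use sut in auto)
    show "(\<lambda>\<omega>. f (y + W (u - s) \<omega>) * h (y + W (t - s) \<omega>) * indicator (csurv b s t y) \<omega>) \<in> borel_measurable M" by measurable
    show "(\<lambda>\<omega>. f (y + W (u - s) \<omega>) * h (y + W (t - s) \<omega>) * indicator (cgrid (c n) (\<tau> n) (?N n) y) \<omega>) \<in> borel_measurable M" for n by measurable
    show "f (y + W (u - s) \<omega>) * h (y + W (t - s) \<omega>) * indicator (cgrid (c n) (\<tau> n) (?N n) y) \<omega> \<le> B * B" for n \<omega>
      using ennreal_mult_bounded[OF ennreal_mult_bounded[OF fB hB] indicator_le_one_ennreal] by simp
    show "(\<lambda>n. f (y + W (u - s) \<omega>) * h (y + W (t - s) \<omega>) * indicator (cgrid (c n) (\<tau> n) (?N n) y) \<omega>)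
      \<longlonglongrightarrow> f (y + W (u - s) \<omega>) * h (y + W (t - s) \<omega>) * indicator (csurv b s t y) \<omega>" if "\<omega> \<in> space M" for \<omega>
      unfolding c_def
      by (rule indicator_tendsto, rule cgrid_mesh_eventually_csurv[OF that b])
        (use sut \<tau>_0 \<tau>_end \<tau>_bounds mesh in auto)
  qed (rule BB)
  have L2: "(\<lambda>n. \<integral>\<^sup>+\<omega>. f (y + W (u - s) \<omega>) * H n (y + W (u - s) \<omega>) * indicator (cgrid (c n) (\<tau> n) (Suc n) y) \<omega> \<partial>M)
    \<longlonglongrightarrow> nn_closed b s u (\<lambda>z. f z * nn_closed b u t h z) y"
    unfolding nn_closed_def[of b s u]
  proof (rule nn_bounded_convergence[where B="B * B"])
    have [measurable]: "csurv b s u y \<in> sets M" by (rule csurv_sets[OF b1(1)]) (use sut in auto)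
    note [measurable] = nn_closed_measurable[OF h b1(2) sut(2)]
    show "(\<lambda>\<omega>. f (y + W (u - s) \<omega>) * nn_closed b u t h (y + W (u - s) \<omega>) * indicator (csurv b s u y) \<omega>) \<in> borel_measurable M" by measurable
    show "(\<lambda>\<omega>. f (y + W (u - s) \<omega>) * H n (y + W (u - s) \<omega>) * indicator (cgrid (c n) (\<tau> n) (Suc n) y) \<omega>) \<in> borel_measurable M" for n by measurable
    show "f (y + W (u - s) \<omega>) * H n (y + W (u - s) \<omega>) * indicator (cgrid (c n) (\<tau> n) (Suc n) y) \<omega> \<le> B * B" for n \<omega>
      using ennreal_mult_bounded[OF ennreal_mult_bounded[OF fB H_bound] indicator_le_one_ennreal] by simp
    fix \<omega> assume \<omega>: "\<omega> \<in> space M"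
    let ?z = "y + W (u - s) \<omega>"
    have ev: "\<forall>\<^sub>F n in sequentially. \<omega> \<in> cgrid (c n) (\<tau> n) (Suc n) y \<longleftrightarrow> \<omega> \<in> csurv b s u y"
    proof -
      have "cgrid (c n) (\<tau> n) (Suc n) y = cgrid (\<lambda>j. b (s + ugrid (u - s) n j)) (ugrid (u - s) n) (Suc n) y" for n
        unfolding cgrid_def c_def by (auto simp: \<tau>_lo)
      then show ?thesis using cgrid_eventually_csurv[OF \<omega> b1(1) sut(1), of "\<lambda>n j. b (s + ugrid (u - s) n j)"] by simp
    qed
    have "f ?z < top" using fB[of ?z] B by (rule le_less_trans)
    then have 1: "(\<lambda>n. f ?z * H n ?z) \<longlonglongrightarrow> f ?z * nn_closed b u t h ?z"
      by (rule ennreal_tendsto_cmult) (rule H_lim)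
    have 2: "(\<lambda>n. f ?z * H n ?z * indicator (csurv b s u y) \<omega>) \<longlonglongrightarrow> f ?z * nn_closed b u t h ?z * indicator (csurv b s u y) \<omega>"
      using 1 by (cases "\<omega> \<in> csurv b s u y") auto
    show "(\<lambda>n. f ?z * H n ?z * indicator (cgrid (c n) (\<tau> n) (Suc n) y) \<omega>)
      \<longlonglongrightarrow> f ?z * nn_closed b u t h ?z * indicator (csurv b s u y) \<omega>"
      by (rule Lim_transform_eventually[OF 2]) (use ev in eventually_elim, auto simp: indicator_def)
  qed (rule BB)
  show ?thesis using LIMSEQ_unique[OF L1[unfolded grid] L2] .
qed

lemma nn_surv_limit:
  assumes h[measurable]: "h \<in> borel_measurable borel" and hB: "\<And>z. h z \<le> B" "B < top"
    and b: "continuous_on {s..t} b" "\<And>r. r \<in> {s..t} \<Longrightarrow> 0 < b r" "s < t"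
  shows "(\<lambda>m. nn_closed (\<lambda>r. shrink m * b r) s t h y) \<longlonglongrightarrow> nn_surv b s t h y"
  unfolding nn_closed_def nn_surv_def
proof (rule nn_bounded_convergence[where B=B])
  have [measurable]: "W (t - s) \<in> borel_measurable M" using b by simp
  have [measurable]: "csurv (\<lambda>r. shrink m * b r) s t y \<in> sets M" for m
    by (rule csurv_sets) (use b in \<open>auto intro!: continuous_intros\<close>)
  note [measurable] = surv_sets[OF b]
  show "(\<lambda>\<omega>. h (y + W (t - s) \<omega>) * indicator (surv b s t y) \<omega>) \<in> borel_measurable M"
    "(\<lambda>\<omega>. h (y + W (t - s) \<omega>) * indicator (csurv (\<lambda>r. shrink m * b r) s t y) \<omega>) \<in> borel_measurable M" for m
    by measurable
  show "h (y + W (t - s) \<omega>) * indicator (csurv (\<lambda>r. shrink m * b r) s t y) \<omega> \<le> B" for m \<omega>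
    using ennreal_mult_bounded[OF hB(1) indicator_le_one_ennreal] by simp
  show "(\<lambda>m. h (y + W (t - s) \<omega>) * indicator (csurv (\<lambda>r. shrink m * b r) s t y) \<omega>)
    \<longlonglongrightarrow> h (y + W (t - s) \<omega>) * indicator (surv b s t y) \<omega>" if "\<omega> \<in> space M" for \<omega>
    by (rule indicator_tendsto, rule csurv_eventually_surv[OF that b(1,2)]) (use b(3) in auto)
qed fact

text \<open>Weak survival below \<open>shrink m * b\<close> satisfies the identity for each
  \<open>m\<close>, and both sides converge as the factors tend to 1.\<close>

theorem nn_surv_markov:
  assumes f[measurable]: "f \<in> borel_measurable borel" and fB: "\<And>z. f z \<le> B"
    and h[measurable]: "h \<in> borel_measurable borel" and hB: "\<And>z. h z \<le> B" and B: "B < top"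
    and b: "continuous_on {s..t} b" "\<And>r. r \<in> {s..t} \<Longrightarrow> 0 < b r" and sut: "s < u" "u < t"
  shows "(\<integral>\<^sup>+\<omega>. f (y + W (u - s) \<omega>) * h (y + W (t - s) \<omega>) * indicator (surv b s t y) \<omega> \<partial>M)
    = nn_surv b s u (\<lambda>z. f z * nn_surv b u t h z) y"
proof -
  let ?b = "\<lambda>m r. shrink m * b r"
  have st: "s < t" using sut by simp
  have b1: "continuous_on {s..u} b" "continuous_on {u..t} b" and bm: "continuous_on {s..t} (?b m)" for m
    using b sut by (auto elim: continuous_on_subset intro!: continuous_intros)
  have bm1: "continuous_on {s..u} (?b m)" "continuous_on {u..t} (?b m)" for m
    using b1 by (auto intro!: continuous_intros)
  have [measurable]: "W (t - s) \<in> borel_measurable M" "W (u - s) \<in> borel_measurable M" using sut by auto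
  have BB: "B * B < top" using B by (simp add: ennreal_mult_less_top)
  have L1: "(\<lambda>m. \<integral>\<^sup>+\<omega>. f (y + W (u - s) \<omega>) * h (y + W (t - s) \<omega>) * indicator (csurv (?b m) s t y) \<omega> \<partial>M)
    \<longlonglongrightarrow> (\<integral>\<^sup>+\<omega>. f (y + W (u - s) \<omega>) * h (y + W (t - s) \<omega>) * indicator (surv b s t y) \<omega> \<partial>M)"
  proof (rule nn_bounded_convergence[where B="B * B"])
    note [measurable] = surv_sets[OF b st] csurv_sets[OF bm st]
    show "(\<lambda>\<omega>. f (y + W (u - s) \<omega>) * h (y + W (t - s) \<omega>) * indicator (surv b s t y) \<omega>) \<in> borel_measurable M" by measurable
    show "(\<lambda>\<omega>. f (y + W (u - s) \<omega>) * h (y + W (t - s) \<omega>) * indicator (csurv (?b m) s t y) \<omega>) \<in> borel_measurable M" for m by measurable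
    show "f (y + W (u - s) \<omega>) * h (y + W (t - s) \<omega>) * indicator (csurv (?b m) s t y) \<omega> \<le> B * B" for m \<omega>
      using ennreal_mult_bounded[OF ennreal_mult_bounded[OF fB hB] indicator_le_one_ennreal] by simp
    show "(\<lambda>m. f (y + W (u - s) \<omega>) * h (y + W (t - s) \<omega>) * indicator (csurv (?b m) s t y) \<omega>)
      \<longlonglongrightarrow> f (y + W (u - s) \<omega>) * h (y + W (t - s) \<omega>) * indicator (surv b s t y) \<omega>" if "\<omega> \<in> space M" for \<omega>
      by (rule indicator_tendsto, rule csurv_eventually_surv[OF that b]) (use st in auto)
  qed (rule BB)
  have L2: "(\<lambda>m. nn_closed (?b m) s u (\<lambda>z. f z * nn_closed (?b m) u t h z) y)
    \<longlonglongrightarrow> nn_surv b s u (\<lambda>z. f z * nn_surv b u t h z) y"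
    unfolding nn_closed_def[of _ s u] nn_surv_def[of _ s u]
  proof (rule nn_bounded_convergence[where B="B * B"])
    have [measurable]: "surv b s u y \<in> sets M" "nn_surv b u t h \<in> borel_measurable borel"
      "csurv (?b m) s u y \<in> sets M" "nn_closed (?b m) u t h \<in> borel_measurable borel" for m
      using b1 bm1 b sut by (auto intro!: surv_sets nn_surv_measurable csurv_sets nn_closed_measurable)
    show "(\<lambda>\<omega>. f (y + W (u - s) \<omega>) * nn_surv b u t h (y + W (u - s) \<omega>) * indicator (surv b s u y) \<omega>) \<in> borel_measurable M"
      by measurable
    show "(\<lambda>\<omega>. f (y + W (u - s) \<omega>) * nn_closed (?b m) u t h (y + W (u - s) \<omega>) * indicator (csurv (?b m) s u y) \<omega>) \<in> borel_measurable M" for m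
      by measurable
    show "f (y + W (u - s) \<omega>) * nn_closed (?b m) u t h (y + W (u - s) \<omega>) * indicator (csurv (?b m) s u y) \<omega> \<le> B * B" for m \<omega>
      using ennreal_mult_bounded[OF ennreal_mult_bounded[OF fB nn_closed_bound(1)[OF hB]] indicator_le_one_ennreal] by simp
    fix \<omega> assume \<omega>: "\<omega> \<in> space M"
    let ?z = "y + W (u - s) \<omega>"
    have ev: "\<forall>\<^sub>F m in sequentially. \<omega> \<in> csurv (?b m) s u y \<longleftrightarrow> \<omega> \<in> surv b s u y"
      by (rule csurv_eventually_surv[OF \<omega> b1(1) b(2)]) (use sut in auto)
    have "f ?z < top" using fB[of ?z] B by (rule le_less_trans)
    then have 1: "(\<lambda>m. f ?z * nn_closed (?b m) u t h ?z) \<longlonglongrightarrow> f ?z * nn_surv b u t h ?z"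
      by (rule ennreal_tendsto_cmult, intro nn_surv_limit[OF h hB B b1(2) b(2) sut(2)]) (use sut in auto)
    have 2: "(\<lambda>m. f ?z * nn_closed (?b m) u t h ?z * indicator (surv b s u y) \<omega>) \<longlonglongrightarrow> f ?z * nn_surv b u t h ?z * indicator (surv b s u y) \<omega>"
      using 1 by (cases "\<omega> \<in> surv b s u y") auto
    show "(\<lambda>m. f ?z * nn_closed (?b m) u t h ?z * indicator (csurv (?b m) s u y) \<omega>)
      \<longlonglongrightarrow> f ?z * nn_surv b u t h ?z * indicator (surv b s u y) \<omega>"
      by (rule Lim_transform_eventually[OF 2]) (use ev in eventually_elim, auto simp: indicator_def)
  qed (rule BB)
  show ?thesis
    using LIMSEQ_unique[OF L1[unfolded nn_closed_markov[OF f fB h hB B bm sut]] L2] .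
qed

end

section \<open>Odd functions and the heat flow\<close>

lemma char_normal_real:
  "(\<integral>y. std_normal_density y * cos (b * y) \<partial>lborel) = exp (- b\<^sup>2 / 2)"
  "(\<integral>y. std_normal_density y * sin (b * y) \<partial>lborel) = 0"
proof -
  interpret N: prob_space std_normal_distribution by (rule prob_space_normal_density) simp
  have int: "complex_integrable std_normal_distribution (\<lambda>x. iexp (b * x))"
    by (rule N.integrable_const_bound[where B=1]) auto
  have "char std_normal_distribution b = complex_of_real (exp (- b\<^sup>2 / 2))"
    by (simp add: char_std_normal_distribution)
  then have *: "(CLINT x|std_normal_distribution. iexp (b * x)) = complex_of_real (exp (- b\<^sup>2 / 2))"
    by (simp add: char_def)
  have "(\<integral>x. Re (iexp (b * x)) \<partial>std_normal_distribution) = exp (- b\<^sup>2 / 2)"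
    using integral_Re[OF int] * by simp
  then show "(\<integral>y. std_normal_density y * cos (b * y) \<partial>lborel) = exp (- b\<^sup>2 / 2)"
    by (subst (asm) integral_density) (auto simp: Re_exp)
  have "(\<integral>x. Im (iexp (b * x)) \<partial>std_normal_distribution) = 0"
    using integral_Im[OF int] * by simp
  then show "(\<integral>y. std_normal_density y * sin (b * y) \<partial>lborel) = 0"
    by (subst (asm) integral_density) (auto simp: Im_exp)
qed

context brownian
begin

lemma bounded_convergence:
  fixes F :: "nat \<Rightarrow> 'a \<Rightarrow> real"
  assumes [measurable]: "\<And>n. F n \<in> borel_measurable M" "G \<in> borel_measurable M"
    and bound: "\<And>n \<omega>. \<omega> \<in> space M \<Longrightarrow> \<bar>F n \<omega>\<bar> \<le> B"
    and lim: "\<And>\<omega>. \<omega> \<in> space M \<Longrightarrow> (\<lambda>n. F n \<omega>) \<longlonglongrightarrow> G \<omega>"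
  shows "(\<lambda>n. \<integral>\<omega>. F n \<omega> \<partial>M) \<longlonglongrightarrow> (\<integral>\<omega>. G \<omega> \<partial>M)"
  by (rule integral_dominated_convergence[where w="\<lambda>_. B"]) (use bound lim in auto)

definition heat :: "real \<Rightarrow> (real \<Rightarrow> real) \<Rightarrow> real \<Rightarrow> real" where
  "heat t F x = (\<integral>\<omega>. F (x + W t \<omega>) \<partial>M)"

lemma bounded_integrable:
  assumes "f \<in> borel_measurable M" "\<And>\<omega>. \<omega> \<in> space M \<Longrightarrow> \<bar>f \<omega>\<bar> \<le> B"
  shows "integrable M (f :: 'a \<Rightarrow> real)"
  by (rule integrable_const_bound[where B=B]) (use assms in auto)

lemma abs_integral_le:
  assumes "f \<in> borel_measurable M" "\<And>\<omega>. \<omega> \<in> space M \<Longrightarrow> \<bar>f \<omega>\<bar> \<le> B"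
  shows "\<bar>\<integral>\<omega>. f \<omega> \<partial>M\<bar> \<le> (B::real)"
proof -
  have "integrable M f" by (rule bounded_integrable) (use assms in auto)
  have "\<bar>\<integral>\<omega>. f \<omega> \<partial>M\<bar> \<le> (\<integral>\<omega>. \<bar>f \<omega>\<bar> \<partial>M)" by simp
  also have "\<dots> \<le> (\<integral>\<omega>. B \<partial>M)"
    by (rule integral_mono) (use assms \<open>integrable M f\<close> in auto)
  finally show ?thesis by (simp add: prob_space)
qed

lemma heat_0: "heat 0 F x = F x"
proof -
  have "heat 0 F x = (\<integral>\<omega>. F x \<partial>M)" unfolding heat_def by (intro Bochner_Integration.integral_cong) (auto simp: W_0)
  then show ?thesis by (simp add: prob_space)
qed

lemma heat_measurable [measurable]:
  assumes [measurable]: "F \<in> borel_measurable borel" and "0 \<le> t"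
  shows "heat t F \<in> borel_measurable borel"
proof -
  have [measurable]: "W t \<in> borel_measurable M" using assms by simp
  show ?thesis unfolding heat_def by measurable
qed

lemma heat_bound:
  assumes [measurable]: "F \<in> borel_measurable borel" and "\<And>x. \<bar>F x\<bar> \<le> B" "0 \<le> t"
  shows "\<bar>heat t F x\<bar> \<le> B"
proof -
  have [measurable]: "W t \<in> borel_measurable M" using assms by simp
  show ?thesis unfolding heat_def by (rule abs_integral_le) (use assms in auto)
qed

lemma W_distributed:
  assumes "0 < t"
  shows "distributed M lborel (W t) (\<lambda>x. ennreal (normal_density 0 (sqrt t) x))"
proof -
  have "distributed M lborel (\<lambda>\<omega>. W t \<omega> - W 0 \<omega>) (\<lambda>x. ennreal (normal_density 0 (sqrt t) x))"
    using W_increment[of 0 t] assms by simp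
  moreover have "distr M lborel (\<lambda>\<omega>. W t \<omega> - W 0 \<omega>) = distr M lborel (W t)"
    by (rule distr_cong) (auto simp: W_0)
  ultimately show ?thesis using assms by (auto simp: distributed_def)
qed

lemma heat_eq_integral:
  assumes "0 < t" and [measurable]: "F \<in> borel_measurable borel"
  shows "heat t F x = (\<integral>y. normal_density 0 (sqrt t) y * F (x + y) \<partial>lborel)"
  unfolding heat_def using distributed_integral[OF W_distributed[OF assms(1)], of "\<lambda>y. F (x + y)"] by simp

lemma heat_eq_nn_gauss:
  assumes "0 < t" and [measurable]: "v \<in> borel_measurable borel" and v: "\<And>x. 0 \<le> v x" "\<And>x. v x \<le> B"
  shows "nn_gauss t (\<lambda>z. ennreal (v z)) x = ennreal (heat t v x)"
proof -
  have [measurable]: "W t \<in> borel_measurable M" using assms by simp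
  have "nn_gauss t (\<lambda>z. ennreal (v z)) x = (\<integral>\<^sup>+\<omega>. ennreal (v (x + W t \<omega>)) \<partial>M)"
    using distributed_nn_integral[OF W_distributed[OF assms(1)], of "\<lambda>y. ennreal (v (x + y))"]
    by (simp add: nn_gauss_shift)
  also have "\<dots> = ennreal (heat t v x)" unfolding heat_def
    by (rule nn_integral_eq_integral) (use v in \<open>auto intro!: bounded_integrable[where B=B] simp: abs_le_iff intro: order_trans[of _ 0]\<close>)
  finally show ?thesis .
qed

lemma heat_add_const:
  assumes [measurable]: "v \<in> borel_measurable borel" and v: "\<And>x. \<bar>v x\<bar> \<le> B" and "0 \<le> t"
  shows "heat t (\<lambda>z. v z + c) x = heat t v x + c"
proof -
  have [measurable]: "W t \<in> borel_measurable M" using assms by simp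
  have "integrable M (\<lambda>\<omega>. v (x + W t \<omega>))" by (rule bounded_integrable[where B=B]) (use v in auto)
  then show ?thesis by (simp add: heat_def prob_space)
qed

text \<open>Signed \<open>v\<close> is reduced to the nonnegative case by adding \<open>B\<close>;
  the constant drops out again because the heat flow preserves it.\<close>

lemma markov_step:
  fixes \<tau> :: "nat \<Rightarrow> real" and w :: "nat \<Rightarrow> real \<Rightarrow> real" and v :: "real \<Rightarrow> real"
  assumes \<tau>0: "\<tau> 0 = 0" and \<tau>: "\<And>i. i \<le> k \<Longrightarrow> \<tau> i < \<tau> (Suc i)"
    and w[measurable]: "\<And>i. w i \<in> borel_measurable borel" and w01: "\<And>i z. 0 \<le> w i z" "\<And>i z. w i z \<le> 1"
    and v[measurable]: "v \<in> borel_measurable borel" and vB: "\<And>z. \<bar>v z\<bar> \<le> B"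
  shows "(\<integral>\<omega>. (\<Prod>j\<le>k. w j (x + W (\<tau> j) \<omega>)) * v (x + W (\<tau> (Suc k)) \<omega>) \<partial>M) =
    (\<integral>\<omega>. (\<Prod>j\<le>k. w j (x + W (\<tau> j) \<omega>)) * heat (\<tau> (Suc k) - \<tau> k) v (x + W (\<tau> k) \<omega>) \<partial>M)"
proof -
  let ?Z = "\<lambda>\<omega>. \<Prod>j\<le>k. w j (x + W (\<tau> j) \<omega>)" and ?\<delta> = "\<tau> (Suc k) - \<tau> k"
  have pos: "0 \<le> \<tau> i" if "i \<le> Suc k" for i
    using that by (induction i) (use \<tau>0 \<tau> in \<open>auto intro: order_trans less_imp_le\<close>)
  have [measurable]: "W (\<tau> i) \<in> borel_measurable M" if "i \<le> Suc k" for i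
    using W_measurable pos that by auto
  have \<delta>: "0 < ?\<delta>" using \<tau>[of k] by simp
  have Z[measurable]: "?Z \<in> borel_measurable M" by (intro borel_measurable_prod) auto
  have Z01: "0 \<le> ?Z \<omega>" "?Z \<omega> \<le> 1" for \<omega> using w01 by (auto intro!: prod_nonneg prod_le_1)
  have hm[measurable]: "heat ?\<delta> v \<in> borel_measurable borel" using \<delta> by simp
  have hB: "\<bar>heat ?\<delta> v z\<bar> \<le> B" for z by (rule heat_bound) (use vB \<delta> in auto)
  have B: "0 \<le> B" using vB[of 0] by simp
  have bnd: "0 \<le> v z + B" "v z + B \<le> 2 * B" "0 \<le> heat ?\<delta> v z + B" "heat ?\<delta> v z + B \<le> 2 * B" for z
    using vB[of z] hB[of z] by auto
  have Zb: "\<bar>?Z \<omega> * q\<bar> \<le> 2 * B" if "0 \<le> q" "q \<le> 2 * B" for \<omega> q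
    using mult_mono[OF Z01(2) that(2), of \<omega>] Z01(1)[of \<omega>] that by (simp add: abs_mult)
  have Zb1: "\<bar>?Z \<omega> * q\<bar> \<le> B" if "\<bar>q\<bar> \<le> B" for \<omega> q
    using mult_mono[OF Z01(2) that, of \<omega>] Z01(1)[of \<omega>] that by (simp add: abs_mult)
  have "ennreal (\<integral>\<omega>. ?Z \<omega> * (v (x + W (\<tau> (Suc k)) \<omega>) + B) \<partial>M) =
    (\<integral>\<^sup>+\<omega>. (\<Prod>j\<le>k. ennreal (w j (x + W (\<tau> j) \<omega>))) * ennreal (v (x + W (\<tau> (Suc k)) \<omega>) + B) \<partial>M)"
    by (subst nn_integral_eq_integral[symmetric])
      (use bnd Z01 Zb w01 in \<open>auto intro!: bounded_integrable[where B="2*B"] AE_I2 mult_nonneg_nonneg nn_integral_cong simp: ennreal_mult prod_ennreal[symmetric]\<close>)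
  also have "\<dots> = (\<integral>\<^sup>+\<omega>. (\<Prod>j\<le>k. ennreal (w j (x + W (\<tau> j) \<omega>))) * nn_gauss ?\<delta> (\<lambda>z. ennreal (v z + B)) (x + W (\<tau> k) \<omega>) \<partial>M)"
    by (rule nn_markov_step) (use \<tau>0 \<tau> in auto)
  also have "\<dots> = (\<integral>\<^sup>+\<omega>. (\<Prod>j\<le>k. ennreal (w j (x + W (\<tau> j) \<omega>))) * ennreal (heat ?\<delta> v (x + W (\<tau> k) \<omega>) + B) \<partial>M)"
    by (subst heat_eq_nn_gauss[OF \<delta>, where B="2*B"]) (use bnd in \<open>auto simp: heat_add_const[OF v vB less_imp_le[OF \<delta>]]\<close>)
  also have "\<dots> = ennreal (\<integral>\<omega>. ?Z \<omega> * (heat ?\<delta> v (x + W (\<tau> k) \<omega>) + B) \<partial>M)"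
    by (subst nn_integral_eq_integral[symmetric])
      (use bnd Z01 Zb w01 in \<open>auto intro!: bounded_integrable[where B="2*B"] AE_I2 mult_nonneg_nonneg nn_integral_cong simp: ennreal_mult prod_ennreal[symmetric]\<close>)
  finally have eq: "(\<integral>\<omega>. ?Z \<omega> * (v (x + W (\<tau> (Suc k)) \<omega>) + B) \<partial>M) = (\<integral>\<omega>. ?Z \<omega> * (heat ?\<delta> v (x + W (\<tau> k) \<omega>) + B) \<partial>M)"
    by (subst (asm) ennreal_inj) (use bnd Z01 in \<open>auto intro!: integral_nonneg_AE AE_I2 mult_nonneg_nonneg\<close>)
  have i: "integrable M (\<lambda>\<omega>. ?Z \<omega> * v (x + W (\<tau> (Suc k)) \<omega>))" "integrable M (\<lambda>\<omega>. ?Z \<omega> * B)"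
      "integrable M (\<lambda>\<omega>. ?Z \<omega> * heat ?\<delta> v (x + W (\<tau> k) \<omega>))"
    by (rule bounded_integrable[where B=B], measurable, rule Zb1, use vB hB B in simp)+
  show ?thesis using eq i by (simp add: distrib_left)
qed

lemma heat_lipschitz:
  assumes [measurable]: "F \<in> borel_measurable borel" and FB: "\<And>x. \<bar>F x\<bar> \<le> B"
    and L: "\<And>x y. \<bar>F x - F y\<bar> \<le> L * \<bar>x - y\<bar>" and t: "0 \<le> t"
  shows "\<bar>heat t F x - heat t F y\<bar> \<le> L * \<bar>x - y\<bar>"
proof -
  have [measurable]: "W t \<in> borel_measurable M" using t by simp
  have "integrable M (\<lambda>\<omega>. F (z + W t \<omega>))" for z by (rule bounded_integrable[where B=B]) (use FB in auto)
  then have "heat t F x - heat t F y = (\<integral>\<omega>. F (x + W t \<omega>) - F (y + W t \<omega>) \<partial>M)"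
    by (simp add: heat_def)
  also have "\<bar>\<dots>\<bar> \<le> L * \<bar>x - y\<bar>"
    by (rule abs_integral_le) (use L[of "x + w" "y + w" for w] in auto)
  finally show ?thesis .
qed

text \<open>Reflection at \<open>c\<close> preserves the Gaussian centred there and changes the sign
  of the integrand, so the value equals its own negative.\<close>

lemma heat_reflect:
  assumes F[measurable]: "F \<in> borel_measurable borel" and odd: "\<And>y. F (2 * c - y) = - F y" and t: "0 \<le> t"
  shows "heat t F c = 0"
proof (cases "t = 0")
  case True
  then show ?thesis using odd[of c] by (simp add: heat_0)
next
  case False
  then have t: "0 < t" using t by simp
  have "heat t F c = (\<integral>y. normal_density 0 (sqrt t) (0 + (-1) * y) * F (c + (0 + (-1) * y)) \<partial>lborel)"
    unfolding heat_eq_integral[OF t F] by (subst lborel_integral_real_affine[where c="-1" and t=0]) auto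
  also have "\<dots> = (\<integral>y. - (normal_density 0 (sqrt t) y * F (c + y)) \<partial>lborel)"
    by (intro Bochner_Integration.integral_cong refl) (use odd[of "c + y" for y] in \<open>simp add: normal_density_def\<close>)
  also have "\<dots> = - heat t F c" by (simp add: heat_eq_integral[OF t F])
  finally show ?thesis by simp
qed

text \<open>Optional stopping at the first grid time outside \<open>{-c..c}\<close>: there the heat flow of a function
  that is odd about both end points is small, because the path has just left the interval.\<close>

lemma csurv_odd:
  assumes F[measurable]: "F \<in> borel_measurable borel" and FB: "\<And>x. \<bar>F x\<bar> \<le> B"
    and L: "\<And>x y. \<bar>F x - F y\<bar> \<le> L * \<bar>x - y\<bar>"
    and odd: "\<And>y. F (2 * c - y) = - F y" "\<And>y. F (- 2 * c - y) = - F y"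
    and x: "\<bar>x\<bar> \<le> c" and t: "0 < t"
  shows "(\<integral>\<omega>. F (x + W t \<omega>) * indicator (csurv (\<lambda>_. c) 0 t x) \<omega> \<partial>M) = heat t F x"
proof -
  have L0: "0 \<le> L" using L[of 1 0] by simp
  have B0: "0 \<le> B" using FB[of 0] by simp
  define Z where "Z n k \<omega> = (indicator (cgrid (\<lambda>_. c) (ugrid t n) k x) \<omega> :: real)" for n k \<omega>
  \<comment> \<open>The overshoot beyond the end point at the first grid time outside is at most one
    increment of the path.\<close>
  define D where "D n \<omega> = (MAX j\<in>{..n}. \<bar>W (ugrid t n (Suc j)) \<omega> - W (ugrid t n j) \<omega>\<bar>)" for n \<omega>
  have [measurable]: "W t \<in> borel_measurable M" using t by simp
  have Wg[measurable]: "W (ugrid t n j) \<in> borel_measurable M" for n j using ugrid_nonneg[of t n j] t by simp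
  have Zm[measurable]: "Z n k \<in> borel_measurable M" for n k
    unfolding Z_def using cgrid_sets[of k "ugrid t n" "\<lambda>_. c" x] ugrid_nonneg[of t n] t by simp
  have Dm[measurable]: "D n \<in> borel_measurable M" for n
    unfolding D_def by (rule borel_measurable_Max) auto
  have D0: "0 \<le> D n \<omega>" for n \<omega>
    unfolding D_def by (rule order_trans[OF abs_ge_zero Max_ge[OF _ imageI[of 0]]]) auto
  have Z01: "0 \<le> Z n k \<omega>" "Z n k \<omega> \<le> 1" "Z n (Suc k) \<omega> \<le> Z n k \<omega>" for n k \<omega>
    by (auto simp: Z_def indicator_def cgrid_def)
  have ZB: "\<bar>q * Z n k \<omega>\<bar> \<le> B" if "\<bar>q\<bar> \<le> B" for q n k \<omega>
    using that B0 by (simp add: Z_def indicator_def)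
  have hB: "\<bar>heat r F z\<bar> \<le> B" if "0 \<le> r" for r z by (rule heat_bound) (use FB that in auto)
  \<comment> \<open>Oddness makes the heat flow vanish at both end points, and the Lipschitz bound
    of \<open>F\<close> survives the flow.\<close>
  have h_small: "\<bar>heat r F y\<bar> \<le> L * (\<bar>y\<bar> - c)" if "0 \<le> r" "c \<le> \<bar>y\<bar>" for r y
  proof (cases "0 \<le> y")
    case True
    have "\<bar>heat r F y - heat r F c\<bar> \<le> L * \<bar>y - c\<bar>" by (rule heat_lipschitz[OF F FB L that(1)])
    moreover have "heat r F c = 0" by (rule heat_reflect[OF F odd(1) that(1)])
    ultimately show ?thesis using True that by simp
  next
    case False
    have "\<bar>heat r F y - heat r F (-c)\<bar> \<le> L * \<bar>y - (-c)\<bar>" by (rule heat_lipschitz[OF F FB L that(1)])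
    moreover have "heat r F (-c) = 0" by (rule heat_reflect[OF F _ that(1)]) (use odd(2) in simp)
    ultimately show ?thesis using False that by simp
  qed
  \<comment> \<open>\<open>Z n k - Z n (Suc k)\<close> indicates that grid time \<open>Suc k\<close>
    is the first one outside; conditioning there replaces \<open>F\<close> at time \<open>t\<close>
    by its heat flow over the remaining time. The cap \<open>B\<close> keeps the right-hand
    integrand bounded, as the passage to the limit by bounded convergence requires.\<close>
  have step: "\<bar>\<integral>\<omega>. F (x + W t \<omega>) * (Z n k \<omega> - Z n (Suc k) \<omega>) \<partial>M\<bar> \<le>
    (\<integral>\<omega>. min B (L * D n \<omega>) * (Z n k \<omega> - Z n (Suc k) \<omega>) \<partial>M)" if k: "k \<le> n" for n k
  proof -
    let ?\<tau> = "ugrid t n"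
    let ?r = "t - ?\<tau> (Suc k)"
    have r: "0 \<le> ?r" using ugrid_le[of t "Suc k" n] t k by simp
    have [measurable]: "heat ?r F \<in> borel_measurable borel" using r by simp
    define w where "w j z = (if j = Suc k then 1 - indicator {-c..c} z else indicator {-c..c} z :: real)" for j z
    have prodw: "(\<Prod>j\<le>Suc k. w j (x + W (?\<tau> j) \<omega>)) = Z n k \<omega> - Z n (Suc k) \<omega>" if "\<omega> \<in> space M" for \<omega>
    proof -
      have "(\<Prod>j\<le>k. w j (x + W (?\<tau> j) \<omega>)) = (\<Prod>j\<le>k. indicator {-c..c} (x + W (?\<tau> j) \<omega>))"
        by (intro prod.cong) (auto simp: w_def)
      then have *: "(\<Prod>j\<le>k. w j (x + W (?\<tau> j) \<omega>)) = Z n k \<omega>"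
        using indicator_cgrid_prod[OF that, where c="\<lambda>_. c" and 'b=real] by (simp add: Z_def)
      have "Z n (Suc k) \<omega> = Z n k \<omega> * indicator {-c..c} (x + W (?\<tau> (Suc k)) \<omega>)"
        unfolding Z_def using indicator_cgrid_prod[OF that, where c="\<lambda>_. c" and 'b=real, symmetric] by simp
      then show ?thesis using * by (simp add: w_def algebra_simps)
    qed
    have eq: "(\<integral>\<omega>. F (x + W t \<omega>) * (Z n k \<omega> - Z n (Suc k) \<omega>) \<partial>M)
      = (\<integral>\<omega>. heat ?r F (x + W (?\<tau> (Suc k)) \<omega>) * (Z n k \<omega> - Z n (Suc k) \<omega>) \<partial>M)"
    \<comment> \<open>For \<open>k = n\<close> the exit happens at \<open>t\<close> itself and no
      time remains.\<close>
    proof (cases "k = n")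
      case True
      then show ?thesis by (simp add: heat_0)
    next
      case False
      then have kn: "Suc k < Suc n" using k by simp
      \<comment> \<open>After the exit index a single further step leads directly to
        \<open>t\<close>, so the Markov step applies to this truncated grid.\<close>
      define \<tau>' where "\<tau>' i = (if i \<le> Suc k then ?\<tau> i else t)" for i
      have lt: "?\<tau> (Suc k) < t"
      proof -
        have "?\<tau> (Suc k) < ?\<tau> (Suc (Suc k))" by (rule ugrid_mono[OF t])
        also have "\<dots> \<le> t" by (rule ugrid_le) (use t kn in auto)
        finally show ?thesis .
      qed
      have "(\<integral>\<omega>. (\<Prod>j\<le>Suc k. w j (x + W (\<tau>' j) \<omega>)) * F (x + W (\<tau>' (Suc (Suc k))) \<omega>) \<partial>M) =
        (\<integral>\<omega>. (\<Prod>j\<le>Suc k. w j (x + W (\<tau>' j) \<omega>)) * heat (\<tau>' (Suc (Suc k)) - \<tau>' (Suc k)) F (x + W (\<tau>' (Suc k)) \<omega>) \<partial>M)"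
        by (rule markov_step[where B=B])
          (use lt ugrid_mono[OF t, of n] FB in \<open>auto simp: \<tau>'_def w_def indicator_def le_Suc_eq\<close>)
      moreover have "(\<Prod>j\<le>Suc k. w j (x + W (\<tau>' j) \<omega>)) = (\<Prod>j\<le>Suc k. w j (x + W (?\<tau> j) \<omega>))" for \<omega>
        by (intro prod.cong) (auto simp: \<tau>'_def)
      ultimately have "(\<integral>\<omega>. (\<Prod>j\<le>Suc k. w j (x + W (?\<tau> j) \<omega>)) * F (x + W t \<omega>) \<partial>M) =
        (\<integral>\<omega>. (\<Prod>j\<le>Suc k. w j (x + W (?\<tau> j) \<omega>)) * heat ?r F (x + W (?\<tau> (Suc k)) \<omega>) \<partial>M)"
        by (simp add: \<tau>'_def del: prod.atMost_Suc)
      moreover have "(\<integral>\<omega>. (\<Prod>j\<le>Suc k. w j (x + W (?\<tau> j) \<omega>)) * G \<omega> \<partial>M) = (\<integral>\<omega>. G \<omega> * (Z n k \<omega> - Z n (Suc k) \<omega>) \<partial>M)" for G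
        by (intro Bochner_Integration.integral_cong refl) (simp add: prodw mult.commute del: prod.atMost_Suc)
      ultimately show ?thesis by metis
    qed
    have "\<bar>\<integral>\<omega>. heat ?r F (x + W (?\<tau> (Suc k)) \<omega>) * (Z n k \<omega> - Z n (Suc k) \<omega>) \<partial>M\<bar>
      \<le> (\<integral>\<omega>. \<bar>heat ?r F (x + W (?\<tau> (Suc k)) \<omega>) * (Z n k \<omega> - Z n (Suc k) \<omega>)\<bar> \<partial>M)"
      by (rule integral_abs_bound)
    also have "\<dots> \<le> (\<integral>\<omega>. min B (L * D n \<omega>) * (Z n k \<omega> - Z n (Suc k) \<omega>) \<partial>M)"
    proof (rule integral_mono)
      have ZZ: "0 \<le> Z n k \<omega> - Z n (Suc k) \<omega>" "Z n k \<omega> - Z n (Suc k) \<omega> \<le> 1" for \<omega>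
        using Z01(3)[of n k \<omega>] Z01(2)[of n k \<omega>] Z01(1)[of n "Suc k" \<omega>] by linarith+
      have bb: "\<bar>q * (Z n k \<omega> - Z n (Suc k) \<omega>)\<bar> \<le> B" if "\<bar>q\<bar> \<le> B" for q \<omega>
        using mult_mono[OF that ZZ(2), of \<omega>] ZZ(1)[of \<omega>] B0 by (simp add: abs_mult)
      show "integrable M (\<lambda>\<omega>. \<bar>heat ?r F (x + W (?\<tau> (Suc k)) \<omega>) * (Z n k \<omega> - Z n (Suc k) \<omega>)\<bar>)"
        by (rule bounded_integrable[where B=B]) (use bb hB[OF r] in auto)
      show "integrable M (\<lambda>\<omega>. min B (L * D n \<omega>) * (Z n k \<omega> - Z n (Suc k) \<omega>))"
        by (rule bounded_integrable[where B=B]) (use bb D0 L0 B0 in \<open>auto intro!: bb\<close>)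
      fix \<omega> assume \<omega>: "\<omega> \<in> space M"
      show "\<bar>heat ?r F (x + W (?\<tau> (Suc k)) \<omega>) * (Z n k \<omega> - Z n (Suc k) \<omega>)\<bar> \<le> min B (L * D n \<omega>) * (Z n k \<omega> - Z n (Suc k) \<omega>)"
      proof (cases "Z n k \<omega> - Z n (Suc k) \<omega> = 0")
        case False
        let ?y = "x + W (?\<tau> (Suc k)) \<omega>"
        have "cgrid (\<lambda>_. c) ?\<tau> (Suc k) x \<subseteq> cgrid (\<lambda>_. c) ?\<tau> k x" by (auto simp: cgrid_def)
        with False have in1: "\<omega> \<in> cgrid (\<lambda>_. c) ?\<tau> k x" and out: "\<omega> \<notin> cgrid (\<lambda>_. c) ?\<tau> (Suc k) x"
          by (cases "\<omega> \<in> cgrid (\<lambda>_. c) ?\<tau> k x"; cases "\<omega> \<in> cgrid (\<lambda>_. c) ?\<tau> (Suc k) x"; auto simp: Z_def)+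
        then have 1: "\<bar>x + W (?\<tau> k) \<omega>\<bar> \<le> c" "c < \<bar>?y\<bar>"
          using \<omega> by (auto simp: cgrid_def le_Suc_eq not_le)
        have "\<bar>?y\<bar> - c \<le> \<bar>W (?\<tau> (Suc k)) \<omega> - W (?\<tau> k) \<omega>\<bar>" using 1 by linarith
        also have "\<dots> \<le> D n \<omega>" unfolding D_def using k by (intro Max_ge) auto
        finally have "\<bar>heat ?r F ?y\<bar> \<le> L * D n \<omega>"
          using h_small[OF r, of ?y] 1 L0 by (meson less_imp_le mult_left_mono order_trans)
        then have "\<bar>heat ?r F ?y\<bar> \<le> min B (L * D n \<omega>)" using hB[OF r] by simp
        then show ?thesis using ZZ(1)[of \<omega>] by (simp add: abs_mult mult_right_mono)
      qed simp
    qed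
    finally show ?thesis unfolding eq .
  qed
  \<comment> \<open>Summing over the first exit index telescopes to the difference between the full
    and the surviving expectation.\<close>
  have total: "\<bar>heat t F x - (\<integral>\<omega>. F (x + W t \<omega>) * Z n (Suc n) \<omega> \<partial>M)\<bar> \<le> (\<integral>\<omega>. min B (L * D n \<omega>) \<partial>M)" for n
  proof -
    have iF: "integrable M (\<lambda>\<omega>. F (x + W t \<omega>) * Z n k \<omega>)" for k
      by (rule bounded_integrable[where B=B], measurable) (rule ZB[OF FB])
    have iD: "integrable M (\<lambda>\<omega>. min B (L * D n \<omega>) * Z n k \<omega>)" for k
      by (rule bounded_integrable[where B=B], measurable, rule ZB) (use D0 L0 B0 in auto)
    have iD1: "integrable M (\<lambda>\<omega>. min B (L * D n \<omega>))"
      by (rule bounded_integrable[where B=B]) (use D0 L0 B0 in auto)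
    have Z0: "Z n 0 \<omega> = 1" if "\<omega> \<in> space M" for \<omega>
      using that x by (simp add: Z_def cgrid_def W_0)
    have tele: "(\<Sum>k\<le>n. a k - a (Suc k)) = a 0 - a (Suc n)" for a :: "nat \<Rightarrow> real"
      by (induction n) auto
    have "heat t F x - (\<integral>\<omega>. F (x + W t \<omega>) * Z n (Suc n) \<omega> \<partial>M)
      = (\<integral>\<omega>. F (x + W t \<omega>) * Z n 0 \<omega> \<partial>M) - (\<integral>\<omega>. F (x + W t \<omega>) * Z n (Suc n) \<omega> \<partial>M)"
      unfolding heat_def by (simp add: Z0 cong: Bochner_Integration.integral_cong)
    also have "\<dots> = (\<Sum>k\<le>n. (\<integral>\<omega>. F (x + W t \<omega>) * Z n k \<omega> \<partial>M) - (\<integral>\<omega>. F (x + W t \<omega>) * Z n (Suc k) \<omega> \<partial>M))"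
      using tele[of "\<lambda>k. \<integral>\<omega>. F (x + W t \<omega>) * Z n k \<omega> \<partial>M"] by simp
    also have "\<dots> = (\<Sum>k\<le>n. \<integral>\<omega>. F (x + W t \<omega>) * (Z n k \<omega> - Z n (Suc k) \<omega>) \<partial>M)"
      by (simp add: right_diff_distrib iF)
    also have "\<bar>\<dots>\<bar> \<le> (\<Sum>k\<le>n. \<bar>\<integral>\<omega>. F (x + W t \<omega>) * (Z n k \<omega> - Z n (Suc k) \<omega>) \<partial>M\<bar>)" by (rule sum_abs)
    also have "\<dots> \<le> (\<Sum>k\<le>n. \<integral>\<omega>. min B (L * D n \<omega>) * (Z n k \<omega> - Z n (Suc k) \<omega>) \<partial>M)"
      by (intro sum_mono step) auto
    also have "\<dots> = (\<Sum>k\<le>n. (\<integral>\<omega>. min B (L * D n \<omega>) * Z n k \<omega> \<partial>M) - (\<integral>\<omega>. min B (L * D n \<omega>) * Z n (Suc k) \<omega> \<partial>M))"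
      by (simp add: right_diff_distrib iD)
    also have "\<dots> = (\<integral>\<omega>. min B (L * D n \<omega>) * Z n 0 \<omega> \<partial>M) - (\<integral>\<omega>. min B (L * D n \<omega>) * Z n (Suc n) \<omega> \<partial>M)"
      using tele[of "\<lambda>k. \<integral>\<omega>. min B (L * D n \<omega>) * Z n k \<omega> \<partial>M"] by simp
    also have "\<dots> \<le> (\<integral>\<omega>. min B (L * D n \<omega>) * Z n 0 \<omega> \<partial>M)"
      using D0 L0 B0 Z01 by (auto intro!: integral_nonneg_AE AE_I2 mult_nonneg_nonneg)
    also have "\<dots> = (\<integral>\<omega>. min B (L * D n \<omega>) \<partial>M)"
      by (simp add: Z0 cong: Bochner_Integration.integral_cong)
    finally show ?thesis .
  qed
  have D_lim: "(\<lambda>n. D n \<omega>) \<longlonglongrightarrow> 0" if \<omega>: "\<omega> \<in> space M" for \<omega>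
  proof (rule LIMSEQ_I)
    fix e :: real assume e: "0 < e"
    have "continuous_on {0..t} (\<lambda>t. W t \<omega>)" using W_continuous[OF \<omega>] by (rule continuous_on_subset) auto
    then have "uniformly_continuous_on {0..t} (\<lambda>t. W t \<omega>)" by (rule compact_uniformly_continuous) simp
    then obtain d where d: "d > 0" "\<And>r r'. r \<in> {0..t} \<Longrightarrow> r' \<in> {0..t} \<Longrightarrow> dist r' r < d \<Longrightarrow> dist (W r' \<omega>) (W r \<omega>) < e"
      using e unfolding uniformly_continuous_on_def by metis
    have "(\<lambda>n. t / real (Suc n)) \<longlonglongrightarrow> 0" by real_asymp
    then have "\<forall>\<^sub>F n in sequentially. t / real (Suc n) < d" by (rule order_tendstoD) (use d in auto)
    then obtain n0 where n0: "\<And>n. n \<ge> n0 \<Longrightarrow> t / real (Suc n) < d" by (auto simp: eventually_sequentially)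
    have "norm (D n \<omega> - 0) < e" if n: "n \<ge> n0" for n
    proof -
      have "\<bar>W (ugrid t n (Suc j)) \<omega> - W (ugrid t n j) \<omega>\<bar> < e" if "j \<le> n" for j
      proof -
        have "ugrid t n j \<in> {0..t}" "ugrid t n (Suc j) \<in> {0..t}"
          using ugrid_le[of t] ugrid_nonneg[of t] t that by auto
        moreover have "dist (ugrid t n (Suc j)) (ugrid t n j) < d"
          using n0[OF n] t by (simp add: dist_real_def ugrid_step)
        ultimately show ?thesis using d(2) by (simp add: dist_real_def)
      qed
      then have "D n \<omega> < e" unfolding D_def by (subst Max_less_iff) auto
      then show ?thesis using D0[of n \<omega>] by simp
    qed
    then show "\<exists>no. \<forall>n\<ge>no. norm (D n \<omega> - 0) < e" by blast
  qed
  have lim0: "(\<lambda>n. \<integral>\<omega>. min B (L * D n \<omega>) \<partial>M) \<longlonglongrightarrow> (\<integral>\<omega>. 0 \<partial>M)"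
  proof (rule bounded_convergence[where B=B])
    show "(\<lambda>n. min B (L * D n \<omega>)) \<longlonglongrightarrow> 0" if "\<omega> \<in> space M" for \<omega>
    proof -
      have "(\<lambda>n. min B (L * D n \<omega>)) \<longlonglongrightarrow> min B (L * 0)" by (intro tendsto_intros D_lim that)
      then show ?thesis using B0 by simp
    qed
  qed (use D0 L0 B0 in auto)
  have cs[measurable]: "csurv (\<lambda>_. c) 0 t x \<in> sets M" by (rule csurv_sets) (use t in auto)
  have lim1: "(\<lambda>n. \<integral>\<omega>. F (x + W t \<omega>) * Z n (Suc n) \<omega> \<partial>M) \<longlonglongrightarrow> (\<integral>\<omega>. F (x + W t \<omega>) * indicator (csurv (\<lambda>_. c) 0 t x) \<omega> \<partial>M)"
  proof (rule bounded_convergence[where B=B])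
    show "(\<lambda>n. F (x + W t \<omega>) * Z n (Suc n) \<omega>) \<longlonglongrightarrow> F (x + W t \<omega>) * indicator (csurv (\<lambda>_. c) 0 t x) \<omega>"
      if "\<omega> \<in> space M" for \<omega>
      unfolding Z_def
      by (rule indicator_tendsto) (use cgrid_eventually_csurv[OF that, of 0 t "\<lambda>_. c" "\<lambda>_ _. c" x] t in simp)
  next
    show "\<bar>F (x + W t \<omega>) * Z n (Suc n) \<omega>\<bar> \<le> B" for n \<omega> by (rule ZB[OF FB])
  qed measurable
  have "(\<lambda>n. heat t F x - (\<integral>\<omega>. F (x + W t \<omega>) * Z n (Suc n) \<omega> \<partial>M)) \<longlonglongrightarrow> 0"
    by (rule Lim_null_comparison[OF _ lim0[simplified]]) (use total in auto)
  moreover have "(\<lambda>n. heat t F x - (\<integral>\<omega>. F (x + W t \<omega>) * Z n (Suc n) \<omega> \<partial>M)) \<longlonglongrightarrow>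
    heat t F x - (\<integral>\<omega>. F (x + W t \<omega>) * indicator (csurv (\<lambda>_. c) 0 t x) \<omega> \<partial>M)"
    by (intro tendsto_intros lim1)
  ultimately show ?thesis using LIMSEQ_unique by fastforce
qed

end

section \<open>Eigenfunctions of the interval\<close>

text \<open>Dirichlet eigenfunctions of half the second derivative on \<open>{-1..1}\<close>,
  numbered so that index 1 is the ground state; index 0 is the zero function.\<close>

definition eigenfun :: "nat \<Rightarrow> real \<Rightarrow> real" where
  "eigenfun k x = sin (real k * (pi * (x + 1) / 2))"

definition eigenval :: "nat \<Rightarrow> real" where
  "eigenval k = (real k * pi / 2)\<^sup>2 / 2"

definition ground :: "real \<Rightarrow> real" where
  "ground x = cos (pi * x / 2)"

lemma eigenval_1: "eigenval 1 = lambda_Bm"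
  by (simp add: eigenval_def lambda_Bm_def power2_eq_square)

lemma eigenfun_1: "eigenfun 1 = ground"
  by (simp add: fun_eq_iff eigenfun_def ground_def distrib_left add_divide_distrib sin_add)

lemma ground_pos: "\<bar>x\<bar> < 1 \<Longrightarrow> 0 < ground x"
  using cos_gt_zero_pi[of "pi * x / 2"] mult_strict_left_mono[of "-1" x pi]
  by (auto simp: ground_def abs_less_iff)

lemma ground_nonneg: "\<bar>x\<bar> \<le> 1 \<Longrightarrow> 0 \<le> ground x"
  using cos_ge_zero[of "pi * x / 2"] mult_left_mono[of "-1" x pi]
  by (auto simp: ground_def abs_le_iff)

lemma eigenfun_bound: "\<bar>eigenfun k x\<bar> \<le> 1"
  by (simp add: eigenfun_def)

lemma eigenfun_continuous: "continuous_on A (eigenfun k)"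
  unfolding eigenfun_def by (intro continuous_intros) auto

lemma eigenfun_measurable [measurable]: "eigenfun k \<in> borel_measurable borel"
  by (rule borel_measurable_continuous_onI) (rule eigenfun_continuous)

lemma ground_measurable [measurable]: "ground \<in> borel_measurable borel"
  using eigenfun_measurable[of 1] by (simp only: eigenfun_1)

lemma abs_sin_diff_le: "\<bar>sin a - sin b\<bar> \<le> \<bar>a - b :: real\<bar>"
proof -
  have "sin a - sin b = 2 * sin ((a - b) / 2) * cos ((a + b) / 2)" by (rule sin_diff_sin)
  then have "\<bar>sin a - sin b\<bar> = 2 * \<bar>sin ((a - b) / 2)\<bar> * \<bar>cos ((a + b) / 2)\<bar>" by (simp add: abs_mult)
  also have "\<dots> \<le> 2 * \<bar>(a - b) / 2\<bar> * 1"
    by (intro mult_mono abs_sin_x_le_abs_x) auto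
  finally show ?thesis by simp
qed

lemma eigenfun_lipschitz: "\<bar>eigenfun k x - eigenfun k y\<bar> \<le> real k * pi / 2 * \<bar>x - y\<bar>"
proof -
  have "\<bar>eigenfun k x - eigenfun k y\<bar> \<le> \<bar>real k * (pi * (x + 1) / 2) - real k * (pi * (y + 1) / 2)\<bar>"
    unfolding eigenfun_def by (rule abs_sin_diff_le)
  also have "real k * (pi * (x + 1) / 2) - real k * (pi * (y + 1) / 2) = real k * pi / 2 * (x - y)"
    by (simp add: field_simps)
  finally show ?thesis by (simp add: abs_mult)
qed

text \<open>The factor 1 is kept so that the equations match the oddness hypotheses for the end
  point \<open>c = 1\<close> literally.\<close>

lemma eigenfun_odd: "eigenfun k (2 * 1 - y) = - eigenfun k y" "eigenfun k (- 2 * 1 - y) = - eigenfun k y"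
proof -
  have *: "sin (2 * real k * pi - z) = - sin z" for z
    by (simp add: sin_diff)
  have "eigenfun k (2 * 1 - y) = sin (2 * real k * pi - real k * (pi * (y + 1) / 2))"
    unfolding eigenfun_def by (rule arg_cong[where f=sin]) (simp add: field_simps)
  then show "eigenfun k (2 * 1 - y) = - eigenfun k y" by (simp add: * eigenfun_def)
  have "eigenfun k (- 2 * 1 - y) = sin (- (real k * (pi * (y + 1) / 2)))"
    unfolding eigenfun_def by (rule arg_cong[where f=sin]) (simp add: field_simps)
  then show "eigenfun k (- 2 * 1 - y) = - eigenfun k y" by (simp add: eigenfun_def)
qed

context brownian
begin

definition kill :: "real \<Rightarrow> (real \<Rightarrow> real) \<Rightarrow> real \<Rightarrow> real" where
  "kill t f x = (\<integral>\<omega>. f (x + W t \<omega>) * indicator (surv (\<lambda>_. 1) 0 t x) \<omega> \<partial>M)"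

text \<open>The weak version at barrier 1 would control \<open>csurv\<close> instead. Dilating
  \<open>F\<close> by \<open>shrink m\<close> gives functions odd about the end points of the
  smaller interval, where the weak version applies; both sides converge as \<open>m\<close> grows,
  and the weak events become the strict one.\<close>

lemma surv_odd:
  assumes F[measurable]: "F \<in> borel_measurable borel" and FB: "\<And>x. \<bar>F x\<bar> \<le> B"
    and L: "\<And>x y. \<bar>F x - F y\<bar> \<le> L * \<bar>x - y\<bar>"
    and odd: "\<And>y. F (2 * 1 - y) = - F y" "\<And>y. F (- 2 * 1 - y) = - F y"
    and x: "\<bar>x\<bar> < 1" and t: "0 < t"
  shows "kill t F x = heat t F x"
proof -
  have [measurable]: "W t \<in> borel_measurable M" using t by simp
  let ?c = shrink
  define G where "G m y = F (y / ?c m)" for m y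
  have c: "0 < ?c m" "?c m < 1" for m by (rule shrink_bounds)+
  have [measurable]: "G m \<in> borel_measurable borel" for m unfolding G_def by measurable
  have GB: "\<bar>G m y\<bar> \<le> B" for m y by (simp add: G_def FB)
  have Gcont: "(\<lambda>m. G m y) \<longlonglongrightarrow> F y" for y
  proof -
    have "continuous_on UNIV F"
    proof (rule lipschitz_on_continuous_on[of "\<bar>L\<bar>"], rule lipschitz_onI)
      show "dist (F a) (F b) \<le> \<bar>L\<bar> * dist a b" for a b
        using order_trans[OF L[of a b] mult_right_mono[of L "\<bar>L\<bar>" "\<bar>a - b\<bar>"]] by (simp add: dist_real_def)
    qed simp
    then have "isCont F (y / 1)" by (simp add: continuous_on_eq_continuous_at)
    moreover have "(\<lambda>m. y / ?c m) \<longlonglongrightarrow> y / 1" by (intro tendsto_intros shrink_tendsto) simp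
    ultimately show ?thesis unfolding G_def using isCont_tendsto_compose by fastforce
  qed
  have ev: "\<forall>\<^sub>F m in sequentially. (\<integral>\<omega>. G m (x + W t \<omega>) * indicator (csurv (\<lambda>_. ?c m) 0 t x) \<omega> \<partial>M) = heat t (G m) x"
    using shrink_eventually[OF x]
  proof eventually_elim
    case (elim m)
    show ?case
    proof (rule csurv_odd[OF _ GB, where L="L / ?c m"])
      fix y z show "\<bar>G m y - G m z\<bar> \<le> L / ?c m * \<bar>y - z\<bar>"
        using L[of "y / ?c m" "z / ?c m"] c[of m]
        by (simp add: G_def diff_divide_distrib[symmetric])
      have "(2 * ?c m - y) / ?c m = 2 * 1 - y / ?c m" "(- 2 * ?c m - y) / ?c m = - 2 * 1 - y / ?c m"
        using c[of m] by (auto simp: field_simps)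
      then show "G m (2 * ?c m - y) = - G m y" "G m (- 2 * ?c m - y) = - G m y"
        unfolding G_def using odd by metis+
    qed (use elim t in auto)
  qed
  have 1: "(\<lambda>m. heat t (G m) x) \<longlonglongrightarrow> heat t F x"
    unfolding heat_def by (rule bounded_convergence[where B=B]) (use GB Gcont in auto)
  have 2: "(\<lambda>m. \<integral>\<omega>. G m (x + W t \<omega>) * indicator (csurv (\<lambda>_. ?c m) 0 t x) \<omega> \<partial>M) \<longlonglongrightarrow> kill t F x"
    unfolding kill_def
  proof (rule bounded_convergence[where B=B])
    fix \<omega> assume \<omega>: "\<omega> \<in> space M"
    have e: "\<forall>\<^sub>F m in sequentially. \<omega> \<in> csurv (\<lambda>_. ?c m) 0 t x \<longleftrightarrow> \<omega> \<in> surv (\<lambda>_. 1) 0 t x"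
      using csurv_eventually_surv[OF \<omega>, of 0 t "\<lambda>_. 1" x] t by simp
    have "(\<lambda>m. G m (x + W t \<omega>) * indicator (surv (\<lambda>_. 1) 0 t x) \<omega>) \<longlonglongrightarrow> F (x + W t \<omega>) * indicator (surv (\<lambda>_. 1) 0 t x) \<omega>"
      by (intro tendsto_intros Gcont)
    then show "(\<lambda>m. G m (x + W t \<omega>) * indicator (csurv (\<lambda>_. ?c m) 0 t x) \<omega>) \<longlonglongrightarrow> F (x + W t \<omega>) * indicator (surv (\<lambda>_. 1) 0 t x) \<omega>"
      by (rule Lim_transform_eventually) (use e in eventually_elim, auto simp: indicator_def)
  next
    show "\<bar>G m (x + W t \<omega>) * indicator (csurv (\<lambda>_. ?c m) 0 t x) \<omega>\<bar> \<le> B" for m \<omega>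
      using GB[of m "x + W t \<omega>"] by (auto simp: indicator_def)
  qed (use t in measurable)
  have 3: "(\<lambda>m. heat t (G m) x) \<longlonglongrightarrow> kill t F x"
    by (rule Lim_transform_eventually[OF 2]) (use ev in eventually_elim, simp)
  show ?thesis using LIMSEQ_unique[OF 3 1] .
qed

text \<open>Addition theorem: the sine of the Gaussian increment averages to 0, its cosine to the
  Gaussian characteristic function.\<close>

lemma heat_eigenfun:
  assumes t: "0 < t"
  shows "heat t (eigenfun k) x = exp (- eigenval k * t) * eigenfun k x"
proof -
  let ?a = "real k * (pi * (x + 1) / 2)" and ?b = "real k * pi / 2"
  have W: "distributed M lborel (W t) (\<lambda>x. ennreal (normal_density 0 (sqrt t) x))" by (rule W_distributed[OF t])
  have st: "distributed M lborel (\<lambda>\<omega>. (W t \<omega> - 0) / sqrt t) (\<lambda>x. ennreal (std_normal_density x))"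
    using W t by (subst normal_standard_normal_convert[symmetric]) auto
  have [measurable]: "W t \<in> borel_measurable M" using t by simp
  have c: "(\<integral>\<omega>. cos (?b * W t \<omega>) \<partial>M) = exp (- eigenval k * t)"
  proof -
    have "(\<integral>\<omega>. cos (?b * W t \<omega>) \<partial>M) = (\<integral>\<omega>. cos (?b * sqrt t * ((W t \<omega> - 0) / sqrt t)) \<partial>M)"
      using t by (simp add: mult.assoc)
    also have "\<dots> = exp (- (?b * sqrt t)\<^sup>2 / 2)"
      unfolding char_normal_real(1)[symmetric] by (rule distributed_integral[OF st, symmetric]) auto
    also have "- (?b * sqrt t)\<^sup>2 / 2 = - eigenval k * t"
      using t by (simp add: eigenval_def power_mult_distrib power_divide field_simps)
    finally show ?thesis .
  qed
  have s: "(\<integral>\<omega>. sin (?b * W t \<omega>) \<partial>M) = 0"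
  proof -
    have "(\<integral>\<omega>. sin (?b * W t \<omega>) \<partial>M) = (\<integral>\<omega>. sin (?b * sqrt t * ((W t \<omega> - 0) / sqrt t)) \<partial>M)"
      using t by (simp add: mult.assoc)
    also have "\<dots> = (\<integral>y. std_normal_density y * sin (?b * sqrt t * y) \<partial>lborel)"
      by (rule distributed_integral[OF st, symmetric]) auto
    also have "\<dots> = 0" by (rule char_normal_real(2))
    finally show ?thesis .
  qed
  have i: "integrable M (\<lambda>\<omega>. cos (?b * W t \<omega>))" "integrable M (\<lambda>\<omega>. sin (?b * W t \<omega>))"
    by (rule bounded_integrable[where B=1], auto)+
  have "heat t (eigenfun k) x = (\<integral>\<omega>. sin ?a * cos (?b * W t \<omega>) + cos ?a * sin (?b * W t \<omega>) \<partial>M)"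
    unfolding heat_def eigenfun_def sin_add[symmetric]
    by (intro Bochner_Integration.integral_cong refl arg_cong[where f=sin]) (simp add: field_simps)
  also have "\<dots> = sin ?a * exp (- eigenval k * t)" using i c s by simp
  finally show ?thesis by (simp add: eigenfun_def)
qed

lemma kill_eigenfun:
  assumes "0 < t" "\<bar>x\<bar> < 1"
  shows "kill t (eigenfun k) x = exp (- eigenval k * t) * eigenfun k x"
proof -
  have "kill t (eigenfun k) x = heat t (eigenfun k) x"
    by (rule surv_odd[where B=1 and L="real k * pi / 2"])
      (rule eigenfun_measurable eigenfun_bound eigenfun_lipschitz eigenfun_odd assms)+
  then show ?thesis by (simp add: heat_eigenfun[OF assms(1)])
qed

lemma kill_ground: "0 < t \<Longrightarrow> \<bar>x\<bar> < 1 \<Longrightarrow> kill t ground x = exp (- lambda_Bm * t) * ground x"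
  using kill_eigenfun[of t x 1] by (simp only: eigenfun_1 eigenval_1)

lemma AE_not_hitting:
  assumes "0 < t"
  shows "AE \<omega> in M. x + W t \<omega> \<noteq> c"
proof -
  have "AE y in density lborel (\<lambda>y. ennreal (normal_density 0 (sqrt t) y)). y \<noteq> c - x"
    by (subst AE_density) (auto intro: AE_mp[OF AE_lborel_singleton[of "c - x"]])
  moreover have "distr M lborel (W t) = density lborel (\<lambda>y. ennreal (normal_density 0 (sqrt t) y))"
    using W_distributed[OF assms] by (simp add: distributed_def)
  ultimately have "AE y in distr M lborel (W t). y \<noteq> c - x" by metis
  then have "AE \<omega> in M. W t \<omega> \<noteq> c - x"
    by (subst (asm) AE_distr_iff) (use assms in auto)
  then show ?thesis by eventually_elim auto
qed

text \<open>The ground state has the same expectation on closed and on strict survival, hence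
  the path almost surely does not touch the boundary without crossing it.\<close>

lemma AE_csurv_surv:
  assumes t: "0 < t" and x: "\<bar>x\<bar> < 1"
  shows "AE \<omega> in M. \<omega> \<in> csurv (\<lambda>_. 1) 0 t x \<longleftrightarrow> \<omega> \<in> surv (\<lambda>_. 1) 0 t x"
proof -
  let ?C = "csurv (\<lambda>_. 1) 0 t x" and ?S = "surv (\<lambda>_. 1) 0 t x"
  have [measurable]: "W t \<in> borel_measurable M" "?C \<in> sets M" "?S \<in> sets M" using t by auto
  have sub: "?S \<subseteq> ?C" by (auto simp: surv_def csurv_def intro: less_imp_le)
  let ?h = "\<lambda>\<omega>. ground (x + W t \<omega>) * indicator ?C \<omega> - ground (x + W t \<omega>) * indicator ?S \<omega>"
  have nn: "0 \<le> ?h \<omega>" for \<omega>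
  proof (cases "\<omega> \<in> ?C")
    case True
    then have "\<bar>x + W t \<omega>\<bar> \<le> 1" using t by (auto simp: csurv_def dest!: bspec[of _ _ t])
    then show ?thesis using True ground_nonneg by (auto simp: indicator_def)
  next
    case False
    then have "\<omega> \<notin> ?S" using sub by auto
    then show ?thesis using False by simp
  qed
  have i: "integrable M (\<lambda>\<omega>. ground (x + W t \<omega>) * indicator ?C \<omega>)" "integrable M (\<lambda>\<omega>. ground (x + W t \<omega>) * indicator ?S \<omega>)"
    by (rule bounded_integrable[where B=1], measurable, use eigenfun_bound[of 1, unfolded eigenfun_1] in \<open>simp add: indicator_def\<close>)+
  have "(\<integral>\<omega>. eigenfun 1 (x + W t \<omega>) * indicator ?C \<omega> \<partial>M) = heat t (eigenfun 1) x"
    by (rule csurv_odd[where B=1 and L="real 1 * pi / 2"])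
      (rule eigenfun_measurable eigenfun_bound eigenfun_lipschitz eigenfun_odd less_imp_le[OF x] t)+
  moreover have "kill t (eigenfun 1) x = heat t (eigenfun 1) x"
    by (rule surv_odd[where B=1 and L="real 1 * pi / 2"])
      (rule eigenfun_measurable eigenfun_bound eigenfun_lipschitz eigenfun_odd x t)+
  ultimately have "(\<integral>\<omega>. ?h \<omega> \<partial>M) = 0"
    using i unfolding eigenfun_1 by (simp add: kill_def)
  then have "AE \<omega> in M. ?h \<omega> = 0"
    by (subst (asm) integral_nonneg_eq_0_iff_AE) (use i nn in auto)
  \<comment> \<open>A vanishing difference excludes touching only where the ground state at the
    final position is positive, that is, off the null event of ending at an end point.\<close>
  then show ?thesis using AE_not_hitting[OF t, of x 1] AE_not_hitting[OF t, of x "-1"] AE_space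
  proof eventually_elim
    case (elim \<omega>)
    show ?case
    proof (rule ccontr)
      assume "\<not> ?thesis"
      then have m: "\<omega> \<in> ?C" "\<omega> \<notin> ?S" using sub by auto
      then have "\<bar>x + W t \<omega>\<bar> \<le> 1" using t by (auto simp: csurv_def dest!: bspec[of _ _ t])
      then have "0 < ground (x + W t \<omega>)" using elim by (intro ground_pos) auto
      then show False using elim m by simp
    qed
  qed
qed

end

section \<open>Pairing with the ground state and \<open>L^1\<close> density of sine
  polynomials\<close>

definition unit_ip :: "(real \<Rightarrow> real) \<Rightarrow> real" where
  "unit_ip f = (\<integral>y. indicator {-1..1} y * (f y * ground y) \<partial>lborel)"

definition unit_norm1 :: "(real \<Rightarrow> real) \<Rightarrow> real" where
  "unit_norm1 f = (\<integral>y. indicator {-1..1} y * \<bar>f y\<bar> \<partial>lborel)"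

lemma ground_bounds: "\<bar>ground x\<bar> \<le> 1"
  by (simp add: ground_def)

lemma unit_integrable:
  fixes f :: "real \<Rightarrow> real"
  assumes [measurable]: "f \<in> borel_measurable borel" and "\<And>x. \<bar>f x\<bar> \<le> B"
  shows "integrable lborel (\<lambda>y. indicator {-1..1} y * f y)"
proof (rule Bochner_Integration.integrable_bound[where f="\<lambda>y. B * indicator {-1..1::real} y"])
  show "integrable lborel (\<lambda>y. B * indicator {-1..1::real} y)" by (auto simp: emeasure_lborel_Icc_eq)
  show "AE x in lborel. norm (indicator {- 1..1} x * f x) \<le> norm (B * indicator {- 1..1} x)"
  proof (intro AE_I2)
    fix x have "\<bar>f x\<bar> \<le> \<bar>B\<bar>" using assms(2)[of x] by simp
    then show "norm (indicator {- 1..1} x * f x) \<le> norm (B * indicator {- 1..1} x)" by (auto simp: indicator_def)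
  qed
qed measurable

lemma unit_ip_integrable:
  assumes [measurable]: "f \<in> borel_measurable borel" and f: "\<And>x. \<bar>f x\<bar> \<le> B"
  shows "integrable lborel (\<lambda>y. indicator {-1..1} y * (f y * ground y))"
proof (rule unit_integrable)
  show "\<bar>f x * ground x\<bar> \<le> B" for x
    using mult_mono[OF f[of x] ground_bounds[of x]] f[of x] by (simp add: abs_mult)
qed measurable

lemma unit_ip_add:
  assumes "f \<in> borel_measurable borel" "\<And>x. \<bar>f x\<bar> \<le> B" "g \<in> borel_measurable borel" "\<And>x. \<bar>g x\<bar> \<le> C"
  shows "unit_ip (\<lambda>x. f x + g x) = unit_ip f + unit_ip g"
  using unit_ip_integrable[OF assms(1,2)] unit_ip_integrable[OF assms(3,4)]
  by (simp add: unit_ip_def distrib_left distrib_right)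

lemma unit_ip_diff_le:
  assumes [measurable]: "f \<in> borel_measurable borel" "g \<in> borel_measurable borel"
    and f: "\<And>x. \<bar>f x\<bar> \<le> B" and g: "\<And>x. \<bar>g x\<bar> \<le> C"
  shows "\<bar>unit_ip f - unit_ip g\<bar> \<le> unit_norm1 (\<lambda>x. f x - g x)"
proof -
  have i: "integrable lborel (\<lambda>y. indicator {-1..1} y * \<bar>f y - g y\<bar>)"
    by (rule unit_integrable[where B="B + C"]) (use f g in \<open>auto intro!: order_trans[OF abs_triangle_ineq4 add_mono]\<close>)
  let ?d = "\<lambda>y. indicator {-1..1} y * (f y * ground y) - indicator {-1..1} y * (g y * ground y)"
  have eq: "unit_ip f - unit_ip g = (\<integral>y. indicator {-1..1} y * (f y * ground y) - indicator {-1..1} y * (g y * ground y) \<partial>lborel)"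
    unfolding unit_ip_def
    by (rule Bochner_Integration.integral_diff[symmetric]) (rule unit_ip_integrable; fact)+
  have "\<bar>\<integral>y. ?d y \<partial>lborel\<bar> \<le> (\<integral>y. \<bar>?d y\<bar> \<partial>lborel)"
    by (rule integral_abs_bound)
  also have "\<dots> \<le> unit_norm1 (\<lambda>x. f x - g x)"
    unfolding unit_norm1_def
  proof (rule integral_mono)
    show "integrable lborel (\<lambda>y. \<bar>indicator {-1..1} y * (f y * ground y) - indicator {-1..1} y * (g y * ground y)\<bar>)"
      by (intro integrable_abs Bochner_Integration.integrable_diff unit_ip_integrable[OF _ f] unit_ip_integrable[OF _ g]) measurable
    fix y
    have "\<bar>(f y - g y) * ground y\<bar> \<le> \<bar>f y - g y\<bar>"
      using mult_left_mono[OF ground_bounds[of y], of "\<bar>f y - g y\<bar>"] by (simp add: abs_mult)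
    then show "\<bar>indicator {-1..1} y * (f y * ground y) - indicator {-1..1} y * (g y * ground y)\<bar>
      \<le> indicator {-1..1} y * \<bar>f y - g y\<bar>"
      by (auto simp: indicator_def algebra_simps)
  qed (rule i)
  finally show ?thesis unfolding eq .
qed

text \<open>Orthogonality of the sines through the product formula. At \<open>k = 1\<close> the
  cosine of the difference angle is constant and has another antiderivative; the value 1 there makes
  the squared ground state a probability density on the interval.\<close>

lemma unit_ip_eigenfun: "unit_ip (eigenfun k) = (if k = 1 then 1 else 0)"
proof -
  let ?\<theta> = "\<lambda>y. pi * (y + 1) / 2 :: real"
  let ?f = "\<lambda>y. (cos ((real k - 1) * ?\<theta> y) - cos ((real k + 1) * ?\<theta> y)) / 2"
  have prod: "eigenfun k y * ground y = ?f y" for y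
  proof -
    have "eigenfun k y * ground y = sin (real k * ?\<theta> y) * sin (?\<theta> y)"
      unfolding eigenfun_1[symmetric] by (simp add: eigenfun_def)
    also have "\<dots> = ?f y"
    proof -
      have "sin (a * z) * sin z = (cos ((a - 1) * z) - cos ((a + 1) * z)) / 2" for a z :: real
        by (simp add: sin_times_sin left_diff_distrib distrib_right)
      then show ?thesis .
    qed
    finally show ?thesis .
  qed
  have ft: "((\<lambda>y. sin (c * ?\<theta> y) * (2 / (c * pi))) has_field_derivative cos (c * ?\<theta> y)) (at y)" if "c \<noteq> 0" for c y :: real
    using that by (auto intro!: derivative_eq_intros simp: field_simps)
  have eq: "unit_ip (eigenfun k) = (\<integral>y. ?f y * indicator {-1..1} y \<partial>lborel)"
    unfolding unit_ip_def prod by (simp add: mult.commute)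
  show ?thesis
  proof (cases "k = 1")
    case True
    have "(\<integral>y. ?f y * indicator {-1..1} y \<partial>lborel) =
      (1 - sin (2 * ?\<theta> 1) * (2 / (2 * pi))) / 2 - (-1 - sin (2 * ?\<theta> (-1)) * (2 / (2 * pi))) / 2"
    proof (rule integral_FTC_Icc_real)
      fix y :: real
      show "((\<lambda>y. (y - sin (2 * ?\<theta> y) * (2 / (2 * pi))) / 2) has_real_derivative ?f y) (at y)"
        using True by (auto intro!: derivative_eq_intros simp: field_simps)
      show "isCont ?f y" by (intro continuous_intros) auto
    qed simp
    also have "\<dots> = 1" by simp
    finally show ?thesis using True eq by simp
  next
    case False
    then have k: "real k - 1 \<noteq> 0" "real k + 1 \<noteq> 0" by auto
    let ?F = "\<lambda>y. (sin ((real k - 1) * ?\<theta> y) * (2 / ((real k - 1) * pi)) - sin ((real k + 1) * ?\<theta> y) * (2 / ((real k + 1) * pi))) / 2"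
    have "(\<integral>y. ?f y * indicator {-1..1} y \<partial>lborel) = ?F 1 - ?F (-1)"
    proof (rule integral_FTC_Icc_real)
      fix y :: real
      show "(?F has_real_derivative ?f y) (at y)"
        by (intro DERIV_cdivide DERIV_diff ft k)
      show "isCont ?f y" by (intro continuous_intros) auto
    qed simp
    moreover have "sin ((real k - 1) * pi) = 0" "sin ((real k + 1) * pi) = 0"
      by (simp_all add: left_diff_distrib distrib_right sin_diff sin_add)
    ultimately show ?thesis using False eq by simp
  qed
qed

text \<open>The concave sine lies above its chord from 0 to \<open>pi / 2\<close>. This turns linear
  vanishing at the end points into domination by the ground state.\<close>

lemma one_minus_abs_le_ground:
  assumes "\<bar>x\<bar> \<le> 1" shows "1 - \<bar>x\<bar> \<le> ground x"
proof -
  have "convex_on {0..pi} (\<lambda>x. - sin x)"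
    by (rule f''_ge0_imp_convex[where f'="\<lambda>x. - cos x" and f''="\<lambda>x. sin x"])
      (auto intro!: derivative_eq_intros sin_ge_zero)
  from convex_onD[OF this, of "1 - \<bar>x\<bar>" 0 "pi / 2"] assms
  have "1 - \<bar>x\<bar> \<le> sin ((1 - \<bar>x\<bar>) * (pi / 2))" by simp
  also have "(1 - \<bar>x\<bar>) * (pi / 2) = pi / 2 - pi * \<bar>x\<bar> / 2" by (simp add: left_diff_distrib)
  also have "sin (pi / 2 - pi * \<bar>x\<bar> / 2) = ground x"
    by (cases "x \<ge> 0") (simp_all add: ground_def sin_diff sin_add)
  finally show ?thesis .
qed

text \<open>Finite linear combinations of eigenfunctions, encoded inductively so that the spectral
  limit extends to them by rule induction.\<close>

inductive sine_poly :: "(real \<Rightarrow> real) \<Rightarrow> bool" where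
  single: "sine_poly (\<lambda>x. c * eigenfun k x)"
| add: "sine_poly f \<Longrightarrow> sine_poly g \<Longrightarrow> sine_poly (\<lambda>x. f x + g x)"

lemma sine_poly_props:
  "sine_poly f \<Longrightarrow> f \<in> borel_measurable borel \<and> (\<exists>B. \<forall>x. \<bar>f x\<bar> \<le> B)"
proof (induction rule: sine_poly.induct)
  case (single c k)
  have "\<bar>c * eigenfun k x\<bar> \<le> \<bar>c\<bar>" for x
    using mult_left_mono[OF eigenfun_bound[of k x], of "\<bar>c\<bar>"] by (simp add: abs_mult)
  then show ?case by (auto intro!: borel_measurable_times)
next
  case (add f g)
  then obtain B C where "\<And>x. \<bar>f x\<bar> \<le> B" "\<And>x. \<bar>g x\<bar> \<le> C" by blast
  then have "\<bar>f x + g x\<bar> \<le> B + C" for x by (meson abs_triangle_ineq add_mono order_trans)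
  then show ?case using add by auto
qed

lemma sine_poly_cmult: "sine_poly f \<Longrightarrow> sine_poly (\<lambda>x. c * f x)"
proof (induction rule: sine_poly.induct)
  case (single d k)
  show ?case using sine_poly.single[of "c * d" k] by (simp add: mult.assoc)
next
  case (add f g)
  show ?case using sine_poly.add[OF add.IH] by (simp add: distrib_left)
qed

text \<open>The factor is minus the cosine of the angle \<open>pi * (x + 1) / 2\<close>, and the
  product formula yields the two neighbouring indices; index 0 is separate because it has no
  predecessor.\<close>

lemma sine_poly_mult_sin: "sine_poly f \<Longrightarrow> sine_poly (\<lambda>x. f x * sin (pi * x / 2))"
proof (induction rule: sine_poly.induct)
  case (single c k)
  show ?case
  proof (cases k)
    case 0
    show ?thesis using sine_poly.single[of 0 0] by (simp add: 0 eigenfun_def)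
  next
    case (Suc j)
    let ?\<theta> = "\<lambda>x. pi * (x + 1) / 2 :: real"
    have s: "sin (pi * x / 2) = - cos (?\<theta> x)" for x
      by (simp add: distrib_left add_divide_distrib cos_add)
    have eq: "c * eigenfun k x * sin (pi * x / 2) = (- c / 2) * eigenfun (k + 1) x + (- c / 2) * eigenfun j x" for x
    proof -
      have "sin ((a + 1) * z) * cos z = (sin ((a + 1 + 1) * z) + sin (a * z)) / 2" for a z :: real
        by (simp add: sin_times_cos distrib_right)
      from this[of "real j" "?\<theta> x"]
      have *: "sin (real k * ?\<theta> x) * cos (?\<theta> x) = (eigenfun (k + 1) x + eigenfun j x) / 2"
        by (simp add: eigenfun_def Suc add_ac)
      have "c * eigenfun k x * sin (pi * x / 2) = - c * (sin (real k * ?\<theta> x) * cos (?\<theta> x))"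
        unfolding s eigenfun_def by simp
      then show ?thesis unfolding * by (simp add: field_simps)
    qed
    show ?thesis unfolding eq by (intro sine_poly.add sine_poly.single)
  qed
next
  case (add f g)
  show ?case using sine_poly.add[OF add.IH] by (simp add: distrib_right)
qed

text \<open>Polynomials in \<open>sin (pi * x / 2)\<close> become available as coefficients of the
  ground state; this is the form in which Weierstrass approximation enters.\<close>

lemma sine_poly_ground_poly: "sine_poly (\<lambda>x. ground x * (\<Sum>i\<le>n. a i * sin (pi * x / 2) ^ i))"
proof -
  have p: "sine_poly (\<lambda>x. ground x * sin (pi * x / 2) ^ i)" for i
  proof (induction i)
    case 0
    show ?case using sine_poly.single[of 1 1] by (simp only: eigenfun_1 power_0 mult_1 mult_1_right)
  next
    case (Suc i)
    show ?case using sine_poly_mult_sin[OF Suc] by (simp add: mult_ac)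
  qed
  show ?thesis
  proof (induction n)
    case 0
    show ?case using sine_poly_cmult[OF p[of 0], of "a 0"] by (simp add: mult_ac)
  next
    case (Suc n)
    have eq: "ground x * (\<Sum>i\<le>Suc n. a i * sin (pi * x / 2) ^ i) =
      ground x * (\<Sum>i\<le>n. a i * sin (pi * x / 2) ^ i) + a (Suc n) * (ground x * sin (pi * x / 2) ^ Suc n)" for x
    proof -
      have "u * (S + b * z) = u * S + b * (u * z)" for u S b z :: real by (simp add: algebra_simps)
      then show ?thesis unfolding sum.atMost_Suc .
    qed
    show ?case unfolding eq by (rule sine_poly.add[OF Suc sine_poly_cmult[OF p]])
  qed
qed

lemma unit_norm1_triangle:
  assumes [measurable]: "f \<in> borel_measurable borel" "g \<in> borel_measurable borel" "h \<in> borel_measurable borel"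
    and B: "\<And>x. \<bar>f x\<bar> \<le> B" "\<And>x. \<bar>g x\<bar> \<le> C" "\<And>x. \<bar>h x\<bar> \<le> D"
  shows "unit_norm1 (\<lambda>x. f x - h x) \<le> unit_norm1 (\<lambda>x. f x - g x) + unit_norm1 (\<lambda>x. g x - h x)"
proof -
  have bb: "\<bar>p x - q x\<bar> \<le> P + Q" if "\<bar>p x\<bar> \<le> P" "\<bar>q x\<bar> \<le> Q" for p q :: "real \<Rightarrow> real" and x P Q
    using that by linarith
  have i: "integrable lborel (\<lambda>y. indicator {-1..1} y * \<bar>f y - h y\<bar>)"
    "integrable lborel (\<lambda>y. indicator {-1..1} y * \<bar>f y - g y\<bar>)"
    "integrable lborel (\<lambda>y. indicator {-1..1} y * \<bar>g y - h y\<bar>)"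
    by (rule unit_integrable, measurable, unfold abs_abs, rule bb, rule B, rule B)+
  have "unit_norm1 (\<lambda>x. f x - h x) \<le> (\<integral>y. indicator {-1..1} y * \<bar>f y - g y\<bar> + indicator {-1..1} y * \<bar>g y - h y\<bar> \<partial>lborel)"
    unfolding unit_norm1_def
    by (rule integral_mono) (use i in \<open>auto simp: indicator_def\<close>)
  then show ?thesis using i by (simp add: unit_norm1_def)
qed

lemma unit_norm1_lim:
  assumes [measurable]: "f \<in> borel_measurable borel" "\<And>n. g n \<in> borel_measurable borel"
    and f: "\<And>x. \<bar>f x\<bar> \<le> B" and g: "\<And>n x. \<bar>g n x\<bar> \<le> B"
    and lim: "AE x in lborel. x \<in> {-1..1} \<longrightarrow> (\<lambda>n. g n x) \<longlonglongrightarrow> f x"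
  shows "(\<lambda>n. unit_norm1 (\<lambda>x. f x - g n x)) \<longlonglongrightarrow> 0"
proof -
  have bb: "\<bar>f x - g n x\<bar> \<le> 2 * B" for x n using f[of x] g[of n x] by linarith
  have "(\<lambda>n. \<integral>y. indicator {-1..1} y * \<bar>f y - g n y\<bar> \<partial>lborel) \<longlonglongrightarrow> (\<integral>y. 0 \<partial>(lborel :: real measure))"
  proof (rule integral_dominated_convergence[where w="\<lambda>y. indicator {-1..1} y * (2 * B)"])
    show "integrable lborel (\<lambda>y::real. indicator {-1..1} y * (2 * B))" by (rule unit_integrable) auto
    show "AE x in lborel. (\<lambda>n. indicator {-1..1} x * \<bar>f x - g n x\<bar>) \<longlonglongrightarrow> 0"
      using lim
    proof eventually_elim
      case (elim x)
      show ?case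
      proof (cases "x \<in> {-1..1}")
        case True
        then have "(\<lambda>n. \<bar>f x - g n x\<bar>) \<longlonglongrightarrow> \<bar>f x - f x\<bar>" using elim by (intro tendsto_intros) auto
        then show ?thesis using True by simp
      qed simp
    qed
    show "AE x in lborel. norm (indicator {- 1..1} x * \<bar>f x - g n x\<bar>) \<le> indicator {- 1..1} x * (2 * B)" for n
      using bb by (auto simp: indicator_def)
  qed measurable
  then show ?thesis by (simp add: unit_norm1_def)
qed

text \<open>Division by the ground state is regularised, the quotient is approximated uniformly by a
  polynomial in \<open>sin (pi * x / 2)\<close>, and multiplication by the ground state returns to
  sine polynomials. The end points, where sines vanish and \<open>f\<close> need not, are negligible
  in \<open>L^1\<close>.\<close>

lemma sine_poly_dense_continuous:
  assumes f: "continuous_on UNIV f" and fB: "\<And>x. \<bar>f x\<bar> \<le> B" and e: "0 < e"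
  shows "\<exists>p. sine_poly p \<and> unit_norm1 (\<lambda>x. f x - p x) \<le> e"
proof -
  have [measurable]: "f \<in> borel_measurable borel" using f by (rule borel_measurable_continuous_onI)
  have B0: "0 \<le> B" using fB[of 0] by simp
  \<comment> \<open>A continuous substitute for \<open>f / ground\<close>: its product with
    \<open>ground\<close> stays within \<open>B\<close> and converges to \<open>f\<close> wherever
    \<open>ground\<close> is nonzero.\<close>
  define g where "g n x = f x * ground x / ((ground x)\<^sup>2 + 1 / real (Suc n))" for n x
  have pos: "0 < (ground x)\<^sup>2 + 1 / real (Suc n)" for n x by (simp add: add_nonneg_pos)
  have gm[measurable]: "g n \<in> borel_measurable borel" for n unfolding g_def by measurable
  have bnd: "\<bar>ground x * g n x\<bar> \<le> B" for n x
  proof -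
    have "ground x * g n x = f x * ((ground x)\<^sup>2 / ((ground x)\<^sup>2 + 1 / real (Suc n)))"
      by (simp add: g_def power2_eq_square)
    moreover have "(ground x)\<^sup>2 / ((ground x)\<^sup>2 + 1 / real (Suc n)) \<le> 1" using pos[of x n] by (simp add: divide_simps)
    moreover have "0 \<le> (ground x)\<^sup>2 / ((ground x)\<^sup>2 + 1 / real (Suc n))" using pos[of x n] by simp
    ultimately show ?thesis using mult_mono[OF fB[of x], of "(ground x)\<^sup>2 / ((ground x)\<^sup>2 + 1 / real (Suc n))" 1] B0
      by (simp only: abs_mult abs_of_nonneg mult_1_right)
  qed
  have "(\<lambda>n. unit_norm1 (\<lambda>x. f x - ground x * g n x)) \<longlonglongrightarrow> 0"
  proof (rule unit_norm1_lim[where B=B])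
    show "AE x in lborel. x \<in> {- 1..1} \<longrightarrow> (\<lambda>n. ground x * g n x) \<longlonglongrightarrow> f x"
      using AE_lborel_singleton[of 1] AE_lborel_singleton[of "-1"]
    proof eventually_elim
      case (elim x)
      show ?case
      proof
        assume "x \<in> {-1..1}"
        then have gp: "0 < ground x" using elim by (intro ground_pos) auto
        have "(\<lambda>n. ground x * (f x * ground x / ((ground x)\<^sup>2 + 1 / real (Suc n)))) \<longlonglongrightarrow> ground x * (f x * ground x / ((ground x)\<^sup>2 + 0))"
          using gp LIMSEQ_inverse_real_of_nat by (intro tendsto_intros) (auto simp: inverse_eq_divide)
        then show "(\<lambda>n. ground x * g n x) \<longlonglongrightarrow> f x"
          using gp by (simp add: g_def power2_eq_square)
      qed
    qed
  qed (use fB bnd in auto)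
  then have "\<forall>\<^sub>F n in sequentially. unit_norm1 (\<lambda>x. f x - ground x * g n x) < e / 2"
    by (rule order_tendstoD) (use e in simp)
  then obtain n where n: "unit_norm1 (\<lambda>x. f x - ground x * g n x) < e / 2"
    by (auto simp: eventually_sequentially)
  \<comment> \<open>The substitution \<open>z = sin (pi * x / 2)\<close> is invertible on the
    interval. As the interval has length 2, the uniform tolerance \<open>e / 4\<close> costs
    \<open>e / 2\<close> in \<open>L^1\<close>.\<close>
  let ?G = "\<lambda>z. g n (2 / pi * arcsin z)"
  have "continuous_on {-1..1} ?G"
  proof (rule continuous_on_compose2[of UNIV "g n"])
    have "continuous_on UNIV ground" unfolding ground_def by (intro continuous_intros) auto
    then show "continuous_on UNIV (g n)"
      unfolding g_def using f pos by (intro continuous_intros) (auto simp: less_imp_neq[THEN not_sym])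
    show "continuous_on {-1..1} (\<lambda>z. 2 / pi * arcsin z)" by (intro continuous_intros) auto
  qed simp
  then obtain q where q: "real_polynomial_function q" "\<And>z. z \<in> {-1..1} \<Longrightarrow> \<bar>?G z - q z\<bar> < e / 4"
    using Stone_Weierstrass_real_polynomial_function[of "{-1..1}" ?G "e/4"] e by auto
  obtain a N where a: "q = (\<lambda>z. \<Sum>i\<le>N. a i * z ^ i)" using q(1) by (auto simp: real_polynomial_function_iff_sum)
  let ?p = "\<lambda>x. ground x * (\<Sum>i\<le>N. a i * sin (pi * x / 2) ^ i)"
  have p: "sine_poly ?p" by (rule sine_poly_ground_poly)
  obtain P where P: "\<And>x. \<bar>?p x\<bar> \<le> P" using sine_poly_props[OF p] by blast
  have [measurable]: "?p \<in> borel_measurable borel" using sine_poly_props[OF p] by blast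
  have close: "\<bar>ground x * g n x - ?p x\<bar> \<le> e / 4" if x: "x \<in> {-1..1}" for x
  proof -
    have "arcsin (sin (pi * x / 2)) = pi * x / 2"
      using x mult_left_mono[of "-1" x pi] by (intro arcsin_sin) auto
    then have "2 / pi * arcsin (sin (pi * x / 2)) = 2 / pi * (pi * x / 2)" by (simp only:)
    then have "2 / pi * arcsin (sin (pi * x / 2)) = x" by simp
    then have "?G (sin (pi * x / 2)) = g n x" by (simp only:)
    then have "\<bar>g n x - q (sin (pi * x / 2))\<bar> < e / 4" using q(2)[of "sin (pi * x / 2)"] by simp
    then have "\<bar>ground x\<bar> * \<bar>g n x - q (sin (pi * x / 2))\<bar> \<le> 1 * (e / 4)"
      by (intro mult_mono ground_bounds) auto
    then show ?thesis unfolding abs_mult[symmetric] a by (simp add: right_diff_distrib)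
  qed
  have "unit_norm1 (\<lambda>x. ground x * g n x - ?p x) \<le> (\<integral>y. indicator {-1..1} y * (e / 4) \<partial>(lborel :: real measure))"
    unfolding unit_norm1_def
  proof (rule integral_mono)
    show "integrable lborel (\<lambda>y. indicator {-1..1} y * \<bar>ground y * g n y - ?p y\<bar>)"
      by (rule unit_integrable[where B="B + P"]) (use bnd[of _ n] P in \<open>auto intro!: order_trans[OF abs_triangle_ineq4 add_mono]\<close>)
    show "integrable lborel (\<lambda>y::real. indicator {-1..1} y * (e / 4))" by (rule unit_integrable[where B="\<bar>e / 4\<bar>"]) auto
    show "indicator {-1..1} y * \<bar>ground y * g n y - ?p y\<bar> \<le> indicator {-1..1} y * (e / 4)" for y
      using close[of y] by (simp add: indicator_def)
  qed
  then have "unit_norm1 (\<lambda>x. ground x * g n x - ?p x) \<le> e / 2" by simp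
  moreover have "unit_norm1 (\<lambda>x. f x - ?p x) \<le> unit_norm1 (\<lambda>x. f x - ground x * g n x) + unit_norm1 (\<lambda>x. ground x * g n x - ?p x)"
    by (rule unit_norm1_triangle[where B=B and C=B and D=P]) (use fB bnd P in auto)
  ultimately show ?thesis using n p by (intro exI[of _ ?p]) auto
qed

text \<open>A measurable function is almost everywhere a limit of continuous ones; clipping these at
  \<open>B\<close> makes dominated convergence applicable.\<close>

lemma sine_poly_dense:
  assumes [measurable]: "f \<in> borel_measurable borel" and fB: "\<And>x. \<bar>f x\<bar> \<le> B" and e: "0 < e"
  shows "\<exists>p. sine_poly p \<and> unit_norm1 (\<lambda>x. f x - p x) \<le> e"
proof -
  have B0: "0 \<le> B" using fB[of 0] by simp
  have "f measurable_on UNIV"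
    by (rule lebesgue_measurable_imp_measurable_on) (auto intro: measurable_completion)
  then obtain N g where N: "negligible N" and gc: "\<And>n. continuous_on UNIV (g n)"
    and gl: "\<And>x. x \<notin> N \<Longrightarrow> (\<lambda>n. g n x) \<longlonglongrightarrow> f x"
    unfolding measurable_on_def by auto
  define c where "c n x = max (- B) (min B (g n x))" for n x
  have cc: "continuous_on UNIV (c n)" for n unfolding c_def using gc by (intro continuous_intros)
  have cB: "\<bar>c n x\<bar> \<le> B" for n x using B0 by (auto simp: c_def)
  have [measurable]: "c n \<in> borel_measurable borel" for n using cc by (rule borel_measurable_continuous_onI)
  obtain N' where N': "N' \<in> null_sets lborel" "N \<subseteq> N'"
    using N by (auto simp: negligible_iff_null_sets null_sets_completion_iff2)
  have "(\<lambda>n. unit_norm1 (\<lambda>x. f x - c n x)) \<longlonglongrightarrow> 0"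
  proof (rule unit_norm1_lim[where B=B])
    show "AE x in lborel. x \<in> {-1..1} \<longrightarrow> (\<lambda>n. c n x) \<longlonglongrightarrow> f x"
      using AE_not_in[OF N'(1)]
    proof eventually_elim
      case (elim x)
      then have "(\<lambda>n. c n x) \<longlonglongrightarrow> max (- B) (min B (f x))"
        unfolding c_def using gl N' by (intro tendsto_intros) auto
      moreover have "max (- B) (min B (f x)) = f x" using fB[of x] by auto
      ultimately show ?case by simp
    qed
  qed (use fB cB in auto)
  then have "\<forall>\<^sub>F n in sequentially. unit_norm1 (\<lambda>x. f x - c n x) < e / 2"
    by (rule order_tendstoD) (use e in simp)
  then obtain n where n: "unit_norm1 (\<lambda>x. f x - c n x) < e / 2"
    by (auto simp: eventually_sequentially)
  obtain p where p: "sine_poly p" "unit_norm1 (\<lambda>x. c n x - p x) \<le> e / 2"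
    using sine_poly_dense_continuous[OF cc cB, of "e/2" n] e by auto
  obtain P where P: "\<And>x. \<bar>p x\<bar> \<le> P" using sine_poly_props[OF p(1)] by blast
  have "unit_norm1 (\<lambda>x. f x - p x) \<le> unit_norm1 (\<lambda>x. f x - c n x) + unit_norm1 (\<lambda>x. c n x - p x)"
    by (rule unit_norm1_triangle) (use fB cB P sine_poly_props[OF p(1)] in auto)
  then show ?thesis using n p by (intro exI[of _ p]) auto
qed

context brownian
begin

section \<open>The killed semigroup\<close>

definition rsurv :: "(real \<Rightarrow> real) \<Rightarrow> real \<Rightarrow> real \<Rightarrow> (real \<Rightarrow> real) \<Rightarrow> real \<Rightarrow> real" where
  "rsurv b s t f y = (\<integral>\<omega>. f (y + W (t - s) \<omega>) * indicator (surv b s t y) \<omega> \<partial>M)"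

lemma kill_eq_rsurv: "kill t f x = rsurv (\<lambda>_. 1) 0 t f x"
  by (simp add: kill_def rsurv_def)

lemma rsurv_measurable:
  assumes [measurable]: "f \<in> borel_measurable borel"
    and b: "continuous_on {s..t} b" "\<And>r. r \<in> {s..t} \<Longrightarrow> 0 < b r" "s < t"
  shows "rsurv b s t f \<in> borel_measurable borel"
proof -
  note [measurable] = surv_pair_measurable[OF b]
  have [measurable]: "W (t - s) \<in> borel_measurable M" using b by simp
  show ?thesis unfolding rsurv_def by measurable
qed

lemma kill_measurable [measurable]: "f \<in> borel_measurable borel \<Longrightarrow> 0 < t \<Longrightarrow> kill t f \<in> borel_measurable borel"
  using rsurv_measurable[of f 0 t "\<lambda>_. 1"] by (simp add: kill_eq_rsurv[abs_def])

lemma rsurv_integrable: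
  fixes f :: "real \<Rightarrow> real"
  assumes [measurable]: "f \<in> borel_measurable borel" and f: "\<And>z. \<bar>f z\<bar> \<le> B"
    and b: "continuous_on {s..t} b" "\<And>r. r \<in> {s..t} \<Longrightarrow> 0 < b r" "s < t"
  shows "integrable M (\<lambda>\<omega>. f (y + W (t - s) \<omega>) * indicator (surv b s t y) \<omega>)"
proof -
  note [measurable] = surv_sets[OF b]
  have [measurable]: "W (t - s) \<in> borel_measurable M" using b by simp
  have "0 \<le> B" by (rule order_trans[OF abs_ge_zero f[of 0]])
  then have "\<bar>f z * indicator A \<omega>\<bar> \<le> B" for z and A :: "'a set" and \<omega>
    using f[of z] by (simp add: indicator_def)
  then show ?thesis by (intro bounded_integrable[where B=B]) auto
qed

lemma kill_integrable:
  fixes f :: "real \<Rightarrow> real"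
  assumes "f \<in> borel_measurable borel" "\<And>z. \<bar>f z\<bar> \<le> B" "0 < t"
  shows "integrable M (\<lambda>\<omega>. f (x + W t \<omega>) * indicator (surv (\<lambda>_. 1) 0 t x) \<omega>)"
  using rsurv_integrable[OF assms(1,2), of 0 t "\<lambda>_. 1" x] assms(3) by simp

lemma surv_endpoint: "\<omega> \<in> surv b s t y \<Longrightarrow> s \<le> t \<Longrightarrow> \<bar>y + W (t - s) \<omega>\<bar> < b t"
  by (simp add: surv_def)

lemma rsurv_mono:
  assumes f: "f \<in> borel_measurable borel" "\<And>z. \<bar>f z\<bar> \<le> B" and g: "g \<in> borel_measurable borel" "\<And>z. \<bar>g z\<bar> \<le> C"
    and b: "continuous_on {s..t} b" "\<And>r. r \<in> {s..t} \<Longrightarrow> 0 < b r" "s < t"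
    and le: "\<And>z. \<bar>z\<bar> < b t \<Longrightarrow> f z \<le> g z"
  shows "rsurv b s t f y \<le> rsurv b s t g y"
  unfolding rsurv_def
proof (rule integral_mono)
  show "integrable M (\<lambda>\<omega>. f (y + W (t - s) \<omega>) * indicator (surv b s t y) \<omega>)"
    by (rule rsurv_integrable[OF f b])
  show "integrable M (\<lambda>\<omega>. g (y + W (t - s) \<omega>) * indicator (surv b s t y) \<omega>)"
    by (rule rsurv_integrable[OF g b])
  fix \<omega>
  show "f (y + W (t - s) \<omega>) * indicator (surv b s t y) \<omega> \<le> g (y + W (t - s) \<omega>) * indicator (surv b s t y) \<omega>"
    using le surv_endpoint[of \<omega> b s t y] b by (simp add: indicator_def)
qed

lemma rsurv_cong:
  assumes "s \<le> t" "\<And>z. \<bar>z\<bar> < b t \<Longrightarrow> f z = g z"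
  shows "rsurv b s t f y = rsurv b s t g y"
  unfolding rsurv_def
  by (intro Bochner_Integration.integral_cong refl) (use assms surv_endpoint in \<open>auto simp: indicator_def\<close>)

lemma rsurv_bound:
  assumes "f \<in> borel_measurable borel" and f: "\<And>z. \<bar>f z\<bar> \<le> B"
    and b: "continuous_on {s..t} b" "\<And>r. r \<in> {s..t} \<Longrightarrow> 0 < b r" "s < t"
  shows "\<bar>rsurv b s t f y\<bar> \<le> B"
  unfolding rsurv_def
proof (rule abs_integral_le)
  show "(\<lambda>\<omega>. f (y + W (t - s) \<omega>) * indicator (surv b s t y) \<omega>) \<in> borel_measurable M"
    using rsurv_integrable[OF assms(1,2) b] by (rule borel_measurable_integrable)
  show "\<bar>f (y + W (t - s) \<omega>) * indicator (surv b s t y) \<omega>\<bar> \<le> B" for \<omega>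
    using f[of "y + W (t - s) \<omega>"] order_trans[OF abs_ge_zero f[of 0]] by (simp add: indicator_def)
qed

lemma rsurv_nonneg: "(\<And>z. 0 \<le> f z) \<Longrightarrow> 0 \<le> rsurv b s t f y"
  unfolding rsurv_def by (rule integral_nonneg_AE) (auto simp: indicator_def)

lemma rsurv_cmult: "rsurv b s t (\<lambda>z. c * f z) y = c * rsurv b s t f y"
  by (simp add: rsurv_def mult.assoc)

lemma rsurv_nn:
  assumes [measurable]: "f \<in> borel_measurable borel" and f: "\<And>z. 0 \<le> f z" "\<And>z. f z \<le> B"
    and b: "continuous_on {s..t} b" "\<And>r. r \<in> {s..t} \<Longrightarrow> 0 < b r" "s < t"
  shows "nn_surv b s t (\<lambda>z. ennreal (f z)) y = ennreal (rsurv b s t f y)"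
proof -
  have fB: "\<bar>f z\<bar> \<le> B" for z using f[of z] by simp
  have "ennreal (rsurv b s t f y) = (\<integral>\<^sup>+\<omega>. ennreal (f (y + W (t - s) \<omega>) * indicator (surv b s t y) \<omega>) \<partial>M)"
    unfolding rsurv_def
    by (rule nn_integral_eq_integral[symmetric]) (use rsurv_integrable[OF assms(1) fB b] f in auto)
  also have "\<dots> = nn_surv b s t (\<lambda>z. ennreal (f z)) y"
    unfolding nn_surv_def by (intro nn_integral_cong) (auto simp: indicator_def)
  finally show ?thesis ..
qed

lemma rsurv_markov:
  assumes f[measurable]: "f \<in> borel_measurable borel" and f01: "\<And>z. 0 \<le> f z" "\<And>z. f z \<le> B"
    and h[measurable]: "h \<in> borel_measurable borel" and h01: "\<And>z. 0 \<le> h z" "\<And>z. h z \<le> B"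
    and b: "continuous_on {s..t} b" "\<And>r. r \<in> {s..t} \<Longrightarrow> 0 < b r" and sut: "s < u" "u < t"
  shows "(\<integral>\<omega>. f (y + W (u - s) \<omega>) * h (y + W (t - s) \<omega>) * indicator (surv b s t y) \<omega> \<partial>M)
    = rsurv b s u (\<lambda>z. f z * rsurv b u t h z) y"
proof -
  have B: "0 \<le> B" using f01[of 0] by linarith
  have b1: "continuous_on {s..u} b" "continuous_on {u..t} b" "\<And>r. r \<in> {s..u} \<Longrightarrow> 0 < b r" "\<And>r. r \<in> {u..t} \<Longrightarrow> 0 < b r"
    using b sut by (auto elim: continuous_on_subset)
  have st: "s < t" using sut by simp
  note [measurable] = surv_sets[OF b st] rsurv_measurable[OF h b1(2,4) sut(2)]
  have [measurable]: "W (t - s) \<in> borel_measurable M" "W (u - s) \<in> borel_measurable M" using sut by auto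
  have rb: "0 \<le> rsurv b u t h z" "rsurv b u t h z \<le> B" for z
    using rsurv_nonneg[of h, OF h01(1)] rsurv_bound[OF h _ b1(2,4) sut(2), of B] h01 by (auto simp: abs_le_iff intro: order_trans)
  have fr: "0 \<le> f z * rsurv b u t h z" "f z * rsurv b u t h z \<le> B * B" for z
    using rb f01[of z] B by (auto intro!: mult_nonneg_nonneg mult_mono)
  have fh: "0 \<le> f z * h z'" "f z * h z' \<le> B * B" for z z'
    using h01[of z'] f01[of z] B by (auto intro!: mult_nonneg_nonneg mult_mono)
  have "ennreal (\<integral>\<omega>. f (y + W (u - s) \<omega>) * h (y + W (t - s) \<omega>) * indicator (surv b s t y) \<omega> \<partial>M)
    = (\<integral>\<^sup>+\<omega>. ennreal (f (y + W (u - s) \<omega>) * h (y + W (t - s) \<omega>) * indicator (surv b s t y) \<omega>) \<partial>M)"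
    by (rule nn_integral_eq_integral[symmetric])
      (use fh B in \<open>auto intro!: bounded_integrable[where B="B * B"] AE_I2 simp: indicator_def abs_le_iff minus_le_iff intro: order_trans[of _ 0]\<close>)
  also have "\<dots> = (\<integral>\<^sup>+\<omega>. ennreal (f (y + W (u - s) \<omega>)) * ennreal (h (y + W (t - s) \<omega>)) * indicator (surv b s t y) \<omega> \<partial>M)"
    by (intro nn_integral_cong) (use f01 h01 in \<open>auto simp: indicator_def ennreal_mult\<close>)
  also have "\<dots> = nn_surv b s u (\<lambda>z. ennreal (f z) * nn_surv b u t (\<lambda>z. ennreal (h z)) z) y"
    by (rule nn_surv_markov[where B="ennreal B"]) (use f01 h01 b sut in \<open>auto intro!: ennreal_leI\<close>)
  also have "\<dots> = nn_surv b s u (\<lambda>z. ennreal (f z * rsurv b u t h z)) y"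
  proof -
    have "nn_surv b u t (\<lambda>z. ennreal (h z)) z = ennreal (rsurv b u t h z)" for z
      by (rule rsurv_nn) (use h01 b1 sut in auto)
    then show ?thesis using f01 rb by (simp add: ennreal_mult)
  qed
  also have "\<dots> = ennreal (rsurv b s u (\<lambda>z. f z * rsurv b u t h z) y)"
    by (rule rsurv_nn[where B="B * B"]) (use fr b1 sut in auto)
  finally show ?thesis
    by (subst (asm) ennreal_inj) (use fh fr in \<open>auto intro!: integral_nonneg_AE AE_I2 rsurv_nonneg simp: indicator_def\<close>)
qed

text \<open>The survival event for a constant barrier depends only on the elapsed time, so the
  general Markov property becomes a semigroup law.\<close>

lemma kill_semigroup:
  assumes h[measurable]: "h \<in> borel_measurable borel" and h01: "\<And>z. 0 \<le> h z" "\<And>z. h z \<le> B" and st: "0 < s" "0 < t"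
  shows "kill (s + t) h x = kill s (kill t h) x"
proof -
  have sh: "surv (\<lambda>_. 1) s (s + t) y = surv (\<lambda>_. 1) 0 t y" for y
    unfolding surv_def
  proof (intro Collect_cong conj_cong refl iffI ballI)
    fix \<omega> r assume "\<forall>r\<in>{s..s + t}. \<bar>y + W (r - s) \<omega>\<bar> < 1" "r \<in> {0..t}"
    then show "\<bar>y + W (r - 0) \<omega>\<bar> < 1" by (auto dest!: bspec[of _ _ "r + s"])
  next
    fix \<omega> r assume "\<forall>r\<in>{0..t}. \<bar>y + W (r - 0) \<omega>\<bar> < 1" "r \<in> {s..s + t}"
    then show "\<bar>y + W (r - s) \<omega>\<bar> < 1" by (auto dest!: bspec[of _ _ "r - s"])
  qed
  have r: "rsurv (\<lambda>_. 1) s (s + t) h z = kill t h z" for z by (simp add: rsurv_def kill_def sh)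
  have "(\<integral>\<omega>. 1 * h (x + W (s + t - 0) \<omega>) * indicator (surv (\<lambda>_. 1) 0 (s + t) x) \<omega> \<partial>M)
    = rsurv (\<lambda>_. 1) 0 s (\<lambda>z. 1 * rsurv (\<lambda>_. 1) s (s + t) h z) x"
    by (rule rsurv_markov[where B="max 1 B"]) (use h01 st in \<open>auto intro: max.coboundedI2\<close>)
  then show ?thesis by (simp add: kill_def r[abs_def] rsurv_def)
qed

lemma kill_outside: "1 \<le> \<bar>x\<bar> \<Longrightarrow> 0 \<le> t \<Longrightarrow> kill t f x = 0"
proof -
  assume x: "1 \<le> \<bar>x\<bar>" "0 \<le> t"
  have "\<omega> \<notin> surv (\<lambda>_. 1) 0 t x" for \<omega>
  proof
    assume "\<omega> \<in> surv (\<lambda>_. 1) 0 t x"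
    then have "\<omega> \<in> space M" "\<bar>x + W (0 - 0) \<omega>\<bar> < 1" using x by (auto simp: surv_def simp del: diff_self)
    then show False using x by (simp add: W_0)
  qed
  then show ?thesis by (simp add: kill_def)
qed

section \<open>Smoothing by the heat flow and boundary behaviour of the survival probability\<close>

lemma heat_eq_density:
  assumes "0 < t" and [measurable]: "F \<in> borel_measurable borel"
  shows "heat t F x = (\<integral>y. normal_density x (sqrt t) y * F y \<partial>lborel)"
proof -
  have "(\<integral>y. normal_density x (sqrt t) y * F y \<partial>lborel) = (\<integral>y. normal_density x (sqrt t) (x + 1 * y) * F (x + 1 * y) \<partial>lborel)"
    by (subst lborel_integral_real_affine[where c=1 and t=x]) auto
  moreover have "normal_density x (sqrt t) (x + 1 * y) = normal_density 0 (sqrt t) y" for y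
    by (simp add: normal_density_def)
  ultimately show ?thesis unfolding heat_eq_integral[OF assms] by simp
qed

text \<open>Two Gaussian exponents differ by \<open>x - x'\<close> times a term linear in
  \<open>y\<close>, and an elementary bound for differences of exponentials reduces the claim to
  first absolute moments. Since the means are at most 2 apart, each moment can be centred at its own
  mean at the price of the summand 1.\<close>

lemma normal_density_lipschitz:
  fixes \<sigma> x x' y :: real
  assumes \<sigma>: "0 < \<sigma>" and x: "\<bar>x - x'\<bar> \<le> 2"
  shows "\<bar>normal_density x \<sigma> y - normal_density x' \<sigma> y\<bar> \<le> \<bar>x - x'\<bar> / \<sigma>\<^sup>2 *
    ((\<bar>y - x\<bar> + 1) * normal_density x \<sigma> y + (\<bar>y - x'\<bar> + 1) * normal_density x' \<sigma> y)"
proof -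
  let ?a = "(y - x)\<^sup>2 / (2 * \<sigma>\<^sup>2)" and ?b = "(y - x')\<^sup>2 / (2 * \<sigma>\<^sup>2)"
  let ?k = "1 / sqrt (2 * pi * \<sigma>\<^sup>2)"
  let ?n = "normal_density x \<sigma> y" and ?m = "normal_density x' \<sigma> y"
  have k: "0 \<le> ?k" by simp
  have ex: "\<bar>exp (- a) - exp (- b)\<bar> \<le> \<bar>a - b\<bar> * (exp (- a) + exp (- b))" for a b :: real
  proof -
    have *: "exp (- a) - exp (- b) \<le> \<bar>a - b\<bar> * (exp (- a) + exp (- b))" for a b :: real
    proof -
      have "1 + (a - b) \<le> exp (a - b)" by (rule exp_ge_add_one_self)
      then have "exp (- a) * (1 + (a - b)) \<le> exp (- a) * exp (a - b)" by (rule mult_left_mono) simp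
      also have "\<dots> = exp (- b)" by (simp add: mult_exp_exp)
      finally have "exp (- a) - exp (- b) \<le> (b - a) * exp (- a)" by (simp add: algebra_simps)
      also have "\<dots> \<le> \<bar>a - b\<bar> * (exp (- a) + exp (- b))" by (intro mult_mono) auto
      finally show ?thesis .
    qed
    show ?thesis using *[of a b] *[of b a] by (simp add: abs_minus_commute add.commute abs_le_iff)
  qed
  have "?n - ?m = ?k * (exp (- ?a) - exp (- ?b))"
    by (simp add: normal_density_def right_diff_distrib)
  then have "\<bar>?n - ?m\<bar> = ?k * \<bar>exp (- ?a) - exp (- ?b)\<bar>"
    by (simp only: abs_mult abs_of_nonneg[OF k])
  also have "\<dots> \<le> ?k * (\<bar>?a - ?b\<bar> * (exp (- ?a) + exp (- ?b)))"
    by (rule mult_left_mono[OF ex k])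
  also have "\<dots> = \<bar>?a - ?b\<bar> * (?n + ?m)"
    by (simp add: normal_density_def algebra_simps)
  also have "\<bar>?a - ?b\<bar> = \<bar>x - x'\<bar> * \<bar>(y - x) + (y - x')\<bar> / (2 * \<sigma>\<^sup>2)"
  proof -
    have "?a - ?b = (x' - x) * ((y - x) + (y - x')) / (2 * \<sigma>\<^sup>2)"
      by (simp add: diff_divide_distrib[symmetric] power2_eq_square algebra_simps)
    then show ?thesis using \<sigma> by (simp add: abs_mult abs_minus_commute)
  qed
  also have "\<bar>x - x'\<bar> * \<bar>(y - x) + (y - x')\<bar> / (2 * \<sigma>\<^sup>2) * (?n + ?m) =
     \<bar>x - x'\<bar> / \<sigma>\<^sup>2 * (\<bar>(y - x) + (y - x')\<bar> / 2 * ?n + \<bar>(y - x) + (y - x')\<bar> / 2 * ?m)"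
    by (simp add: field_simps)
  also have "\<dots> \<le> \<bar>x - x'\<bar> / \<sigma>\<^sup>2 * ((\<bar>y - x\<bar> + 1) * ?n + (\<bar>y - x'\<bar> + 1) * ?m)"
  proof (intro mult_left_mono add_mono mult_right_mono)
    have "\<bar>2 * a + d\<bar> \<le> 2 * \<bar>a\<bar> + \<bar>d\<bar>" for a d :: real
      using abs_triangle_ineq[of "2 * a" d] abs_mult[of 2 a] by simp
    from this[of "y - x" "x - x'"] this[of "y - x'" "x' - x"]
    have "\<bar>2 * (y - x) + (x - x')\<bar> \<le> 2 * \<bar>y - x\<bar> + \<bar>x - x'\<bar>" "\<bar>2 * (y - x') + (x' - x)\<bar> \<le> 2 * \<bar>y - x'\<bar> + \<bar>x' - x\<bar>" .
    moreover have "2 * (y - x) + (x - x') = (y - x) + (y - x')" "2 * (y - x') + (x' - x) = (y - x) + (y - x')" by simp_all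
    ultimately show "\<bar>(y - x) + (y - x')\<bar> / 2 \<le> \<bar>y - x\<bar> + 1" "\<bar>(y - x) + (y - x')\<bar> / 2 \<le> \<bar>y - x'\<bar> + 1"
      using x by (simp_all add: abs_minus_commute)
  qed auto
  finally show ?thesis .
qed

text \<open>The constant depends on \<open>t\<close> but not on \<open>F\<close>; this is what
  survives when \<open>F\<close> runs through functions with unbounded Lipschitz constants.\<close>

lemma heat_smoothing:
  assumes t: "0 < t"
  shows "\<exists>C\<ge>0. \<forall>F x x'. F \<in> borel_measurable borel \<longrightarrow> (\<forall>y. \<bar>F y\<bar> \<le> 1) \<longrightarrow> \<bar>x - x'\<bar> \<le> 2 \<longrightarrow>
    \<bar>heat t F x - heat t F x'\<bar> \<le> C * \<bar>x - x'\<bar>"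
proof -
  let ?\<sigma> = "sqrt t"
  have \<sigma>: "0 < ?\<sigma>" using t by simp
  define m where "m = ?\<sigma> * sqrt (2 / pi) + 1"
  have m: "0 \<le> m" using t by (simp add: m_def)
  have mi: "integrable lborel (\<lambda>y. (\<bar>y - x\<bar> + 1) * normal_density x ?\<sigma> y)"
    and mv: "(\<integral>y. (\<bar>y - x\<bar> + 1) * normal_density x ?\<sigma> y \<partial>lborel) = m" for x
  proof -
    have 1: "integrable lborel (\<lambda>y. normal_density x ?\<sigma> y * \<bar>y - x\<bar>)"
      using integrable_normal_moment_abs[OF \<sigma>, of x 1] by simp
    have 2: "(\<integral>y. normal_density x ?\<sigma> y * \<bar>y - x\<bar> \<partial>lborel) = ?\<sigma> * sqrt (2 / pi)"
      using integral_normal_moment_abs_odd[OF \<sigma>, of x 0] by simp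
    have 3: "integrable lborel (normal_density x ?\<sigma>)" "(\<integral>y. normal_density x ?\<sigma> y \<partial>lborel) = 1" using \<sigma> by auto
    have eq: "(\<bar>y - x\<bar> + 1) * normal_density x ?\<sigma> y = normal_density x ?\<sigma> y * \<bar>y - x\<bar> + normal_density x ?\<sigma> y" for y
      by (simp add: algebra_simps)
    show "integrable lborel (\<lambda>y. (\<bar>y - x\<bar> + 1) * normal_density x ?\<sigma> y)"
      unfolding eq using 1 3 by (intro Bochner_Integration.integrable_add)
    show "(\<integral>y. (\<bar>y - x\<bar> + 1) * normal_density x ?\<sigma> y \<partial>lborel) = m"
      unfolding eq m_def using 1 2 3 by simp
  qed
  show ?thesis
  proof (intro exI[of _ "2 * m / t"] conjI allI impI)
    show "0 \<le> 2 * m / t" using m t by simp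
    fix F :: "real \<Rightarrow> real" and x x' :: real
    assume [measurable]: "F \<in> borel_measurable borel" and F: "\<forall>y. \<bar>F y\<bar> \<le> 1" and x: "\<bar>x - x'\<bar> \<le> 2"
    let ?n = "normal_density x ?\<sigma>" and ?m = "normal_density x' ?\<sigma>"
    have iF: "integrable lborel (\<lambda>y. normal_density z ?\<sigma> y * F y)" for z
      by (rule Bochner_Integration.integrable_bound[where f="normal_density z ?\<sigma>"])
        (use \<sigma> F in \<open>auto simp: abs_mult intro!: mult_left_le\<close>)
    have eq: "heat t F x - heat t F x' = (\<integral>y. ?n y * F y - ?m y * F y \<partial>lborel)"
      using t iF by (simp add: heat_eq_density)
    have "\<bar>\<integral>y. ?n y * F y - ?m y * F y \<partial>lborel\<bar> \<le> (\<integral>y. \<bar>?n y * F y - ?m y * F y\<bar> \<partial>lborel)"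
      by (rule integral_abs_bound)
    also have "\<dots> \<le> (\<integral>y. \<bar>x - x'\<bar> / ?\<sigma>\<^sup>2 * ((\<bar>y - x\<bar> + 1) * ?n y + (\<bar>y - x'\<bar> + 1) * ?m y) \<partial>lborel)"
    proof (rule integral_mono)
      show "integrable lborel (\<lambda>y. \<bar>?n y * F y - ?m y * F y\<bar>)" using iF by auto
      show "integrable lborel (\<lambda>y. \<bar>x - x'\<bar> / ?\<sigma>\<^sup>2 * ((\<bar>y - x\<bar> + 1) * ?n y + (\<bar>y - x'\<bar> + 1) * ?m y))"
        by (intro integrable_mult_right Bochner_Integration.integrable_add mi)
      fix y
      have "\<bar>?n y * F y - ?m y * F y\<bar> = \<bar>?n y - ?m y\<bar> * \<bar>F y\<bar>"
        by (simp add: left_diff_distrib[symmetric] abs_mult)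
      also have "\<dots> \<le> \<bar>?n y - ?m y\<bar>" using F by (simp add: mult_left_le)
      also have "\<dots> \<le> \<bar>x - x'\<bar> / ?\<sigma>\<^sup>2 * ((\<bar>y - x\<bar> + 1) * ?n y + (\<bar>y - x'\<bar> + 1) * ?m y)"
        by (rule normal_density_lipschitz[OF \<sigma> x])
      finally show "\<bar>?n y * F y - ?m y * F y\<bar> \<le> \<bar>x - x'\<bar> / ?\<sigma>\<^sup>2 * ((\<bar>y - x\<bar> + 1) * ?n y + (\<bar>y - x'\<bar> + 1) * ?m y)" .
    qed
    also have "\<dots> = \<bar>x - x'\<bar> / ?\<sigma>\<^sup>2 * (m + m)"
      using mi[of x] mi[of x'] by (simp only: integral_mult_right_zero Bochner_Integration.integral_add mv)
    finally show "\<bar>heat t F x - heat t F x'\<bar> \<le> 2 * m / t * \<bar>x - x'\<bar>"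
      unfolding eq using t by (simp add: mult.commute)
  qed
qed

text \<open>The truncations of \<open>n * ground\<close> are odd about both end points and increase to
  the indicator of the open interval.\<close>

lemma kill_one_lipschitz:
  assumes t: "0 < t"
  shows "\<exists>C\<ge>0. \<forall>x x'. \<bar>kill t (\<lambda>_. 1) x - kill t (\<lambda>_. 1) x'\<bar> \<le> C * \<bar>x - x'\<bar>"
proof -
  define F where "F n x = max (-1) (min 1 (real n * ground x))" for n x
  obtain C where C: "C \<ge> 0" and smooth: "\<And>G x x'. G \<in> borel_measurable borel \<Longrightarrow> (\<And>y. \<bar>G y\<bar> \<le> 1) \<Longrightarrow> \<bar>x - x'\<bar> \<le> 2 \<Longrightarrow>
    \<bar>heat t G x - heat t G x'\<bar> \<le> C * \<bar>x - x'\<bar>"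
    using heat_smoothing[OF t] by metis
  have Fm[measurable]: "F n \<in> borel_measurable borel" for n unfolding F_def by measurable
  have FB: "\<bar>F n x\<bar> \<le> 1" for n x by (auto simp: F_def)
  \<comment> \<open>This constant grows with \<open>n\<close> and serves only to qualify
    \<open>F n\<close> for \<open>surv_odd\<close>; the bound uniform in \<open>n\<close> comes from
    smoothing.\<close>
  have FL: "\<bar>F n x - F n y\<bar> \<le> real n * (pi / 2) * \<bar>x - y\<bar>" for n x y
  proof -
    have "\<bar>F n x - F n y\<bar> \<le> \<bar>real n * ground x - real n * ground y\<bar>" unfolding F_def by linarith
    also have "\<dots> = real n * \<bar>ground x - ground y\<bar>" by (simp add: right_diff_distrib[symmetric] abs_mult)
    also have "\<dots> \<le> real n * (pi / 2 * \<bar>x - y\<bar>)"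
      using eigenfun_lipschitz[of 1 x y] unfolding eigenfun_1 by (intro mult_left_mono) auto
    finally show ?thesis by (simp add: mult.assoc)
  qed
  have odd: "F n (2 * 1 - y) = - F n y" "F n (- 2 * 1 - y) = - F n y" for n y
    using eigenfun_odd[of 1 y] unfolding eigenfun_1 F_def by (auto simp: max_def min_def)
  have FK: "kill t (F n) x = heat t (F n) x" if "\<bar>x\<bar> < 1" for n x
    by (rule surv_odd[OF Fm FB FL odd that t])
  have F1: "heat t (F n) 1 = 0" "heat t (F n) (-1) = 0" for n
    by (rule heat_reflect; use odd t in simp)+
  have [measurable]: "W t \<in> borel_measurable M" using t by simp
  have lim: "(\<lambda>n. kill t (F n) x) \<longlonglongrightarrow> kill t (\<lambda>_. 1) x" for x
    unfolding kill_def
  proof (rule bounded_convergence[where B=1])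
    show "\<bar>F n (x + W t \<omega>) * indicator (surv (\<lambda>_. 1) 0 t x) \<omega>\<bar> \<le> 1" for n \<omega>
      using FB[of n] by (simp add: indicator_def)
    fix \<omega>
    show "(\<lambda>n. F n (x + W t \<omega>) * indicator (surv (\<lambda>_. 1) 0 t x) \<omega>) \<longlonglongrightarrow> 1 * indicator (surv (\<lambda>_. 1) 0 t x) \<omega>"
    proof (cases "\<omega> \<in> surv (\<lambda>_. 1) 0 t x")
      case True
      then have g: "0 < ground (x + W t \<omega>)" using surv_endpoint[OF True] t by (intro ground_pos) auto
      obtain n0 where n0: "1 < real n0 * ground (x + W t \<omega>)" using reals_Archimedean3[OF g] by blast
      have "F n (x + W t \<omega>) = 1" if "n0 \<le> n" for n
      proof -
        have "real n0 * ground (x + W t \<omega>) \<le> real n * ground (x + W t \<omega>)"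
          using that g by (intro mult_right_mono) auto
        then show ?thesis using n0 by (simp add: F_def)
      qed
      then have "\<forall>\<^sub>F n in sequentially. F n (x + W t \<omega>) = 1" by (auto simp: eventually_sequentially)
      then show ?thesis using True by (simp add: tendsto_eventually)
    qed simp
  qed (use t in measurable)
  have in_in: "\<bar>kill t (\<lambda>_. 1) x - kill t (\<lambda>_. 1) x'\<bar> \<le> C * \<bar>x - x'\<bar>" if "\<bar>x\<bar> < 1" "\<bar>x'\<bar> < 1" for x x'
  proof (rule LIMSEQ_le_const2)
    show "(\<lambda>n. \<bar>kill t (F n) x - kill t (F n) x'\<bar>) \<longlonglongrightarrow> \<bar>kill t (\<lambda>_. 1) x - kill t (\<lambda>_. 1) x'\<bar>"
      by (intro tendsto_intros lim)
    show "\<exists>N. \<forall>n\<ge>N. \<bar>kill t (F n) x - kill t (F n) x'\<bar> \<le> C * \<bar>x - x'\<bar>"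
      using smooth[OF Fm FB, of x x'] that by (auto simp: FK)
  qed
  \<comment> \<open>The heat flow of \<open>F n\<close> vanishes at the end points by oddness, so
    comparison with the nearer end point gives linear decay.\<close>
  have bdry: "\<bar>kill t (\<lambda>_. 1) x\<bar> \<le> C * (1 - \<bar>x\<bar>)" if "\<bar>x\<bar> < 1" for x
  proof (rule LIMSEQ_le_const2)
    show "(\<lambda>n. \<bar>kill t (F n) x\<bar>) \<longlonglongrightarrow> \<bar>kill t (\<lambda>_. 1) x\<bar>"
      by (intro tendsto_intros lim)
    have "\<bar>kill t (F n) x\<bar> \<le> C * (1 - \<bar>x\<bar>)" for n
      using smooth[OF Fm FB, of x 1 n] smooth[OF Fm FB, of x "-1" n] that F1[of n]
      by (cases "x \<ge> 0") (auto simp: FK algebra_simps)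
    then show "\<exists>N. \<forall>n\<ge>N. \<bar>kill t (F n) x\<bar> \<le> C * (1 - \<bar>x\<bar>)" by blast
  qed
  have "\<bar>kill t (\<lambda>_. 1) x - kill t (\<lambda>_. 1) x'\<bar> \<le> C * \<bar>x - x'\<bar>" for x x'
  proof -
    have in_out: "\<bar>kill t (\<lambda>_. 1) z\<bar> \<le> C * \<bar>z - z'\<bar>" if "\<bar>z\<bar> < 1" "1 \<le> \<bar>z'\<bar>" for z z'
    proof -
      have "C * (1 - \<bar>z\<bar>) \<le> C * \<bar>z - z'\<bar>" using C that by (intro mult_left_mono) auto
      then show ?thesis using bdry[OF that(1)] by simp
    qed
    have out: "kill t (\<lambda>_. 1) z = 0" if "1 \<le> \<bar>z\<bar>" for z using kill_outside that t by simp
    show ?thesis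
      using in_in[of x x'] in_out[of x x'] in_out[of x' x] out[of x] out[of x'] C
      by (cases "\<bar>x\<bar> < 1"; cases "\<bar>x'\<bar> < 1") (auto simp: not_less abs_minus_commute)
  qed
  then show ?thesis using C by blast
qed

text \<open>Lipschitz continuity and vanishing at the end points bound the survival probability by
  the distance to the boundary, hence by the ground state.\<close>

lemma kill_one_le_ground:
  assumes t: "0 < t"
  shows "\<exists>C\<ge>0. \<forall>x. \<bar>x\<bar> < 1 \<longrightarrow> kill t (\<lambda>_. 1) x \<le> C * ground x"
proof -
  obtain C where C: "C \<ge> 0" "\<And>x x'. \<bar>kill t (\<lambda>_. 1) x - kill t (\<lambda>_. 1) x'\<bar> \<le> C * \<bar>x - x'\<bar>"
    using kill_one_lipschitz[OF t] by blast
  have "kill t (\<lambda>_. 1) x \<le> C * ground x" if x: "\<bar>x\<bar> < 1" for x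
  proof -
    have k: "kill t (\<lambda>_. 1) 1 = 0" "kill t (\<lambda>_. 1) (-1) = 0" using kill_outside t by auto
    have "kill t (\<lambda>_. 1) x \<le> C * (1 - \<bar>x\<bar>)"
      using C(2)[of x 1] C(2)[of x "-1"] x k by (cases "x \<ge> 0") (auto simp: algebra_simps)
    also have "\<dots> \<le> C * ground x" using C x one_minus_abs_le_ground by (intro mult_left_mono) auto
    finally show ?thesis .
  qed
  then show ?thesis using C by blast
qed

section \<open>Decay of the killed semigroup and the spectral limit\<close>

lemma kill_mono:
  assumes "f \<in> borel_measurable borel" "\<And>z. \<bar>f z\<bar> \<le> B" "g \<in> borel_measurable borel" "\<And>z. \<bar>g z\<bar> \<le> C"
    and "0 < t" "\<And>z. \<bar>z\<bar> < 1 \<Longrightarrow> f z \<le> g z"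
  shows "kill t f x \<le> kill t g x"
  unfolding kill_eq_rsurv by (rule rsurv_mono) (use assms in auto)

lemma kill_nonneg: "(\<And>z. 0 \<le> f z) \<Longrightarrow> 0 \<le> kill t f x"
  unfolding kill_eq_rsurv by (rule rsurv_nonneg)

lemma kill_bound:
  assumes "f \<in> borel_measurable borel" "\<And>z. \<bar>f z\<bar> \<le> B" "0 < t"
  shows "\<bar>kill t f x\<bar> \<le> B"
  unfolding kill_eq_rsurv by (rule rsurv_bound) (use assms in auto)

lemma kill_cmult: "kill t (\<lambda>z. c * f z) x = c * kill t f x"
  unfolding kill_eq_rsurv by (rule rsurv_cmult)

lemma kill_add:
  assumes "f \<in> borel_measurable borel" "\<And>z. \<bar>f z\<bar> \<le> B" "g \<in> borel_measurable borel" "\<And>z. \<bar>g z\<bar> \<le> C" "0 < t"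
  shows "kill t (\<lambda>z. f z + g z) x = kill t f x + kill t g x"
  unfolding kill_def using kill_integrable[OF assms(1,2,5)] kill_integrable[OF assms(3,4,5)]
  by (simp add: distrib_right)

lemma kill_abs_le:
  assumes "f \<in> borel_measurable borel" "\<And>z. \<bar>f z\<bar> \<le> B" "g \<in> borel_measurable borel" "\<And>z. \<bar>g z\<bar> \<le> C" "0 < t"
  shows "\<bar>kill t f x - kill t g x\<bar> \<le> kill t (\<lambda>z. \<bar>f z - g z\<bar>) x"
proof -
  let ?S = "surv (\<lambda>_. 1) 0 t x"
  have eq: "kill t f x - kill t g x = (\<integral>\<omega>. f (x + W t \<omega>) * indicator ?S \<omega> - g (x + W t \<omega>) * indicator ?S \<omega> \<partial>M)"
    unfolding kill_def using kill_integrable[OF assms(1,2,5)] kill_integrable[OF assms(3,4,5)] by simp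
  have "\<bar>\<integral>\<omega>. f (x + W t \<omega>) * indicator ?S \<omega> - g (x + W t \<omega>) * indicator ?S \<omega> \<partial>M\<bar>
    \<le> (\<integral>\<omega>. \<bar>f (x + W t \<omega>) * indicator ?S \<omega> - g (x + W t \<omega>) * indicator ?S \<omega>\<bar> \<partial>M)"
    by (rule integral_abs_bound)
  also have "\<dots> = kill t (\<lambda>z. \<bar>f z - g z\<bar>) x"
    unfolding kill_def by (intro Bochner_Integration.integral_cong refl) (simp add: indicator_def)
  finally show ?thesis unfolding eq .
qed

text \<open>One unit of time brings the survival probability below a multiple of the ground state,
  which from then on decays exactly at rate \<open>lambda_Bm\<close>.\<close>

lemma kill_one_decay:
  "\<exists>C\<ge>0. \<forall>t>1. \<forall>x. \<bar>x\<bar> < 1 \<longrightarrow> exp (lambda_Bm * t) * kill t (\<lambda>_. 1) x \<le> C * ground x"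
proof -
  obtain C where C: "C \<ge> 0" "\<And>x. \<bar>x\<bar> < 1 \<Longrightarrow> kill 1 (\<lambda>_. 1) x \<le> C * ground x"
    using kill_one_le_ground[of 1] by auto
  have "exp (lambda_Bm * t) * kill t (\<lambda>_. 1) x \<le> C * exp lambda_Bm * ground x" if t: "1 < t" and x: "\<bar>x\<bar> < 1" for t x
  proof -
    have "kill t (\<lambda>_. 1) x = kill (t - 1) (kill 1 (\<lambda>_. 1)) x"
      using kill_semigroup[of "\<lambda>_. 1" 1 "t - 1" 1 x] t by simp
    also have "\<dots> \<le> kill (t - 1) (\<lambda>z. C * ground z) x"
    proof (rule kill_mono[where B=1 and C=C])
      show "\<bar>kill 1 (\<lambda>_. 1) z\<bar> \<le> 1" for z by (rule kill_bound) auto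
      show "\<bar>C * ground z\<bar> \<le> C" for z using C(1) ground_bounds[of z] by (simp add: abs_mult mult_left_le)
    qed (use C t in auto)
    also have "\<dots> = C * (exp (- lambda_Bm * (t - 1)) * ground x)"
      using kill_ground[of "t - 1" x] t x by (simp add: kill_cmult)
    finally have "exp (lambda_Bm * t) * kill t (\<lambda>_. 1) x \<le> exp (lambda_Bm * t) * (C * (exp (- lambda_Bm * (t - 1)) * ground x))"
      by (rule mult_left_mono) simp
    also have "\<dots> = C * (exp (lambda_Bm * t) * exp (- lambda_Bm * (t - 1))) * ground x" by simp
    also have "exp (lambda_Bm * t) * exp (- lambda_Bm * (t - 1)) = exp lambda_Bm"
      by (simp add: mult_exp_exp algebra_simps)
    finally show ?thesis .
  qed
  then show ?thesis using C(1) by (intro exI[of _ "C * exp lambda_Bm"]) auto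
qed

text \<open>The Gaussian density of variance 1 is at most \<open>1 / sqrt (2 * pi)\<close>, hence
  below 1, and killing only decreases the expectation of a nonnegative function.\<close>

lemma kill_le_norm1:
  assumes [measurable]: "g \<in> borel_measurable borel" and g: "\<And>z. 0 \<le> g z" "\<And>z. g z \<le> B"
  shows "kill 1 g x \<le> unit_norm1 g"
proof -
  let ?G = "\<lambda>z. indicator {-1..1} z * \<bar>g z\<bar>"
  have gb: "\<bar>g z\<bar> \<le> B" "\<bar>?G z\<bar> \<le> B" for z using g[of z] by (auto simp: indicator_def)
  have [measurable]: "W 1 \<in> borel_measurable M" by simp
  have "kill 1 g x \<le> heat 1 ?G x"
    unfolding kill_def heat_def
  proof (rule integral_mono)
    show "integrable M (\<lambda>\<omega>. g (x + W 1 \<omega>) * indicator (surv (\<lambda>_. 1) 0 1 x) \<omega>)"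
      by (rule kill_integrable[OF _ gb(1)]) auto
    show "integrable M (\<lambda>\<omega>. ?G (x + W 1 \<omega>))"
      by (rule bounded_integrable[where B=B]) (use gb in auto)
    show "g (x + W 1 \<omega>) * indicator (surv (\<lambda>_. 1) 0 1 x) \<omega> \<le> ?G (x + W 1 \<omega>)" for \<omega>
      using surv_endpoint[of \<omega> "\<lambda>_. 1" 0 1 x] g by (auto simp: indicator_def abs_less_iff)
  qed
  also have "\<dots> = (\<integral>y. normal_density x 1 y * ?G y \<partial>lborel)"
    by (subst heat_eq_density) auto
  also have "\<dots> \<le> (\<integral>y. ?G y \<partial>lborel)"
  proof (rule integral_mono)
    have i: "integrable lborel ?G" by (rule unit_integrable[where B=B]) (use gb in auto)
    have n1: "normal_density x 1 y \<le> 1" for y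
    proof -
      have "1 \<le> sqrt (2 * pi * 1\<^sup>2)" using pi_gt3 by (intro real_le_rsqrt) simp
      then have "1 / sqrt (2 * pi * 1\<^sup>2) * exp (- (y - x)\<^sup>2 / (2 * 1\<^sup>2)) \<le> 1 * 1"
        by (intro mult_mono) auto
      then show ?thesis unfolding normal_density_def by simp
    qed
    show le: "normal_density x 1 y * ?G y \<le> ?G y" for y
      using mult_right_mono[OF n1[of y], of "?G y"] by simp
    show "integrable lborel (\<lambda>y. normal_density x 1 y * ?G y)"
      by (rule Bochner_Integration.integrable_bound[OF i]) (use le in auto)
    show "integrable lborel ?G" by (rule i)
  qed
  finally show ?thesis by (simp add: unit_norm1_def)
qed

text \<open>One unit of time turns the \<open>L^1\<close> norm into a uniform bound, and the
  remaining time, longer than 1, provides the decay. Approximation in \<open>L^1\<close> thus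
  transfers to the rescaled semigroup uniformly in time.\<close>

lemma kill_norm1_decay:
  "\<exists>C\<ge>0. \<forall>t>2. \<forall>(g :: real \<Rightarrow> real) B x. g \<in> borel_measurable borel \<longrightarrow> (\<forall>z. 0 \<le> g z \<and> g z \<le> B) \<longrightarrow> \<bar>x\<bar> < 1 \<longrightarrow>
    exp (lambda_Bm * t) * kill t g x \<le> C * unit_norm1 g"
proof -
  obtain C where C: "C \<ge> 0" "\<And>t x. t > 1 \<Longrightarrow> \<bar>x\<bar> < 1 \<Longrightarrow> exp (lambda_Bm * t) * kill t (\<lambda>_. 1) x \<le> C * ground x"
    using kill_one_decay by blast
  show ?thesis
  proof (intro exI[of _ "C * exp lambda_Bm"] conjI allI impI)
    show "0 \<le> C * exp lambda_Bm" using C by simp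
    fix t B x :: real and g :: "real \<Rightarrow> real"
    assume t: "2 < t" and [measurable]: "g \<in> borel_measurable borel" and g: "\<forall>z. 0 \<le> g z \<and> g z \<le> B" and x: "\<bar>x\<bar> < 1"
    have n0: "0 \<le> unit_norm1 g" unfolding unit_norm1_def by (rule integral_nonneg_AE) auto
    have gb: "\<bar>g z\<bar> \<le> B" for z using g by simp
    have "kill t g x = kill (t - 1) (kill 1 g) x"
      using kill_semigroup[of g B "t - 1" 1 x] t g by simp
    also have "\<dots> \<le> kill (t - 1) (\<lambda>_. unit_norm1 g * 1) x"
    proof (rule kill_mono[where B=B and C="unit_norm1 g"])
      show "\<bar>kill 1 g z\<bar> \<le> B" for z by (rule kill_bound[OF _ gb]) auto
      show "kill 1 g z \<le> unit_norm1 g * 1" for z using kill_le_norm1[of g B z] g by simp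
    qed (use t n0 in auto)
    also have "\<dots> = unit_norm1 g * kill (t - 1) (\<lambda>_. 1) x" by (rule kill_cmult)
    finally have "exp (lambda_Bm * t) * kill t g x \<le> exp (lambda_Bm * t) * (unit_norm1 g * kill (t - 1) (\<lambda>_. 1) x)"
      by (rule mult_left_mono) simp
    also have "\<dots> = exp lambda_Bm * unit_norm1 g * (exp (lambda_Bm * (t - 1)) * kill (t - 1) (\<lambda>_. 1) x)"
      by (simp add: right_diff_distrib exp_diff)
    also have "\<dots> \<le> exp lambda_Bm * unit_norm1 g * (C * 1)"
    proof (rule mult_left_mono)
      have "C * ground x \<le> C * 1" using C ground_bounds[of x] by (intro mult_left_mono) auto
      then show "exp (lambda_Bm * (t - 1)) * kill (t - 1) (\<lambda>_. 1) x \<le> C * 1" using C(2)[of "t - 1" x] t x by linarith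
    qed (use n0 in simp)
    finally show "exp (lambda_Bm * t) * kill t g x \<le> C * exp lambda_Bm * unit_norm1 g" by (simp add: mult_ac)
  qed
qed

text \<open>Uniformity in the starting point is part of the notion, because the limit is later
  integrated against arbitrary laws on the open interval and inserted into another killed
  expectation.\<close>

definition spectral :: "(real \<Rightarrow> real) \<Rightarrow> bool" where
  "spectral f \<longleftrightarrow> (\<forall>e>0. \<exists>T>0. \<forall>t\<ge>T. \<forall>x. \<bar>x\<bar> < 1 \<longrightarrow>
    \<bar>exp (lambda_Bm * t) * kill t f x - unit_ip f * ground x\<bar> \<le> e)"

lemma spectral_single: "spectral (\<lambda>x. c * eigenfun k x)"
  unfolding spectral_def
proof (intro allI impI)
  fix e :: real assume e: "0 < e"
  have ip: "unit_ip (\<lambda>x. c * eigenfun k x) = c * unit_ip (eigenfun k)"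
    by (simp add: unit_ip_def mult.left_commute mult.assoc)
  have main: "exp (lambda_Bm * t) * kill t (\<lambda>x. c * eigenfun k x) x = c * (exp ((lambda_Bm - eigenval k) * t) * eigenfun k x)"
    if "0 < t" "\<bar>x\<bar> < 1" for t x
    using that by (simp add: kill_cmult kill_eigenfun left_diff_distrib mult_exp_exp exp_diff exp_minus divide_inverse)
  consider "k = 0" | "k = 1" | "2 \<le> k" by linarith
  then show "\<exists>T>0. \<forall>t\<ge>T. \<forall>x. \<bar>x\<bar> < 1 \<longrightarrow> \<bar>exp (lambda_Bm * t) * kill t (\<lambda>x. c * eigenfun k x) x -
      unit_ip (\<lambda>x. c * eigenfun k x) * ground x\<bar> \<le> e"
  proof cases
    case 1
    then show ?thesis using e by (intro exI[of _ 1]) (auto simp: eigenfun_def kill_def unit_ip_def)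
  next
    case 2
    show ?thesis
    proof (intro exI[of _ 1] conjI allI impI)
      fix t x :: real assume tx: "1 \<le> t" "\<bar>x\<bar> < 1"
      have "exp (lambda_Bm * t) * kill t (\<lambda>x. c * eigenfun k x) x = c * ground x"
        using main[of t x] tx unfolding 2 eigenfun_1 eigenval_1 by simp
      moreover have "unit_ip (\<lambda>x. c * eigenfun k x) = c" using ip unit_ip_eigenfun 2 by simp
      ultimately show "\<bar>exp (lambda_Bm * t) * kill t (\<lambda>x. c * eigenfun k x) x -
        unit_ip (\<lambda>x. c * eigenfun k x) * ground x\<bar> \<le> e"
        using e by simp
    qed simp
  next
    case 3
    \<comment> \<open>The spectral gap is at least \<open>3 * pi\<^sup>2 / 8\<close>; the crude
      bound 1 is enough.\<close>
    have "lambda_Bm - eigenval k \<le> -1"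
    proof -
      have "4 \<le> (real k)\<^sup>2" using 3 power_mono[of 2 "real k" 2] by simp
      then have "pi\<^sup>2 * 3 \<le> pi\<^sup>2 * ((real k)\<^sup>2 - 1)" by (intro mult_left_mono) auto
      moreover have "pi\<^sup>2 * ((real k)\<^sup>2 - 1) = pi\<^sup>2 * (real k)\<^sup>2 - pi\<^sup>2" by (simp add: right_diff_distrib)
      moreover have "9 \<le> pi\<^sup>2" using power_mono[of 3 pi 2] pi_gt3 by simp
      ultimately have "8 + pi\<^sup>2 \<le> pi\<^sup>2 * (real k)\<^sup>2" by linarith
      then show ?thesis by (simp add: lambda_Bm_def eigenval_def power_mult_distrib power_divide field_simps)
    qed
    then have ex: "exp ((lambda_Bm - eigenval k) * t) \<le> exp (- t)" if "0 < t" for t :: real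
      using mult_right_mono[of "lambda_Bm - eigenval k" "-1" t] that by simp
    have "((\<lambda>t. \<bar>c\<bar> * exp (- t)) \<longlongrightarrow> 0) at_top" by real_asymp
    then have "\<forall>\<^sub>F t in at_top. \<bar>c\<bar> * exp (- t) < e" by (rule order_tendstoD) (rule e)
    then obtain T where T: "\<And>t. t \<ge> T \<Longrightarrow> \<bar>c\<bar> * exp (- t) < e" by (auto simp: eventually_at_top_linorder)
    show ?thesis
    proof (intro exI[of _ "max T 1"] conjI allI impI)
      fix t x :: real assume t: "max T 1 \<le> t" and x: "\<bar>x\<bar> < 1"
      have "\<bar>exp (lambda_Bm * t) * kill t (\<lambda>x. c * eigenfun k x) x\<bar> = \<bar>c\<bar> * (exp ((lambda_Bm - eigenval k) * t) * \<bar>eigenfun k x\<bar>)"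
        using main[of t x] t x by (simp add: abs_mult)
      also have "\<dots> \<le> \<bar>c\<bar> * (exp (- t) * 1)"
        using t by (intro mult_left_mono mult_mono ex eigenfun_bound) auto
      also have "\<dots> \<le> e" using T[of t] t by simp
      finally show "\<bar>exp (lambda_Bm * t) * kill t (\<lambda>x. c * eigenfun k x) x - unit_ip (\<lambda>x. c * eigenfun k x) * ground x\<bar> \<le> e"
        using 3 by (simp add: ip unit_ip_eigenfun)
    qed simp
  qed
qed

lemma spectral_add:
  assumes f: "f \<in> borel_measurable borel" "\<And>z. \<bar>f z\<bar> \<le> B" and g: "g \<in> borel_measurable borel" "\<And>z. \<bar>g z\<bar> \<le> C"
    and sf: "spectral f" and sg: "spectral g"
  shows "spectral (\<lambda>z. f z + g z)"
  unfolding spectral_def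
proof (intro allI impI)
  fix e :: real assume "0 < e"
  then have e: "0 < e / 2" by simp
  obtain T1 where T1: "T1 > 0" "\<And>t x. t \<ge> T1 \<Longrightarrow> \<bar>x\<bar> < 1 \<Longrightarrow> \<bar>exp (lambda_Bm * t) * kill t f x - unit_ip f * ground x\<bar> \<le> e / 2"
    using sf e unfolding spectral_def by blast
  obtain T2 where T2: "T2 > 0" "\<And>t x. t \<ge> T2 \<Longrightarrow> \<bar>x\<bar> < 1 \<Longrightarrow> \<bar>exp (lambda_Bm * t) * kill t g x - unit_ip g * ground x\<bar> \<le> e / 2"
    using sg e unfolding spectral_def by blast
  show "\<exists>T>0. \<forall>t\<ge>T. \<forall>x. \<bar>x\<bar> < 1 \<longrightarrow> \<bar>exp (lambda_Bm * t) * kill t (\<lambda>z. f z + g z) x - unit_ip (\<lambda>z. f z + g z) * ground x\<bar> \<le> e"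
  proof (intro exI[of _ "max T1 T2"] conjI allI impI)
    fix t x :: real assume t: "max T1 T2 \<le> t" and x: "\<bar>x\<bar> < 1"
    have "exp (lambda_Bm * t) * kill t (\<lambda>z. f z + g z) x - unit_ip (\<lambda>z. f z + g z) * ground x =
      (exp (lambda_Bm * t) * kill t f x - unit_ip f * ground x) + (exp (lambda_Bm * t) * kill t g x - unit_ip g * ground x)"
      using t T1(1) by (simp add: kill_add[OF f g] unit_ip_add[OF f g] algebra_simps)
    then show "\<bar>exp (lambda_Bm * t) * kill t (\<lambda>z. f z + g z) x - unit_ip (\<lambda>z. f z + g z) * ground x\<bar> \<le> e"
      using T1(2)[of t x] T2(2)[of t x] t x by linarith
  qed (use T1 in auto)
qed

lemma spectral_sine_poly: "sine_poly p \<Longrightarrow> spectral p"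
proof (induction rule: sine_poly.induct)
  case (single c k)
  show ?case by (rule spectral_single)
next
  case (add f g)
  obtain B C where "\<And>z. \<bar>f z\<bar> \<le> B" "\<And>z. \<bar>g z\<bar> \<le> C"
    using sine_poly_props[OF add(1)] sine_poly_props[OF add(2)] by blast
  then show ?case using spectral_add[of f B g C] sine_poly_props[OF add(1)] sine_poly_props[OF add(2)] add.IH by blast
qed

text \<open>Sine polynomials are dense in \<open>L^1\<close>, and both sides are \<open>L^1\<close>
  continuous in \<open>f\<close>, uniformly over large times and starting points.\<close>

theorem spectral_limit:
  assumes [measurable]: "f \<in> borel_measurable borel" and f: "\<And>z. \<bar>f z\<bar> \<le> B"
  shows "spectral f"
  unfolding spectral_def
proof (intro allI impI)
  fix e :: real assume e: "0 < e"
  obtain C where C: "C \<ge> 0" and decay: "\<And>t g D x. t > 2 \<Longrightarrow> g \<in> borel_measurable borel \<Longrightarrow> (\<And>z. 0 \<le> g z \<and> g z \<le> D) \<Longrightarrow> \<bar>x\<bar> < 1 \<Longrightarrow>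
    exp (lambda_Bm * t) * kill t g x \<le> C * unit_norm1 g"
    using kill_norm1_decay by blast
  \<comment> \<open>Chosen so that the semigroup error \<open>C * d\<close> and the pairing error
    \<open>d\<close> add up to \<open>e / 2\<close>.\<close>
  define d where "d = e / (2 * (C + 1))"
  have d: "0 < d" using e C by (simp add: d_def)
  obtain p where p: "sine_poly p" "unit_norm1 (\<lambda>x. f x - p x) \<le> d"
    using sine_poly_dense[of f B d] f d by auto
  obtain P where P: "\<And>x. \<bar>p x\<bar> \<le> P" using sine_poly_props[OF p(1)] by blast
  have [measurable]: "p \<in> borel_measurable borel" using sine_poly_props[OF p(1)] by blast
  obtain T where T: "T > 0" "\<And>t x. t \<ge> T \<Longrightarrow> \<bar>x\<bar> < 1 \<Longrightarrow> \<bar>exp (lambda_Bm * t) * kill t p x - unit_ip p * ground x\<bar> \<le> e / 2"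
    using spectral_sine_poly[OF p(1)] e unfolding spectral_def by (meson half_gt_zero)
  show "\<exists>T>0. \<forall>t\<ge>T. \<forall>x. \<bar>x\<bar> < 1 \<longrightarrow> \<bar>exp (lambda_Bm * t) * kill t f x - unit_ip f * ground x\<bar> \<le> e"
  proof (intro exI[of _ "max T 3"] conjI allI impI)
    fix t x :: real assume t: "max T 3 \<le> t" and x: "\<bar>x\<bar> < 1"
    let ?E = "exp (lambda_Bm * t)"
    have "\<bar>kill t f x - kill t p x\<bar> \<le> kill t (\<lambda>z. \<bar>f z - p z\<bar>) x"
      by (rule kill_abs_le[OF _ f _ P]) (use t in auto)
    then have "?E * \<bar>kill t f x - kill t p x\<bar> \<le> ?E * kill t (\<lambda>z. \<bar>f z - p z\<bar>) x" by (rule mult_left_mono) simp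
    also have "\<dots> \<le> C * unit_norm1 (\<lambda>z. \<bar>f z - p z\<bar>)"
      by (rule decay[of t "\<lambda>z. \<bar>f z - p z\<bar>" "B + P" x]) (use t x f P in \<open>auto intro!: order_trans[OF abs_triangle_ineq4 add_mono]\<close>)
    also have "unit_norm1 (\<lambda>z. \<bar>f z - p z\<bar>) = unit_norm1 (\<lambda>z. f z - p z)" by (simp add: unit_norm1_def)
    also have "C * unit_norm1 (\<lambda>z. f z - p z) \<le> C * d" by (rule mult_left_mono[OF p(2) C])
    finally have 1: "\<bar>?E * kill t f x - ?E * kill t p x\<bar> \<le> C * d"
      by (simp add: right_diff_distrib[symmetric] abs_mult)
    have "\<bar>unit_ip f - unit_ip p\<bar> * \<bar>ground x\<bar> \<le> d * 1"
      by (intro mult_mono ground_bounds order_trans[OF unit_ip_diff_le[OF _ _ f P] p(2)]) (use d in auto)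
    then have 2: "\<bar>unit_ip f * ground x - unit_ip p * ground x\<bar> \<le> d" by (simp add: left_diff_distrib[symmetric] abs_mult)
    have "d * (2 * (C + 1)) = e" using C by (simp add: d_def)
    then have "C * d + d = e / 2" by (simp add: algebra_simps)
    then show "\<bar>?E * kill t f x - unit_ip f * ground x\<bar> \<le> e"
      using 1 2 T(2)[of t x] t x by linarith
  qed simp
qed

end

section \<open>Hitting times and the quasi-stationary distribution\<close>

text \<open>A strict inequality with the infimum needs a gap: at time \<open>t\<close> the path is
  off the level, and by continuity it stays off it for some time afterwards.\<close>

lemma hitting_time_gt_iff:
  fixes y :: "real \<Rightarrow> real"
  assumes y: "continuous_on {s..} y" and st: "s \<le> t"
  shows "ereal t < Inf (ereal ` {r. s \<le> r \<and> \<bar>y r\<bar> = 1}) \<longleftrightarrow> (\<forall>r\<in>{s..t}. \<bar>y r\<bar> \<noteq> 1)"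
proof
  assume lt: "ereal t < Inf (ereal ` {r. s \<le> r \<and> \<bar>y r\<bar> = 1})"
  show "\<forall>r\<in>{s..t}. \<bar>y r\<bar> \<noteq> 1"
  proof (intro ballI notI)
    fix r assume "r \<in> {s..t}" "\<bar>y r\<bar> = 1"
    then have "Inf (ereal ` {r. s \<le> r \<and> \<bar>y r\<bar> = 1}) \<le> ereal r" by (intro Inf_lower) auto
    also have "\<dots> \<le> ereal t" using \<open>r \<in> {s..t}\<close> by simp
    finally show False using lt by simp
  qed
next
  assume ne: "\<forall>r\<in>{s..t}. \<bar>y r\<bar> \<noteq> 1"
  have "continuous_on {s..} (\<lambda>r. \<bar>y r\<bar> - 1)" using y by (intro continuous_intros)
  moreover have "0 < \<bar>\<bar>y t\<bar> - 1\<bar>" using ne st by simp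
  ultimately obtain d where d: "d > 0" "\<And>r. r \<in> {s..} \<Longrightarrow> dist r t < d \<Longrightarrow> dist (\<bar>y r\<bar> - 1) (\<bar>y t\<bar> - 1) < \<bar>\<bar>y t\<bar> - 1\<bar>"
    using st unfolding continuous_on_iff by (metis atLeast_iff)
  have "t + d \<le> r" if r: "s \<le> r" "\<bar>y r\<bar> = 1" for r
  proof (rule ccontr)
    assume "\<not> t + d \<le> r"
    then have "r \<le> t \<or> dist r t < d" by (auto simp: dist_real_def)
    then show False
    proof
      assume "r \<le> t" then show False using ne r by auto
    next
      assume "dist r t < d"
      then have "dist (\<bar>y r\<bar> - 1) (\<bar>y t\<bar> - 1) < \<bar>\<bar>y t\<bar> - 1\<bar>" by (intro d(2)) (use r in auto)
      moreover have "dist (\<bar>y r\<bar> - 1) (\<bar>y t\<bar> - 1) = \<bar>\<bar>y t\<bar> - 1\<bar>"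
        using r by (simp add: dist_real_def abs_minus_commute)
      ultimately show False by simp
    qed
  qed
  then have "ereal (t + d) \<le> Inf (ereal ` {r. s \<le> r \<and> \<bar>y r\<bar> = 1})"
    by (auto intro!: INF_greatest)
  moreover have "ereal t < ereal (t + d)" using d by simp
  ultimately show "ereal t < Inf (ereal ` {r. s \<le> r \<and> \<bar>y r\<bar> = 1})" by (rule less_le_trans[rotated])
qed

text \<open>The hitting time asks for modulus exactly 1, so a path that starts outside the interval
  also counts as not yet stopped. The outer cases enter the measurability in the starting point,
  which is required on the whole line.\<close>

lemma avoiding_one_cases:
  fixes y :: "real \<Rightarrow> real"
  assumes y: "continuous_on {s..t} y" and st: "s \<le> t"
  shows "(\<forall>r\<in>{s..t}. \<bar>y r\<bar> \<noteq> 1) \<longleftrightarrow>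
    (\<forall>r\<in>{s..t}. \<bar>y r\<bar> < 1) \<or> (\<forall>r\<in>{s..t}. 1 < 1 * y r) \<or> (\<forall>r\<in>{s..t}. 1 < (-1) * y r)"
proof
  assume ne: "\<forall>r\<in>{s..t}. \<bar>y r\<bar> \<noteq> 1"
  have c: "connected (y ` {s..t})" using y by (intro connected_continuous_image) auto
  have no: "1 \<notin> y ` {s..t}" "-1 \<notin> y ` {s..t}" using ne by auto
  have mid: "z \<in> y ` {s..t}" if "a \<in> y ` {s..t}" "b \<in> y ` {s..t}" "a \<le> z" "z \<le> b" for a b z
    using connectedD_interval[OF c that(1,2,3,4)] .
  have ys: "y s \<in> y ` {s..t}" using st by auto
  show "(\<forall>r\<in>{s..t}. \<bar>y r\<bar> < 1) \<or> (\<forall>r\<in>{s..t}. 1 < 1 * y r) \<or> (\<forall>r\<in>{s..t}. 1 < (-1) * y r)"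
  proof (rule ccontr)
    assume "\<not> ?thesis"
    then obtain r1 r2 r3 where r: "r1 \<in> {s..t}" "1 \<le> \<bar>y r1\<bar>" "r2 \<in> {s..t}" "y r2 \<le> 1" "r3 \<in> {s..t}" "-1 \<le> y r3"
      by (auto simp: not_less)
    then have "y r1 \<in> y ` {s..t}" "y r2 \<in> y ` {s..t}" "y r3 \<in> y ` {s..t}" by blast+
    then show False using mid[of "y r2" "y r1" 1] mid[of "y r1" "y r3" "-1"] no r
      by (cases "y r1 \<ge> 0") auto
  qed
qed (force simp: abs_if)

lemma closure_open_interval_rats: "s < t \<Longrightarrow> closure ({s<..<t} \<inter> \<rat>) = {s..t::real}"
proof
  assume st: "s < t"
  show "closure ({s<..<t} \<inter> \<rat>) \<subseteq> {s..t}" by (rule closure_minimal) auto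
  have "{s<..<t} \<subseteq> closure ({s<..<t} \<inter> \<rat>)"
    using open_Int_closure_subset[of "{s<..<t}" "\<rat>"] by (simp add: Rats_closure_real)
  then have "closure {s<..<t} \<subseteq> closure ({s<..<t} \<inter> \<rat>)" by (rule closure_minimal) simp
  then show "{s..t} \<subseteq> closure ({s<..<t} \<inter> \<rat>)" using st by simp
qed

section \<open>Measurability of hitting times; the quasi-stationary law and its companions\<close>

context brownian
begin

definition above :: "real \<Rightarrow> (real \<Rightarrow> real) \<Rightarrow> real \<Rightarrow> real \<Rightarrow> real \<Rightarrow> 'a set" where
  "above c b s t y = {\<omega>\<in>space M. \<forall>r\<in>{s..t}. b r < c * (y + W (r - s) \<omega>)}"

text \<open>Uncountably many strict inequalities become countable conditions: by compactness the gap
  to the barrier has a positive minimum, so a margin \<open>1 / real (Suc m)\<close> at rational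
  times is equivalent.\<close>

lemma above_pair_measurable:
  assumes b: "continuous_on {s..t} b" and st: "s < t"
  shows "(\<lambda>z. indicator (above c b s t (fst z)) (snd z) :: real) \<in> borel_measurable (borel \<Otimes>\<^sub>M M)"
proof -
  let ?Q = "{s<..<t} \<inter> \<rat>"
  have iff: "\<omega> \<in> above c b s t y \<longleftrightarrow> (\<exists>m::nat. \<forall>r\<in>?Q. b r + 1 / real (Suc m) \<le> c * (y + W (r - s) \<omega>))"
    if \<omega>: "\<omega> \<in> space M" for y \<omega>
  proof -
    let ?h = "\<lambda>r. c * (y + W (r - s) \<omega>) - b r"
    have h: "continuous_on {s..t} ?h" by (intro continuous_intros W_continuous_shift \<omega> b)
    show ?thesis
    proof
      assume ab: "\<omega> \<in> above c b s t y"
      obtain r0 where r0: "r0 \<in> {s..t}" "\<forall>r\<in>{s..t}. ?h r0 \<le> ?h r"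
        using continuous_attains_inf[of "{s..t}" ?h] h st by auto
      have "0 < ?h r0" using ab r0(1) by (auto simp: above_def)
      then obtain m where "inverse (real (Suc m)) < ?h r0" using reals_Archimedean by blast
      then have m: "1 / real (Suc m) < ?h r0" by (simp only: inverse_eq_divide)
      have "b r + 1 / real (Suc m) \<le> c * (y + W (r - s) \<omega>)" if "r \<in> ?Q" for r
      proof -
        have "?h r0 \<le> ?h r" using r0(2) that by auto
        then show ?thesis using m by linarith
      qed
      then show "\<exists>m::nat. \<forall>r\<in>?Q. b r + 1 / real (Suc m) \<le> c * (y + W (r - s) \<omega>)" by blast
    next
      assume "\<exists>m::nat. \<forall>r\<in>?Q. b r + 1 / real (Suc m) \<le> c * (y + W (r - s) \<omega>)"
      then obtain m where m0: "\<forall>r\<in>?Q. b r + 1 / real (Suc m) \<le> c * (y + W (r - s) \<omega>)" by blast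
      have m: "1 / real (Suc m) \<le> ?h r" if "r \<in> ?Q" for r using bspec[OF m0 that] by linarith
      have hr: "1 / real (Suc m) \<le> ?h r" if "r \<in> {s..t}" for r
        by (rule continuous_ge_on_closure[of ?Q ?h]) (use h m that closure_open_interval_rats[OF st] in auto)
      have "0 < 1 / real (Suc m)" by simp
      then have "0 < ?h r" if "r \<in> {s..t}" for r using hr[OF that] by linarith
      then show "\<omega> \<in> above c b s t y" using \<omega> by (auto simp: above_def)
    qed
  qed
  have Q: "(\<forall>r\<in>?Q. P r) \<longleftrightarrow> (\<forall>q::rat. s < of_rat q \<and> of_rat q < t \<longrightarrow> P (of_rat q))" for P :: "real \<Rightarrow> bool"
    by (auto simp: Rats_def)
  have "Measurable.pred (borel \<Otimes>\<^sub>M M) (\<lambda>z. \<exists>m::nat. \<forall>r\<in>?Q. b r + 1 / real (Suc m) \<le> c * (fst z + W (r - s) (snd z)))"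
    unfolding Q
  proof (rule pred_intros_countable(2), rule pred_intros_countable(1))
    fix m :: nat and q :: rat
    show "Measurable.pred (borel \<Otimes>\<^sub>M M) (\<lambda>z. s < of_rat q \<and> of_rat q < t \<longrightarrow>
      b (of_rat q) + 1 / real (Suc m) \<le> c * (fst z + W (of_rat q - s) (snd z)))"
    proof (cases "s < of_rat q \<and> of_rat q < t")
      case True
      then have [measurable]: "W (of_rat q - s) \<in> borel_measurable M" by (intro W_measurable) auto
      show ?thesis by measurable
    qed simp
  qed
  then have "(\<lambda>z. indicator {z \<in> space (borel \<Otimes>\<^sub>M M). \<exists>m::nat. \<forall>r\<in>?Q. b r + 1 / real (Suc m) \<le> c * (fst z + W (r - s) (snd z))} z :: real)
    \<in> borel_measurable (borel \<Otimes>\<^sub>M M)"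
    by (intro borel_measurable_indicator) (simp add: pred_def)
  then show ?thesis
    by (rule measurable_cong[THEN iffD1, rotated]) (auto simp: indicator_def iff space_pair_measure)
qed

lemma tauB_gt_iff:
  assumes \<omega>: "\<omega> \<in> space M" and t: "0 \<le> t"
  shows "ereal t < tauB W x \<omega> \<longleftrightarrow>
    \<omega> \<in> surv (\<lambda>_. 1) 0 t x \<or> \<omega> \<in> above 1 (\<lambda>_. 1) 0 t x \<or> \<omega> \<in> above (-1) (\<lambda>_. 1) 0 t x"
proof -
  have c: "continuous_on {0..} (\<lambda>r. x + W r \<omega>)" by (intro continuous_intros W_continuous \<omega>)
  then have c': "continuous_on {0..t} (\<lambda>r. x + W r \<omega>)" by (rule continuous_on_subset) auto
  show ?thesis
    unfolding tauB_def hitting_time_gt_iff[OF c t] avoiding_one_cases[OF c' t]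
    by (simp add: surv_def above_def \<omega>)
qed

lemma tauB_gt_iff_surv:
  assumes \<omega>: "\<omega> \<in> space M" and t: "0 \<le> t" and x: "\<bar>x\<bar> < 1"
  shows "ereal t < tauB W x \<omega> \<longleftrightarrow> \<omega> \<in> surv (\<lambda>_. 1) 0 t x"
proof -
  have "\<omega> \<notin> above c (\<lambda>_. 1) 0 t x" if "\<bar>c\<bar> = 1" for c
  proof
    assume "\<omega> \<in> above c (\<lambda>_. 1) 0 t x"
    then have "1 < c * (x + W (0 - 0) \<omega>)" using t by (auto simp: above_def simp del: diff_self)
    then have "1 < c * x" by (simp add: W_0 \<omega>)
    moreover have "\<bar>c * x\<bar> < 1" using that x by (simp add: abs_mult)
    ultimately show False by simp
  qed
  then show ?thesis using tauB_gt_iff[OF \<omega> t] by auto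
qed

definition qsd_prob :: "real \<Rightarrow> real set \<Rightarrow> real \<Rightarrow> real" where
  "qsd_prob t A x = measure M {\<omega>\<in>space M. x + W t \<omega> \<in> A \<and> tauB W x \<omega> > ereal t}"

lemma tauB_pair_measurable:
  assumes t: "0 < t"
  shows "(\<lambda>z. indicator {\<omega>\<in>space M. tauB W (fst z) \<omega> > ereal t} (snd z) :: real) \<in> borel_measurable (borel \<Otimes>\<^sub>M M)"
proof -
  have c: "continuous_on {0..t} (\<lambda>_. 1::real)" by simp
  note [measurable] = surv_pair_measurable[OF c _ t, simplified] above_pair_measurable[OF c t]
  let ?s = "\<lambda>z. indicator (surv (\<lambda>_. 1) 0 t (fst z)) (snd z) :: real"
  let ?a = "\<lambda>c z. indicator (above c (\<lambda>_. 1) 0 t (fst z)) (snd z) :: real"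
  have "(\<lambda>z. max (?s z) (max (?a 1 z) (?a (-1) z))) \<in> borel_measurable (borel \<Otimes>\<^sub>M M)" by measurable
  then show ?thesis
    by (rule measurable_cong[THEN iffD1, rotated])
      (use t in \<open>auto simp: indicator_def space_pair_measure tauB_gt_iff max_def\<close>)
qed

lemma qsd_prob_eq_kill:
  assumes t: "0 \<le> t" and x: "\<bar>x\<bar> < 1"
  shows "qsd_prob t A x = kill t (indicator A) x"
proof -
  have "qsd_prob t A x = (\<integral>\<omega>. indicator {\<omega>\<in>space M. x + W t \<omega> \<in> A \<and> tauB W x \<omega> > ereal t} \<omega> \<partial>M)"
    unfolding qsd_prob_def by (simp add: Int_absorb2 subset_eq)
  also have "\<dots> = kill t (indicator A) x"
    unfolding kill_def
    by (intro Bochner_Integration.integral_cong refl) (auto simp: indicator_def tauB_gt_iff_surv[OF _ t x])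
  finally show ?thesis .
qed

lemma qsd_prob_measurable:
  assumes [measurable]: "A \<in> sets borel" and t: "0 \<le> t"
  shows "qsd_prob t A \<in> borel_measurable borel"
\<comment> \<open>At time 0 the event is explicit; joint measurability of the hitting event was
  obtained for positive times.\<close>
proof (cases "t = 0")
  case True
  have "qsd_prob 0 A x = indicator (A - {-1, 1}) x" for x
  proof -
    have "{\<omega>\<in>space M. x + W 0 \<omega> \<in> A \<and> tauB W x \<omega> > ereal 0} = (if x \<in> A - {-1,1} then space M else {})"
    proof -
      have "ereal 0 < tauB W x \<omega> \<longleftrightarrow> \<bar>x\<bar> \<noteq> 1" if "\<omega> \<in> space M" for \<omega>
        using hitting_time_gt_iff[of 0 "\<lambda>r. x + W r \<omega>" 0] that
        by (simp add: tauB_def W_0 continuous_on_add W_continuous)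
      then show ?thesis by (auto simp: W_0 abs_if split: if_splits)
    qed
    then show ?thesis by (simp add: qsd_prob_def prob_space)
  qed
  then have "qsd_prob 0 A = indicator (A - {-1, 1})" by auto
  then show ?thesis by (simp add: True)
next
  case False
  then have t: "0 < t" using t by simp
  have [measurable]: "W t \<in> borel_measurable M" using t by simp
  note [measurable] = tauB_pair_measurable[OF t]
  have "(\<lambda>z. indicator A (fst z + W t (snd z)) * indicator {\<omega>\<in>space M. tauB W (fst z) \<omega> > ereal t} (snd z) :: real)
    \<in> borel_measurable (borel \<Otimes>\<^sub>M M)"
    by (rule borel_measurable_times[OF _ tauB_pair_measurable[OF t]]) measurable
  then have "(\<lambda>x. \<integral>\<omega>. (indicator A (x + W t \<omega>) * indicator {\<omega>\<in>space M. tauB W x \<omega> > ereal t} \<omega> :: real) \<partial>M) \<in> borel_measurable borel"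
    by (intro borel_measurable_lebesgue_integral) (simp add: split_beta')
  moreover have "qsd_prob t A x = (\<integral>\<omega>. indicator A (x + W t \<omega>) * indicator {\<omega>\<in>space M. tauB W x \<omega> > ereal t} \<omega> \<partial>M)" for x
  proof -
    have "qsd_prob t A x = (\<integral>\<omega>. indicator {\<omega>\<in>space M. x + W t \<omega> \<in> A \<and> tauB W x \<omega> > ereal t} \<omega> \<partial>M)"
      unfolding qsd_prob_def by (simp add: Int_absorb2 subset_eq)
    also have "\<dots> = (\<integral>\<omega>. indicator A (x + W t \<omega>) * indicator {\<omega>\<in>space M. tauB W x \<omega> > ereal t} \<omega> \<partial>M)"
      by (intro Bochner_Integration.integral_cong refl) (auto simp: indicator_def)
    finally show ?thesis .
  qed
  ultimately show ?thesis by (subst measurable_cong) auto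
qed

lemma kill_0: "\<bar>x\<bar> < 1 \<Longrightarrow> kill 0 f x = f x"
proof -
  assume x: "\<bar>x\<bar> < 1"
  have "kill 0 f x = (\<integral>\<omega>. f x \<partial>M)" unfolding kill_def
    by (intro Bochner_Integration.integral_cong) (use x in \<open>auto simp: W_0 surv_def\<close>)
  then show ?thesis by (simp add: prob_space)
qed

lemma spectral_tendsto:
  assumes [measurable]: "f \<in> borel_measurable borel" and "\<And>z. \<bar>f z\<bar> \<le> B" and x: "\<bar>x\<bar> < 1"
  shows "((\<lambda>t. exp (lambda_Bm * t) * kill t f x) \<longlongrightarrow> unit_ip f * ground x) at_top"
proof (rule tendstoI)
  fix e :: real assume "0 < e"
  then have "0 < e / 2" by simp
  then obtain T where "\<forall>t\<ge>T. \<forall>x. \<bar>x\<bar> < 1 \<longrightarrow> \<bar>exp (lambda_Bm * t) * kill t f x - unit_ip f * ground x\<bar> \<le> e / 2"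
    using spectral_limit[OF assms(1,2)] unfolding spectral_def by blast
  then show "\<forall>\<^sub>F t in at_top. dist (exp (lambda_Bm * t) * kill t f x) (unit_ip f * ground x) < e"
    using x \<open>0 < e\<close> by (intro eventually_at_top_linorderI[of T]) (fastforce simp: dist_real_def)
qed

lemma eta_Bm_eq:
  assumes x: "\<bar>x\<bar> < 1"
  shows "eta_Bm M W x = unit_ip (\<lambda>_. 1) * ground x"
proof -
  have "((\<lambda>t. exp (lambda_Bm * t) * measure M {\<omega>\<in>space M. tauB W x \<omega> > ereal t}) \<longlongrightarrow> unit_ip (\<lambda>_. 1) * ground x) at_top"
  proof (rule Lim_transform_eventually[OF spectral_tendsto[of "\<lambda>_. 1" 1 x]])
    show "\<forall>\<^sub>F t in at_top. exp (lambda_Bm * t) * kill t (\<lambda>_. 1) x = exp (lambda_Bm * t) * measure M {\<omega>\<in>space M. tauB W x \<omega> > ereal t}"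
      using eventually_ge_at_top[of 0]
    proof eventually_elim
      case (elim t)
      show ?case using qsd_prob_eq_kill[OF elim x, of UNIV] by (simp add: qsd_prob_def)
    qed
  qed (use x in auto)
  then show ?thesis unfolding eta_Bm_def by (rule tendsto_Lim[rotated]) simp
qed

text \<open>Its value is \<open>4 / pi\<close>. It normalises the ground state to the
  quasi-stationary density, and \<open>mass * ground\<close> is \<open>eta_Bm\<close> on the open
  interval.\<close>

definition mass :: real where "mass = unit_ip (\<lambda>_. 1)"

lemma ground_continuous: "continuous_on A ground"
  using eigenfun_continuous[of A 1] unfolding eigenfun_1 .

lemma mass_pos: "0 < mass"
proof -
  have "(\<integral>y. ground y * indicator {-1..1} y \<partial>lborel) = sin (pi * 1 / 2) * (2 / pi) - sin (pi * (-1) / 2) * (2 / pi)"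
  proof (rule integral_FTC_Icc_real)
    show "((\<lambda>y. sin (pi * y / 2) * (2 / pi)) has_real_derivative ground y) (at y)" for y
      by (auto intro!: derivative_eq_intros simp: ground_def)
    show "isCont ground y" for y unfolding ground_def by (intro continuous_intros) auto
  qed simp
  also have "\<dots> > 0" by simp
  finally show ?thesis by (simp add: mass_def unit_ip_def mult.commute)
qed

definition alpha0 :: "real measure" where
  "alpha0 = density lborel (\<lambda>x. ennreal (indicator {-1..1} x * ground x / mass))"

lemma alpha0_weight_nonneg: "0 \<le> indicator {-1..1} x * ground x / mass"
  using ground_nonneg[of x] mass_pos by (auto simp: indicator_def abs_le_iff)

lemma sets_alpha0 [simp, measurable_cong]: "sets alpha0 = sets borel"
  by (simp add: alpha0_def)

lemma integral_alpha0:
  assumes [measurable]: "h \<in> borel_measurable borel"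
  shows "(\<integral>x. h x \<partial>alpha0) = unit_ip h / mass"
proof -
  have "(\<integral>x. h x \<partial>alpha0) = (\<integral>x. (indicator {-1..1} x * ground x / mass) * h x \<partial>lborel)"
    unfolding alpha0_def by (subst integral_density) (use alpha0_weight_nonneg in auto)
  also have "\<dots> = (\<integral>x. (indicator {-1..1} x * (h x * ground x)) / mass \<partial>lborel)"
    by (intro Bochner_Integration.integral_cong refl) simp
  finally show ?thesis by (simp add: unit_ip_def)
qed

lemma emeasure_alpha0:
  assumes [measurable]: "A \<in> sets borel"
  shows "emeasure alpha0 A = ennreal (unit_ip (indicator A) / mass)"
proof -
  have i: "integrable lborel (\<lambda>y. indicator {-1..1} y * (indicator A y * ground y) / mass)"
    by (intro integrable_divide_zero unit_ip_integrable[where B=1]) (auto simp: indicator_def)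
  have "emeasure alpha0 A = (\<integral>\<^sup>+x. ennreal (indicator {-1..1} x * (indicator A x * ground x) / mass) \<partial>lborel)"
    unfolding alpha0_def by (subst emeasure_density) (auto intro!: nn_integral_cong simp: indicator_def)
  also have "\<dots> = ennreal (\<integral>x. indicator {-1..1} x * (indicator A x * ground x) / mass \<partial>lborel)"
  proof (rule nn_integral_eq_integral[OF i], rule AE_I2)
    show "0 \<le> indicator {-1..1} x * (indicator A x * ground x) / mass" for x
      using alpha0_weight_nonneg[of x] by (auto simp: indicator_def split: if_splits)
  qed
  finally show ?thesis by (simp add: unit_ip_def)
qed

text \<open>The ground state vanishes at the end points, so the pairing sees only the open
  interval.\<close>

lemma unit_ip_cong: "(\<And>x. \<bar>x\<bar> < 1 \<Longrightarrow> f x = g x) \<Longrightarrow> unit_ip f = unit_ip g"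
proof -
  assume eq: "\<And>x. \<bar>x\<bar> < 1 \<Longrightarrow> f x = g x"
  have "indicator {-1..1} y * (f y * ground y) = indicator {-1..1} y * (g y * ground y)" for y :: real
  proof (cases "\<bar>y\<bar> < 1")
    case False
    then have "y \<notin> {-1..1} \<or> ground y = 0" by (auto simp: ground_def abs_if split: if_splits)
    then show ?thesis by auto
  qed (simp add: eq)
  then show ?thesis unfolding unit_ip_def by (intro Bochner_Integration.integral_cong refl)
qed

lemma unit_ip_nonneg: "(\<And>x. 0 \<le> f x) \<Longrightarrow> 0 \<le> unit_ip f"
  unfolding unit_ip_def using ground_nonneg
  by (intro integral_nonneg_AE AE_I2) (auto simp: indicator_def abs_le_iff)

text \<open>The ground state is an eigenvector of the adjoint as well. To see this, the large-time
  limit of \<open>kill r (kill t f)\<close> at the point 0, where the ground state is 1, is computed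
  once from the spectral limit of \<open>kill t f\<close> and once from the semigroup law.\<close>

lemma unit_ip_kill:
  assumes f[measurable]: "f \<in> borel_measurable borel" and f01: "\<And>z. 0 \<le> f z" "\<And>z. f z \<le> B" and t: "0 \<le> t"
  shows "unit_ip (kill t f) = exp (- lambda_Bm * t) * unit_ip f"
proof (cases "t = 0")
  case True
  have "unit_ip (kill 0 f) = unit_ip f" by (rule unit_ip_cong) (rule kill_0)
  then show ?thesis using True by simp
next
  case False
  then have t: "0 < t" using t by simp
  have fB: "\<bar>f z\<bar> \<le> B" for z using f01[of z] by simp
  have "((\<lambda>r. exp (lambda_Bm * r) * kill r (kill t f) 0) \<longlongrightarrow> unit_ip (kill t f) * ground 0) at_top"
    by (rule spectral_tendsto[where B=B]) (use t kill_bound[OF f fB t] in auto)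
  moreover have "((\<lambda>r. exp (lambda_Bm * r) * kill r (kill t f) 0) \<longlongrightarrow> exp (- lambda_Bm * t) * (unit_ip f * ground 0)) at_top"
  proof (rule Lim_transform_eventually)
    have "((\<lambda>r. exp (lambda_Bm * (r + t)) * kill (r + t) f 0) \<longlongrightarrow> unit_ip f * ground 0) at_top"
      by (rule filterlim_compose[OF spectral_tendsto[OF f fB]]) (auto intro: filterlim_tendsto_add_at_top[OF tendsto_const filterlim_ident, of t, simplified add.commute])
    then show "((\<lambda>r. exp (- lambda_Bm * t) * (exp (lambda_Bm * (r + t)) * kill (r + t) f 0)) \<longlongrightarrow>
      exp (- lambda_Bm * t) * (unit_ip f * ground 0)) at_top" by (rule tendsto_mult_left)
    show "\<forall>\<^sub>F r in at_top. exp (- lambda_Bm * t) * (exp (lambda_Bm * (r + t)) * kill (r + t) f 0) = exp (lambda_Bm * r) * kill r (kill t f) 0"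
      using eventually_gt_at_top[of 0]
    proof eventually_elim
      case (elim r)
      have "exp (- lambda_Bm * t) * exp (lambda_Bm * (r + t)) = exp (lambda_Bm * r)"
        by (simp add: mult_exp_exp algebra_simps)
      then show ?case using kill_semigroup[OF f f01 elim t, of 0] by (simp add: mult.assoc[symmetric])
    qed
  qed
  ultimately have "unit_ip (kill t f) * ground 0 = exp (- lambda_Bm * t) * (unit_ip f * ground 0)"
    by (rule tendsto_unique[rotated]) simp
  then show ?thesis by (simp add: ground_def)
qed

text \<open>Uniform convergence on the open interval passes through integration against any
  probability measure concentrated there.\<close>

lemma tendsto_kill_integral:
  assumes [measurable]: "f \<in> borel_measurable borel" and f: "\<And>z. \<bar>f z\<bar> \<le> B"
    and \<nu>: "prob_space \<nu>" "sets \<nu> = sets borel" "AE x in \<nu>. \<bar>x\<bar> < 1"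
  shows "((\<lambda>t. exp (lambda_Bm * t) * (\<integral>x. kill t f x \<partial>\<nu>)) \<longlongrightarrow> unit_ip f * (\<integral>x. ground x \<partial>\<nu>)) at_top"
proof (rule tendstoI)
  fix e :: real assume "0 < e"
  then have e: "0 < e / 2" by simp
  interpret \<nu>: prob_space \<nu> by fact
  note [measurable_cong] = \<nu>(2)
  obtain T where T: "T > 0" "\<And>t x. t \<ge> T \<Longrightarrow> \<bar>x\<bar> < 1 \<Longrightarrow> \<bar>exp (lambda_Bm * t) * kill t f x - unit_ip f * ground x\<bar> \<le> e / 2"
    using spectral_limit[OF assms(1,2)] e unfolding spectral_def by blast
  show "\<forall>\<^sub>F t in at_top. dist (exp (lambda_Bm * t) * (\<integral>x. kill t f x \<partial>\<nu>)) (unit_ip f * (\<integral>x. ground x \<partial>\<nu>)) < e"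
  proof (rule eventually_at_top_linorderI[of T])
    fix t assume t: "T \<le> t"
    then have t0: "0 < t" using T(1) by simp
    have [measurable]: "kill t f \<in> borel_measurable borel" using t0 by simp
    have i: "integrable \<nu> (kill t f)" "integrable \<nu> ground"
      by (rule \<nu>.integrable_const_bound[where B=B]; use kill_bound[OF _ f t0] in simp)
        (rule \<nu>.integrable_const_bound[where B=1]; use ground_bounds in simp)
    let ?d = "\<lambda>x. exp (lambda_Bm * t) * kill t f x - unit_ip f * ground x"
    have "dist (exp (lambda_Bm * t) * (\<integral>x. kill t f x \<partial>\<nu>)) (unit_ip f * (\<integral>x. ground x \<partial>\<nu>)) = \<bar>\<integral>x. ?d x \<partial>\<nu>\<bar>"
      using i by (simp add: dist_real_def)
    moreover have "\<bar>\<integral>x. ?d x \<partial>\<nu>\<bar> \<le> (\<integral>x. \<bar>?d x\<bar> \<partial>\<nu>)" by (rule integral_abs_bound)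
    moreover have "(\<integral>x. \<bar>?d x\<bar> \<partial>\<nu>) \<le> (\<integral>x. e / 2 \<partial>\<nu>)"
    proof (rule integral_mono_AE)
      show "integrable \<nu> (\<lambda>x. \<bar>?d x\<bar>)"
        using i by (intro integrable_abs Bochner_Integration.integrable_diff integrable_mult_right)
      show "AE x in \<nu>. \<bar>?d x\<bar> \<le> e / 2" using \<nu>(3) by eventually_elim (rule T(2)[OF t])
    qed simp
    moreover have "(\<integral>x. e / 2 \<partial>\<nu>) = e / 2" by (simp add: \<nu>.prob_space)
    ultimately show "dist (exp (lambda_Bm * t) * (\<integral>x. kill t f x \<partial>\<nu>)) (unit_ip f * (\<integral>x. ground x \<partial>\<nu>)) < e"
      using e by linarith
  qed
qed

lemma qsd_integral:
  assumes \<nu>: "sets \<nu> = sets borel" "AE x in \<nu>. \<bar>x\<bar> < 1" and A[measurable]: "A \<in> sets borel" and t: "0 < t"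
  shows "(\<integral>x. qsd_prob t A x \<partial>\<nu>) = (\<integral>x. kill t (indicator A) x \<partial>\<nu>)"
proof (rule integral_cong_AE)
  note [measurable_cong] = \<nu>(1)
  note [measurable] = qsd_prob_measurable[OF A less_imp_le[OF t]]
  have [measurable]: "kill t (indicator A) \<in> borel_measurable borel" using t by simp
  show "qsd_prob t A \<in> borel_measurable \<nu>" "kill t (indicator A) \<in> borel_measurable \<nu>" by measurable
  show "AE x in \<nu>. qsd_prob t A x = kill t (indicator A) x"
    using \<nu>(2) by eventually_elim (use t in \<open>simp add: qsd_prob_eq_kill\<close>)
qed


lemma AE_unit:
  assumes "prob_space \<nu>" "sets \<nu> = sets borel" "emeasure \<nu> {-1<..<1::real} = 1"
  shows "AE x in \<nu>. \<bar>x\<bar> < 1"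
proof -
  interpret \<nu>: prob_space \<nu> by fact
  have "AE x in \<nu>. x \<in> {-1<..<1}"
  proof (rule \<nu>.AE_prob_1)
    show "measure \<nu> {-1<..<1} = 1" using assms(3) unfolding \<nu>.emeasure_eq_measure by simp
  qed
  then show ?thesis by eventually_elim (auto simp: abs_less_iff)
qed

lemma integral_ground_pos:
  assumes "prob_space \<nu>" "sets \<nu> = sets borel" "AE x in \<nu>. \<bar>x\<bar> < 1"
  shows "0 < (\<integral>x. ground x \<partial>\<nu>)"
proof -
  interpret \<nu>: prob_space \<nu> by fact
  note [measurable_cong] = assms(2)
  have i: "integrable \<nu> ground"
    by (rule \<nu>.integrable_const_bound[where B=1]; use ground_bounds in simp)
  have nn: "AE x in \<nu>. 0 \<le> ground x" using assms(3) by eventually_elim (simp add: ground_nonneg)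
  have "(\<integral>x. ground x \<partial>\<nu>) \<noteq> 0"
  proof
    assume "(\<integral>x. ground x \<partial>\<nu>) = 0"
    then have "AE x in \<nu>. ground x = 0" using integral_nonneg_eq_0_iff_AE[OF i nn] by simp
    with assms(3) have "AE x in \<nu>. False"
      by eventually_elim (use ground_pos in fastforce)
    then show False by simp
  qed
  then show ?thesis using integral_nonneg_AE[OF nn] by linarith
qed

text \<open>By \<open>unit_ip_kill\<close> all killed expectations under \<open>alpha0\<close> decay
  by the same factor, so conditioning on survival leaves the law unchanged.\<close>

lemma is_QSD_alpha0: "is_QSD_Bm M W alpha0"
proof -
  have one: "unit_ip (indicator UNIV) = mass" by (simp add: mass_def)
  have in1: "unit_ip (indicator {-1<..<1}) = mass"
    unfolding mass_def by (rule unit_ip_cong) (auto simp: abs_less_iff)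
  have "emeasure alpha0 (space alpha0) = 1"
    using emeasure_alpha0[of UNIV] mass_pos by (simp add: mass_def sets_eq_imp_space_eq[OF sets_alpha0])
  then have ps: "prob_space alpha0" by (rule prob_spaceI)
  have u: "emeasure alpha0 {-1<..<1} = 1" using emeasure_alpha0[of "{-1<..<1}"] mass_pos by (simp add: in1)
  have I: "(\<integral>x. qsd_prob t A x \<partial>alpha0) = exp (- lambda_Bm * t) * (unit_ip (indicator A) / mass)"
    if t: "0 \<le> t" and A[measurable]: "A \<in> sets borel" for t A
  proof -
    have "(\<integral>x. qsd_prob t A x \<partial>alpha0) = unit_ip (qsd_prob t A) / mass"
      by (rule integral_alpha0[OF qsd_prob_measurable[OF A t]])
    also have "unit_ip (qsd_prob t A) = unit_ip (kill t (indicator A))"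
      by (rule unit_ip_cong) (rule qsd_prob_eq_kill[OF t])
    also have "\<dots> = exp (- lambda_Bm * t) * unit_ip (indicator A)"
      by (rule unit_ip_kill[where B=1]) (use t in \<open>auto simp: indicator_def\<close>)
    finally show ?thesis by simp
  qed
  have S: "measure M {\<omega>\<in>space M. tauB W x \<omega> > ereal t} = qsd_prob t UNIV x" for x t by (simp add: qsd_prob_def)
  have "0 < (\<integral>x. qsd_prob t UNIV x \<partial>alpha0) \<and> (\<forall>A\<in>sets borel. (\<integral>x. qsd_prob t A x \<partial>alpha0) / (\<integral>x. qsd_prob t UNIV x \<partial>alpha0) = measure alpha0 A)"
    if t: "0 \<le> t" for t
  proof (intro conjI ballI)
    have IU: "(\<integral>x. qsd_prob t UNIV x \<partial>alpha0) = exp (- lambda_Bm * t)"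
      using I[OF t, of UNIV] mass_pos unfolding one by simp
    then show "0 < (\<integral>x. qsd_prob t UNIV x \<partial>alpha0)" by simp
    fix A :: "real set" assume A: "A \<in> sets borel"
    have "0 \<le> unit_ip (indicator A) / mass" using mass_pos by (auto intro!: divide_nonneg_pos unit_ip_nonneg)
    then show "(\<integral>x. qsd_prob t A x \<partial>alpha0) / (\<integral>x. qsd_prob t UNIV x \<partial>alpha0) = measure alpha0 A"
      using I[OF t A] IU by (simp add: measure_def emeasure_alpha0[OF A])
  qed
  then show ?thesis unfolding is_QSD_Bm_def S qsd_prob_def[symmetric] using ps u by simp
qed

text \<open>Yaglom limit: quasi-stationarity makes the ratio of killed masses constant in time,
  while its limit is determined by the ground state. The common factor, the integral of the ground
  state, is positive and cancels.\<close>

lemma is_QSD_unique: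
  assumes "is_QSD_Bm M W \<alpha>"
  shows "\<alpha> = alpha0"
proof -
  have sets: "sets \<alpha> = sets borel" and ps: "prob_space \<alpha>" and u: "emeasure \<alpha> {-1<..<1} = 1"
    and q: "\<And>t. t \<ge> 0 \<Longrightarrow> 0 < (\<integral>x. qsd_prob t UNIV x \<partial>\<alpha>)"
      "\<And>t A. t \<ge> 0 \<Longrightarrow> A \<in> sets borel \<Longrightarrow> (\<integral>x. qsd_prob t A x \<partial>\<alpha>) / (\<integral>x. qsd_prob t UNIV x \<partial>\<alpha>) = measure \<alpha> A"
    using assms unfolding is_QSD_Bm_def qsd_prob_def by auto
  interpret \<alpha>: prob_space \<alpha> by fact
  have ae: "AE x in \<alpha>. \<bar>x\<bar> < 1" by (rule AE_unit[OF ps sets u])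
  have G: "0 < (\<integral>x. ground x \<partial>\<alpha>)" by (rule integral_ground_pos[OF ps sets ae])
  have main: "measure \<alpha> A = unit_ip (indicator A) / mass" if A[measurable]: "A \<in> sets borel" for A
  proof -
    have lim: "((\<lambda>t. exp (lambda_Bm * t) * (\<integral>x. kill t (indicator C) x \<partial>\<alpha>)) \<longlongrightarrow> unit_ip (indicator C) * (\<integral>x. ground x \<partial>\<alpha>)) at_top"
      if [measurable]: "C \<in> sets borel" for C
      by (rule tendsto_kill_integral[where B=1]) (use ps sets ae in \<open>auto simp: indicator_def\<close>)
    have U: "unit_ip (indicator UNIV) = mass" by (simp add: mass_def)
    have "((\<lambda>t. measure \<alpha> A * (exp (lambda_Bm * t) * (\<integral>x. kill t (indicator UNIV) x \<partial>\<alpha>))) \<longlongrightarrow> measure \<alpha> A * (unit_ip (indicator UNIV) * (\<integral>x. ground x \<partial>\<alpha>))) at_top"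
      by (intro tendsto_intros lim) simp
    moreover have "\<forall>\<^sub>F t in at_top. measure \<alpha> A * (exp (lambda_Bm * t) * (\<integral>x. kill t (indicator UNIV) x \<partial>\<alpha>)) = exp (lambda_Bm * t) * (\<integral>x. kill t (indicator A) x \<partial>\<alpha>)"
      using eventually_gt_at_top[of 0]
    proof eventually_elim
      case (elim t)
      have "measure \<alpha> A * (\<integral>x. kill t (indicator UNIV) x \<partial>\<alpha>) = (\<integral>x. kill t (indicator A) x \<partial>\<alpha>)"
        using q(1)[of t] q(2)[of t A] elim by (simp add: qsd_integral[OF sets ae _ elim] field_simps)
      then show ?case by (simp add: mult.left_commute)
    qed
    ultimately have "((\<lambda>t. exp (lambda_Bm * t) * (\<integral>x. kill t (indicator A) x \<partial>\<alpha>)) \<longlongrightarrow> measure \<alpha> A * (unit_ip (indicator UNIV) * (\<integral>x. ground x \<partial>\<alpha>))) at_top"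
      by (rule Lim_transform_eventually)
    then have "measure \<alpha> A * (unit_ip (indicator UNIV) * (\<integral>x. ground x \<partial>\<alpha>)) = unit_ip (indicator A) * (\<integral>x. ground x \<partial>\<alpha>)"
      by (rule tendsto_unique[rotated, OF _ lim]) simp_all
    then show ?thesis using G mass_pos unfolding U by (simp add: field_simps)
  qed
  show ?thesis
  proof (rule measure_eqI)
    show "sets \<alpha> = sets alpha0" using sets by simp
    fix A assume "A \<in> sets \<alpha>"
    then have "A \<in> sets borel" using sets by simp
    then show "emeasure \<alpha> A = emeasure alpha0 A"
      using main by (simp add: \<alpha>.emeasure_eq_measure emeasure_alpha0)
  qed
qed

lemma alpha_Bm_eq: "alpha_Bm M W = alpha0"
  unfolding alpha_Bm_def by (rule the_equality) (rule is_QSD_alpha0, erule is_QSD_unique)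

text \<open>\<open>eta_Bm\<close> is known on the open interval, which carries
  \<open>alpha0\<close>; it is replaced by a function nonnegative everywhere. The factor
  \<open>mass\<close> cancels against the normalisation of \<open>alpha0\<close> and leaves the
  squared ground state as density.\<close>

lemma integral_beta_Bm:
  assumes [measurable]: "f \<in> borel_measurable borel"
  shows "(\<integral>x. f x \<partial>beta_Bm M W) = unit_ip (\<lambda>x. f x * ground x)"
proof -
  have ps: "prob_space alpha0" using is_QSD_alpha0 unfolding is_QSD_Bm_def by (elim conjE)
  have u: "emeasure alpha0 {-1<..<1} = 1" using is_QSD_alpha0 unfolding is_QSD_Bm_def by (elim conjE)
  have ae: "AE x in alpha0. \<bar>x\<bar> < 1" by (rule AE_unit[OF ps sets_alpha0 u])
  let ?e = "\<lambda>x. max 0 (mass * ground x)"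
  have ae': "AE x in alpha0. ennreal (eta_Bm M W x) = ennreal (?e x)"
    using ae
  proof eventually_elim
    case (elim x)
    then show ?case using eta_Bm_eq[OF elim] ground_nonneg[of x] mass_pos by (simp add: mass_def)
  qed
  have "beta_Bm M W = density alpha0 (\<lambda>x. ennreal (?e x))"
    unfolding beta_Bm_def alpha_Bm_eq density_def
    by (intro arg_cong[where f="measure_of (space alpha0) (sets alpha0)"] ext nn_integral_cong_AE)
      (use ae' in eventually_elim, simp)
  then have "(\<integral>x. f x \<partial>beta_Bm M W) = (\<integral>x. ?e x * f x \<partial>alpha0)"
    by (simp only:) (subst integral_density, auto)
  also have "\<dots> = unit_ip (\<lambda>x. ?e x * f x) / mass" by (rule integral_alpha0) measurable
  also have "unit_ip (\<lambda>x. ?e x * f x) = unit_ip (\<lambda>x. mass * (f x * ground x))"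
    by (rule unit_ip_cong) (use ground_nonneg mass_pos in \<open>simp add: max_def mult_nonneg_nonneg\<close>)
  also have "\<dots> = mass * unit_ip (\<lambda>x. f x * ground x)"
    by (simp add: unit_ip_def mult.left_commute mult.assoc)
  finally show ?thesis using mass_pos by simp
qed

end

section \<open>Rescaling a moving barrier\<close>

text \<open>Passing from \<open>y = a x\<close>, \<open>y' = b z\<close> to the rescaled coordinates uses the identity
  \<open>(b z - a x)^2 = a b (z - x)^2 + (b - a) (b z^2 - a x^2)\<close>.\<close>

lemma normal_density_scale:
  fixes a b \<Delta> x z :: real
  assumes a: "0 < a" and b: "0 < b" and \<Delta>: "0 < \<Delta>"
  shows "b * normal_density (a * x) (sqrt \<Delta>) (b * z) =
    sqrt (b / a) * exp (- ((b - a) / \<Delta> / 2 * (b * z\<^sup>2 - a * x\<^sup>2))) * normal_density x (sqrt (\<Delta> / (a * b))) z"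
proof -
  have ab: "0 < a * b" using a b by simp
  have pre: "b / sqrt (2 * pi * \<Delta>) = sqrt (b / a) / sqrt (2 * pi * (\<Delta> / (a * b)))"
  proof -
    have "sqrt (b / a) * sqrt (a * b) = b" using a b by (simp add: real_sqrt_mult[symmetric] real_sqrt_unique power2_eq_square)
    moreover have "sqrt (2 * pi * (\<Delta> / (a * b))) = sqrt (2 * pi * \<Delta>) / sqrt (a * b)"
      by (simp add: real_sqrt_divide[symmetric])
    ultimately show ?thesis by simp
  qed
  have ex: "- (b * z - a * x)\<^sup>2 / (2 * \<Delta>) = - ((b - a) / \<Delta> / 2 * (b * z\<^sup>2 - a * x\<^sup>2)) + (- (z - x)\<^sup>2 / (2 * (\<Delta> / (a * b))))"
  proof -
    have "(b * z - a * x)\<^sup>2 = (b - a) * (b * z\<^sup>2 - a * x\<^sup>2) + a * b * (z - x)\<^sup>2"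
      by (simp add: power2_eq_square algebra_simps)
    then show ?thesis using a b \<Delta> by (simp add: field_simps)
  qed
  have s: "(sqrt \<Delta>)\<^sup>2 = \<Delta>" "(sqrt (\<Delta> / (a * b)))\<^sup>2 = \<Delta> / (a * b)" using \<Delta> ab by auto
  have alg: "b * (1 / s1 * (e1 * e2)) = q * e1 * (1 / s2 * e2)" if "b / s1 = q / s2" for s1 s2 q e1 e2 :: real
  proof -
    have "b * (1 / s1 * (e1 * e2)) = b / s1 * (e1 * e2)" by simp
    also have "\<dots> = q * e1 * (1 / s2 * e2)" unfolding that by simp
    finally show ?thesis .
  qed
  show ?thesis unfolding normal_density_def s ex exp_add by (rule alg[OF pre])
qed

lemma indicator_scale:
  fixes a c z :: real
  assumes a: "0 < a"
  shows "indicator {- (c * a)..c * a} (a * z) = (indicator {-c..c} z :: ennreal)"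
proof -
  have "{- (c * a)..c * a} = {a * (- c)..a * c}" by (simp add: mult.commute)
  then show ?thesis
    using mult_le_cancel_left_pos[OF a, of "- c" z] mult_le_cancel_left_pos[OF a, of z c]
    by (simp only: indicator_def atLeastAtMost_iff)
qed

lemma nn_gauss_scale:
  fixes a b \<Delta> x :: real
  assumes [measurable]: "v \<in> borel_measurable borel" and a: "0 < a" and b: "0 < b" and \<Delta>: "0 < \<Delta>"
  shows "nn_gauss \<Delta> v (a * x) = (\<integral>\<^sup>+z. ennreal (sqrt (b / a)) *
    (ennreal (normal_density x (sqrt (\<Delta> / (a * b))) z) *
     (ennreal (exp (- ((b - a) / \<Delta> / 2 * (b * z\<^sup>2 - a * x\<^sup>2)))) * v (b * z))) \<partial>lborel)"
proof -
  have "nn_gauss \<Delta> v (a * x) = ennreal \<bar>b\<bar> * (\<integral>\<^sup>+z. ennreal (normal_density (a * x) (sqrt \<Delta>) (0 + b * z)) * v (0 + b * z) \<partial>lborel)"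
    unfolding nn_gauss_def by (rule nn_integral_real_affine) (use b in auto)
  also have "\<dots> = (\<integral>\<^sup>+z. ennreal b * (ennreal (normal_density (a * x) (sqrt \<Delta>) (0 + b * z)) * v (0 + b * z)) \<partial>lborel)"
    using b by (subst nn_integral_cmult) auto
  also have "\<dots> = (\<integral>\<^sup>+z. ennreal (b * normal_density (a * x) (sqrt \<Delta>) (b * z)) * v (b * z) \<partial>lborel)"
    using b by (simp add: ennreal_mult' mult.assoc)
  also have "\<dots> = (\<integral>\<^sup>+z. ennreal (sqrt (b / a)) *
    (ennreal (normal_density x (sqrt (\<Delta> / (a * b))) z) *
     (ennreal (exp (- ((b - a) / \<Delta> / 2 * (b * z\<^sup>2 - a * x\<^sup>2)))) * v (b * z))) \<partial>lborel)"
    unfolding normal_density_scale[OF a b \<Delta>]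
    using a b by (intro nn_integral_cong) (simp add: ennreal_mult ac_simps)
  finally show ?thesis .
qed

text \<open>One backward step of the upper comparison: as \<open>d' \<le> d\<close> and
  \<open>b * z\<^sup>2\<close> is nonnegative, the weight left by later steps is absorbed by the
  exponential of this step.\<close>

lemma nn_gauss_scale_upper:
  fixes a b \<Delta> x d d' :: real
  assumes vX[measurable]: "vX \<in> borel_measurable borel" and vB[measurable]: "vB \<in> borel_measurable borel"
    and ab: "0 < a" "0 < b" "0 < \<Delta>" and d: "d = (b - a) / \<Delta>" "d' \<le> d"
    and le: "\<And>z. vX (b * z) \<le> ennreal (exp (d' * b * z\<^sup>2 / 2)) * vB z"
  shows "nn_gauss \<Delta> vX (a * x) \<le> ennreal (exp (d * a * x\<^sup>2 / 2)) * (ennreal (sqrt (b / a)) * nn_gauss (\<Delta> / (a * b)) vB x)"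
proof -
  have "nn_gauss \<Delta> vX (a * x) \<le> (\<integral>\<^sup>+z. ennreal (exp (d * a * x\<^sup>2 / 2)) * (ennreal (sqrt (b / a)) *
    (ennreal (normal_density x (sqrt (\<Delta> / (a * b))) z) * vB z)) \<partial>lborel)"
    unfolding nn_gauss_scale[OF vX ab]
  proof (rule nn_integral_mono)
    fix z
    have "d' * (b * z\<^sup>2) \<le> d * (b * z\<^sup>2)" using d ab by (intro mult_right_mono) auto
    then have "- (d / 2 * (b * z\<^sup>2 - a * x\<^sup>2)) + d' * b * z\<^sup>2 / 2 \<le> d * a * x\<^sup>2 / 2"
      by (simp add: algebra_simps)
    then have e: "exp (- (d / 2 * (b * z\<^sup>2 - a * x\<^sup>2))) * exp (d' * b * z\<^sup>2 / 2) \<le> exp (d * a * x\<^sup>2 / 2)"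
      by (simp add: mult_exp_exp)
    have "ennreal (exp (- (d / 2 * (b * z\<^sup>2 - a * x\<^sup>2)))) * vX (b * z) \<le>
      ennreal (exp (- (d / 2 * (b * z\<^sup>2 - a * x\<^sup>2)))) * (ennreal (exp (d' * b * z\<^sup>2 / 2)) * vB z)"
      by (intro mult_left_mono le) auto
    also have "\<dots> = ennreal (exp (- (d / 2 * (b * z\<^sup>2 - a * x\<^sup>2))) * exp (d' * b * z\<^sup>2 / 2)) * vB z"
      by (simp add: ennreal_mult mult.assoc)
    also have "\<dots> \<le> ennreal (exp (d * a * x\<^sup>2 / 2)) * vB z"
      by (intro mult_right_mono ennreal_leI e) auto
    finally have "ennreal (exp (- (d / 2 * (b * z\<^sup>2 - a * x\<^sup>2)))) * vX (b * z) \<le> ennreal (exp (d * a * x\<^sup>2 / 2)) * vB z" .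
    then have "ennreal (sqrt (b / a)) * (ennreal (normal_density x (sqrt (\<Delta> / (a * b))) z) *
        (ennreal (exp (- (d / 2 * (b * z\<^sup>2 - a * x\<^sup>2)))) * vX (b * z))) \<le>
      ennreal (sqrt (b / a)) * (ennreal (normal_density x (sqrt (\<Delta> / (a * b))) z) *
        (ennreal (exp (d * a * x\<^sup>2 / 2)) * vB z))"
      by (intro mult_left_mono) auto
    then show "ennreal (sqrt (b / a)) * (ennreal (normal_density x (sqrt (\<Delta> / (a * b))) z) *
        (ennreal (exp (- ((b - a) / \<Delta> / 2 * (b * z\<^sup>2 - a * x\<^sup>2)))) * vX (b * z))) \<le>
      ennreal (exp (d * a * x\<^sup>2 / 2)) * (ennreal (sqrt (b / a)) * (ennreal (normal_density x (sqrt (\<Delta> / (a * b))) z) * vB z))"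
      by (simp only: d(1) mult.left_commute)
  qed
  also have "\<dots> = ennreal (exp (d * a * x\<^sup>2 / 2)) * (ennreal (sqrt (b / a)) * nn_gauss (\<Delta> / (a * b)) vB x)"
    unfolding nn_gauss_def by (simp add: nn_integral_cmult)
  finally show ?thesis .
qed

text \<open>Decreasing slopes help the upper bound because the weight \<open>z\<^sup>2\<close> is
  nonnegative. For the lower bound it is shifted to \<open>z\<^sup>2 - 1\<close>, nonpositive on the
  support, so that the same monotonicity helps again; the shift costs \<open>d * (b - a) / 2\<close>
  per step, collected in \<open>r\<close>.\<close>

lemma nn_gauss_scale_lower:
  fixes a b \<Delta> x d d' r :: real
  assumes vX[measurable]: "vX \<in> borel_measurable borel" and vB[measurable]: "vB \<in> borel_measurable borel"
    and ab: "0 < a" "0 < b" "0 < \<Delta>" and d: "d = (b - a) / \<Delta>" "d' \<le> d"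
    and le: "\<And>z. ennreal (exp (d' * b * (z\<^sup>2 - 1) / 2 - r)) * vB z \<le> vX (b * z)"
    and supp: "\<And>z. 1 < \<bar>z\<bar> \<Longrightarrow> vB z = 0"
  shows "ennreal (exp (d * a * (x\<^sup>2 - 1) / 2 - (r + d * (b - a) / 2))) * (ennreal (sqrt (b / a)) * nn_gauss (\<Delta> / (a * b)) vB x)
    \<le> nn_gauss \<Delta> vX (a * x)"
proof -
  let ?e = "exp (d * a * (x\<^sup>2 - 1) / 2 - (r + d * (b - a) / 2))"
  have "ennreal ?e * (ennreal (sqrt (b / a)) * nn_gauss (\<Delta> / (a * b)) vB x) =
    (\<integral>\<^sup>+z. ennreal ?e * (ennreal (sqrt (b / a)) * (ennreal (normal_density x (sqrt (\<Delta> / (a * b))) z) * vB z)) \<partial>lborel)"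
    unfolding nn_gauss_def by (simp add: nn_integral_cmult)
  also have "\<dots> \<le> nn_gauss \<Delta> vX (a * x)"
    unfolding nn_gauss_scale[OF vX ab]
  proof (rule nn_integral_mono)
    fix z
    have "ennreal ?e * vB z \<le> ennreal (exp (- (d / 2 * (b * z\<^sup>2 - a * x\<^sup>2)))) * vX (b * z)"
    proof (cases "1 < \<bar>z\<bar>")
      case True
      then show ?thesis by (simp add: supp)
    next
      case False
      then have "z\<^sup>2 \<le> 1" by (simp add: abs_square_le_1)
      then have "0 \<le> (d' - d) * (b * (z\<^sup>2 - 1))" using d ab by (intro mult_nonpos_nonpos mult_nonneg_nonpos) auto
      then have "d * a * (x\<^sup>2 - 1) / 2 - (r + d * (b - a) / 2) \<le> - (d / 2 * (b * z\<^sup>2 - a * x\<^sup>2)) + (d' * b * (z\<^sup>2 - 1) / 2 - r)"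
        by (simp add: algebra_simps diff_divide_distrib add_divide_distrib)
      then have e: "?e \<le> exp (- (d / 2 * (b * z\<^sup>2 - a * x\<^sup>2))) * exp (d' * b * (z\<^sup>2 - 1) / 2 - r)"
        by (simp add: mult_exp_exp)
      have "ennreal ?e * vB z \<le> ennreal (exp (- (d / 2 * (b * z\<^sup>2 - a * x\<^sup>2))) * exp (d' * b * (z\<^sup>2 - 1) / 2 - r)) * vB z"
        by (intro mult_right_mono ennreal_leI e) auto
      also have "\<dots> = ennreal (exp (- (d / 2 * (b * z\<^sup>2 - a * x\<^sup>2)))) * (ennreal (exp (d' * b * (z\<^sup>2 - 1) / 2 - r)) * vB z)"
        by (simp add: ennreal_mult mult.assoc)
      also have "\<dots> \<le> ennreal (exp (- (d / 2 * (b * z\<^sup>2 - a * x\<^sup>2)))) * vX (b * z)"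
        by (intro mult_left_mono le) auto
      finally show ?thesis .
    qed
    then have "ennreal (sqrt (b / a)) * (ennreal (normal_density x (sqrt (\<Delta> / (a * b))) z) * (ennreal ?e * vB z)) \<le>
      ennreal (sqrt (b / a)) * (ennreal (normal_density x (sqrt (\<Delta> / (a * b))) z) *
        (ennreal (exp (- (d / 2 * (b * z\<^sup>2 - a * x\<^sup>2)))) * vX (b * z)))"
      by (intro mult_left_mono) auto
    then show "ennreal ?e * (ennreal (sqrt (b / a)) * (ennreal (normal_density x (sqrt (\<Delta> / (a * b))) z) * vB z)) \<le>
      ennreal (sqrt (b / a)) * (ennreal (normal_density x (sqrt (\<Delta> / (a * b))) z) *
        (ennreal (exp (- ((b - a) / \<Delta> / 2 * (b * z\<^sup>2 - a * x\<^sup>2)))) * vX (b * z)))"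
      by (simp only: d(1) mult.left_commute)
  qed
  finally show ?thesis .
qed

context brownian
begin

text \<open>The discrete clock \<open>\<integral> dr / g^2\<close>; the product \<open>g i * g (Suc i)\<close> is what the change of variables in one
  Gaussian step produces exactly.\<close>

definition clockgrid :: "(nat \<Rightarrow> real) \<Rightarrow> (nat \<Rightarrow> real) \<Rightarrow> nat \<Rightarrow> real" where
  "clockgrid t g j = (\<Sum>i<j. (t (Suc i) - t i) / (g i * g (Suc i)))"

text \<open>One Gaussian step from \<open>a x\<close> to \<open>b z\<close> contributes \<open>exp (- d (b z^2 - a x^2) / 2)\<close> with the slope \<open>d\<close> of
  the barrier. Since the slopes of a concave barrier decrease, the weight \<open>exp (d' b z^2 / 2)\<close> left over
  from the later steps is absorbed, and only the weight at the starting point survives.\<close>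

lemma grid_compare_upper:
  fixes t g D :: "nat \<Rightarrow> real" and c x :: real
  assumes t: "\<And>i. i < k \<Longrightarrow> t i < t (Suc i)" and g: "\<And>i. 0 < g i"
    and D: "\<And>i. i < k \<Longrightarrow> D i = (g (Suc i) - g i) / (t (Suc i) - t i)" "\<And>i. i < k \<Longrightarrow> D (Suc i) \<le> D i"
    and v: "vX \<in> borel_measurable borel" "vB \<in> borel_measurable borel"
    and le: "\<And>z. vX (g k * z) \<le> ennreal (exp (D k * g k * z\<^sup>2 / 2)) * vB z"
  shows "(\<integral>\<^sup>+\<omega>. (\<Prod>j\<le>k. indicator {- (c * g j)..c * g j} (g 0 * x + W (t j - t 0) \<omega>)) * vX (g 0 * x + W (t k - t 0) \<omega>) \<partial>M)
    \<le> ennreal (exp (D 0 * g 0 * x\<^sup>2 / 2)) * (ennreal (sqrt (g k / g 0)) *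
      (\<integral>\<^sup>+\<omega>. (\<Prod>j\<le>k. indicator {-c..c} (x + W (clockgrid t g j) \<omega>)) * vB (x + W (clockgrid t g k) \<omega>) \<partial>M))"
  using t D v le
proof (induction k arbitrary: vX vB)
  case 0
  have i: "indicator {- (c * g 0)..c * g 0} (g 0 * x) = (indicator {-c..c} x :: ennreal)"
    by (rule indicator_scale[OF g])
  have g0: "g 0 \<noteq> 0" using g[of 0] by simp
  have "(\<integral>\<^sup>+\<omega>. indicator {- (c * g 0)..c * g 0} (g 0 * x + W 0 \<omega>) * vX (g 0 * x + W 0 \<omega>) \<partial>M)
     = (\<integral>\<^sup>+\<omega>. indicator {-c..c} x * vX (g 0 * x) \<partial>M)"
    by (intro nn_integral_cong) (simp add: W_0 i)
  moreover have "(\<integral>\<^sup>+\<omega>. indicator {-c..c} (x + W 0 \<omega>) * vB (x + W 0 \<omega>) \<partial>M) = (\<integral>\<^sup>+\<omega>. indicator {-c..c} x * vB x \<partial>M)"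
    by (intro nn_integral_cong) (simp add: W_0)
  ultimately show ?case
    using mult_left_mono[OF "0.prems"(6)[of x], of "indicator {-c..c} x"] g0
    by (simp add: clockgrid_def emeasure_space_1 mult.left_commute)
next
  case (Suc k)
  note [measurable] = Suc.prems(4,5)
  let ?wX = "\<lambda>j. indicator {- (c * g j)..c * g j} :: real \<Rightarrow> ennreal" and ?wB = "indicator {-c..c} :: real \<Rightarrow> ennreal"
  let ?a = "clockgrid t g"
  let ?\<Delta> = "t (Suc k) - t k"
  have \<Delta>: "0 < ?\<Delta>" using Suc.prems(1)[of k] by simp
  have astep: "?a (Suc j) - ?a j = (t (Suc j) - t j) / (g j * g (Suc j))" for j by (simp add: clockgrid_def)
  \<comment> \<open>The last step is absorbed into new terminal functions, one for each process; the
    induction hypothesis then asks for exactly one Gaussian scaling step.\<close>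
  let ?vX = "nn_gauss ?\<Delta> (\<lambda>z. ?wX (Suc k) z * vX z)"
  let ?vB = "\<lambda>z. ennreal (sqrt (g (Suc k) / g k)) * nn_gauss (?\<Delta> / (g k * g (Suc k))) (\<lambda>z. ?wB z * vB z) z"
  have ind: "?wX (Suc k) (g (Suc k) * z) = ?wB z" for z
    by (rule indicator_scale[OF g])
  have "(\<integral>\<^sup>+\<omega>. (\<Prod>j\<le>Suc k. ?wX j (g 0 * x + W (t j - t 0) \<omega>)) * vX (g 0 * x + W (t (Suc k) - t 0) \<omega>) \<partial>M)
    = (\<integral>\<^sup>+\<omega>. (\<Prod>j\<le>k. ?wX j (g 0 * x + W (t j - t 0) \<omega>)) * (\<lambda>z. ?wX (Suc k) z * vX z) (g 0 * x + W (t (Suc k) - t 0) \<omega>) \<partial>M)"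
    by (simp add: mult.assoc)
  also have "\<dots> = (\<integral>\<^sup>+\<omega>. (\<Prod>j\<le>k. ?wX j (g 0 * x + W (t j - t 0) \<omega>)) * ?vX (g 0 * x + W (t k - t 0) \<omega>) \<partial>M)"
    using nn_markov_step[of "\<lambda>j. t j - t 0" k ?wX "\<lambda>z. ?wX (Suc k) z * vX z" "g 0 * x"] Suc.prems(1) by simp
  also have "\<dots> \<le> ennreal (exp (D 0 * g 0 * x\<^sup>2 / 2)) * (ennreal (sqrt (g k / g 0)) *
      (\<integral>\<^sup>+\<omega>. (\<Prod>j\<le>k. ?wB (x + W (?a j) \<omega>)) * ?vB (x + W (?a k) \<omega>) \<partial>M))"
  proof (rule Suc.IH)
    fix z
    show "?vX (g k * z) \<le> ennreal (exp (D k * g k * z\<^sup>2 / 2)) * ?vB z"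
    proof (rule nn_gauss_scale_upper[where d'="D (Suc k)"])
      fix z
      have "?wB z * vX (g (Suc k) * z) \<le> ?wB z * (ennreal (exp (D (Suc k) * g (Suc k) * z\<^sup>2 / 2)) * vB z)"
        by (intro mult_left_mono Suc.prems(6)) auto
      then show "?wX (Suc k) (g (Suc k) * z) * vX (g (Suc k) * z) \<le> ennreal (exp (D (Suc k) * g (Suc k) * z\<^sup>2 / 2)) * (?wB z * vB z)"
        unfolding ind by (simp add: mult.left_commute)
    qed (use g \<Delta> Suc.prems in auto)
  next
    show "t i < t (Suc i)" if "i < k" for i using Suc.prems(1)[of i] that by simp
    show "D i = (g (Suc i) - g i) / (t (Suc i) - t i)" if "i < k" for i by (rule Suc.prems(2)) (use that in simp)
    show "D (Suc i) \<le> D i" if "i < k" for i by (rule Suc.prems(3)) (use that in simp)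
  qed measurable
  also have "(\<integral>\<^sup>+\<omega>. (\<Prod>j\<le>k. ?wB (x + W (?a j) \<omega>)) * ?vB (x + W (?a k) \<omega>) \<partial>M)
    = ennreal (sqrt (g (Suc k) / g k)) * (\<integral>\<^sup>+\<omega>. (\<Prod>j\<le>k. ?wB (x + W (?a j) \<omega>)) *
        nn_gauss (?a (Suc k) - ?a k) (\<lambda>z. ?wB z * vB z) (x + W (?a k) \<omega>) \<partial>M)"
  proof -
    have a0: "0 \<le> ?a j" if "j \<le> Suc k" for j
      unfolding clockgrid_def using Suc.prems(1) g that
      by (intro sum_nonneg divide_nonneg_pos mult_pos_pos) (auto simp: less_imp_le)
    have [measurable]: "W (?a j) \<in> borel_measurable M" if "j \<le> Suc k" for j using a0[OF that] by simp
    show ?thesis unfolding astep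
      by (subst nn_integral_cmult[symmetric]) (auto simp: mult.left_commute intro!: borel_measurable_times borel_measurable_prod)
  qed
  also have "(\<integral>\<^sup>+\<omega>. (\<Prod>j\<le>k. ?wB (x + W (?a j) \<omega>)) * nn_gauss (?a (Suc k) - ?a k) (\<lambda>z. ?wB z * vB z) (x + W (?a k) \<omega>) \<partial>M)
    = (\<integral>\<^sup>+\<omega>. (\<Prod>j\<le>k. ?wB (x + W (?a j) \<omega>)) * (\<lambda>z. ?wB z * vB z) (x + W (?a (Suc k)) \<omega>) \<partial>M)"
  proof (rule nn_markov_step[symmetric])
    show "?a i < ?a (Suc i)" if "i \<le> k" for i
    proof -
      have "0 < (t (Suc i) - t i) / (g i * g (Suc i))" using Suc.prems(1)[of i] g that by simp
      then show ?thesis using astep[of i] by simp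
    qed
  qed (auto simp: clockgrid_def)
  also have "\<dots> = (\<integral>\<^sup>+\<omega>. (\<Prod>j\<le>Suc k. ?wB (x + W (?a j) \<omega>)) * vB (x + W (?a (Suc k)) \<omega>) \<partial>M)"
    by (simp add: mult.assoc)
  also have "ennreal (sqrt (g k / g 0)) * (ennreal (sqrt (g (Suc k) / g k)) * (\<integral>\<^sup>+\<omega>. (\<Prod>j\<le>Suc k. ?wB (x + W (?a j) \<omega>)) * vB (x + W (?a (Suc k)) \<omega>) \<partial>M))
    = ennreal (sqrt (g (Suc k) / g 0)) * (\<integral>\<^sup>+\<omega>. (\<Prod>j\<le>Suc k. ?wB (x + W (?a j) \<omega>)) * vB (x + W (?a (Suc k)) \<omega>) \<partial>M)"
  proof -
    have "g k \<noteq> 0" using g[of k] by simp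
    then have "sqrt (g k / g 0) * sqrt (g (Suc k) / g k) = sqrt (g (Suc k) / g 0)"
      by (simp add: real_sqrt_mult[symmetric])
    then have "ennreal (sqrt (g k / g 0)) * ennreal (sqrt (g (Suc k) / g k)) = ennreal (sqrt (g (Suc k) / g 0))"
      using g less_imp_le[OF g] by (subst ennreal_mult[symmetric]) auto
    then show ?thesis by (simp only: mult.assoc[symmetric])
  qed
  finally show ?case .
qed

text \<open>The accumulated cost is a Riemann sum for half the integral of the squared derivative of
  the barrier. The bound \<open>c \<le> 1\<close> places the indicators inside the support on which
  the shifted weight is nonpositive.\<close>

lemma grid_compare_lower:
  fixes t g D :: "nat \<Rightarrow> real" and c x r :: real
  assumes t: "\<And>i. i < k \<Longrightarrow> t i < t (Suc i)" and g: "\<And>i. 0 < g i" and c: "c \<le> 1"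
    and D: "\<And>i. i < k \<Longrightarrow> D i = (g (Suc i) - g i) / (t (Suc i) - t i)" "\<And>i. i < k \<Longrightarrow> D (Suc i) \<le> D i"
    and v: "vX \<in> borel_measurable borel" "vB \<in> borel_measurable borel"
    and le: "\<And>z. ennreal (exp (D k * g k * (z\<^sup>2 - 1) / 2 - r)) * vB z \<le> vX (g k * z)"
  shows "ennreal (exp (D 0 * g 0 * (x\<^sup>2 - 1) / 2 - (r + (\<Sum>i<k. D i * (g (Suc i) - g i) / 2)))) * (ennreal (sqrt (g k / g 0)) *
      (\<integral>\<^sup>+\<omega>. (\<Prod>j\<le>k. indicator {-c..c} (x + W (clockgrid t g j) \<omega>)) * vB (x + W (clockgrid t g k) \<omega>) \<partial>M))
    \<le> (\<integral>\<^sup>+\<omega>. (\<Prod>j\<le>k. indicator {- (c * g j)..c * g j} (g 0 * x + W (t j - t 0) \<omega>)) * vX (g 0 * x + W (t k - t 0) \<omega>) \<partial>M)"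
  using t D v le
proof (induction k arbitrary: vX vB r)
  case 0
  have i: "indicator {- (c * g 0)..c * g 0} (g 0 * x) = (indicator {-c..c} x :: ennreal)"
    by (rule indicator_scale[OF g])
  have g0: "g 0 \<noteq> 0" using g[of 0] by simp
  have "(\<integral>\<^sup>+\<omega>. indicator {- (c * g 0)..c * g 0} (g 0 * x + W 0 \<omega>) * vX (g 0 * x + W 0 \<omega>) \<partial>M)
     = (\<integral>\<^sup>+\<omega>. indicator {-c..c} x * vX (g 0 * x) \<partial>M)"
    by (intro nn_integral_cong) (simp add: W_0 i)
  moreover have "(\<integral>\<^sup>+\<omega>. indicator {-c..c} (x + W 0 \<omega>) * vB (x + W 0 \<omega>) \<partial>M) = (\<integral>\<^sup>+\<omega>. indicator {-c..c} x * vB x \<partial>M)"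
    by (intro nn_integral_cong) (simp add: W_0)
  ultimately show ?case
    using mult_left_mono[OF "0.prems"(6)[of x], of "indicator {-c..c} x"] g0
    by (simp add: clockgrid_def emeasure_space_1 mult.left_commute)
next
  case (Suc k)
  note [measurable] = Suc.prems(4,5)
  let ?wX = "\<lambda>j. indicator {- (c * g j)..c * g j} :: real \<Rightarrow> ennreal" and ?wB = "indicator {-c..c} :: real \<Rightarrow> ennreal"
  let ?a = "clockgrid t g"
  let ?\<Delta> = "t (Suc k) - t k"
  let ?r = "r + D k * (g (Suc k) - g k) / 2"
  have \<Delta>: "0 < ?\<Delta>" using Suc.prems(1)[of k] by simp
  have astep: "?a (Suc j) - ?a j = (t (Suc j) - t j) / (g j * g (Suc j))" for j by (simp add: clockgrid_def)
  let ?vX = "nn_gauss ?\<Delta> (\<lambda>z. ?wX (Suc k) z * vX z)"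
  let ?vB = "\<lambda>z. ennreal (sqrt (g (Suc k) / g k)) * nn_gauss (?\<Delta> / (g k * g (Suc k))) (\<lambda>z. ?wB z * vB z) z"
  have ind: "?wX (Suc k) (g (Suc k) * z) = ?wB z" for z
    by (rule indicator_scale[OF g])
  have e: "(\<integral>\<^sup>+\<omega>. (\<Prod>j\<le>k. ?wB (x + W (?a j) \<omega>)) * ?vB (x + W (?a k) \<omega>) \<partial>M)
    = ennreal (sqrt (g (Suc k) / g k)) * (\<integral>\<^sup>+\<omega>. (\<Prod>j\<le>Suc k. ?wB (x + W (?a j) \<omega>)) * vB (x + W (?a (Suc k)) \<omega>) \<partial>M)"
  proof -
    have a0: "0 \<le> ?a j" if "j \<le> Suc k" for j
      unfolding clockgrid_def using Suc.prems(1) g that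
      by (intro sum_nonneg divide_nonneg_pos mult_pos_pos) (auto simp: less_imp_le)
    have [measurable]: "W (?a j) \<in> borel_measurable M" if "j \<le> Suc k" for j using a0[OF that] by simp
    have "(\<integral>\<^sup>+\<omega>. (\<Prod>j\<le>k. ?wB (x + W (?a j) \<omega>)) * ?vB (x + W (?a k) \<omega>) \<partial>M) =
      ennreal (sqrt (g (Suc k) / g k)) * (\<integral>\<^sup>+\<omega>. (\<Prod>j\<le>k. ?wB (x + W (?a j) \<omega>)) *
        nn_gauss (?a (Suc k) - ?a k) (\<lambda>z. ?wB z * vB z) (x + W (?a k) \<omega>) \<partial>M)"
      unfolding astep
      by (subst nn_integral_cmult[symmetric]) (auto simp: mult.left_commute intro!: borel_measurable_times borel_measurable_prod)
    also have "(\<integral>\<^sup>+\<omega>. (\<Prod>j\<le>k. ?wB (x + W (?a j) \<omega>)) * nn_gauss (?a (Suc k) - ?a k) (\<lambda>z. ?wB z * vB z) (x + W (?a k) \<omega>) \<partial>M)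
      = (\<integral>\<^sup>+\<omega>. (\<Prod>j\<le>k. ?wB (x + W (?a j) \<omega>)) * (\<lambda>z. ?wB z * vB z) (x + W (?a (Suc k)) \<omega>) \<partial>M)"
    proof (rule nn_markov_step[symmetric])
      show "?a i < ?a (Suc i)" if "i \<le> k" for i
      proof -
        have "0 < (t (Suc i) - t i) / (g i * g (Suc i))" using Suc.prems(1)[of i] g that by simp
        then show ?thesis using astep[of i] by simp
      qed
    qed (auto simp: clockgrid_def)
    finally show ?thesis by (simp add: mult.assoc)
  qed
  have sq: "ennreal (sqrt (g (Suc k) / g 0)) = ennreal (sqrt (g k / g 0)) * ennreal (sqrt (g (Suc k) / g k))"
  proof -
    have "g k \<noteq> 0" using g[of k] by simp
    then have "sqrt (g k / g 0) * sqrt (g (Suc k) / g k) = sqrt (g (Suc k) / g 0)"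
      by (simp add: real_sqrt_mult[symmetric])
    then show ?thesis
      using g less_imp_le[OF g] by (subst ennreal_mult[symmetric]) auto
  qed
  have rs: "r + (\<Sum>i<Suc k. D i * (g (Suc i) - g i) / 2) = ?r + (\<Sum>i<k. D i * (g (Suc i) - g i) / 2)" by simp
  have "ennreal (exp (D 0 * g 0 * (x\<^sup>2 - 1) / 2 - (?r + (\<Sum>i<k. D i * (g (Suc i) - g i) / 2)))) * (ennreal (sqrt (g k / g 0)) *
      (\<integral>\<^sup>+\<omega>. (\<Prod>j\<le>k. ?wB (x + W (?a j) \<omega>)) * ?vB (x + W (?a k) \<omega>) \<partial>M))
    \<le> (\<integral>\<^sup>+\<omega>. (\<Prod>j\<le>k. ?wX j (g 0 * x + W (t j - t 0) \<omega>)) * ?vX (g 0 * x + W (t k - t 0) \<omega>) \<partial>M)"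
  proof (rule Suc.IH)
    fix z
    show "ennreal (exp (D k * g k * (z\<^sup>2 - 1) / 2 - ?r)) * ?vB z \<le> ?vX (g k * z)"
    proof (rule nn_gauss_scale_lower[where d'="D (Suc k)"])
      fix z
      have "?wB z * (ennreal (exp (D (Suc k) * g (Suc k) * (z\<^sup>2 - 1) / 2 - r)) * vB z) \<le> ?wB z * vX (g (Suc k) * z)"
        by (intro mult_left_mono Suc.prems(6)) auto
      then show "ennreal (exp (D (Suc k) * g (Suc k) * (z\<^sup>2 - 1) / 2 - r)) * (?wB z * vB z) \<le> ?wX (Suc k) (g (Suc k) * z) * vX (g (Suc k) * z)"
        unfolding ind by (simp add: mult.left_commute)
      show "?wB z * vB z = 0" if "1 < \<bar>z\<bar>" using that c by (auto simp: indicator_def abs_if split: if_splits)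
    qed (use g \<Delta> Suc.prems in auto)
  next
    show "t i < t (Suc i)" if "i < k" for i using Suc.prems(1)[of i] that by simp
    show "D i = (g (Suc i) - g i) / (t (Suc i) - t i)" if "i < k" for i by (rule Suc.prems(2)) (use that in simp)
    show "D (Suc i) \<le> D i" if "i < k" for i by (rule Suc.prems(3)) (use that in simp)
  qed measurable
  also have "\<dots> = (\<integral>\<^sup>+\<omega>. (\<Prod>j\<le>k. ?wX j (g 0 * x + W (t j - t 0) \<omega>)) * (\<lambda>z. ?wX (Suc k) z * vX z) (g 0 * x + W (t (Suc k) - t 0) \<omega>) \<partial>M)"
    using nn_markov_step[of "\<lambda>j. t j - t 0" k ?wX "\<lambda>z. ?wX (Suc k) z * vX z" "g 0 * x"] Suc.prems(1) by simp
  also have "\<dots> = (\<integral>\<^sup>+\<omega>. (\<Prod>j\<le>Suc k. ?wX j (g 0 * x + W (t j - t 0) \<omega>)) * vX (g 0 * x + W (t (Suc k) - t 0) \<omega>) \<partial>M)"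
    by (simp add: mult.assoc)
  finally show ?case unfolding e rs sq by (simp only: mult.assoc)
qed

end

section \<open>The barrier \<open>(t + 1) powr \<kappa>\<close> and its chord slopes\<close>

definition bd :: "real \<Rightarrow> real \<Rightarrow> real" where
  "bd \<kappa> t = (t + 1) powr \<kappa>"

text \<open>The first term is half of the bound \<open>\<kappa> (u + 1)^(2\<kappa>-1)\<close> for \<open>g' g\<close> at time \<open>u\<close>, the second half of a bound for
  the integral of \<open>g'^2\<close> over \<open>{u..}\<close>. The factor 4 is lost by evaluating \<open>g'\<close> at the left end \<open>a\<close> of grid
  cells of length at most 1, where \<open>z + 1 \<le> 2 (a + 1)\<close>.\<close>

definition err :: "real \<Rightarrow> real \<Rightarrow> real" where
  "err \<kappa> u = (\<kappa> + 4 * \<kappa>\<^sup>2 / (1 - 2 * \<kappa>)) / 2 * (u + 1) powr (2 * \<kappa> - 1)"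

lemma bd_pos: "0 \<le> t \<Longrightarrow> 0 < bd \<kappa> t"
  by (simp add: bd_def)

lemma bd_mono: "0 < \<kappa> \<Longrightarrow> 0 \<le> s \<Longrightarrow> s \<le> t \<Longrightarrow> bd \<kappa> s \<le> bd \<kappa> t"
  by (simp add: bd_def powr_mono2)

lemma bd_continuous: "0 \<le> s \<Longrightarrow> continuous_on {s..t} (bd \<kappa>)"
  unfolding bd_def by (intro continuous_intros) auto

text \<open>The mean value theorem places each chord slope between the derivatives at the ends of
  its cell, so slopes of adjacent cells are ordered. The third bound is written as a difference so
  that it telescopes over a grid.\<close>

lemma bd_slope:
  assumes \<kappa>: "0 < \<kappa>" "\<kappa> < 1/2" and ab: "0 \<le> a" "a < b" "b - a \<le> 1"
  defines "d \<equiv> (bd \<kappa> b - bd \<kappa> a) / (b - a)"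
  shows "\<kappa> * (b + 1) powr (\<kappa> - 1) \<le> d" "d \<le> \<kappa> * (a + 1) powr (\<kappa> - 1)"
    "d * (bd \<kappa> b - bd \<kappa> a) \<le> 4 * \<kappa>\<^sup>2 / (1 - 2 * \<kappa>) * ((a + 1) powr (2 * \<kappa> - 1) - (b + 1) powr (2 * \<kappa> - 1))"
proof -
  have "\<exists>z>a. z < b \<and> bd \<kappa> b - bd \<kappa> a = (b - a) * (\<kappa> * (z + 1) powr (\<kappa> - 1))"
    unfolding bd_def by (rule MVT2) (use ab in \<open>auto intro!: derivative_eq_intros\<close>)
  then obtain z where z: "a < z" "z < b" "bd \<kappa> b - bd \<kappa> a = (b - a) * (\<kappa> * (z + 1) powr (\<kappa> - 1))" by blast
  then have d: "d = \<kappa> * (z + 1) powr (\<kappa> - 1)" using ab by (simp add: d_def)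
  have "(b + 1) powr (\<kappa> - 1) \<le> (z + 1) powr (\<kappa> - 1)" "(z + 1) powr (\<kappa> - 1) \<le> (a + 1) powr (\<kappa> - 1)"
    using z ab \<kappa> by (auto intro!: powr_mono2')
  then show lo: "\<kappa> * (b + 1) powr (\<kappa> - 1) \<le> d" and up: "d \<le> \<kappa> * (a + 1) powr (\<kappa> - 1)"
    using \<kappa> unfolding d by auto
  let ?p = "2 * \<kappa> - 2"
  have d0: "0 \<le> d" using \<kappa> unfolding d by simp
  have "d * (bd \<kappa> b - bd \<kappa> a) = d * d * (b - a)" using ab by (simp add: d_def)
  also have "\<dots> \<le> (\<kappa> * (a + 1) powr (\<kappa> - 1)) * (\<kappa> * (a + 1) powr (\<kappa> - 1)) * (b - a)"
    using up d0 ab \<kappa> by (intro mult_right_mono mult_mono) auto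
  also have "\<dots> = \<kappa>\<^sup>2 * ((b - a) * (a + 1) powr ?p)"
  proof -
    have "(a + 1) powr (\<kappa> - 1) * (a + 1) powr (\<kappa> - 1) = (a + 1) powr ?p"
      by (simp add: powr_add[symmetric])
    then show ?thesis by (simp add: power2_eq_square mult_ac)
  qed
  finally have 1: "d * (bd \<kappa> b - bd \<kappa> a) \<le> \<kappa>\<^sup>2 * ((b - a) * (a + 1) powr ?p)" .
  have "\<exists>z>a. z < b \<and> (b + 1) powr (2 * \<kappa> - 1) - (a + 1) powr (2 * \<kappa> - 1) = (b - a) * ((2 * \<kappa> - 1) * (z + 1) powr (2 * \<kappa> - 1 - 1))"
    by (rule MVT2) (use ab in \<open>auto intro!: derivative_eq_intros\<close>)
  then obtain y where y: "a < y" "y < b"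
    "(b + 1) powr (2 * \<kappa> - 1) - (a + 1) powr (2 * \<kappa> - 1) = (b - a) * ((2 * \<kappa> - 1) * (y + 1) powr ?p)" by auto
  have "(a + 1) powr ?p * (1 / 4) \<le> (a + 1) powr ?p * 2 powr ?p"
  proof (rule mult_left_mono)
    have "(2::real) powr (-2) \<le> 2 powr ?p" using \<kappa> by (intro powr_mono) auto
    then show "1 / 4 \<le> (2::real) powr ?p" by (simp add: powr_minus_divide)
  qed simp
  also have "\<dots> = (2 * (a + 1)) powr ?p" using powr_mult[of 2 "a + 1" ?p] ab by (simp only: mult.commute)
  also have "\<dots> \<le> (y + 1) powr ?p" using y ab \<kappa> by (intro powr_mono2') auto
  finally have q: "(a + 1) powr ?p \<le> 4 * (y + 1) powr ?p" by simp
  have "(b - a) * (a + 1) powr ?p \<le> (b - a) * (4 * (y + 1) powr ?p)" using q ab by (intro mult_left_mono) auto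
  also have "\<dots> = 4 / (1 - 2 * \<kappa>) * ((b - a) * ((1 - 2 * \<kappa>) * (y + 1) powr ?p))" using \<kappa> by simp
  also have "(b - a) * ((1 - 2 * \<kappa>) * (y + 1) powr ?p) = (a + 1) powr (2 * \<kappa> - 1) - (b + 1) powr (2 * \<kappa> - 1)"
    using y(3) by (simp add: algebra_simps)
  finally have "(b - a) * (a + 1) powr ?p \<le> 4 / (1 - 2 * \<kappa>) * ((a + 1) powr (2 * \<kappa> - 1) - (b + 1) powr (2 * \<kappa> - 1))" .
  then have 2: "\<kappa>\<^sup>2 * ((b - a) * (a + 1) powr ?p) \<le> \<kappa>\<^sup>2 * (4 / (1 - 2 * \<kappa>) * ((a + 1) powr (2 * \<kappa> - 1) - (b + 1) powr (2 * \<kappa> - 1)))"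
    by (rule mult_left_mono) simp
  then show "d * (bd \<kappa> b - bd \<kappa> a) \<le> 4 * \<kappa>\<^sup>2 / (1 - 2 * \<kappa>) * ((a + 1) powr (2 * \<kappa> - 1) - (b + 1) powr (2 * \<kappa> - 1))"
  proof -
    have "\<kappa>\<^sup>2 * (4 / (1 - 2 * \<kappa>) * q) = 4 * \<kappa>\<^sup>2 / (1 - 2 * \<kappa>) * q" for q by simp
    then show ?thesis using order_trans[OF 1 2] by (simp only:)
  qed
qed

context brownian
begin

lemma indicator_cgrid_prod_ennreal:
  assumes "\<omega> \<in> space M"
  shows "(\<Prod>j\<le>n. indicator {-c j..c j} (y + W (\<tau> j) \<omega>)) = (indicator (cgrid c \<tau> n y) \<omega> :: ennreal)"
proof -
  have "ennreal (\<Prod>j\<le>n. indicator {-c j..c j} (y + W (\<tau> j) \<omega>)) = ennreal (indicator (cgrid c \<tau> n y) \<omega>)"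
    by (subst indicator_cgrid_prod[OF assms]) simp
  then show ?thesis by (simp add: prod_ennreal[symmetric] ennreal_indicator)
qed

text \<open>The last grid point may lie beyond \<open>A\<close>; strict survival extends a little
  past \<open>A\<close> by continuity, which covers the overshoot.\<close>

lemma cgrid_eventually_succeeds:
  assumes \<omega>: "\<omega> \<in> surv (\<lambda>_. c) 0 A x" and A: "0 \<le> A"
    and a: "\<And>n j. j \<le> N n \<Longrightarrow> 0 \<le> a n j \<and> a n j \<le> a n (N n)" and aN: "(\<lambda>n. a n (N n)) \<longlonglongrightarrow> A"
  shows "\<forall>\<^sub>F n in sequentially. \<omega> \<in> cgrid (\<lambda>_. c) (a n) (N n) x"
proof -
  have sp: "\<omega> \<in> space M" and s: "\<And>r. r \<in> {0..A} \<Longrightarrow> \<bar>x + W r \<omega>\<bar> < c" using \<omega> by (auto simp: surv_def)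
  have "continuous_on {0..} (\<lambda>r. \<bar>x + W r \<omega>\<bar>)" by (intro continuous_intros W_continuous sp)
  moreover have "0 < c - \<bar>x + W A \<omega>\<bar>" using s[of A] A by simp
  ultimately obtain d where d: "d > 0" "\<And>r. r \<in> {0..} \<Longrightarrow> dist r A < d \<Longrightarrow> dist \<bar>x + W r \<omega>\<bar> \<bar>x + W A \<omega>\<bar> < c - \<bar>x + W A \<omega>\<bar>"
    using A unfolding continuous_on_iff by (metis atLeast_iff)
  have in_c: "\<bar>x + W r \<omega>\<bar> < c" if "0 \<le> r" "r < A + d" for r
  proof (cases "r \<le> A")
    case True then show ?thesis using s that by simp
  next
    case False
    then have "dist r A < d" using that by (simp add: dist_real_def)
    then have "dist \<bar>x + W r \<omega>\<bar> \<bar>x + W A \<omega>\<bar> < c - \<bar>x + W A \<omega>\<bar>" using d(2) that by simp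
    then show ?thesis by (simp add: dist_real_def)
  qed
  have "\<forall>\<^sub>F n in sequentially. a n (N n) < A + d" by (rule order_tendstoD[OF aN]) (use d in simp)
  then show ?thesis
  proof eventually_elim
    case (elim n)
    show ?case unfolding cgrid_def
    proof (intro CollectI conjI allI impI sp)
      fix j assume "j \<le> N n"
      then have "0 \<le> a n j" "a n j < A + d" using a[of j n] elim by auto
      then show "\<bar>x + W (a n j) \<omega>\<bar> \<le> c" using in_c by (simp add: less_imp_le)
    qed
  qed
qed

text \<open>At barrier 1 the grid limit is the strict event because touching without crossing is
  null. For the other constants no such null set has been established; intersecting the grid events
  with the strict event forces convergence and still yields lower bounds.\<close>

lemma nn_cgrid_limit:
  assumes h: "continuous_on UNIV (h :: real \<Rightarrow> real)" and hB: "\<And>z. 0 \<le> h z" "\<And>z. h z \<le> B" and A: "0 < A" and x: "\<bar>x\<bar> < 1"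
    and a0: "\<And>n. a n 0 = 0" and a: "\<And>n j. j \<le> N n \<Longrightarrow> 0 \<le> a n j \<and> a n j \<le> a n (N n)"
    and aN: "(\<lambda>n. a n (N n)) \<longlonglongrightarrow> A"
    and mesh: "\<And>d. d > 0 \<Longrightarrow> \<forall>\<^sub>F n in sequentially. \<forall>j<N n. a n (Suc j) - a n j < d"
  shows "(\<lambda>n. \<integral>\<^sup>+\<omega>. ennreal (h (x + W (a n (N n)) \<omega>)) * indicator (cgrid (\<lambda>_. 1) (a n) (N n) x) \<omega> \<partial>M)
      \<longlonglongrightarrow> nn_surv (\<lambda>_. 1) 0 A (\<lambda>z. ennreal (h z)) x"
    and "0 < c \<Longrightarrow> (\<lambda>n. \<integral>\<^sup>+\<omega>. ennreal (h (x + W (a n (N n)) \<omega>)) * indicator (cgrid (\<lambda>_. c) (a n) (N n) x \<inter> surv (\<lambda>_. c) 0 A x) \<omega> \<partial>M)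
      \<longlonglongrightarrow> nn_surv (\<lambda>_. c) 0 A (\<lambda>z. ennreal (h z)) x"
proof -
  have [measurable]: "h \<in> borel_measurable borel" using h by (rule borel_measurable_continuous_onI)
  have [measurable]: "W A \<in> borel_measurable M" "W (a n (N n)) \<in> borel_measurable M" for n using A a[of "N n" n] by auto
  have cg[measurable]: "cgrid (\<lambda>_. c) (a n) (N n) x \<in> sets M" for n c
    by (rule cgrid_sets) (use a in auto)
  have hW: "(\<lambda>n. ennreal (h (x + W (a n (N n)) \<omega>))) \<longlonglongrightarrow> ennreal (h (x + W A \<omega>))" if "\<omega> \<in> space M" for \<omega>
  proof -
    have "(\<lambda>n. W (a n (N n)) \<omega>) \<longlonglongrightarrow> W A \<omega>"
      by (rule continuous_on_tendsto_compose[OF W_continuous[OF that] aN]) (use A a in auto)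
    then have "(\<lambda>n. x + W (a n (N n)) \<omega>) \<longlonglongrightarrow> x + W A \<omega>" by (intro tendsto_intros)
    then have "(\<lambda>n. h (x + W (a n (N n)) \<omega>)) \<longlonglongrightarrow> h (x + W A \<omega>)"
      by (rule continuous_on_tendsto_compose[OF h]) auto
    then show ?thesis by (rule tendsto_ennrealI)
  qed
  have hle: "ennreal (h z) * indicator S \<omega> \<le> ennreal B" for z S and \<omega> :: 'a
    using ennreal_mult_bounded[OF ennreal_leI[OF hB(2)] indicator_le_one_ennreal] by simp
  have transfer: "(\<lambda>n. ennreal (h (x + W (a n (N n)) \<omega>)) * indicator (S n) \<omega>) \<longlonglongrightarrow> ennreal (h (x + W A \<omega>)) * indicator T \<omega>"
    if "\<omega> \<in> space M" "\<forall>\<^sub>F n in sequentially. \<omega> \<in> S n \<longleftrightarrow> \<omega> \<in> T" for \<omega> S T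
  proof -
    have "(\<lambda>n. ennreal (h (x + W (a n (N n)) \<omega>)) * indicator T \<omega>) \<longlonglongrightarrow> ennreal (h (x + W A \<omega>)) * indicator T \<omega>"
      using hW[OF that(1)] by (cases "\<omega> \<in> T") auto
    then show ?thesis
      by (rule Lim_transform_eventually) (use that(2) in eventually_elim, auto simp: indicator_def)
  qed
  show "(\<lambda>n. \<integral>\<^sup>+\<omega>. ennreal (h (x + W (a n (N n)) \<omega>)) * indicator (cgrid (\<lambda>_. 1) (a n) (N n) x) \<omega> \<partial>M)
      \<longlonglongrightarrow> nn_surv (\<lambda>_. 1) 0 A (\<lambda>z. ennreal (h z)) x"
    unfolding nn_surv_def diff_zero
  proof (rule nn_integral_dominated_convergence[where w="\<lambda>_. ennreal B"])
    have [measurable]: "surv (\<lambda>_. 1) 0 A x \<in> sets M" using A by simp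
    show "(\<lambda>\<omega>. ennreal (h (x + W A \<omega>)) * indicator (surv (\<lambda>_. 1) 0 A x) \<omega>) \<in> borel_measurable M" by measurable
    show "AE \<omega> in M. (\<lambda>n. ennreal (h (x + W (a n (N n)) \<omega>)) * indicator (cgrid (\<lambda>_. 1) (a n) (N n) x) \<omega>)
      \<longlonglongrightarrow> ennreal (h (x + W A \<omega>)) * indicator (surv (\<lambda>_. 1) 0 A x) \<omega>"
      using AE_csurv_surv[OF A x] AE_space
    proof eventually_elim
      case (elim \<omega>)
      show ?case
      proof (rule transfer[OF elim(2)], cases "\<omega> \<in> surv (\<lambda>_. 1) 0 A x")
        case True
        then have "\<forall>\<^sub>F n in sequentially. \<omega> \<in> cgrid (\<lambda>_. 1) (a n) (N n) x"
          by (rule cgrid_eventually_succeeds[where N=N and a=a, OF _ less_imp_le[OF A] a aN])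
        then show "\<forall>\<^sub>F n in sequentially. \<omega> \<in> cgrid (\<lambda>_. 1) (a n) (N n) x \<longleftrightarrow> \<omega> \<in> surv (\<lambda>_. 1) 0 A x"
          using True by simp
      next
        case False
        then have "\<omega> \<notin> csurv (\<lambda>_. 1) 0 A x" using elim by simp
        then have "\<forall>\<^sub>F n in sequentially. \<omega> \<notin> cgrid (\<lambda>j. 1) (a n) (N n) x"
          using cgrid_eventually_fails[OF elim(2), of 0 A "\<lambda>_. 1" x a N] A a0 aN mesh by simp
        then show "\<forall>\<^sub>F n in sequentially. \<omega> \<in> cgrid (\<lambda>_. 1) (a n) (N n) x \<longleftrightarrow> \<omega> \<in> surv (\<lambda>_. 1) 0 A x"
          using False by simp
      qed
    qed
  qed (use hle in \<open>auto simp: emeasure_space_1\<close>)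
  show "(\<lambda>n. \<integral>\<^sup>+\<omega>. ennreal (h (x + W (a n (N n)) \<omega>)) * indicator (cgrid (\<lambda>_. c) (a n) (N n) x \<inter> surv (\<lambda>_. c) 0 A x) \<omega> \<partial>M)
      \<longlonglongrightarrow> nn_surv (\<lambda>_. c) 0 A (\<lambda>z. ennreal (h z)) x" if c: "0 < c"
    unfolding nn_surv_def diff_zero
  proof (rule nn_bounded_convergence[where B="ennreal B"])
    have S[measurable]: "surv (\<lambda>_. c) 0 A x \<in> sets M" by (rule surv_sets) (use A c in auto)
    show "(\<lambda>\<omega>. ennreal (h (x + W A \<omega>)) * indicator (surv (\<lambda>_. c) 0 A x) \<omega>) \<in> borel_measurable M" by measurable
    show "(\<lambda>\<omega>. ennreal (h (x + W (a n (N n)) \<omega>)) * indicator (cgrid (\<lambda>_. c) (a n) (N n) x \<inter> surv (\<lambda>_. c) 0 A x) \<omega>) \<in> borel_measurable M" for n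
      by measurable
    fix \<omega> assume \<omega>: "\<omega> \<in> space M"
    show "(\<lambda>n. ennreal (h (x + W (a n (N n)) \<omega>)) * indicator (cgrid (\<lambda>_. c) (a n) (N n) x \<inter> surv (\<lambda>_. c) 0 A x) \<omega>)
      \<longlonglongrightarrow> ennreal (h (x + W A \<omega>)) * indicator (surv (\<lambda>_. c) 0 A x) \<omega>"
    proof (rule transfer[OF \<omega>], cases "\<omega> \<in> surv (\<lambda>_. c) 0 A x")
      case True
      then have "\<forall>\<^sub>F n in sequentially. \<omega> \<in> cgrid (\<lambda>_. c) (a n) (N n) x"
        by (rule cgrid_eventually_succeeds[where N=N and a=a, OF _ less_imp_le[OF A] a aN])
      then show "\<forall>\<^sub>F n in sequentially. \<omega> \<in> cgrid (\<lambda>_. c) (a n) (N n) x \<inter> surv (\<lambda>_. c) 0 A x \<longleftrightarrow> \<omega> \<in> surv (\<lambda>_. c) 0 A x"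
        using True by simp
    qed simp
  qed (use hle in auto)
qed

text \<open>Weak survival at one factor implies strict survival at every larger factor, so each
  strict survivor below 1 is eventually included.\<close>

lemma nn_surv_shrink:
  assumes [measurable]: "h \<in> borel_measurable borel" and hB: "\<And>z. h z \<le> B" "B < top" and A: "0 < A"
  shows "(\<lambda>m. nn_surv (\<lambda>_. shrink m) 0 A h x) \<longlonglongrightarrow> nn_surv (\<lambda>_. 1) 0 A h x"
  unfolding nn_surv_def diff_zero
proof (rule nn_bounded_convergence[where B=B])
  have [measurable]: "W A \<in> borel_measurable M" using A by simp
  have [measurable]: "surv (\<lambda>_. shrink m) 0 A x \<in> sets M" "surv (\<lambda>_. 1) 0 A x \<in> sets M" for m
    by (rule surv_sets; use A shrink_bounds in auto)+
  show "(\<lambda>\<omega>. h (x + W A \<omega>) * indicator (surv (\<lambda>_. 1) 0 A x) \<omega>) \<in> borel_measurable M"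
    "(\<lambda>\<omega>. h (x + W A \<omega>) * indicator (surv (\<lambda>_. shrink m) 0 A x) \<omega>) \<in> borel_measurable M" for m by measurable
  show "h (x + W A \<omega>) * indicator (surv (\<lambda>_. shrink m) 0 A x) \<omega> \<le> B" for m \<omega>
    using ennreal_mult_bounded[OF hB(1) indicator_le_one_ennreal] by simp
  fix \<omega> assume \<omega>: "\<omega> \<in> space M"
  show "(\<lambda>m. h (x + W A \<omega>) * indicator (surv (\<lambda>_. shrink m) 0 A x) \<omega>) \<longlonglongrightarrow> h (x + W A \<omega>) * indicator (surv (\<lambda>_. 1) 0 A x) \<omega>"
  proof (rule indicator_tendsto, cases "\<omega> \<in> surv (\<lambda>_. 1) 0 A x")
    case True
    have "\<forall>\<^sub>F m in sequentially. \<omega> \<in> csurv (\<lambda>r. shrink m * 1) 0 A x \<longleftrightarrow> \<omega> \<in> surv (\<lambda>_. 1) 0 A x"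
      by (rule csurv_eventually_surv[OF \<omega>]) (use A in auto)
    then obtain m0 where m0: "\<omega> \<in> csurv (\<lambda>r. shrink m0) 0 A x" using True by (auto simp: eventually_sequentially)
    have "\<forall>\<^sub>F m in sequentially. shrink m0 < shrink m" by (rule shrink_eventually[OF shrink_bounds(2)])
    then show "\<forall>\<^sub>F m in sequentially. \<omega> \<in> surv (\<lambda>_. shrink m) 0 A x \<longleftrightarrow> \<omega> \<in> surv (\<lambda>_. 1) 0 A x"
      by eventually_elim (use m0 True in \<open>force simp: surv_def csurv_def\<close>)
  next
    case False
    have "surv (\<lambda>_. shrink m) 0 A x \<subseteq> surv (\<lambda>_. 1) 0 A x" for m
      using shrink_bounds[of m] by (force simp: surv_def)
    then show "\<forall>\<^sub>F m in sequentially. \<omega> \<in> surv (\<lambda>_. shrink m) 0 A x \<longleftrightarrow> \<omega> \<in> surv (\<lambda>_. 1) 0 A x"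
      using False by (intro always_eventually) auto
  qed
qed fact


section \<open>Uniform time grids, their clocks, and the comparison with killed Brownian
  motion\<close>

definition tgrid :: "real \<Rightarrow> real \<Rightarrow> nat \<Rightarrow> nat \<Rightarrow> real" where
  "tgrid u t n j = u + ugrid (t - u) n j"

definition clock :: "real \<Rightarrow> real \<Rightarrow> real \<Rightarrow> nat \<Rightarrow> nat \<Rightarrow> real" where
  "clock \<kappa> u t n = clockgrid (tgrid u t n) (\<lambda>j. bd \<kappa> (tgrid u t n j))"

lemma tgrid_simps [simp]: "tgrid u t n 0 = u" "tgrid u t n (Suc n) = t"
  by (auto simp: tgrid_def)

lemma tgrid_step: "tgrid u t n (Suc j) - tgrid u t n j = (t - u) / real (Suc n)"
  by (simp add: tgrid_def ugrid_step)

lemma tgrid_mono: "u < t \<Longrightarrow> tgrid u t n j < tgrid u t n (Suc j)"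
  by (simp add: tgrid_def ugrid_mono)

lemma tgrid_ge: "u < t \<Longrightarrow> u \<le> tgrid u t n j"
  by (simp add: tgrid_def ugrid_nonneg)

lemma tgrid_le: "u < t \<Longrightarrow> j \<le> Suc n \<Longrightarrow> tgrid u t n j \<le> t"
  using ugrid_le[of "t - u" j n] by (simp add: tgrid_def)

lemma clock_0: "clock \<kappa> u t n 0 = 0"
  by (simp add: clock_def clockgrid_def)

lemma clock_step: "clock \<kappa> u t n (Suc j) - clock \<kappa> u t n j =
  (t - u) / real (Suc n) / (bd \<kappa> (tgrid u t n j) * bd \<kappa> (tgrid u t n (Suc j)))"
  by (simp add: clock_def clockgrid_def tgrid_step)

lemma clock_step_bounds:
  assumes \<kappa>: "0 < \<kappa>" and u: "0 \<le> u" "u < t"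
  shows "0 < clock \<kappa> u t n (Suc j) - clock \<kappa> u t n j"
    "clock \<kappa> u t n (Suc j) - clock \<kappa> u t n j \<le> (t - u) / real (Suc n) / (bd \<kappa> u)\<^sup>2"
    "j \<le> n \<Longrightarrow> (t - u) / real (Suc n) / (bd \<kappa> t)\<^sup>2 \<le> clock \<kappa> u t n (Suc j) - clock \<kappa> u t n j"
proof -
  let ?a = "tgrid u t n j" and ?b = "tgrid u t n (Suc j)"
  have ab: "u \<le> ?a" "u \<le> ?b" using tgrid_ge[OF u(2)] by auto
  have d: "0 < (t - u) / real (Suc n)" using u by simp
  have p: "0 < bd \<kappa> ?a" "0 < bd \<kappa> ?b" "0 < bd \<kappa> u" "0 < bd \<kappa> t" using bd_pos ab u by auto
  show "0 < clock \<kappa> u t n (Suc j) - clock \<kappa> u t n j" unfolding clock_step by (rule divide_pos_pos[OF d mult_pos_pos[OF p(1,2)]])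
  have "bd \<kappa> u * bd \<kappa> u \<le> bd \<kappa> ?a * bd \<kappa> ?b" using p ab u \<kappa> by (intro mult_mono bd_mono) auto
  then show "clock \<kappa> u t n (Suc j) - clock \<kappa> u t n j \<le> (t - u) / real (Suc n) / (bd \<kappa> u)\<^sup>2"
    unfolding clock_step power2_eq_square using p d by (intro divide_left_mono) auto
  assume "j \<le> n"
  then have "?a \<le> t" "?b \<le> t" using tgrid_le[OF u(2)] by auto
  then have "bd \<kappa> ?a * bd \<kappa> ?b \<le> bd \<kappa> t * bd \<kappa> t" using p ab u \<kappa> by (intro mult_mono bd_mono) auto
  then show "(t - u) / real (Suc n) / (bd \<kappa> t)\<^sup>2 \<le> clock \<kappa> u t n (Suc j) - clock \<kappa> u t n j"
    unfolding clock_step power2_eq_square using p d by (intro divide_left_mono) auto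
qed

text \<open>The bounds are independent of \<open>n\<close>, so the final clock values have a
  convergent subsequence.\<close>

lemma clock_bounds:
  assumes "0 < \<kappa>" "0 \<le> u" "u < t"
  shows "clock \<kappa> u t n (Suc n) \<in> {(t - u) / (bd \<kappa> t)\<^sup>2..(t - u) / (bd \<kappa> u)\<^sup>2}"
proof -
  let ?a = "clock \<kappa> u t n"
  have eq: "?a (Suc n) = (\<Sum>j<Suc n. ?a (Suc j) - ?a j)"
    using sum_lessThan_telescope[of ?a "Suc n"] by (simp only: clock_0)
  have lo: "real (Suc n) * ((t - u) / real (Suc n) / (bd \<kappa> t)\<^sup>2) \<le> ?a (Suc n)"
    unfolding eq using sum_bounded_below[of "{..<Suc n}" "(t - u) / real (Suc n) / (bd \<kappa> t)\<^sup>2" "\<lambda>j. ?a (Suc j) - ?a j"]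
      clock_step_bounds(3)[OF assms] by (simp only: card_lessThan lessThan_iff less_Suc_eq_le)
  have up: "?a (Suc n) \<le> real (Suc n) * ((t - u) / real (Suc n) / (bd \<kappa> u)\<^sup>2)"
    unfolding eq using sum_bounded_above[of "{..<Suc n}" "\<lambda>j. ?a (Suc j) - ?a j" "(t - u) / real (Suc n) / (bd \<kappa> u)\<^sup>2"]
      clock_step_bounds(2)[OF assms] by (simp only: card_lessThan)
  have c: "real (Suc n) * ((t - u) / real (Suc n) / z) = (t - u) / z" for z by simp
  show ?thesis using lo up unfolding c by simp
qed

lemma clock_mono:
  assumes "0 < \<kappa>" "0 \<le> u" "u < t"
  shows "j \<le> k \<Longrightarrow> clock \<kappa> u t n j \<le> clock \<kappa> u t n k"
proof -
  have "mono (clock \<kappa> u t n)"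
    by (rule incseq_SucI) (use clock_step_bounds(1)[OF assms] in \<open>auto simp: less_imp_le\<close>)
  then show "j \<le> k \<Longrightarrow> clock \<kappa> u t n j \<le> clock \<kappa> u t n k" by (rule monoD)
qed

lemma clock_mesh:
  assumes "0 < \<kappa>" "0 \<le> u" "u < t" "0 < d"
  shows "\<forall>\<^sub>F n in sequentially. \<forall>j<Suc n. clock \<kappa> u t n (Suc j) - clock \<kappa> u t n j < d"
proof -
  have "(\<lambda>n. (t - u) / real (Suc n) / (bd \<kappa> u)\<^sup>2) \<longlonglongrightarrow> 0 / (bd \<kappa> u)\<^sup>2"
    by (intro tendsto_divide tendsto_const) (real_asymp | use bd_pos[OF assms(2), of \<kappa>] in simp)+
  then have "\<forall>\<^sub>F n in sequentially. (t - u) / real (Suc n) / (bd \<kappa> u)\<^sup>2 < d"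
    by (rule order_tendstoD) (use assms in simp)
  then show ?thesis
    by eventually_elim (use clock_step_bounds(2)[OF assms(1-3)] in \<open>meson order_le_less_trans\<close>)
qed

text \<open>Slots past the last cell get slope 0, so that the backward recursion of \<open>grid_compare_upper\<close> starts from the
  trivial weight 1.\<close>

definition slope :: "real \<Rightarrow> real \<Rightarrow> real \<Rightarrow> nat \<Rightarrow> nat \<Rightarrow> real" where
  "slope \<kappa> u t n j = (if j \<le> n then (bd \<kappa> (tgrid u t n (Suc j)) - bd \<kappa> (tgrid u t n j)) / (tgrid u t n (Suc j) - tgrid u t n j) else 0)"

text \<open>The initial weight and the telescoping cost correspond to the two terms of
  \<open>err\<close>. The cells are kept at length at most 1 for the sake of
  \<open>bd_slope\<close>.\<close>

lemma slope_facts: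
  assumes \<kappa>: "0 < \<kappa>" "\<kappa> < 1/2" and u: "0 \<le> u" "u < t" and n: "(t - u) / real (Suc n) \<le> 1"
  shows "slope \<kappa> u t n (Suc j) \<le> slope \<kappa> u t n j"
    "0 \<le> slope \<kappa> u t n j"
    "slope \<kappa> u t n 0 * bd \<kappa> u / 2 + (\<Sum>j<Suc n. slope \<kappa> u t n j * (bd \<kappa> (tgrid u t n (Suc j)) - bd \<kappa> (tgrid u t n j)) / 2) \<le> err \<kappa> u"
proof -
  let ?t = "tgrid u t n"
  have cell: "0 \<le> ?t j" "?t j < ?t (Suc j)" "?t (Suc j) - ?t j \<le> 1" for j
    using tgrid_ge[OF u(2), of n j] u tgrid_mono[OF u(2)] n by (auto simp: tgrid_step)
  note sl = bd_slope[OF \<kappa> cell]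
  have lo: "\<kappa> * (?t (Suc j) + 1) powr (\<kappa> - 1) \<le> slope \<kappa> u t n j" if "j \<le> n" for j
    using sl(1) that by (simp add: slope_def)
  show nn: "0 \<le> slope \<kappa> u t n j" for j
  proof (cases "j \<le> n")
    case True
    have "0 \<le> \<kappa> * (?t (Suc j) + 1) powr (\<kappa> - 1)" using \<kappa> by simp
    then show ?thesis using lo[OF True] by linarith
  qed (simp add: slope_def)
  show "slope \<kappa> u t n (Suc j) \<le> slope \<kappa> u t n j"
  proof (cases "Suc j \<le> n")
    case True
    then have "slope \<kappa> u t n (Suc j) \<le> \<kappa> * (?t (Suc j) + 1) powr (\<kappa> - 1)" using sl(2)[of "Suc j"] by (simp add: slope_def)
    also have "\<dots> \<le> slope \<kappa> u t n j" by (rule lo) (use True in simp)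
    finally show ?thesis .
  next
    case False
    then show ?thesis using nn[of j] by (simp add: slope_def)
  qed
  let ?C = "4 * \<kappa>\<^sup>2 / (1 - 2 * \<kappa>)" and ?F = "\<lambda>j. (?t j + 1) powr (2 * \<kappa> - 1)"
  have C: "0 \<le> ?C" using \<kappa> by simp
  have "(\<Sum>j<Suc n. slope \<kappa> u t n j * (bd \<kappa> (?t (Suc j)) - bd \<kappa> (?t j)) / 2) \<le> (\<Sum>j<Suc n. ?C / 2 * (?F j - ?F (Suc j)))"
  proof (rule sum_mono)
    fix j assume "j \<in> {..<Suc n}"
    then have "slope \<kappa> u t n j = (bd \<kappa> (?t (Suc j)) - bd \<kappa> (?t j)) / (?t (Suc j) - ?t j)" by (simp add: slope_def)
    then have "slope \<kappa> u t n j * (bd \<kappa> (?t (Suc j)) - bd \<kappa> (?t j)) \<le> ?C * (?F j - ?F (Suc j))" using sl(3)[of j] by simp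
    then have "slope \<kappa> u t n j * (bd \<kappa> (?t (Suc j)) - bd \<kappa> (?t j)) / 2 \<le> ?C * (?F j - ?F (Suc j)) / 2"
      by (rule divide_right_mono) simp
    then show "slope \<kappa> u t n j * (bd \<kappa> (?t (Suc j)) - bd \<kappa> (?t j)) / 2 \<le> ?C / 2 * (?F j - ?F (Suc j))"
      by (simp only: times_divide_eq_left)
  qed
  also have "\<dots> = ?C / 2 * (?F 0 - ?F (Suc n))"
    unfolding sum_distrib_left[symmetric] sum_lessThan_telescope'[of ?F] ..
  also have "\<dots> \<le> ?C / 2 * (u + 1) powr (2 * \<kappa> - 1)"
  proof (rule mult_left_mono)
    show "0 \<le> ?C / 2" using C by (rule divide_nonneg_pos) simp
  qed simp
  finally have 1: "(\<Sum>j<Suc n. slope \<kappa> u t n j * (bd \<kappa> (?t (Suc j)) - bd \<kappa> (?t j)) / 2) \<le> ?C / 2 * (u + 1) powr (2 * \<kappa> - 1)" .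
  have "slope \<kappa> u t n 0 * bd \<kappa> u \<le> \<kappa> * (u + 1) powr (\<kappa> - 1) * bd \<kappa> u"
    using sl(2)[of 0] bd_pos[OF u(1), of \<kappa>] by (intro mult_right_mono) (auto simp: slope_def)
  also have "\<dots> = \<kappa> * (u + 1) powr (2 * \<kappa> - 1)"
    by (simp add: bd_def powr_add[symmetric] algebra_simps)
  finally have 2: "slope \<kappa> u t n 0 * bd \<kappa> u / 2 \<le> \<kappa> * (u + 1) powr (2 * \<kappa> - 1) / 2" by simp
  have "err \<kappa> u = \<kappa> * (u + 1) powr (2 * \<kappa> - 1) / 2 + ?C / 2 * (u + 1) powr (2 * \<kappa> - 1)"
    unfolding err_def by (simp add: distrib_right add_divide_distrib)
  then show "slope \<kappa> u t n 0 * bd \<kappa> u / 2 + (\<Sum>j<Suc n. slope \<kappa> u t n j * (bd \<kappa> (?t (Suc j)) - bd \<kappa> (?t j)) / 2) \<le> err \<kappa> u"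
    using 1 2 by linarith
qed

text \<open>The upper bound involves only the initial weight, the lower bound also the accumulated
  cost. As \<open>x\<^sup>2\<close> lies between 0 and 1, \<open>err\<close> dominates both
  exponents.\<close>

lemma grid_sandwich:
  assumes \<kappa>: "0 < \<kappa>" "\<kappa> < 1/2" and u: "0 \<le> u" "u < t" and n: "(t - u) / real (Suc n) \<le> 1" and x: "\<bar>x\<bar> < 1"
    and h[measurable]: "h \<in> borel_measurable borel"
  defines "X c \<equiv> \<integral>\<^sup>+\<omega>. h (bd \<kappa> u * x + W (t - u) \<omega>) *
      indicator (cgrid (\<lambda>j. c * bd \<kappa> (u + ugrid (t - u) n j)) (ugrid (t - u) n) (Suc n) (bd \<kappa> u * x)) \<omega> \<partial>M"
    and "U c \<equiv> \<integral>\<^sup>+\<omega>. h (bd \<kappa> t * (x + W (clock \<kappa> u t n (Suc n)) \<omega>)) *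
      indicator (cgrid (\<lambda>_. c) (clock \<kappa> u t n) (Suc n) x) \<omega> \<partial>M"
    and "r \<equiv> ennreal (sqrt (bd \<kappa> t / bd \<kappa> u))"
  shows "X c \<le> ennreal (exp (err \<kappa> u)) * (r * U c)"
    "c \<le> 1 \<Longrightarrow> ennreal (exp (- err \<kappa> u)) * (r * U c) \<le> X c"
proof -
  let ?t = "tgrid u t n" and ?g = "\<lambda>j. bd \<kappa> (tgrid u t n j)" and ?D = "slope \<kappa> u t n"
  have g: "0 < ?g j" for j using tgrid_ge[OF u(2), of n j] u by (intro bd_pos) auto
  note sf = slope_facts[OF \<kappa> u n]
  have D: "?D i = (?g (Suc i) - ?g i) / (?t (Suc i) - ?t i)" if "i < Suc n" for i using that by (simp add: slope_def)
  have DN: "?D (Suc n) = 0" by (simp add: slope_def)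
  have x2: "0 \<le> x\<^sup>2" "x\<^sup>2 \<le> 1" using x by (auto simp: abs_square_le_1)
  have S0: "0 \<le> (\<Sum>j<Suc n. ?D j * (?g (Suc j) - ?g j) / 2)"
  proof (rule sum_nonneg)
    fix j
    have "?g j \<le> ?g (Suc j)" using tgrid_ge[OF u(2), of n j] u tgrid_mono[OF u(2), of n j] \<kappa> by (intro bd_mono) auto
    then show "0 \<le> ?D j * (?g (Suc j) - ?g j) / 2" using sf(2) by simp
  qed
  have Dg: "0 \<le> ?D 0 * bd \<kappa> u / 2" using sf(2)[of 0] bd_pos[OF u(1), of \<kappa>] by simp
  have eX: "(\<integral>\<^sup>+\<omega>. (\<Prod>j\<le>Suc n. indicator {- (c * ?g j)..c * ?g j} (?g 0 * x + W (?t j - ?t 0) \<omega>)) * h (?g 0 * x + W (?t (Suc n) - ?t 0) \<omega>) \<partial>M) = X c" for c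
    unfolding X_def
  proof (rule nn_integral_cong)
    fix \<omega> assume "\<omega> \<in> space M"
    from indicator_cgrid_prod_ennreal[OF this, of "\<lambda>j. c * ?g j" "?g 0 * x" "\<lambda>j. ?t j - ?t 0" "Suc n"]
    show "(\<Prod>j\<le>Suc n. indicator {- (c * ?g j)..c * ?g j} (?g 0 * x + W (?t j - ?t 0) \<omega>)) * h (?g 0 * x + W (?t (Suc n) - ?t 0) \<omega>)
      = h (bd \<kappa> u * x + W (t - u) \<omega>) *
      indicator (cgrid (\<lambda>j. c * bd \<kappa> (u + ugrid (t - u) n j)) (ugrid (t - u) n) (Suc n) (bd \<kappa> u * x)) \<omega>"
      by (simp add: tgrid_def mult.commute del: prod.atMost_Suc)
  qed
  have eU: "(\<integral>\<^sup>+\<omega>. (\<Prod>j\<le>Suc n. indicator {- c..c} (x + W (clockgrid ?t ?g j) \<omega>)) * (\<lambda>z. h (bd \<kappa> t * z)) (x + W (clockgrid ?t ?g (Suc n)) \<omega>) \<partial>M) = U c" for c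
    unfolding U_def clock_def[symmetric]
  proof (rule nn_integral_cong)
    fix \<omega> assume "\<omega> \<in> space M"
    from indicator_cgrid_prod_ennreal[OF this, of "\<lambda>j. c" x "clock \<kappa> u t n" "Suc n"]
    show "(\<Prod>j\<le>Suc n. indicator {- c..c} (x + W (clock \<kappa> u t n j) \<omega>)) * h (bd \<kappa> t * (x + W (clock \<kappa> u t n (Suc n)) \<omega>))
      = h (bd \<kappa> t * (x + W (clock \<kappa> u t n (Suc n)) \<omega>)) * indicator (cgrid (\<lambda>_. c) (clock \<kappa> u t n) (Suc n) x) \<omega>"
      by (simp add: mult.commute del: prod.atMost_Suc)
  qed
  have gr: "r = ennreal (sqrt (?g (Suc n) / ?g 0))" by (simp add: r_def)
  have "X c \<le> ennreal (exp (?D 0 * ?g 0 * x\<^sup>2 / 2)) * (ennreal (sqrt (?g (Suc n) / ?g 0)) * U c)"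
    unfolding eX[symmetric] eU[symmetric]
  proof (rule grid_compare_upper[where D="?D"])
    show "?t i < ?t (Suc i)" for i by (rule tgrid_mono[OF u(2)])
    show "0 < ?g i" for i by (rule g)
    show "?D i = (?g (Suc i) - ?g i) / (?t (Suc i) - ?t i)" if "i < Suc n" for i by (rule D[OF that])
    show "?D (Suc i) \<le> ?D i" for i by (rule sf(1))
    show "h (?g (Suc n) * z) \<le> ennreal (exp (?D (Suc n) * ?g (Suc n) * z\<^sup>2 / 2)) * h (bd \<kappa> t * z)" for z by (simp add: DN)
  qed measurable
  also have "\<dots> \<le> ennreal (exp (err \<kappa> u)) * (r * U c)"
    unfolding gr
  proof (intro mult_right_mono ennreal_leI)
    have "?D 0 * bd \<kappa> u / 2 * x\<^sup>2 \<le> ?D 0 * bd \<kappa> u / 2" using mult_left_mono[OF x2(2) Dg] by simp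
    then show "exp (?D 0 * ?g 0 * x\<^sup>2 / 2) \<le> exp (err \<kappa> u)" using sf(3) S0 by simp
  qed simp
  finally show "X c \<le> ennreal (exp (err \<kappa> u)) * (r * U c)" .
  assume c: "c \<le> 1"
  have "ennreal (exp (- err \<kappa> u)) * (r * U c) \<le>
    ennreal (exp (?D 0 * ?g 0 * (x\<^sup>2 - 1) / 2 - (0 + (\<Sum>j<Suc n. ?D j * (?g (Suc j) - ?g j) / 2)))) * (ennreal (sqrt (?g (Suc n) / ?g 0)) * U c)"
    unfolding gr
  proof (intro mult_right_mono ennreal_leI)
    have "- (?D 0 * bd \<kappa> u / 2) \<le> ?D 0 * bd \<kappa> u * (x\<^sup>2 - 1) / 2"
      using mult_left_mono[OF x2(1) Dg] by (simp add: algebra_simps)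
    then have "- err \<kappa> u \<le> ?D 0 * ?g 0 * (x\<^sup>2 - 1) / 2 - (0 + (\<Sum>j<Suc n. ?D j * (?g (Suc j) - ?g j) / 2))"
      unfolding tgrid_simps using sf(3) by linarith
    then show "exp (- err \<kappa> u) \<le> exp (?D 0 * ?g 0 * (x\<^sup>2 - 1) / 2 - (0 + (\<Sum>j<Suc n. ?D j * (?g (Suc j) - ?g j) / 2)))"
      by (simp only: exp_le_cancel_iff)
  qed simp
  also have "\<dots> \<le> X c"
    unfolding eX[symmetric] eU[symmetric]
  proof (rule grid_compare_lower[where D="?D"])
    show "?t i < ?t (Suc i)" for i by (rule tgrid_mono[OF u(2)])
    show "0 < ?g i" for i by (rule g)
    show "c \<le> 1" by (rule c)
    show "?D i = (?g (Suc i) - ?g i) / (?t (Suc i) - ?t i)" if "i < Suc n" for i by (rule D[OF that])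
    show "?D (Suc i) \<le> ?D i" for i by (rule sf(1))
    show "ennreal (exp (?D (Suc n) * ?g (Suc n) * (z\<^sup>2 - 1) / 2 - 0)) * h (bd \<kappa> t * z) \<le> h (?g (Suc n) * z)" for z by (simp add: DN)
  qed measurable
  finally show "ennreal (exp (- err \<kappa> u)) * (r * U c) \<le> X c" .
qed

text \<open>The duration \<open>A\<close> is a cluster point of the discrete clocks, found by
  compactness before \<open>h\<close> and \<open>x\<close> are chosen; hence it is common to all
  test functions, and the two bounds on it stand in for its value.\<close>

theorem comparison:
  assumes \<kappa>: "0 < \<kappa>" "\<kappa> < 1/2" and u: "0 \<le> u" "u < t"
  shows "\<exists>A\<in>{(t - u) / (bd \<kappa> t)\<^sup>2..(t - u) / (bd \<kappa> u)\<^sup>2}. \<forall>h B x. continuous_on UNIV h \<longrightarrow> (\<forall>z. 0 \<le> h z \<and> h z \<le> B) \<longrightarrow> \<bar>x\<bar> < 1 \<longrightarrow>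
    exp (- err \<kappa> u) * (sqrt (bd \<kappa> t / bd \<kappa> u) * kill A (\<lambda>z. h (bd \<kappa> t * z)) x) \<le> rsurv (bd \<kappa>) u t h (bd \<kappa> u * x) \<and>
    rsurv (bd \<kappa>) u t h (bd \<kappa> u * x) \<le> exp (err \<kappa> u) * (sqrt (bd \<kappa> t / bd \<kappa> u) * kill A (\<lambda>z. h (bd \<kappa> t * z)) x)"
proof -
  let ?b = "bd \<kappa>" and ?r = "sqrt (bd \<kappa> t / bd \<kappa> u)"
  let ?I = "{(t - u) / (bd \<kappa> t)\<^sup>2..(t - u) / (bd \<kappa> u)\<^sup>2}"
  obtain A \<sigma> where A: "A \<in> ?I" and \<sigma>: "strict_mono \<sigma>" and lim: "((\<lambda>n. clock \<kappa> u t n (Suc n)) \<circ> \<sigma>) \<longlonglongrightarrow> A"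
    using compact_Icc[of "(t - u) / (bd \<kappa> t)\<^sup>2" "(t - u) / (bd \<kappa> u)\<^sup>2"] clock_bounds[OF \<kappa>(1) u]
    unfolding compact_def by meson
  have bp: "0 < ?b t" "0 < ?b u" using bd_pos u by auto
  have A0: "0 < A"
  proof -
    have "0 < (t - u) / (bd \<kappa> t)\<^sup>2" using u bp by simp
    then show ?thesis using A by auto
  qed
  define N where "N n = Suc (\<sigma> n)" for n
  define a where "a n = clock \<kappa> u t (\<sigma> n)" for n
  have a0: "a n 0 = 0" for n by (simp add: a_def clock_0)
  have ab: "0 \<le> a n j \<and> a n j \<le> a n (N n)" if "j \<le> N n" for n j
    using clock_mono[OF \<kappa>(1) u, of 0 j "\<sigma> n"] clock_mono[OF \<kappa>(1) u, of j "N n" "\<sigma> n"] that by (simp add: a_def clock_0)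
  have aN: "(\<lambda>n. a n (N n)) \<longlonglongrightarrow> A" using lim by (simp add: a_def N_def o_def)
  have mesh: "\<forall>\<^sub>F n in sequentially. \<forall>j<N n. a n (Suc j) - a n j < d" if "d > 0" for d
    unfolding a_def N_def
    using eventually_subseq[OF \<sigma> clock_mesh[OF \<kappa>(1) u that]] by simp
  have small: "\<forall>\<^sub>F n in sequentially. (t - u) / real (Suc (\<sigma> n)) \<le> 1"
  proof -
    have "(\<lambda>n. (t - u) / real (Suc n)) \<longlonglongrightarrow> 0" by real_asymp
    then have "\<forall>\<^sub>F n in sequentially. (t - u) / real (Suc n) < 1" by (rule order_tendstoD) simp
    then have "\<forall>\<^sub>F n in sequentially. (t - u) / real (Suc n) \<le> 1" by (rule eventually_mono) simp
    then show ?thesis by (rule eventually_subseq[OF \<sigma>])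
  qed
  have bc: "continuous_on {u..t} ?b" "\<And>r. r \<in> {u..t} \<Longrightarrow> 0 < ?b r" using bd_continuous bd_pos u by auto
  show ?thesis
  proof (intro bexI[OF _ A] allI impI)
    fix h :: "real \<Rightarrow> real" and B x :: real
    assume h: "continuous_on UNIV h" and hB: "\<forall>z. 0 \<le> h z \<and> h z \<le> B" and x: "\<bar>x\<bar> < 1"
    let ?h = "\<lambda>z. ennreal (h z)" and ?k = "\<lambda>z. h (?b t * z)" and ?y = "?b u * x"
    have [measurable]: "h \<in> borel_measurable borel" using h by (rule borel_measurable_continuous_onI)
    have k: "continuous_on UNIV ?k" by (rule continuous_on_compose2[OF h]) (auto intro!: continuous_intros)
    have [measurable]: "?k \<in> borel_measurable borel" using k by (rule borel_measurable_continuous_onI)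
    have kB: "0 \<le> ?k z" "?k z \<le> B" for z using hB by auto
    have hB': "?h z \<le> ennreal B" "ennreal (?k z) \<le> ennreal B" for z using hB by (auto intro: ennreal_leI)
    define X where "X c n = (\<integral>\<^sup>+\<omega>. ?h (?y + W (t - u) \<omega>) *
      indicator (cgrid (\<lambda>j. c * ?b (u + ugrid (t - u) n j)) (ugrid (t - u) n) (Suc n) ?y) \<omega> \<partial>M)" for c n
    define U where "U c n = (\<integral>\<^sup>+\<omega>. ?h (?b t * (x + W (clock \<kappa> u t n (Suc n)) \<omega>)) *
      indicator (cgrid (\<lambda>_. c) (clock \<kappa> u t n) (Suc n) x) \<omega> \<partial>M)" for c n
    have sand: "X c n \<le> ennreal (exp (err \<kappa> u)) * (ennreal ?r * U c n)"
      "c \<le> 1 \<Longrightarrow> ennreal (exp (- err \<kappa> u)) * (ennreal ?r * U c n) \<le> X c n"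
      if "(t - u) / real (Suc n) \<le> 1" for c n
      unfolding X_def U_def using grid_sandwich[OF \<kappa> u that x, of ?h c] by auto
    \<comment> \<open>Strict survival implies every grid event, so the grid bound passes to the
      limit along the subsequence.\<close>
    have upper: "nn_surv ?b u t ?h ?y \<le> ennreal (exp (err \<kappa> u)) * (ennreal ?r * nn_surv (\<lambda>_. 1) 0 A (\<lambda>z. ennreal (?k z)) x)"
    proof (rule tendsto_lowerbound)
      have "(\<lambda>n. U 1 (\<sigma> n)) \<longlonglongrightarrow> nn_surv (\<lambda>_. 1) 0 A (\<lambda>z. ennreal (?k z)) x"
        using nn_cgrid_limit(1)[OF k kB A0 x a0 ab aN mesh] by (simp add: U_def a_def N_def)
      then show "(\<lambda>n. ennreal (exp (err \<kappa> u)) * (ennreal ?r * U 1 (\<sigma> n))) \<longlonglongrightarrow>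
        ennreal (exp (err \<kappa> u)) * (ennreal ?r * nn_surv (\<lambda>_. 1) 0 A (\<lambda>z. ennreal (?k z)) x)"
        by (intro ennreal_tendsto_cmult) auto
      have le: "nn_surv ?b u t ?h ?y \<le> X 1 n" for n
        unfolding nn_surv_def X_def
      proof (intro nn_integral_mono mult_left_mono)
        have "surv ?b u t ?y \<subseteq> cgrid (\<lambda>j. 1 * ?b (u + ugrid (t - u) n j)) (ugrid (t - u) n) (Suc n) ?y"
        proof
          fix \<omega> assume "\<omega> \<in> surv ?b u t ?y"
          then have "\<omega> \<in> csurv ?b u t ?y" by (auto simp: surv_def csurv_def less_imp_le)
          then have "\<omega> \<in> cgrid (\<lambda>j. ?b (u + ugrid (t - u) n j)) (ugrid (t - u) n) (Suc n) ?y"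
            by (rule csurv_imp_cgrid) (use u ugrid_nonneg ugrid_le in auto)
          then show "\<omega> \<in> cgrid (\<lambda>j. 1 * ?b (u + ugrid (t - u) n j)) (ugrid (t - u) n) (Suc n) ?y" by simp
        qed
        then show "indicator (surv ?b u t ?y) \<omega> \<le> (indicator (cgrid (\<lambda>j. 1 * ?b (u + ugrid (t - u) n j)) (ugrid (t - u) n) (Suc n) ?y) \<omega> :: ennreal)" for \<omega>
          by (auto simp: indicator_def)
      qed simp
      show "\<forall>\<^sub>F n in sequentially. nn_surv ?b u t ?h ?y \<le> ennreal (exp (err \<kappa> u)) * (ennreal ?r * U 1 (\<sigma> n))"
        using small by eventually_elim (use le sand(1) order_trans in blast)
    qed simp
    \<comment> \<open>Weak survival below the shrunken barrier is contained in strict survival below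
      \<open>?b\<close>. On the clock side the grid event is intersected with strict survival, which
      can only decrease a lower bound.\<close>
    have low: "ennreal (exp (- err \<kappa> u)) * (ennreal ?r * nn_surv (\<lambda>_. shrink m) 0 A (\<lambda>z. ennreal (?k z)) x) \<le> nn_surv ?b u t ?h ?y" for m
    proof -
      let ?c = "shrink m"
      have c: "0 < ?c" "?c \<le> 1" using shrink_bounds[of m] by auto
      define V where "V n = (\<integral>\<^sup>+\<omega>. ennreal (?k (x + W (a n (N n)) \<omega>)) * indicator (cgrid (\<lambda>_. ?c) (a n) (N n) x \<inter> surv (\<lambda>_. ?c) 0 A x) \<omega> \<partial>M)" for n
      have V: "V \<longlonglongrightarrow> nn_surv (\<lambda>_. ?c) 0 A (\<lambda>z. ennreal (?k z)) x"
        unfolding V_def by (rule nn_cgrid_limit(2)[OF k kB A0 x a0 ab aN mesh c(1)])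
      have VU: "V n \<le> U ?c (\<sigma> n)" for n
        unfolding V_def U_def a_def N_def by (intro nn_integral_mono mult_left_mono) (auto simp: indicator_def)
      have cb: "continuous_on {u..t} (\<lambda>r. ?c * ?b r)" using bc by (intro continuous_intros)
      have Xlim: "(\<lambda>n. X ?c n) \<longlonglongrightarrow> nn_closed (\<lambda>r. ?c * ?b r) u t ?h ?y"
        unfolding X_def by (rule nn_closed_grid_limit[OF _ hB'(1) _ cb u(2)]) auto
      have "ennreal (exp (- err \<kappa> u)) * (ennreal ?r * nn_surv (\<lambda>_. ?c) 0 A (\<lambda>z. ennreal (?k z)) x) \<le> nn_closed (\<lambda>r. ?c * ?b r) u t ?h ?y"
      proof (rule tendsto_le[OF _ LIMSEQ_subseq_LIMSEQ[OF Xlim \<sigma>, unfolded o_def]])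
        show "(\<lambda>n. ennreal (exp (- err \<kappa> u)) * (ennreal ?r * V n)) \<longlonglongrightarrow> ennreal (exp (- err \<kappa> u)) * (ennreal ?r * nn_surv (\<lambda>_. ?c) 0 A (\<lambda>z. ennreal (?k z)) x)"
          by (intro ennreal_tendsto_cmult V) auto
        show "\<forall>\<^sub>F n in sequentially. ennreal (exp (- err \<kappa> u)) * (ennreal ?r * V n) \<le> X ?c (\<sigma> n)"
          using small
        proof eventually_elim
          case (elim n)
          have "ennreal (exp (- err \<kappa> u)) * (ennreal ?r * V n) \<le> ennreal (exp (- err \<kappa> u)) * (ennreal ?r * U ?c (\<sigma> n))"
            by (intro mult_left_mono VU) auto
          also have "\<dots> \<le> X ?c (\<sigma> n)" by (rule sand(2)[OF elim c(2)])
          finally show ?case .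
        qed
      qed simp
      also have "\<dots> \<le> nn_surv ?b u t ?h ?y"
        unfolding nn_closed_def nn_surv_def
      proof (intro nn_integral_mono mult_left_mono)
        have "?c * ?b r < ?b r" if "r \<in> {u..t}" for r using bc(2)[OF that] shrink_bounds[of m] by simp
        then have "csurv (\<lambda>r. ?c * ?b r) u t ?y \<subseteq> surv ?b u t ?y"
          by (fastforce simp: csurv_def surv_def)
        then show "indicator (csurv (\<lambda>r. ?c * ?b r) u t ?y) \<omega> \<le> (indicator (surv ?b u t ?y) \<omega> :: ennreal)" for \<omega>
          by (auto simp: indicator_def)
      qed simp
      finally show ?thesis .
    qed
    have lower: "ennreal (exp (- err \<kappa> u)) * (ennreal ?r * nn_surv (\<lambda>_. 1) 0 A (\<lambda>z. ennreal (?k z)) x) \<le> nn_surv ?b u t ?h ?y"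
    proof (rule tendsto_upperbound)
      show "(\<lambda>m. ennreal (exp (- err \<kappa> u)) * (ennreal ?r * nn_surv (\<lambda>_. shrink m) 0 A (\<lambda>z. ennreal (?k z)) x)) \<longlonglongrightarrow>
        ennreal (exp (- err \<kappa> u)) * (ennreal ?r * nn_surv (\<lambda>_. 1) 0 A (\<lambda>z. ennreal (?k z)) x)"
        by (intro ennreal_tendsto_cmult nn_surv_shrink[OF _ hB'(2) _ A0]) auto
      show "\<forall>\<^sub>F m in sequentially. ennreal (exp (- err \<kappa> u)) * (ennreal ?r * nn_surv (\<lambda>_. shrink m) 0 A (\<lambda>z. ennreal (?k z)) x) \<le> nn_surv ?b u t ?h ?y"
        using low by simp
    qed simp
    have eX: "nn_surv ?b u t ?h ?y = ennreal (rsurv ?b u t h ?y)"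
      by (rule rsurv_nn) (use hB bc u in auto)
    have eK: "nn_surv (\<lambda>_. 1) 0 A (\<lambda>z. ennreal (?k z)) x = ennreal (kill A ?k x)"
      unfolding kill_eq_rsurv by (rule rsurv_nn) (use kB A0 in auto)
    have K0: "0 \<le> kill A ?k x" by (rule kill_nonneg) (rule kB)
    have X0: "0 \<le> rsurv ?b u t h ?y" by (rule rsurv_nonneg) (use hB in auto)
    have r0: "0 \<le> ?r" using bp by simp
    have m: "ennreal (exp e) * (ennreal ?r * ennreal (kill A ?k x)) = ennreal (exp e * (?r * kill A ?k x))" for e
      using r0 K0 by (simp add: ennreal_mult)
    show "exp (- err \<kappa> u) * (?r * kill A ?k x) \<le> rsurv ?b u t h ?y \<and> rsurv ?b u t h ?y \<le> exp (err \<kappa> u) * (?r * kill A ?k x)"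
      using lower upper unfolding eX eK m
      by (subst (asm) ennreal_le_iff, simp add: X0, subst (asm) ennreal_le_iff, use r0 K0 in simp, simp)
  qed
qed

end

section \<open>The conditioned process\<close>

text \<open>The times \<open>u\<close> fall into an initial stretch up to \<open>u1\<close>, a final
  window of length \<open>T * (bd \<kappa> t)\<^sup>2\<close>, and the rest. On the first two the
  integrand is merely bounded, but the window is of order \<open>t\<close> to the power
  \<open>2 * \<kappa> < 1\<close> and hence negligible after division by \<open>t\<close>.\<close>

lemma average_limit:
  fixes R :: "real \<Rightarrow> real \<Rightarrow> real"
  assumes \<kappa>: "0 < \<kappa>" "\<kappa> < 1/2" and s: "0 \<le> s" and L: "0 \<le> L"
    and cont: "\<And>t. s < t \<Longrightarrow> continuous_on {s..t} (R t)"
    and bound: "\<And>t u. s < t \<Longrightarrow> u \<in> {s..t} \<Longrightarrow> 0 \<le> R t u \<and> R t u \<le> B"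
    and lim: "\<And>e. 0 < e \<Longrightarrow> \<exists>u1\<ge>s. \<exists>T>0. \<forall>t u. u1 \<le> u \<longrightarrow> u < t \<longrightarrow> T * (bd \<kappa> t)\<^sup>2 \<le> t - u \<longrightarrow> \<bar>R t u - L\<bar> \<le> e"
  shows "((\<lambda>t. (1 / t) * (\<integral>u\<in>{s..t}. R t u \<partial>lborel)) \<longlongrightarrow> L) at_top"
proof (rule tendstoI)
  fix e :: real assume e: "0 < e"
  then have "0 < e / 2" by simp
  from lim[OF this] obtain u1 T where u1: "s \<le> u1" and T: "0 < T"
    and near: "\<And>t u. u1 \<le> u \<Longrightarrow> u < t \<Longrightarrow> T * (bd \<kappa> t)\<^sup>2 \<le> t - u \<Longrightarrow> \<bar>R t u - L\<bar> \<le> e / 2" by blast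
  have B: "0 \<le> B" using bound[of "s + 1" s] by auto
  define w where "w t = T * (bd \<kappa> t)\<^sup>2" for t
  have w: "0 \<le> w t" for t using T by (simp add: w_def)
  let ?C = "B + L"
  have main: "\<bar>(\<integral>u\<in>{s..t}. R t u \<partial>lborel) - L * (t - s)\<bar> \<le> e / 2 * (t - s) + ?C * ((u1 - s) + w t)"
    if t: "s < t" for t
  proof -
    have iR: "integrable lborel (\<lambda>u. indicator {s..t} u * R t u)"
      using borel_integrable_atLeastAtMost'[OF cont[OF t]] by (simp add: set_integrable_def)
    have iI: "integrable lborel (\<lambda>u. indicator {a..b} u * c)" for a b c :: real by (cases "a \<le> b") auto
    let ?D = "\<lambda>u. indicator {s..t} u * R t u - indicator {s..t} u * L"
    let ?E = "\<lambda>u. indicator {s..t} u * (e / 2) + (indicator {s..u1} u * ?C + indicator {t - w t..t} u * ?C)"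
    have pw: "\<bar>?D u\<bar> \<le> ?E u" for u
    proof (cases "u \<in> {s..t}")
      case True
      have b: "\<bar>R t u - L\<bar> \<le> ?C" using bound[OF t True] L by auto
      have C: "0 \<le> ?C" using B L by simp
      consider "u \<le> u1" | "t - w t \<le> u" | "u1 \<le> u" "u < t" "w t \<le> t - u" using w[of t]
        by (cases "u \<le> u1"; cases "t - w t \<le> u") auto
      then show ?thesis
      proof cases
        case 1
        then show ?thesis using True b C e by (auto simp: indicator_def intro: order_trans)
      next
        case 2
        then show ?thesis using True b C e by (auto simp: indicator_def intro: order_trans)
      next
        case 3
        then have "\<bar>R t u - L\<bar> \<le> e / 2" using near by (simp add: w_def)
        then show ?thesis using True C by (auto simp: indicator_def)
      qed
    next
      case False
      then show ?thesis using B L by (simp add: indicator_def)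
    qed
    have iD: "integrable lborel ?D" using iR iI by (intro Bochner_Integration.integrable_diff)
    have iE: "integrable lborel ?E" by (intro Bochner_Integration.integrable_add iI)
    have eq: "(\<integral>u\<in>{s..t}. R t u \<partial>lborel) - L * (t - s) = (\<integral>u. ?D u \<partial>lborel)"
      using iR iI[of s t L] t by (simp add: set_lebesgue_integral_def)
    have "\<bar>\<integral>u. ?D u \<partial>lborel\<bar> \<le> (\<integral>u. \<bar>?D u\<bar> \<partial>lborel)" by (rule integral_abs_bound)
    also have "\<dots> \<le> (\<integral>u. ?E u \<partial>lborel)"
      by (rule integral_mono) (use iD iE pw in auto)
    also have "\<dots> = (\<integral>u. indicator {s..t} u * (e / 2) \<partial>lborel) +
       ((\<integral>u. indicator {s..u1} u * ?C \<partial>lborel) + (\<integral>u. indicator {t - w t..t} u * ?C \<partial>lborel))"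
      by (subst Bochner_Integration.integral_add, rule iI, intro Bochner_Integration.integrable_add iI,
          subst Bochner_Integration.integral_add, (rule iI)+, rule refl)
    also have "\<dots> = (t - s) * (e / 2) + ((u1 - s) * ?C + w t * ?C)"
    proof -
      have "(\<integral>u. indicator {a..b} u * c \<partial>lborel) = (b - a) * c" if "a \<le> b" for a b c :: real
        using that by simp
      from this[of s t] this[of s u1] this[of "t - w t" t] show ?thesis using t u1 w[of t] by simp
    qed
    finally show ?thesis unfolding eq by (simp add: algebra_simps)
  qed
  \<comment> \<open>The tolerance is split into \<open>e / 4\<close> for replacing the length
    \<open>t - s\<close> by \<open>t\<close>, and \<open>3 * e / 4\<close> for the remaining terms,
    whose limit is \<open>e / 2\<close>.\<close>
  have "((\<lambda>t. L * (t - s) / t) \<longlongrightarrow> L) at_top" by real_asymp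
  from tendstoD[OF this, of "e / 4"] have "\<forall>\<^sub>F t in at_top. \<bar>L * (t - s) / t - L\<bar> < e / 4"
    using e by (simp add: dist_real_def)
  moreover have "((\<lambda>t. (e / 2 * (t - s) + ?C * ((u1 - s) + w t)) / t) \<longlongrightarrow> e / 2) at_top"
    unfolding w_def bd_def using \<kappa> by real_asymp
  then have "\<forall>\<^sub>F t in at_top. (e / 2 * (t - s) + ?C * ((u1 - s) + w t)) / t < 3 * e / 4"
    by (rule order_tendstoD) (use e in simp)
  ultimately show "\<forall>\<^sub>F t in at_top. dist ((1 / t) * (\<integral>u\<in>{s..t}. R t u \<partial>lborel)) L < e"
    using eventually_gt_at_top[of s]
  proof eventually_elim
    case (elim t)
    let ?J = "\<integral>u\<in>{s..t}. R t u \<partial>lborel"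
    have t: "0 < t" using elim s by simp
    have "\<bar>?J - L * (t - s)\<bar> / t \<le> (e / 2 * (t - s) + ?C * ((u1 - s) + w t)) / t"
      using main[OF elim(3)] t by (intro divide_right_mono) auto
    moreover have "\<bar>?J - L * (t - s)\<bar> / t = \<bar>(1 / t) * ?J - L * (t - s) / t\<bar>"
      using t by (simp add: diff_divide_distrib[symmetric])
    ultimately have "\<bar>(1 / t) * ?J - L * (t - s) / t\<bar> < 3 * e / 4" using elim(2) by linarith
    then show ?case unfolding dist_real_def using elim(1) by linarith
  qed
qed

section \<open>The rescaled process started from \<open>\<mu>\<close>\<close>

locale moving_boundary = brownian M W for M :: "'a measure" and W +
  fixes \<kappa> s :: real and \<mu> :: "real measure"
  assumes \<kappa>: "0 < \<kappa>" "\<kappa> < 1/2" and s: "0 \<le> s"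
    and sets_mu: "sets \<mu> = sets borel" and prob_mu: "prob_space \<mu>" and supp_mu: "emeasure \<mu> {-1<..<1} = 1"
begin

sublocale mu: prob_space \<mu> by (rule prob_mu)

lemma AE_mu: "AE x in \<mu>. \<bar>x\<bar> < 1"
  by (rule AE_unit[OF prob_mu sets_mu supp_mu])

abbreviation g where "g \<equiv> bd \<kappa>"

lemma g_pos: "0 \<le> t \<Longrightarrow> 0 < g t"
  by (rule bd_pos)

lemma g_cont: "0 \<le> a \<Longrightarrow> continuous_on {a..b} g"
  by (rule bd_continuous)

lemma Xproc_eq: "Xproc \<kappa> W s x r \<omega> = (g s * x + W (r - s) \<omega>) / g r"
  by (simp add: Xproc_def bd_def mult.commute)

lemma Xproc_continuous:
  assumes "\<omega> \<in> space M"
  shows "continuous_on {s..} (\<lambda>r. Xproc \<kappa> W s x r \<omega>)"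
  unfolding Xproc_def
proof (intro continuous_intros)
  show "continuous_on {s..} (\<lambda>r. W (r - s) \<omega>)"
    by (rule continuous_on_compose2[OF W_continuous[OF assms]]) (auto intro!: continuous_intros)
qed (use s in auto)

text \<open>Multiplication by the barrier turns level 1 of the rescaled process into the barrier
  \<open>g\<close> for the Brownian path.\<close>

lemma tauX_gt_iff:
  assumes \<omega>: "\<omega> \<in> space M" and st: "s \<le> t"
  shows "ereal t < tauX \<kappa> W s x \<omega> \<longleftrightarrow>
    \<omega> \<in> surv g s t (g s * x) \<or> \<omega> \<in> above 1 g s t (g s * x) \<or> \<omega> \<in> above (-1) g s t (g s * x)"
proof -
  let ?X = "\<lambda>r. Xproc \<kappa> W s x r \<omega>"
  have c: "continuous_on {s..t} ?X" by (rule continuous_on_subset[OF Xproc_continuous[OF \<omega>]]) auto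
  have a: "\<bar>?X r\<bar> < 1 \<longleftrightarrow> \<bar>g s * x + W (r - s) \<omega>\<bar> < g r"
    and b: "1 < q * ?X r \<longleftrightarrow> g r < q * (g s * x + W (r - s) \<omega>)" if "r \<in> {s..t}" for r q
    using g_pos[of r] that s by (auto simp: Xproc_eq divide_simps abs_less_iff minus_less_iff)
  have e1: "(\<forall>r\<in>{s..t}. \<bar>?X r\<bar> < 1) \<longleftrightarrow> \<omega> \<in> surv g s t (g s * x)" using \<omega> a by (simp add: surv_def)
  have e2: "(\<forall>r\<in>{s..t}. 1 < q * ?X r) \<longleftrightarrow> \<omega> \<in> above q g s t (g s * x)" for q using \<omega> b by (simp add: above_def)
  show ?thesis
    unfolding tauX_def hitting_time_gt_iff[OF Xproc_continuous[OF \<omega>] st] avoiding_one_cases[OF c st] e1 e2 ..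
qed

lemma tauX_gt_iff_surv:
  assumes \<omega>: "\<omega> \<in> space M" and st: "s \<le> t" and x: "\<bar>x\<bar> < 1"
  shows "ereal t < tauX \<kappa> W s x \<omega> \<longleftrightarrow> \<omega> \<in> surv g s t (g s * x)"
proof -
  have "\<omega> \<notin> above c g s t (g s * x)" if "\<bar>c\<bar> = 1" for c
  proof
    assume "\<omega> \<in> above c g s t (g s * x)"
    then have "\<forall>r\<in>{s..t}. g r < c * (g s * x + W (r - s) \<omega>)" by (simp add: above_def)
    then have "g s < c * (g s * x + W (s - s) \<omega>)" by (rule bspec) (use st in simp)
    then have "g s * 1 < g s * (c * x)" by (simp add: W_0 \<omega> mult.left_commute)
    then have "1 < c * x" using g_pos[OF s] by (simp only: mult_less_cancel_left_pos)
    moreover have "\<bar>c * x\<bar> < 1" using that x by (simp add: abs_mult)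
    ultimately show False by simp
  qed
  then show ?thesis using tauX_gt_iff[OF \<omega> st] by auto
qed

lemma tauX_pair_measurable:
  assumes st: "s < t"
  shows "(\<lambda>z. indicator {\<omega>. tauX \<kappa> W s (fst z) \<omega> > ereal t} (snd z) :: real) \<in> borel_measurable (borel \<Otimes>\<^sub>M M)"
proof -
  have p: "0 < g r" if "r \<in> {s..t}" for r using that s by (intro g_pos) auto
  let ?i = "\<lambda>z :: real \<times> 'a. (g s * fst z, snd z)"
  have i: "?i \<in> measurable (borel \<Otimes>\<^sub>M M) (borel \<Otimes>\<^sub>M M)" by measurable
  let ?s = "\<lambda>z. indicator (surv g s t (fst (?i z))) (snd (?i z)) :: real"
  let ?a = "\<lambda>c z. indicator (above c g s t (fst (?i z))) (snd (?i z)) :: real"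
  have "?s \<in> borel_measurable (borel \<Otimes>\<^sub>M M)"
    by (rule measurable_compose[OF i surv_pair_measurable[OF g_cont[OF s] _ st]]) (rule p)
  moreover have "?a c \<in> borel_measurable (borel \<Otimes>\<^sub>M M)" for c
    by (rule measurable_compose[OF i above_pair_measurable[OF g_cont[OF s] st]])
  ultimately have "(\<lambda>z. max (?s z) (max (?a 1 z) (?a (-1) z))) \<in> borel_measurable (borel \<Otimes>\<^sub>M M)" by (intro borel_measurable_max)
  then show ?thesis
    by (rule measurable_cong[THEN iffD1, rotated])
      (use st in \<open>auto simp: indicator_def space_pair_measure tauX_gt_iff max_def\<close>)
qed

definition num :: "(real \<Rightarrow> real) \<Rightarrow> real \<Rightarrow> real \<Rightarrow> real \<Rightarrow> real" where
  "num f u t x = (\<integral>\<omega>. f (Xproc \<kappa> W s x u \<omega>) * indicator {\<omega>. tauX \<kappa> W s x \<omega> > ereal t} \<omega> \<partial>M)"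

lemma Emu_eq: "Emu_surv M \<mu> \<kappa> W s f u t = (\<integral>x. num f u t x \<partial>\<mu>)"
  by (simp add: Emu_surv_def num_def)

text \<open>For the constant function 1 the time \<open>u\<close> is arbitrary; numerator and
  denominator thus become instances of one expression with the same \<open>u\<close>.\<close>

lemma Pmu_eq: "Pmu_surv M \<mu> \<kappa> W s t = (\<integral>x. num (\<lambda>_. 1) u t x \<partial>\<mu>)"
proof -
  have "measure M {\<omega>\<in>space M. tauX \<kappa> W s x \<omega> > ereal t} = num (\<lambda>_. 1) u t x" for x
  proof -
    have "num (\<lambda>_. 1) u t x = (\<integral>\<omega>. indicator {\<omega>\<in>space M. tauX \<kappa> W s x \<omega> > ereal t} \<omega> \<partial>M)"
      unfolding num_def by (intro Bochner_Integration.integral_cong refl) (simp add: indicator_def)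
    then show ?thesis by (simp add: Int_absorb2 subset_eq)
  qed
  then show ?thesis by (simp add: Pmu_surv_def)
qed

lemma num_integrand_pair:
  fixes f :: "real \<Rightarrow> real"
  assumes [measurable]: "f \<in> borel_measurable borel" and st: "s < t" and su: "s \<le> u"
  shows "(\<lambda>z. f (Xproc \<kappa> W s (fst z) u (snd z)) * indicator {\<omega>. tauX \<kappa> W s (fst z) \<omega> > ereal t} (snd z)) \<in> borel_measurable (borel \<Otimes>\<^sub>M M)"
proof (rule borel_measurable_times[OF _ tauX_pair_measurable[OF st]])
  have [measurable]: "W (u - s) \<in> borel_measurable M" using su by simp
  show "(\<lambda>z. f (Xproc \<kappa> W s (fst z) u (snd z))) \<in> borel_measurable (borel \<Otimes>\<^sub>M M)"
    unfolding Xproc_def by measurable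
qed

lemma num_measurable:
  assumes f: "f \<in> borel_measurable borel" and st: "s < t" and su: "s \<le> u"
  shows "num f u t \<in> borel_measurable borel"
  unfolding num_def[abs_def]
  by (rule borel_measurable_lebesgue_integral) (use num_integrand_pair[OF assms] in \<open>simp add: split_beta'\<close>)

lemma num_integrand:
  fixes f :: "real \<Rightarrow> real"
  assumes f: "f \<in> borel_measurable borel" and st: "s < t" and su: "s \<le> u"
  shows "(\<lambda>\<omega>. f (Xproc \<kappa> W s x u \<omega>) * indicator {\<omega>. tauX \<kappa> W s x \<omega> > ereal t} \<omega>) \<in> borel_measurable M"
  using measurable_compose[OF measurable_Pair1'[of x borel M] num_integrand_pair[OF assms]] by simp

lemma num_bound:
  assumes f: "f \<in> borel_measurable borel" "\<And>z. \<bar>f z\<bar> \<le> B" and st: "s < t" and su: "s \<le> u"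
  shows "\<bar>num f u t x\<bar> \<le> B"
  unfolding num_def
  by (rule abs_integral_le[OF num_integrand[OF f(1) st su]])
    (use f(2) order_trans[OF abs_ge_zero f(2)[of 0]] in \<open>auto simp: indicator_def\<close>)

lemma mu_integrable:
  assumes [measurable]: "h \<in> borel_measurable borel" and "\<And>x. \<bar>h x\<bar> \<le> B"
  shows "integrable \<mu> (h :: real \<Rightarrow> real)"
proof -
  note [measurable_cong] = sets_mu
  show ?thesis by (rule mu.integrable_const_bound[where B=B]) (use assms in auto)
qed

lemma num_integrable:
  assumes "f \<in> borel_measurable borel" "\<And>z. \<bar>f z\<bar> \<le> B" "s < t" "s \<le> u"
  shows "integrable \<mu> (num f u t)"
  by (rule mu_integrable[OF num_measurable num_bound]) (use assms in auto)

text \<open>Continuity in \<open>u\<close> gives integrability on \<open>{s..t}\<close>, so that the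
  time average is a genuine integral and not a default value.\<close>

lemma Emu_continuous:
  assumes f: "continuous_on UNIV f" "\<And>z. \<bar>f z\<bar> \<le> B" and st: "s < t"
  shows "continuous_on {s..t} (\<lambda>u. Emu_surv M \<mu> \<kappa> W s f u t)"
  unfolding continuous_on_sequentially
proof (intro allI ballI impI)
  fix u :: "nat \<Rightarrow> real" and v assume v: "v \<in> {s..t}" and u: "(\<forall>n. u n \<in> {s..t}) \<and> u \<longlonglongrightarrow> v"
  have fm: "f \<in> borel_measurable borel" using f(1) by (rule borel_measurable_continuous_onI)
  have B: "0 \<le> B" by (rule order_trans[OF abs_ge_zero f(2)[of 0]])
  have su: "s \<le> u n" "s \<le> v" for n using u v by auto
  have inner: "(\<lambda>n. num f (u n) t x) \<longlonglongrightarrow> num f v t x" for x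
    unfolding num_def
  proof (rule bounded_convergence[where B=B])
    fix \<omega> assume \<omega>: "\<omega> \<in> space M"
    have "(\<lambda>n. Xproc \<kappa> W s x (u n) \<omega>) \<longlonglongrightarrow> Xproc \<kappa> W s x v \<omega>"
      by (rule continuous_on_tendsto_compose[OF Xproc_continuous[OF \<omega>]]) (use u v in auto)
    then have "(\<lambda>n. f (Xproc \<kappa> W s x (u n) \<omega>)) \<longlonglongrightarrow> f (Xproc \<kappa> W s x v \<omega>)"
      by (rule continuous_on_tendsto_compose[OF f(1)]) auto
    then show "(\<lambda>n. f (Xproc \<kappa> W s x (u n) \<omega>) * indicator {\<omega>. tauX \<kappa> W s x \<omega> > ereal t} \<omega>)
      \<longlonglongrightarrow> f (Xproc \<kappa> W s x v \<omega>) * indicator {\<omega>. tauX \<kappa> W s x \<omega> > ereal t} \<omega>"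
      by (intro tendsto_intros)
  next
    show "\<bar>f (Xproc \<kappa> W s x (u n) \<omega>) * indicator {\<omega>. tauX \<kappa> W s x \<omega> > ereal t} \<omega>\<bar> \<le> B" for n \<omega>
      using f(2) B by (auto simp: indicator_def)
  qed (use num_integrand[OF fm st] su in auto)
  have "(\<lambda>n. \<integral>x. num f (u n) t x \<partial>\<mu>) \<longlonglongrightarrow> (\<integral>x. num f v t x \<partial>\<mu>)"
  proof (rule integral_dominated_convergence[where w="\<lambda>_. B"])
    note [measurable_cong] = sets_mu
    have [measurable]: "num f (u n) t \<in> borel_measurable borel" "num f v t \<in> borel_measurable borel" for n
      by (rule num_measurable[OF fm st su(1)]) (rule num_measurable[OF fm st su(2)])
    show "num f v t \<in> borel_measurable \<mu>" "num f (u n) t \<in> borel_measurable \<mu>" for n by measurable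
    show "AE x in \<mu>. (\<lambda>n. num f (u n) t x) \<longlonglongrightarrow> num f v t x" using inner by simp
    show "AE x in \<mu>. norm (num f (u n) t x) \<le> B" for n
      using num_bound[OF fm f(2) st su(1)] by simp
  qed simp
  then show "((\<lambda>u. Emu_surv M \<mu> \<kappa> W s f u t) \<circ> u) \<longlonglongrightarrow> Emu_surv M \<mu> \<kappa> W s f v t"
    by (simp add: o_def Emu_eq)
qed

text \<open>Integration against the unnormalised law at time \<open>U\<close> of the rescaled path
  that has survived since \<open>s\<close>: a measure of mass at most 1 on the open unit
  interval.\<close>

definition entry :: "real \<Rightarrow> (real \<Rightarrow> real) \<Rightarrow> real" where
  "entry U h = (\<integral>x. rsurv g s U (\<lambda>z. h (z / g U)) (g s * x) \<partial>\<mu>)"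

lemma g_cont_pos:
  assumes "0 \<le> a"
  shows "continuous_on {a..b} g" "\<And>r. r \<in> {a..b} \<Longrightarrow> 0 < g r"
  using g_cont g_pos assms by auto

lemma rsurv_mu_integrable:
  assumes h: "h \<in> borel_measurable borel" "\<And>z. \<bar>h z\<bar> \<le> B" and U: "s < U"
  shows "integrable \<mu> (\<lambda>x. rsurv g s U h (g s * x))"
proof (rule mu_integrable)
  have "(\<lambda>x. g s * x) \<in> borel_measurable borel"
    by (intro borel_measurable_continuous_onI continuous_intros)
  then show "(\<lambda>x. rsurv g s U h (g s * x)) \<in> borel_measurable borel"
    by (rule measurable_compose[OF _ rsurv_measurable[OF h(1) g_cont_pos[OF s] U]])
  show "\<bar>rsurv g s U h (g s * x)\<bar> \<le> B" for x
    by (rule rsurv_bound[OF h g_cont_pos[OF s] U])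
qed

text \<open>The underlying measure has mass at most 1 and is carried by the open unit interval, so
  uniform closeness there suffices; this is the form in which spectral convergence is
  available.\<close>

lemma entry_close:
  assumes h[measurable]: "h \<in> borel_measurable borel" and hB: "\<And>z. \<bar>h z\<bar> \<le> B"
    and k[measurable]: "k \<in> borel_measurable borel" and kB: "\<And>z. \<bar>k z\<bar> \<le> C"
    and U: "s < U" and close: "\<And>z. \<bar>z\<bar> < 1 \<Longrightarrow> \<bar>h z - k z\<bar> \<le> d" and d: "0 \<le> d"
  shows "\<bar>entry U h - entry U k\<bar> \<le> d"
proof -
  let ?h = "\<lambda>x. rsurv g s U (\<lambda>z. h (z / g U)) (g s * x)" and ?k = "\<lambda>x. rsurv g s U (\<lambda>z. k (z / g U)) (g s * x)"
  have U0: "0 < g U" using U s by (intro g_pos) simp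
  have i: "integrable \<mu> ?h" "integrable \<mu> ?k"
    by (rule rsurv_mu_integrable[OF _ hB U], measurable) (rule rsurv_mu_integrable[OF _ kB U], measurable)
  have pw: "\<bar>?h x - ?k x\<bar> \<le> d" for x
  proof -
    let ?S = "surv g s U (g s * x)" and ?Y = "\<lambda>\<omega>. g s * x + W (U - s) \<omega>"
    note gc = g_cont_pos[OF s, where b=U]
    have ii: "integrable M (\<lambda>\<omega>. h (?Y \<omega> / g U) * indicator ?S \<omega>)" "integrable M (\<lambda>\<omega>. k (?Y \<omega> / g U) * indicator ?S \<omega>)"
      by (rule rsurv_integrable[of "\<lambda>z. h (z / g U)" B s U g "g s * x", OF _ hB gc U], measurable)
        (rule rsurv_integrable[of "\<lambda>z. k (z / g U)" C s U g "g s * x", OF _ kB gc U], measurable)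
    have "?h x - ?k x = (\<integral>\<omega>. h (?Y \<omega> / g U) * indicator ?S \<omega> - k (?Y \<omega> / g U) * indicator ?S \<omega> \<partial>M)"
      using ii by (simp add: rsurv_def)
    moreover have "\<bar>\<integral>\<omega>. h (?Y \<omega> / g U) * indicator ?S \<omega> - k (?Y \<omega> / g U) * indicator ?S \<omega> \<partial>M\<bar> \<le> d"
    proof (rule abs_integral_le)
      show "(\<lambda>\<omega>. h (?Y \<omega> / g U) * indicator ?S \<omega> - k (?Y \<omega> / g U) * indicator ?S \<omega>) \<in> borel_measurable M"
        using ii by (intro borel_measurable_diff borel_measurable_integrable)
      fix \<omega> assume "\<omega> \<in> space M"
      show "\<bar>h (?Y \<omega> / g U) * indicator ?S \<omega> - k (?Y \<omega> / g U) * indicator ?S \<omega>\<bar> \<le> d"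
      proof (cases "\<omega> \<in> ?S")
        case True
        then have "\<bar>?Y \<omega> / g U\<bar> < 1" using surv_endpoint[OF True] U U0 by (simp add: divide_simps)
        then show ?thesis using True close by simp
      qed (simp add: d)
    qed
    ultimately show ?thesis by simp
  qed
  have "entry U h - entry U k = (\<integral>x. ?h x - ?k x \<partial>\<mu>)" using i by (simp add: entry_def)
  moreover have "\<bar>\<integral>x. ?h x - ?k x \<partial>\<mu>\<bar> \<le> (\<integral>x. \<bar>?h x - ?k x\<bar> \<partial>\<mu>)" by (rule integral_abs_bound)
  moreover have "(\<integral>x. \<bar>?h x - ?k x\<bar> \<partial>\<mu>) \<le> (\<integral>x. d \<partial>\<mu>)"
    by (rule integral_mono) (use i pw in auto)
  moreover have "(\<integral>x. d \<partial>\<mu>) = d" by (simp add: mu.prob_space)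
  ultimately show ?thesis by linarith
qed

lemma entry_cmult: "entry U (\<lambda>z. c * h z) = c * entry U h"
  by (simp add: entry_def rsurv_cmult)

lemma entry_mono:
  assumes h[measurable]: "h \<in> borel_measurable borel" and hB: "\<And>z. \<bar>h z\<bar> \<le> B"
    and k[measurable]: "k \<in> borel_measurable borel" and kB: "\<And>z. \<bar>k z\<bar> \<le> C"
    and U: "s < U" and le: "\<And>z. \<bar>z\<bar> < 1 \<Longrightarrow> h z \<le> k z"
  shows "entry U h \<le> entry U k"
  unfolding entry_def
proof (rule integral_mono)
  have U0: "0 < g U" using U s by (intro g_pos) simp
  show "integrable \<mu> (\<lambda>x. rsurv g s U (\<lambda>z. h (z / g U)) (g s * x))"
    by (rule rsurv_mu_integrable[OF _ hB U]) measurable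
  show "integrable \<mu> (\<lambda>x. rsurv g s U (\<lambda>z. k (z / g U)) (g s * x))"
    by (rule rsurv_mu_integrable[OF _ kB U]) measurable
  show "rsurv g s U (\<lambda>z. h (z / g U)) (g s * x) \<le> rsurv g s U (\<lambda>z. k (z / g U)) (g s * x)" for x
  proof (rule rsurv_mono[OF _ hB _ kB g_cont_pos[OF s] U])
    show "h (z / g U) \<le> k (z / g U)" if "\<bar>z\<bar> < g U" for z
      by (rule le) (use that U0 in \<open>simp add: divide_simps\<close>)
  qed measurable
qed


section \<open>Two-sided bounds through the killed semigroup\<close>

lemma num_eq_rsurv:
  assumes f[measurable]: "f \<in> borel_measurable borel" and fB: "\<And>z. 0 \<le> f z" "\<And>z. f z \<le> B"
    and ut: "s < u" "u < t" and x: "\<bar>x\<bar> < 1"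
  shows "num f u t x = rsurv g s u (\<lambda>z. f (z / g u) * rsurv g u t (\<lambda>_. 1) z) (g s * x)"
proof -
  have "num f u t x = (\<integral>\<omega>. f ((g s * x + W (u - s) \<omega>) / g u) * 1 * indicator (surv g s t (g s * x)) \<omega> \<partial>M)"
    unfolding num_def
  proof (intro Bochner_Integration.integral_cong refl)
    fix \<omega> assume \<omega>: "\<omega> \<in> space M"
    show "f (Xproc \<kappa> W s x u \<omega>) * indicator {\<omega>. ereal t < tauX \<kappa> W s x \<omega>} \<omega>
      = f ((g s * x + W (u - s) \<omega>) / g u) * 1 * indicator (surv g s t (g s * x)) \<omega>"
      using tauX_gt_iff_surv[OF \<omega> _ x, of t] ut by (simp add: Xproc_eq indicator_def)
  qed
  also have "\<dots> = rsurv g s u (\<lambda>z. f (z / g u) * rsurv g u t (\<lambda>_. 1) z) (g s * x)"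
    by (rule rsurv_markov[where f="\<lambda>z. f (z / g u)" and h="\<lambda>_. 1" and B="max B 1", OF _ _ _ _ _ _ g_cont_pos[OF s] ut])
      (use fB in \<open>auto intro: max.coboundedI1\<close>)
  finally show ?thesis .
qed

lemma rsurv_split:
  assumes h: "h \<in> borel_measurable borel" and hB: "\<And>z. 0 \<le> h z" "\<And>z. h z \<le> B" and Uu: "s < U" "U < u"
  shows "rsurv g s u h y = rsurv g s U (rsurv g U u h) y"
proof -
  have "rsurv g s u h y = (\<integral>\<omega>. 1 * h (y + W (u - s) \<omega>) * indicator (surv g s u y) \<omega> \<partial>M)"
    by (simp add: rsurv_def)
  also have "\<dots> = rsurv g s U (\<lambda>z. 1 * rsurv g U u h z) y"
    by (rule rsurv_markov[where f="\<lambda>_. 1" and h=h and B="max B 1", OF _ _ _ h _ _ g_cont_pos[OF s] Uu])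
      (use hB in \<open>auto intro: max.coboundedI1\<close>)
  finally show ?thesis by simp
qed

text \<open>\<open>comparison\<close> is stated for continuous functions, and one of its uses is for
  \<open>f\<close> times this survival probability.\<close>

lemma kill_one_continuous: "0 < t \<Longrightarrow> continuous_on UNIV (kill t (\<lambda>_. 1))"
proof -
  assume "0 < t"
  then obtain C where "0 \<le> C" "\<And>x x'. \<bar>kill t (\<lambda>_. 1) x - kill t (\<lambda>_. 1) x'\<bar> \<le> C * \<bar>x - x'\<bar>"
    using kill_one_lipschitz[of t] by blast
  then have "C-lipschitz_on UNIV (kill t (\<lambda>_. 1))" by (auto simp: lipschitz_on_def dist_real_def)
  then show ?thesis by (rule lipschitz_on_continuous_on)
qed

lemma err_antimono: "0 \<le> u \<Longrightarrow> u \<le> v \<Longrightarrow> err \<kappa> v \<le> err \<kappa> u"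
  unfolding err_def using \<kappa> by (intro mult_left_mono powr_mono2') auto

text \<open>Comparison is applied on \<open>{u..t}\<close> to the constant 1 and on
  \<open>{U..u}\<close> to \<open>f\<close> times the resulting survival probability. Each use costs
  an exponent of at most \<open>err \<kappa> U\<close>. The constant \<open>c\<close> is the product
  of the two square-root factors; being independent of \<open>f\<close> and \<open>x\<close>, it
  will cancel in the ratio.\<close>

lemma num_sandwich:
  assumes Uut: "s < U" "U < u" "u < t"
  obtains a b c where "(u - U) / (g u)\<^sup>2 \<le> a" "(t - u) / (g t)\<^sup>2 \<le> b" "0 < c"
    "\<And>f B x. continuous_on UNIV f \<Longrightarrow> (\<And>z. 0 \<le> f z) \<Longrightarrow> (\<And>z. f z \<le> B) \<Longrightarrow> \<bar>x\<bar> < 1 \<Longrightarrow>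
      exp (- 2 * err \<kappa> U) * (c * rsurv g s U (\<lambda>z. kill a (\<lambda>z. f z * kill b (\<lambda>_. 1) z) (z / g U)) (g s * x)) \<le> num f u t x \<and>
      num f u t x \<le> exp (2 * err \<kappa> U) * (c * rsurv g s U (\<lambda>z. kill a (\<lambda>z. f z * kill b (\<lambda>_. 1) z) (z / g U)) (g s * x))"
proof -
  have nn: "0 \<le> U" "0 \<le> u" "0 \<le> t" using s Uut by auto
  have pos: "0 < g U" "0 < g u" "0 < g t" using nn by (auto intro: g_pos)
  let ?r = "sqrt (g u / g U)" and ?r' = "sqrt (g t / g u)"
  have r: "0 < ?r" "0 < ?r'" using pos by auto
  from comparison[OF \<kappa> nn(1) Uut(2)] obtain a where a: "(u - U) / (g u)\<^sup>2 \<le> a"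
    and cmp: "\<And>h B x. continuous_on UNIV h \<Longrightarrow> (\<And>z. 0 \<le> h z \<and> h z \<le> B) \<Longrightarrow> \<bar>x\<bar> < 1 \<Longrightarrow>
      exp (- err \<kappa> U) * (?r * kill a (\<lambda>z. h (g u * z)) x) \<le> rsurv g U u h (g U * x) \<and>
      rsurv g U u h (g U * x) \<le> exp (err \<kappa> U) * (?r * kill a (\<lambda>z. h (g u * z)) x)"
    unfolding Bex_def atLeastAtMost_iff by metis
  from comparison[OF \<kappa> nn(2) Uut(3)] obtain b where b: "(t - u) / (g t)\<^sup>2 \<le> b"
    and cmp': "\<And>h B x. continuous_on UNIV h \<Longrightarrow> (\<And>z. 0 \<le> h z \<and> h z \<le> B) \<Longrightarrow> \<bar>x\<bar> < 1 \<Longrightarrow>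
      exp (- err \<kappa> u) * (?r' * kill b (\<lambda>z. h (g t * z)) x) \<le> rsurv g u t h (g u * x) \<and>
      rsurv g u t h (g u * x) \<le> exp (err \<kappa> u) * (?r' * kill b (\<lambda>z. h (g t * z)) x)"
    unfolding Bex_def atLeastAtMost_iff by metis
  have ab: "0 < a" "0 < b"
    using less_le_trans[OF _ a, of 0] less_le_trans[OF _ b, of 0] Uut pos by auto
  define e where "e = err \<kappa> U"
  have ee: "err \<kappa> u \<le> e" using err_antimono[OF nn(1)] Uut by (simp add: e_def)
  let ?k = "kill b (\<lambda>_. 1)"
  have k: "0 \<le> ?k z" "?k z \<le> 1" for z
    using kill_nonneg[of "\<lambda>_. 1" b z] kill_bound[of "\<lambda>_. 1" 1 b z] ab by (auto simp: abs_le_iff)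
  have kc: "continuous_on UNIV ?k" by (rule kill_one_continuous[OF ab(2)])
  show thesis
  proof (rule that[OF a b, of "?r * ?r'"])
    fix f :: "real \<Rightarrow> real" and B x :: real
    assume f: "continuous_on UNIV f" "\<And>z. 0 \<le> f z" "\<And>z. f z \<le> B" and x: "\<bar>x\<bar> < 1"
    have B: "0 \<le> B" using order_trans[OF f(2) f(3)[of 0]] .
    have fm[measurable]: "f \<in> borel_measurable borel" using f(1) by (rule borel_measurable_continuous_onI)
    have km[measurable]: "?k \<in> borel_measurable borel" using kc by (rule borel_measurable_continuous_onI)
    define h where "h z = f (z / g u) * ?k (z / g u)" for z
    have hc: "continuous_on UNIV h"
      unfolding h_def using pos
      by (intro continuous_intros continuous_on_compose2[OF f(1)] continuous_on_compose2[OF kc]) auto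
    have hm[measurable]: "h \<in> borel_measurable borel" using hc by (rule borel_measurable_continuous_onI)
    have hB: "0 \<le> h z" "h z \<le> B" for z
      using mult_mono[OF f(3)[of "z / g u"] k(2)[of "z / g u"]] f(2) k(1) B by (simp_all add: h_def)
    have hab: "\<bar>h z\<bar> \<le> B" for z using hB[of z] by simp
    define p where "p z = f (z / g u) * rsurv g u t (\<lambda>_. 1) z" for z
    have rm: "rsurv g u t (\<lambda>_. 1) \<in> borel_measurable borel"
      by (rule rsurv_measurable[OF _ g_cont_pos[OF nn(2)] Uut(3)]) simp
    then have pm[measurable]: "p \<in> borel_measurable borel" unfolding p_def[abs_def] by measurable
    have "\<bar>rsurv g u t (\<lambda>_. 1) z\<bar> \<le> 1" for z
      by (rule rsurv_bound[OF _ _ g_cont_pos[OF nn(2)] Uut(3)]) auto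
    moreover have "0 \<le> rsurv g u t (\<lambda>_. 1) z" for z by (rule rsurv_nonneg) simp
    ultimately have r1: "0 \<le> rsurv g u t (\<lambda>_. 1) z" "rsurv g u t (\<lambda>_. 1) z \<le> 1" for z
      by (simp_all add: abs_le_iff)
    have pB: "\<bar>p z\<bar> \<le> B" for z
      using mult_mono[OF f(3)[of "z / g u"] r1(2)[of z]] f(2) r1(1) B by (simp add: p_def)
    let ?q = "\<lambda>z. kill a (\<lambda>z. f z * ?k z) z"
    have qm[measurable]: "?q \<in> borel_measurable borel" by (intro kill_measurable ab) measurable
    have fkB: "\<bar>f z * ?k z\<bar> \<le> B" for z using hab[of "g u * z"] pos by (simp add: h_def)
    have qB: "\<bar>?q z\<bar> \<le> B" for z by (rule kill_bound[OF _ fkB ab(1)]) measurable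
    have hq: "kill a (\<lambda>z. h (g u * z)) z = ?q z" for z using pos by (simp add: h_def)
    have num: "num f u t x = rsurv g s u p (g s * x)"
      unfolding p_def[abs_def] by (rule num_eq_rsurv) (use f x Uut in auto)
    have ph: "exp (- e) * ?r' * h z \<le> p z \<and> p z \<le> exp e * ?r' * h z" if "\<bar>z\<bar> < g u" for z
    proof -
      have "\<bar>z / g u\<bar> < 1" using that pos by (simp add: divide_simps)
      from cmp'[of "\<lambda>_. 1" 1, OF _ _ this]
      have "exp (- err \<kappa> u) * (?r' * ?k (z / g u)) \<le> rsurv g u t (\<lambda>_. 1) z"
        "rsurv g u t (\<lambda>_. 1) z \<le> exp (err \<kappa> u) * (?r' * ?k (z / g u))" using pos by auto
      moreover have "exp (- e) * (?r' * ?k (z / g u)) \<le> exp (- err \<kappa> u) * (?r' * ?k (z / g u))"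
        "exp (err \<kappa> u) * (?r' * ?k (z / g u)) \<le> exp e * (?r' * ?k (z / g u))"
        using ee k r by (intro mult_right_mono mult_nonneg_nonneg; simp)+
      ultimately have "exp (- e) * (?r' * ?k (z / g u)) \<le> rsurv g u t (\<lambda>_. 1) z"
        "rsurv g u t (\<lambda>_. 1) z \<le> exp e * (?r' * ?k (z / g u))" by linarith+
      from mult_left_mono[OF this(1) f(2)[of "z / g u"]] mult_left_mono[OF this(2) f(2)[of "z / g u"]]
      show ?thesis by (simp add: p_def h_def mult_ac)
    qed
    have hq': "exp (- e) * ?r * ?q (z / g U) \<le> rsurv g U u h z \<and> rsurv g U u h z \<le> exp e * ?r * ?q (z / g U)"
      if "\<bar>z\<bar> < g U" for z
    proof -
      have "\<bar>z / g U\<bar> < 1" using that pos by (simp add: divide_simps)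
      from cmp[of h B, OF hc _ this] show ?thesis using hB pos unfolding hq by (simp add: e_def mult.assoc)
    qed
    have split: "rsurv g s u h y = rsurv g s U (rsurv g U u h) y" for y
      by (rule rsurv_split[OF hm hB Uut(1,2)])
    have rhm[measurable]: "rsurv g U u h \<in> borel_measurable borel"
      by (rule rsurv_measurable[OF hm g_cont_pos[OF nn(1)] Uut(2)])
    have rhB: "\<bar>rsurv g U u h z\<bar> \<le> B" for z by (rule rsurv_bound[OF hm hab g_cont_pos[OF nn(1)] Uut(2)])
    have su: "s < u" using Uut by simp
    let ?y = "g s * x"
    have bd: "\<bar>c * h z\<bar> \<le> \<bar>c\<bar> * B" "\<bar>c * ?q z\<bar> \<le> \<bar>c\<bar> * B" for c z
      using hab[of z] qB[of z] by (auto simp: abs_mult intro!: mult_left_mono)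
    let ?I = "rsurv g s U (\<lambda>z. ?q (z / g U)) ?y"
    note m1 = rsurv_mono[OF _ _ _ _ g_cont_pos[OF s] su] and m2 = rsurv_mono[OF _ _ _ _ g_cont_pos[OF s] Uut(1)]
    have "rsurv g s u (\<lambda>z. exp (- e) * ?r' * h z) ?y \<le> rsurv g s u p ?y"
      by (rule m1[where B="\<bar>exp (- e) * ?r'\<bar> * B" and C=B]) (use bd(1) pB ph in \<open>measurable, blast+\<close>)
    moreover have "rsurv g s u p ?y \<le> rsurv g s u (\<lambda>z. exp e * ?r' * h z) ?y"
      by (rule m1[where C="\<bar>exp e * ?r'\<bar> * B" and B=B]) (use bd(1) pB ph in \<open>measurable, blast+\<close>)
    moreover have "rsurv g s U (\<lambda>z. exp (- e) * ?r * ?q (z / g U)) ?y \<le> rsurv g s U (rsurv g U u h) ?y"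
      by (rule m2[where B="\<bar>exp (- e) * ?r\<bar> * B" and C=B]) (use bd(2) rhB hq' in \<open>measurable, blast+\<close>)
    moreover have "rsurv g s U (rsurv g U u h) ?y \<le> rsurv g s U (\<lambda>z. exp e * ?r * ?q (z / g U)) ?y"
      by (rule m2[where C="\<bar>exp e * ?r\<bar> * B" and B=B]) (use bd(2) rhB hq' in \<open>measurable, blast+\<close>)
    ultimately have i: "exp (- e) * ?r' * rsurv g s u h ?y \<le> num f u t x" "num f u t x \<le> exp e * ?r' * rsurv g s u h ?y"
      "exp (- e) * ?r * ?I \<le> rsurv g s u h ?y" "rsurv g s u h ?y \<le> exp e * ?r * ?I"
      unfolding rsurv_cmult num split by auto
    have "exp (- e) * ?r' * (exp (- e) * ?r * ?I) \<le> exp (- e) * ?r' * rsurv g s u h ?y"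
      "exp e * ?r' * rsurv g s u h ?y \<le> exp e * ?r' * (exp e * ?r * ?I)"
      by (intro mult_left_mono[OF i(3)] mult_left_mono[OF i(4)]; use r in simp)+
    moreover have "exp (- e) * ?r' * (exp (- e) * ?r * ?I) = exp (- 2 * e) * (?r * ?r' * ?I)"
      "exp e * ?r' * (exp e * ?r * ?I) = exp (2 * e) * (?r * ?r' * ?I)"
      by (simp_all add: mult_2 mult_ac flip: exp_add)
    ultimately show "exp (- 2 * err \<kappa> U) * (?r * ?r' * ?I) \<le> num f u t x \<and> num f u t x \<le> exp (2 * err \<kappa> U) * (?r * ?r' * ?I)"
      using i(1,2) unfolding e_def by linarith
  qed (use r in simp)
qed

text \<open>The durations and the constant do not depend on the starting point, so the pointwise
  bounds can be integrated.\<close>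

lemma Emu_sandwich:
  assumes Uut: "s < U" "U < u" "u < t"
  obtains a b c where "(u - U) / (g u)\<^sup>2 \<le> a" "(t - u) / (g t)\<^sup>2 \<le> b" "0 < c"
    "\<And>f B. continuous_on UNIV f \<Longrightarrow> (\<And>z. 0 \<le> f z) \<Longrightarrow> (\<And>z. f z \<le> B) \<Longrightarrow>
      exp (- 2 * err \<kappa> U) * (c * entry U (kill a (\<lambda>z. f z * kill b (\<lambda>_. 1) z))) \<le> Emu_surv M \<mu> \<kappa> W s f u t \<and>
      Emu_surv M \<mu> \<kappa> W s f u t \<le> exp (2 * err \<kappa> U) * (c * entry U (kill a (\<lambda>z. f z * kill b (\<lambda>_. 1) z)))"
proof -
  from num_sandwich[OF Uut] obtain a b c where abc: "(u - U) / (g u)\<^sup>2 \<le> a" "(t - u) / (g t)\<^sup>2 \<le> b" "0 < c"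
    and sw: "\<And>f B x. continuous_on UNIV f \<Longrightarrow> (\<And>z. 0 \<le> f z) \<Longrightarrow> (\<And>z. f z \<le> B) \<Longrightarrow> \<bar>x\<bar> < 1 \<Longrightarrow>
      exp (- 2 * err \<kappa> U) * (c * rsurv g s U (\<lambda>z. kill a (\<lambda>z. f z * kill b (\<lambda>_. 1) z) (z / g U)) (g s * x)) \<le> num f u t x \<and>
      num f u t x \<le> exp (2 * err \<kappa> U) * (c * rsurv g s U (\<lambda>z. kill a (\<lambda>z. f z * kill b (\<lambda>_. 1) z) (z / g U)) (g s * x))"
    by blast
  have nn: "0 \<le> u" "0 \<le> t" using s Uut by auto
  have ab: "0 < a" "0 < b"
    using less_le_trans[OF _ abc(1), of 0] less_le_trans[OF _ abc(2), of 0] Uut g_pos[OF nn(1)] g_pos[OF nn(2)] by auto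
  show thesis
  proof (rule that[OF abc])
    fix f :: "real \<Rightarrow> real" and B
    assume f: "continuous_on UNIV f" "\<And>z. 0 \<le> f z" "\<And>z. f z \<le> B"
    have B: "0 \<le> B" using order_trans[OF f(2) f(3)[of 0]] .
    have fB: "\<bar>f z\<bar> \<le> B" for z using f(2,3)[of z] by simp
    have fm[measurable]: "f \<in> borel_measurable borel" using f(1) by (rule borel_measurable_continuous_onI)
    have km[measurable]: "kill b (\<lambda>_. 1) \<in> borel_measurable borel" by (rule kill_measurable[OF _ ab(2)]) simp
    have k: "\<bar>kill b (\<lambda>_. 1) z\<bar> \<le> 1" for z by (rule kill_bound) (use ab in auto)
    have fk: "\<bar>f z * kill b (\<lambda>_. 1) z\<bar> \<le> B" for z
      using mult_mono[OF fB[of z] k[of z]] B by (simp add: abs_mult)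
    let ?q = "kill a (\<lambda>z. f z * kill b (\<lambda>_. 1) z)"
    have qm[measurable]: "?q \<in> borel_measurable borel" by (intro kill_measurable ab) measurable
    have qB: "\<bar>?q z\<bar> \<le> B" for z by (rule kill_bound[OF _ fk ab(1)]) measurable
    let ?I = "\<lambda>x. rsurv g s U (\<lambda>z. ?q (z / g U)) (g s * x)"
    have iI: "integrable \<mu> ?I" by (rule rsurv_mu_integrable[OF _ qB Uut(1)]) measurable
    have iN: "integrable \<mu> (num f u t)" by (rule num_integrable[OF fm fB]) (use Uut in auto)
    have "(\<integral>x. exp (- 2 * err \<kappa> U) * (c * ?I x) \<partial>\<mu>) \<le> (\<integral>x. num f u t x \<partial>\<mu>)"
      using AE_mu sw[OF f]
      by (intro integral_mono_AE integrable_mult_right iI iN) auto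
    moreover have "(\<integral>x. num f u t x \<partial>\<mu>) \<le> (\<integral>x. exp (2 * err \<kappa> U) * (c * ?I x) \<partial>\<mu>)"
      using AE_mu sw[OF f]
      by (intro integral_mono_AE integrable_mult_right iI iN) auto
    ultimately show "exp (- 2 * err \<kappa> U) * (c * entry U ?q) \<le> Emu_surv M \<mu> \<kappa> W s f u t \<and>
      Emu_surv M \<mu> \<kappa> W s f u t \<le> exp (2 * err \<kappa> U) * (c * entry U ?q)"
      by (simp add: entry_def Emu_eq)
  qed
qed

text \<open>Comparison on \<open>{s..U}\<close> bounds the integrand below by a multiple of the
  ground state of the starting point; the error factor may be far from 1 here, as only positivity
  matters.\<close>

lemma entry_ground_pos:
  assumes U: "s < U"
  shows "0 < entry U ground"
proof -
  have U0: "0 < g U" using U s by (intro g_pos) simp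
  let ?r = "sqrt (g U / g s)"
  have r: "0 < ?r" using U0 g_pos[OF s] by simp
  from comparison[OF \<kappa> s U] obtain a where a: "(U - s) / (g U)\<^sup>2 \<le> a"
    and cmp: "\<And>h B x. continuous_on UNIV h \<Longrightarrow> (\<And>z. 0 \<le> h z \<and> h z \<le> B) \<Longrightarrow> \<bar>x\<bar> < 1 \<Longrightarrow>
      exp (- err \<kappa> s) * (?r * kill a (\<lambda>z. h (g U * z)) x) \<le> rsurv g s U h (g s * x)"
    unfolding Bex_def atLeastAtMost_iff by metis
  have a0: "0 < a" using less_le_trans[OF _ a, of 0] U U0 by auto
  define c where "c = exp (- err \<kappa> s) * (?r * exp (- lambda_Bm * a))"
  have c: "0 < c" using r by (simp add: c_def)
  let ?I = "\<lambda>x. rsurv g s U (\<lambda>z. ground (z / g U)) (g s * x)"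
  have pw: "c * ground x \<le> ?I x" if x: "\<bar>x\<bar> < 1" for x
  proof -
    \<comment> \<open>Comparison asks for nonnegativity on the whole line; inside the interval
      taking the positive part changes nothing.\<close>
    define h where "h z = max 0 (ground (z / g U))" for z
    have gp: "0 \<le> ground z" if "\<bar>z\<bar> < 1" for z using ground_pos[OF that] by simp
    have "exp (- err \<kappa> s) * (?r * kill a (\<lambda>z. h (g U * z)) x) \<le> rsurv g s U h (g s * x)"
    proof (rule cmp[of h 1])
      show "continuous_on UNIV h"
        unfolding h_def using U0
        by (intro continuous_intros continuous_on_compose2[OF ground_continuous[of UNIV]]) auto
      show "0 \<le> h z \<and> h z \<le> 1" for z using ground_bounds[of "z / g U"] by (auto simp: h_def)
    qed (rule x)
    moreover have "kill a (\<lambda>z. h (g U * z)) x = kill a ground x"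
      unfolding kill_eq_rsurv by (rule rsurv_cong) (use a0 U0 gp in \<open>auto simp: h_def\<close>)
    moreover have "rsurv g s U h (g s * x) = ?I x"
      by (rule rsurv_cong) (use U U0 gp in \<open>auto simp: h_def divide_simps intro!: max_absorb2\<close>)
    ultimately show ?thesis using kill_ground[OF a0 x] by (simp add: c_def mult_ac)
  qed
  have "0 < c * (\<integral>x. ground x \<partial>\<mu>)" using c integral_ground_pos[OF prob_mu sets_mu AE_mu] by simp
  also have "\<dots> = (\<integral>x. c * ground x \<partial>\<mu>)" by simp
  also have "\<dots> \<le> (\<integral>x. ?I x \<partial>\<mu>)"
  proof (rule integral_mono_AE)
    show "integrable \<mu> (\<lambda>x. c * ground x)"
      by (intro integrable_mult_right mu_integrable[OF ground_measurable ground_bounds])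
    show "integrable \<mu> ?I" by (rule rsurv_mu_integrable[OF _ ground_bounds U]) measurable
    show "AE x in \<mu>. c * ground x \<le> ?I x" using AE_mu pw by auto
  qed
  finally show ?thesis by (simp add: entry_def)
qed

text \<open>The constant 1 dominates the ground state, and each killing step multiplies the ground
  state by an exponential.\<close>

lemma entry_kill_kill_pos:
  assumes U: "s < U" and ab: "0 < a" "0 < b"
  shows "0 < entry U (kill a (kill b (\<lambda>_. 1)))"
proof -
  have km[measurable]: "kill b (\<lambda>_. 1) \<in> borel_measurable borel" by (rule kill_measurable[OF _ ab(2)]) simp
  have k: "\<bar>kill b (\<lambda>_. 1) z\<bar> \<le> 1" for z by (rule kill_bound) (use ab in auto)
  let ?c = "exp (- lambda_Bm * a) * exp (- lambda_Bm * b)"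
  have one: "exp (- lambda_Bm * b) * ground z \<le> kill b (\<lambda>_. 1) z" if "\<bar>z\<bar> < 1" for z
    unfolding kill_ground[OF ab(2) that, symmetric]
    by (rule kill_mono[OF ground_measurable ground_bounds, where C=1]) (use ab ground_bounds in \<open>auto simp: abs_le_iff\<close>)
  have two: "?c * ground z \<le> kill a (kill b (\<lambda>_. 1)) z" if z: "\<bar>z\<bar> < 1" for z
  proof -
    have "kill a (\<lambda>z. exp (- lambda_Bm * b) * ground z) z \<le> kill a (kill b (\<lambda>_. 1)) z"
      by (rule kill_mono[where B="exp (- lambda_Bm * b)", OF _ _ km k ab(1) one])
        (use ground_bounds in \<open>auto simp: abs_mult\<close>)
    then show ?thesis unfolding kill_cmult using kill_ground[OF ab(1) z] by (simp add: mult_ac)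
  qed
  have "0 < ?c * entry U ground" using entry_ground_pos[OF U] by simp
  also have "\<dots> = entry U (\<lambda>z. ?c * ground z)" by (rule entry_cmult[symmetric])
  also have "\<dots> \<le> entry U (kill a (kill b (\<lambda>_. 1)))"
  proof (rule entry_mono[where B="?c" and C=1])
    show "\<bar>?c * ground z\<bar> \<le> ?c" for z using ground_bounds[of z] by (simp add: abs_mult)
    show "\<bar>kill a (kill b (\<lambda>_. 1)) z\<bar> \<le> 1" for z by (rule kill_bound[OF km k ab(1)])
    show "kill a (kill b (\<lambda>_. 1)) \<in> borel_measurable borel" by (rule kill_measurable[OF km ab(1)])
    show "(\<lambda>z. ?c * ground z) \<in> borel_measurable borel" by measurable
  qed (use U two in auto)
  finally show ?thesis .
qed

text \<open>Any two intermediate times give a positive lower bound through the sandwich; the thirds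
  of the interval are an arbitrary choice.\<close>

lemma Pmu_pos:
  assumes t: "s < t"
  shows "0 < Pmu_surv M \<mu> \<kappa> W s t"
proof -
  define U u where "U = s + (t - s) / 3" and "u = s + 2 * (t - s) / 3"
  have Uut: "s < U" "U < u" "u < t" using t by (auto simp: U_def u_def field_simps)
  then have nn: "0 \<le> u" "0 \<le> t" using s by auto
  obtain a b c where abc: "(u - U) / (g u)\<^sup>2 \<le> a" "(t - u) / (g t)\<^sup>2 \<le> b" "0 < c"
    and sw: "\<And>f B. continuous_on UNIV f \<Longrightarrow> (\<And>z. 0 \<le> f z) \<Longrightarrow> (\<And>z. f z \<le> B) \<Longrightarrow>
      exp (- 2 * err \<kappa> U) * (c * entry U (kill a (\<lambda>z. f z * kill b (\<lambda>_. 1) z))) \<le> Emu_surv M \<mu> \<kappa> W s f u t \<and>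
      Emu_surv M \<mu> \<kappa> W s f u t \<le> exp (2 * err \<kappa> U) * (c * entry U (kill a (\<lambda>z. f z * kill b (\<lambda>_. 1) z)))"
    using Emu_sandwich[OF Uut] by blast
  have ab: "0 < a" "0 < b"
    using less_le_trans[OF _ abc(1), of 0] less_le_trans[OF _ abc(2), of 0] Uut g_pos[OF nn(1)] g_pos[OF nn(2)] by auto
  have "0 < exp (- 2 * err \<kappa> U) * (c * entry U (kill a (kill b (\<lambda>_. 1))))"
    using entry_kill_kill_pos[OF Uut(1) ab] abc(3) by simp
  also have "\<dots> \<le> Emu_surv M \<mu> \<kappa> W s (\<lambda>_. 1) u t" using sw[of "\<lambda>_. 1" 1] by simp
  finally show ?thesis by (simp add: Emu_eq Pmu_eq[of t u])
qed

text \<open>Inner limit first: the rescaled survival probability over \<open>b\<close> is uniformly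
  close to \<open>mass * ground\<close>. The outer semigroup amplifies this error only boundedly by
  \<open>kill_one_decay\<close>, and the spectral limit for \<open>f\<close> times the ground state
  concludes.\<close>

lemma kill_kill_limit:
  assumes f[measurable]: "f \<in> borel_measurable borel" and fB: "\<And>z. \<bar>f z\<bar> \<le> B" and e: "0 < e"
  obtains T where "0 < T" "\<And>a b x. T \<le> a \<Longrightarrow> T \<le> b \<Longrightarrow> \<bar>x\<bar> < 1 \<Longrightarrow>
    \<bar>exp (lambda_Bm * (a + b)) * kill a (\<lambda>z. f z * kill b (\<lambda>_. 1) z) x - mass * unit_ip (\<lambda>z. f z * ground z) * ground x\<bar> \<le> e"
proof -
  have B: "0 \<le> B" by (rule order_trans[OF abs_ge_zero fB[of 0]])
  obtain C where C: "0 \<le> C" "\<And>t x. 1 < t \<Longrightarrow> \<bar>x\<bar> < 1 \<Longrightarrow> exp (lambda_Bm * t) * kill t (\<lambda>_. 1) x \<le> C * ground x"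
    using kill_one_decay by blast
  \<comment> \<open>The inner error is amplified by at most \<open>B * C\<close>, the outer one,
    \<open>d'\<close>, by \<open>mass\<close>; the summand 1 keeps the denominator positive.\<close>
  define d where "d = e / (2 * (B * C + 1))"
  define d' where "d' = e / (2 * mass)"
  have d: "0 < d" "0 < d'" using e B C(1) mass_pos by (auto simp: d_def d'_def intro!: divide_pos_pos add_nonneg_pos)
  have s1: "spectral (\<lambda>_. 1)" by (rule spectral_limit[where B=1]) auto
  have fgB: "\<bar>f z * ground z\<bar> \<le> B" for z
    using mult_mono[OF fB[of z] ground_bounds[of z]] B by (simp add: abs_mult)
  have s2: "spectral (\<lambda>z. f z * ground z)" by (rule spectral_limit[OF _ fgB]) measurable
  obtain T1 where T1: "0 < T1" "\<And>t x. T1 \<le> t \<Longrightarrow> \<bar>x\<bar> < 1 \<Longrightarrow> \<bar>exp (lambda_Bm * t) * kill t (\<lambda>_. 1) x - mass * ground x\<bar> \<le> d"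
    using s1 d(1) unfolding spectral_def mass_def by blast
  obtain T2 where T2: "0 < T2" "\<And>t x. T2 \<le> t \<Longrightarrow> \<bar>x\<bar> < 1 \<Longrightarrow>
      \<bar>exp (lambda_Bm * t) * kill t (\<lambda>z. f z * ground z) x - unit_ip (\<lambda>z. f z * ground z) * ground x\<bar> \<le> d'"
    using s2 d(2) unfolding spectral_def by blast
  show thesis
  proof (rule that[of "max 2 (max T1 T2)"])
    fix a b x :: real assume "max 2 (max T1 T2) \<le> a" "max 2 (max T1 T2) \<le> b" and x: "\<bar>x\<bar> < 1"
    then have ab: "1 < a" "T2 \<le> a" "T1 \<le> b" "0 < a" "0 < b" by auto
    let ?k = "kill b (\<lambda>_. 1)" and ?L = "exp (lambda_Bm * b)"
    have km[measurable]: "?k \<in> borel_measurable borel" by (rule kill_measurable[OF _ ab(5)]) simp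
    have k: "\<bar>?k z\<bar> \<le> 1" for z by (rule kill_bound) (use ab in auto)
    have fk: "\<bar>f z * ?k z\<bar> \<le> B" for z
      using mult_mono[OF fB[of z] k[of z]] B by (simp add: abs_mult)
    let ?p = "\<lambda>z. ?L * (f z * ?k z)" and ?q = "\<lambda>z. mass * (f z * ground z)"
    have pB: "\<bar>?p z\<bar> \<le> ?L * B" for z using fk[of z] by (simp add: abs_mult)
    have qB: "\<bar>?q z\<bar> \<le> mass * B" for z using fgB[of z] mass_pos by (simp add: abs_mult)
    have pq: "\<bar>?p z - ?q z\<bar> \<le> B * d" if "\<bar>z\<bar> < 1" for z
    proof -
      have "?p z - ?q z = f z * (?L * ?k z - mass * ground z)" by (simp add: algebra_simps)
      then show ?thesis using mult_mono[OF fB[of z] T1(2)[OF ab(3) that]] B by (simp add: abs_mult)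
    qed
    have "\<bar>kill a ?p x - kill a ?q x\<bar> \<le> kill a (\<lambda>z. \<bar>?p z - ?q z\<bar>) x"
      by (rule kill_abs_le[OF _ pB _ qB ab(4)]) measurable
    also have "\<dots> \<le> kill a (\<lambda>z. B * d * 1) x"
    proof (rule kill_mono[where B="?L * B + mass * B" and C="B * d"])
      show "\<bar>\<bar>?p z - ?q z\<bar>\<bar> \<le> ?L * B + mass * B" for z using pB[of z] qB[of z] by linarith
      show "\<bar>B * d * 1\<bar> \<le> B * d" using B d by simp
      show "(\<lambda>z. \<bar>?p z - ?q z\<bar>) \<in> borel_measurable borel" by measurable
    qed (use ab pq in auto)
    also have "\<dots> = B * d * kill a (\<lambda>_. 1) x" by (rule kill_cmult)
    finally have i1: "\<bar>kill a ?p x - kill a ?q x\<bar> \<le> B * d * kill a (\<lambda>_. 1) x" .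
    let ?E = "exp (lambda_Bm * a)"
    have "\<bar>?E * kill a ?p x - ?E * kill a ?q x\<bar> = ?E * \<bar>kill a ?p x - kill a ?q x\<bar>"
      by (simp add: abs_mult flip: right_diff_distrib)
    also have "\<dots> \<le> ?E * (B * d * kill a (\<lambda>_. 1) x)" by (rule mult_left_mono[OF i1]) simp
    also have "\<dots> = B * d * (?E * kill a (\<lambda>_. 1) x)" by simp
    also have "\<dots> \<le> B * d * C"
    proof (rule mult_left_mono)
      show "?E * kill a (\<lambda>_. 1) x \<le> C"
        using C(2)[OF ab(1) x] mult_left_mono[OF abs_le_D1[OF ground_bounds[of x]] C(1)] by simp
    qed (use B d in simp)
    also have "\<dots> \<le> d * (B * C + 1)" using d by (simp add: algebra_simps)
    also have "\<dots> = e / 2"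
    proof -
      have "0 < B * C + 1" using B C(1) by (intro add_nonneg_pos) auto
      then show ?thesis unfolding d_def by (simp add: divide_simps)
    qed
    finally have j1: "\<bar>?E * kill a ?p x - ?E * kill a ?q x\<bar> \<le> e / 2" .
    let ?u = "unit_ip (\<lambda>z. f z * ground z)"
    have eq: "?E * kill a ?q x - mass * ?u * ground x = mass * (?E * kill a (\<lambda>z. f z * ground z) x - ?u * ground x)"
      unfolding kill_cmult by (simp add: algebra_simps)
    have j2: "\<bar>?E * kill a ?q x - mass * ?u * ground x\<bar> \<le> e / 2"
    proof -
      have "mass * \<bar>?E * kill a (\<lambda>z. f z * ground z) x - ?u * ground x\<bar> \<le> mass * d'"
        using T2(2)[OF ab(2) x] mass_pos by (intro mult_left_mono) auto
      moreover have "mass * d' = e / 2" using mass_pos by (simp add: d'_def)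
      ultimately show ?thesis unfolding eq abs_mult using mass_pos by simp
    qed
    have "exp (lambda_Bm * (a + b)) * kill a (\<lambda>z. f z * ?k z) x = ?E * kill a ?p x"
      unfolding kill_cmult by (simp add: distrib_left exp_add)
    then show "\<bar>exp (lambda_Bm * (a + b)) * kill a (\<lambda>z. f z * ?k z) x - mass * ?u * ground x\<bar> \<le> e"
      using j1 j2 by linarith
  qed simp
qed

lemma entry_limit:
  assumes f[measurable]: "f \<in> borel_measurable borel" and fB: "\<And>z. \<bar>f z\<bar> \<le> B" and e: "0 < e" and U: "s < U"
  obtains T where "0 < T" "\<And>a b. T \<le> a \<Longrightarrow> T \<le> b \<Longrightarrow>
    \<bar>exp (lambda_Bm * (a + b)) * entry U (kill a (\<lambda>z. f z * kill b (\<lambda>_. 1) z)) - mass * unit_ip (\<lambda>z. f z * ground z) * entry U ground\<bar> \<le> e"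
proof -
  have B: "0 \<le> B" by (rule order_trans[OF abs_ge_zero fB[of 0]])
  from kill_kill_limit[OF f fB e] obtain T where T: "0 < T" "\<And>a b x. T \<le> a \<Longrightarrow> T \<le> b \<Longrightarrow> \<bar>x\<bar> < 1 \<Longrightarrow>
    \<bar>exp (lambda_Bm * (a + b)) * kill a (\<lambda>z. f z * kill b (\<lambda>_. 1) z) x - mass * unit_ip (\<lambda>z. f z * ground z) * ground x\<bar> \<le> e"
    by blast
  show thesis
  proof (rule that[OF T(1)])
    fix a b assume ab': "T \<le> a" "T \<le> b"
    then have ab: "0 < a" "0 < b" using T(1) by auto
    let ?k = "kill b (\<lambda>_. 1)" and ?E = "exp (lambda_Bm * (a + b))" and ?c = "mass * unit_ip (\<lambda>z. f z * ground z)"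
    have km[measurable]: "?k \<in> borel_measurable borel" by (rule kill_measurable[OF _ ab(2)]) simp
    have k: "\<bar>?k z\<bar> \<le> 1" for z by (rule kill_bound) (use ab in auto)
    have fk: "\<bar>f z * ?k z\<bar> \<le> B" for z
      using mult_mono[OF fB[of z] k[of z]] B by (simp add: abs_mult)
    let ?q = "kill a (\<lambda>z. f z * ?k z)"
    have qm[measurable]: "?q \<in> borel_measurable borel" by (intro kill_measurable ab) measurable
    have qB: "\<bar>?q z\<bar> \<le> B" for z by (rule kill_bound[OF _ fk ab(1)]) measurable
    have "\<bar>entry U (\<lambda>z. ?E * ?q z) - entry U (\<lambda>z. ?c * ground z)\<bar> \<le> e"
    proof (rule entry_close[where B="?E * B" and C="\<bar>?c\<bar>"])
      show "\<bar>?E * ?q z\<bar> \<le> ?E * B" for z using qB[of z] by (simp add: abs_mult)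
      show "\<bar>?c * ground z\<bar> \<le> \<bar>?c\<bar>" for z
        using mult_left_mono[OF ground_bounds[of z], of "\<bar>?c\<bar>"] by (simp only: abs_mult[of ?c] mult_1_right abs_ge_zero)
      show "\<bar>?E * ?q z - ?c * ground z\<bar> \<le> e" if "\<bar>z\<bar> < 1" for z by (rule T(2)[OF ab' that])
      show "(\<lambda>z. ?E * ?q z) \<in> borel_measurable borel" "(\<lambda>z. ?c * ground z) \<in> borel_measurable borel" by measurable
    qed (use U e in auto)
    then show "\<bar>?E * entry U ?q - ?c * entry U ground\<bar> \<le> e" unfolding entry_cmult .
  qed
qed

lemma unit_ip_ground: "unit_ip ground = 1"
  using unit_ip_eigenfun[of 1] unfolding eigenfun_1 by simp

end

section \<open>The limit of the conditional expectations and of their time average\<close>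

lemma ratio_sandwich:
  fixes F Q c d x y :: real
  assumes "0 < c" "0 < Q" "0 \<le> F"
    and x: "exp (- d) * (c * F) \<le> x" "x \<le> exp d * (c * F)"
    and y: "exp (- d) * (c * Q) \<le> y" "y \<le> exp d * (c * Q)"
  shows "exp (- 2 * d) * (F / Q) \<le> x / y" "x / y \<le> exp (2 * d) * (F / Q)"
proof -
  have y0: "0 < y" using less_le_trans[OF _ y(1), of 0] assms(1,2) by simp
  have x0: "0 \<le> x" using order_trans[OF _ x(1), of 0] assms(1,3) by simp
  have "x / y \<le> (exp d * (c * F)) / (exp (- d) * (c * Q))"
    by (rule frac_le) (use x x0 y assms in auto)
  also have "\<dots> = exp d / exp (- d) * (F / Q)" using assms(1) by simp
  also have "exp d / exp (- d) = exp (2 * d)" by (simp flip: exp_diff)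
  finally show "x / y \<le> exp (2 * d) * (F / Q)" .
  have "(exp (- d) * (c * F)) / (exp d * (c * Q)) \<le> x / y"
    by (rule frac_le) (use x x0 y y0 assms in auto)
  moreover have "(exp (- d) * (c * F)) / (exp d * (c * Q)) = exp (- d) / exp d * (F / Q)"
    using assms(1) by simp
  moreover have "exp (- d) / exp d = exp (- 2 * d)" by (simp flip: exp_diff)
  ultimately show "exp (- 2 * d) * (F / Q) \<le> x / y" by simp
qed

text \<open>The bound \<open>d \<le> m / 2\<close> keeps the denominator \<open>q\<close> above
  \<open>m / 2\<close>.\<close>

lemma ratio_close:
  fixes p q m d L :: real
  assumes p: "\<bar>p - L * m\<bar> \<le> d" and q: "\<bar>q - m\<bar> \<le> d" and d: "d \<le> m / 2" and m: "0 < m" and L: "0 \<le> L"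
  shows "\<bar>p / q - L\<bar> \<le> 2 * d * (1 + L) / m"
proof -
  have q0: "m / 2 \<le> q" using q d by linarith
  have "\<bar>L * (m - q)\<bar> \<le> L * d" unfolding abs_mult using q L by (simp add: mult_left_mono abs_minus_commute)
  then have "\<bar>p - L * q\<bar> \<le> d * (1 + L)" using p by (simp add: algebra_simps)
  then have "\<bar>p - L * q\<bar> / q \<le> d * (1 + L) / (m / 2)"
    by (rule frac_le[rotated 1]) (use q0 m L order_trans[OF abs_ge_zero p] in auto)
  moreover have "p / q - L = (p - L * q) / q" using q0 m by (simp add: diff_divide_distrib)
  ultimately show ?thesis using q0 m by (simp add: mult_ac)
qed

context moving_boundary
begin

lemma unit_ip_mult_ground_nonneg:
  assumes "\<And>z. 0 \<le> f z"
  shows "0 \<le> unit_ip (\<lambda>z. f z * ground z)"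
proof -
  have "unit_ip (\<lambda>z. f z * ground z) = unit_ip (\<lambda>z. \<bar>f z * ground z\<bar>)"
    by (rule unit_ip_cong) (simp add: abs_mult assms abs_of_pos[OF ground_pos])
  also have "0 \<le> \<dots>" by (rule unit_ip_nonneg) simp
  finally show ?thesis .
qed

lemma err_tendsto_0: "(err \<kappa> \<longlongrightarrow> 0) at_top"
  unfolding err_def using \<kappa> by real_asymp

text \<open>The order of choices matters: \<open>U\<close> for the comparison error, then
  \<open>T\<close> for the limits of \<open>entry\<close> at this fixed \<open>U\<close>, then
  \<open>u1\<close> so that the clock from \<open>U\<close> to \<open>u\<close> exceeds
  \<open>T\<close>. The clock from \<open>u\<close> to \<open>t\<close> is long by the assumption on
  \<open>t - u\<close>.\<close>

lemma Emu_ratio_limit: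
  assumes f: "continuous_on UNIV f" "\<And>z. 0 \<le> f z" "\<And>z. f z \<le> B" and e: "0 < e"
  defines "L \<equiv> unit_ip (\<lambda>z. f z * ground z)"
  shows "\<exists>u1\<ge>s. \<exists>T>0. \<forall>t u. u1 \<le> u \<longrightarrow> u < t \<longrightarrow> T * (g t)\<^sup>2 \<le> t - u \<longrightarrow>
    \<bar>Emu_surv M \<mu> \<kappa> W s f u t / Pmu_surv M \<mu> \<kappa> W s t - L\<bar> \<le> e"
proof -
  have fm[measurable]: "f \<in> borel_measurable borel" using f(1) by (rule borel_measurable_continuous_onI)
  have fB: "\<bar>f z\<bar> \<le> B" for z using f(2,3)[of z] by simp
  have L: "0 \<le> L" unfolding L_def by (rule unit_ip_mult_ground_nonneg[OF f(2)])
  \<comment> \<open>Numerator and denominator are each known up to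
    \<open>exp (2 * err \<kappa> U)\<close> in both directions, hence the ratio up to
    \<open>exp (4 * err \<kappa> U)\<close>; the ratio that is multiplied by this factor will be at
    most \<open>L + e / 2\<close>.\<close>
  have "((\<lambda>U. (exp (4 * err \<kappa> U) - 1) * (L + e / 2)) \<longlongrightarrow> (exp (4 * 0) - 1) * (L + e / 2)) at_top"
    by (intro tendsto_intros err_tendsto_0)
  then have "\<forall>\<^sub>F U in at_top. (exp (4 * err \<kappa> U) - 1) * (L + e / 2) < e / 2"
    by (rule order_tendstoD) (use e in simp)
  then have "\<forall>\<^sub>F U in at_top. s < U \<and> (exp (4 * err \<kappa> U) - 1) * (L + e / 2) < e / 2"
    using eventually_gt_at_top[of s] by eventually_elim simp
  from eventually_happens'[OF trivial_limit_at_top_linorder this]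
  obtain U where U: "s < U" and errU: "(exp (4 * err \<kappa> U) - 1) * (L + e / 2) < e / 2" by auto
  have U0: "0 \<le> U" using s U by simp
  have errp: "0 \<le> err \<kappa> U" unfolding err_def using \<kappa> by simp
  define m where "m = mass * entry U ground"
  have m: "0 < m" using mass_pos entry_ground_pos[OF U] by (simp add: m_def)
  \<comment> \<open>The first bound makes \<open>ratio_close\<close> applicable, the second makes
    its conclusion at most \<open>e / 2\<close>.\<close>
  define d where "d = min (m / 2) (e * m / (4 * (1 + L)))"
  have d: "0 < d" using m e L by (simp add: d_def)
  have d': "d \<le> m / 2" unfolding d_def by (rule min.cobounded1)
  have d2: "2 * d * (1 + L) / m \<le> e / 2"
  proof -
    have "d * (4 * (1 + L)) \<le> e * m"
      using L by (subst pos_le_divide_eq[symmetric]) (simp_all add: d_def)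
    then show ?thesis using m by (simp add: field_simps)
  qed
  obtain T1 where T1: "0 < T1" "\<And>a b. T1 \<le> a \<Longrightarrow> T1 \<le> b \<Longrightarrow>
    \<bar>exp (lambda_Bm * (a + b)) * entry U (kill a (\<lambda>z. f z * kill b (\<lambda>_. 1) z)) - mass * L * entry U ground\<bar> \<le> d"
    using entry_limit[OF fm fB d U] unfolding L_def by blast
  have "\<bar>1 :: real\<bar> \<le> 1" by simp
  from entry_limit[OF borel_measurable_const this d U]
  obtain T2 where T2: "0 < T2" "\<And>a b. T2 \<le> a \<Longrightarrow> T2 \<le> b \<Longrightarrow>
    \<bar>exp (lambda_Bm * (a + b)) * entry U (kill a (kill b (\<lambda>_. 1))) - mass * entry U ground\<bar> \<le> d"
    unfolding mult_1 unit_ip_ground mult_1_right by blast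
  define T where "T = max T1 T2"
  have T: "0 < T" "T1 \<le> T" "T2 \<le> T" using T1(1) by (auto simp: T_def)
  have "filterlim (\<lambda>u. (u - U) / (g u)\<^sup>2) at_top at_top"
    unfolding bd_def using \<kappa> by real_asymp
  then have "\<forall>\<^sub>F u in at_top. T \<le> (u - U) / (g u)\<^sup>2" by (simp add: filterlim_at_top)
  then have "\<forall>\<^sub>F u in at_top. U < u \<and> T \<le> (u - U) / (g u)\<^sup>2"
    using eventually_gt_at_top[of U] by eventually_elim simp
  then obtain u1 where u1: "\<And>u. u1 \<le> u \<Longrightarrow> U < u \<and> T \<le> (u - U) / (g u)\<^sup>2"
    by (auto simp: eventually_at_top_linorder)
  show ?thesis
  proof (intro exI conjI allI impI)
    show "s \<le> u1" using u1[of u1] U by simp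
    show "0 < T" by (rule T)
    fix t u assume u: "u1 \<le> u" "u < t" and tu: "T * (g t)\<^sup>2 \<le> t - u"
    from u1[OF u(1)] have Uu: "U < u" and Tu: "T \<le> (u - U) / (g u)\<^sup>2" by auto
    have gt: "0 < g t" using u Uu U0 by (intro g_pos) simp
    have Tt: "T \<le> (t - u) / (g t)\<^sup>2" using tu gt by (simp add: pos_le_divide_eq)
    obtain a b c where ab: "(u - U) / (g u)\<^sup>2 \<le> a" "(t - u) / (g t)\<^sup>2 \<le> b" and c: "0 < c"
      and sw: "\<And>f B. continuous_on UNIV f \<Longrightarrow> (\<And>z. 0 \<le> f z) \<Longrightarrow> (\<And>z. f z \<le> B) \<Longrightarrow>
      exp (- 2 * err \<kappa> U) * (c * entry U (kill a (\<lambda>z. f z * kill b (\<lambda>_. 1) z))) \<le> Emu_surv M \<mu> \<kappa> W s f u t \<and>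
      Emu_surv M \<mu> \<kappa> W s f u t \<le> exp (2 * err \<kappa> U) * (c * entry U (kill a (\<lambda>z. f z * kill b (\<lambda>_. 1) z)))"
      using Emu_sandwich[OF U Uu u(2)] by blast
    have Tab: "T \<le> a" "T \<le> b" using order_trans[OF Tu ab(1)] order_trans[OF Tt ab(2)] by auto
    then have ab0: "0 < a" "0 < b" using T(1) by auto
    define F where "F = entry U (kill a (\<lambda>z. f z * kill b (\<lambda>_. 1) z))"
    define Q where "Q = entry U (kill a (kill b (\<lambda>_. 1)))"
    define X where "X = Emu_surv M \<mu> \<kappa> W s f u t"
    define Y where "Y = Pmu_surv M \<mu> \<kappa> W s t"
    have Y: "Y = Emu_surv M \<mu> \<kappa> W s (\<lambda>_. 1) u t" by (simp add: Y_def Pmu_eq[of t u] Emu_eq)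
    have Q: "0 < Q" unfolding Q_def by (rule entry_kill_kill_pos[OF U ab0])
    have F: "0 \<le> F" unfolding F_def entry_def
      by (intro integral_nonneg_AE AE_I2 rsurv_nonneg kill_nonneg mult_nonneg_nonneg f(2)) simp
    have x: "exp (- (2 * err \<kappa> U)) * (c * F) \<le> X" "X \<le> exp (2 * err \<kappa> U) * (c * F)"
      using sw[OF f] by (auto simp: X_def F_def)
    have y: "exp (- (2 * err \<kappa> U)) * (c * Q) \<le> Y" "Y \<le> exp (2 * err \<kappa> U) * (c * Q)"
      using sw[of "\<lambda>_. 1" 1] by (auto simp: Y Q_def)
    note sand = ratio_sandwich[OF c Q F x y]
    let ?E = "exp (lambda_Bm * (a + b))"
    have "\<bar>?E * F - L * m\<bar> \<le> d" using T1(2)[of a b] Tab T by (simp add: F_def m_def mult_ac)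
    moreover have "\<bar>?E * Q - m\<bar> \<le> d" using T2(2)[of a b] Tab T by (simp add: Q_def m_def)
    ultimately have "\<bar>(?E * F) / (?E * Q) - L\<bar> \<le> 2 * d * (1 + L) / m"
      by (rule ratio_close[OF _ _ d' m L])
    then have rho: "\<bar>F / Q - L\<bar> \<le> e / 2" using d2 by simp
    define \<delta> where "\<delta> = exp (4 * err \<kappa> U)"
    have \<delta>: "1 \<le> \<delta>" using errp by (simp add: \<delta>_def)
    \<comment> \<open>A linear lower bound for \<open>1 / \<delta>\<close>, which makes the lower
      error the mirror image of the upper one.\<close>
    have low: "2 - \<delta> \<le> exp (- 4 * err \<kappa> U)"
    proof -
      have "0 \<le> (\<delta> - 1)\<^sup>2 / \<delta>" using \<delta> by simp
      also have "\<dots> = exp (- 4 * err \<kappa> U) - (2 - \<delta>)"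
        using \<delta> by (simp add: \<delta>_def exp_minus field_simps power2_eq_square)
      finally show ?thesis by simp
    qed
    have FQ: "0 \<le> F / Q" using F Q by simp
    have "(\<delta> - 1) * (F / Q) \<le> (\<delta> - 1) * (L + e / 2)" using rho \<delta> by (intro mult_left_mono) linarith+
    then have small: "(\<delta> - 1) * (F / Q) \<le> e / 2" using errU unfolding \<delta>_def by linarith
    have "X / Y \<le> \<delta> * (F / Q)" using sand(2) by (simp add: \<delta>_def)
    then have "X / Y \<le> F / Q + (\<delta> - 1) * (F / Q)" unfolding left_diff_distrib by linarith
    moreover have "(2 - \<delta>) * (F / Q) \<le> X / Y"
      using order_trans[OF mult_right_mono[OF low FQ]] sand(1) by simp
    then have "F / Q - (\<delta> - 1) * (F / Q) \<le> X / Y" unfolding left_diff_distrib by linarith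
    ultimately show "\<bar>Emu_surv M \<mu> \<kappa> W s f u t / Pmu_surv M \<mu> \<kappa> W s t - L\<bar> \<le> e"
      using rho small unfolding X_def[symmetric] Y_def[symmetric] by linarith
  qed
qed

lemma Emu_bounds:
  assumes f: "f \<in> borel_measurable borel" "\<And>z. 0 \<le> f z" "\<And>z. f z \<le> B" and tu: "s < t" "s \<le> u"
  shows "0 \<le> Emu_surv M \<mu> \<kappa> W s f u t / Pmu_surv M \<mu> \<kappa> W s t"
    "Emu_surv M \<mu> \<kappa> W s f u t / Pmu_surv M \<mu> \<kappa> W s t \<le> B"
proof -
  have fB: "\<bar>f z\<bar> \<le> B" for z using f(2,3)[of z] by simp
  have nn: "0 \<le> num f u t x" for x
    unfolding num_def by (intro integral_nonneg_AE AE_I2) (use f(2) in \<open>simp add: indicator_def\<close>)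
  have le: "num f u t x \<le> B * num (\<lambda>_. 1) u t x" for x
  proof -
    have "num f u t x \<le> (\<integral>\<omega>. B * (1 * indicator {\<omega>. ereal t < tauX \<kappa> W s x \<omega>} \<omega>) \<partial>M)"
      unfolding num_def
    proof (rule integral_mono)
      show "integrable M (\<lambda>\<omega>. f (Xproc \<kappa> W s x u \<omega>) * indicator {\<omega>. ereal t < tauX \<kappa> W s x \<omega>} \<omega>)"
        by (rule bounded_integrable[OF num_integrand[OF f(1) tu], where B=B])
          (use fB order_trans[OF abs_ge_zero fB[of 0]] in \<open>auto simp: indicator_def\<close>)
      show "integrable M (\<lambda>\<omega>. B * (1 * indicator {\<omega>. ereal t < tauX \<kappa> W s x \<omega>} \<omega>))"
        by (intro integrable_mult_right bounded_integrable[OF num_integrand[of "\<lambda>_. 1", OF _ tu], where B=1])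
          (auto simp: indicator_def)
    qed (use f in \<open>simp add: indicator_def\<close>)
    then show ?thesis by (simp add: num_def)
  qed
  have i1: "integrable \<mu> (num f u t)" by (rule num_integrable[OF f(1) fB tu])
  have i2: "integrable \<mu> (num (\<lambda>_. 1) u t)" by (rule num_integrable[where B=1]) (use tu in auto)
  have "Emu_surv M \<mu> \<kappa> W s f u t \<le> (\<integral>x. B * num (\<lambda>_. 1) u t x \<partial>\<mu>)"
    unfolding Emu_eq by (rule integral_mono[OF i1 integrable_mult_right[OF i2] le])
  then have "Emu_surv M \<mu> \<kappa> W s f u t \<le> B * Pmu_surv M \<mu> \<kappa> W s t" by (simp add: Pmu_eq[of t u])
  then show "Emu_surv M \<mu> \<kappa> W s f u t / Pmu_surv M \<mu> \<kappa> W s t \<le> B"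
    using Pmu_pos[OF tu(1)] by (simp add: pos_divide_le_eq)
  have "0 \<le> Emu_surv M \<mu> \<kappa> W s f u t" unfolding Emu_eq by (simp add: nn)
  then show "0 \<le> Emu_surv M \<mu> \<kappa> W s f u t / Pmu_surv M \<mu> \<kappa> W s t"
    using Pmu_pos[OF tu(1)] by simp
qed

lemma nonneg_average_limit:
  assumes f: "continuous_on UNIV f" "\<And>z. 0 \<le> f z" "\<And>z. f z \<le> B"
  shows "((\<lambda>t. (1 / t) * (\<integral>u\<in>{s..t}. Emu_surv M \<mu> \<kappa> W s f u t / Pmu_surv M \<mu> \<kappa> W s t \<partial>lborel))
       \<longlongrightarrow> unit_ip (\<lambda>z. f z * ground z)) at_top"
proof (rule average_limit[OF \<kappa> s])
  have fm: "f \<in> borel_measurable borel" using f(1) by (rule borel_measurable_continuous_onI)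
  have fB: "\<bar>f z\<bar> \<le> B" for z using f(2,3)[of z] by simp
  show "0 \<le> unit_ip (\<lambda>z. f z * ground z)" by (rule unit_ip_mult_ground_nonneg[OF f(2)])
  show "continuous_on {s..t} (\<lambda>u. Emu_surv M \<mu> \<kappa> W s f u t / Pmu_surv M \<mu> \<kappa> W s t)" if "s < t" for t
    using Pmu_pos[OF that] by (intro continuous_intros Emu_continuous[OF f(1) fB that]) auto
  show "0 \<le> Emu_surv M \<mu> \<kappa> W s f u t / Pmu_surv M \<mu> \<kappa> W s t \<and> Emu_surv M \<mu> \<kappa> W s f u t / Pmu_surv M \<mu> \<kappa> W s t \<le> B"
    if "s < t" "u \<in> {s..t}" for t u
    using Emu_bounds[OF fm f(2,3) that(1)] that(2) by simp
  show "\<exists>u1\<ge>s. \<exists>T>0. \<forall>t u. u1 \<le> u \<longrightarrow> u < t \<longrightarrow> T * (g t)\<^sup>2 \<le> t - u \<longrightarrow>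
    \<bar>Emu_surv M \<mu> \<kappa> W s f u t / Pmu_surv M \<mu> \<kappa> W s t - unit_ip (\<lambda>z. f z * ground z)\<bar> \<le> e" if "0 < e" for e
    by (rule Emu_ratio_limit[OF f that])
qed

lemma Emu_add_const:
  assumes f: "f \<in> borel_measurable borel" "\<And>z. \<bar>f z\<bar> \<le> B" and tu: "s < t" "s \<le> u"
  shows "Emu_surv M \<mu> \<kappa> W s (\<lambda>z. f z + c) u t = Emu_surv M \<mu> \<kappa> W s f u t + c * Pmu_surv M \<mu> \<kappa> W s t"
proof -
  let ?i = "\<lambda>x \<omega>. indicator {\<omega>. ereal t < tauX \<kappa> W s x \<omega>} \<omega> :: real"
  have "num (\<lambda>z. f z + c) u t x = num f u t x + c * num (\<lambda>_. 1) u t x" for x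
  proof -
    have i: "integrable M (\<lambda>\<omega>. f (Xproc \<kappa> W s x u \<omega>) * ?i x \<omega>)"
      by (rule bounded_integrable[OF num_integrand[OF f(1) tu], where B=B])
        (use f(2) order_trans[OF abs_ge_zero f(2)[of 0]] in \<open>auto simp: indicator_def\<close>)
    have j: "integrable M (\<lambda>\<omega>. 1 * ?i x \<omega>)"
      by (rule bounded_integrable[OF num_integrand[of "\<lambda>_. 1", OF _ tu], where B=1]) (auto simp: indicator_def)
    have "num (\<lambda>z. f z + c) u t x = (\<integral>\<omega>. f (Xproc \<kappa> W s x u \<omega>) * ?i x \<omega> + c * (1 * ?i x \<omega>) \<partial>M)"
      by (simp add: num_def distrib_right)
    also have "\<dots> = num f u t x + c * num (\<lambda>_. 1) u t x"
      unfolding num_def by (subst Bochner_Integration.integral_add[OF i integrable_mult_right[OF j]]) simp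
    finally show ?thesis .
  qed
  moreover have "integrable \<mu> (num f u t)" by (rule num_integrable[OF f tu])
  moreover have "integrable \<mu> (num (\<lambda>_. 1) u t)" by (rule num_integrable[where B=1]) (use tu in auto)
  ultimately show ?thesis by (simp add: Emu_eq Pmu_eq[of t u])
qed

text \<open>Signed \<open>f\<close> is shifted by its bound \<open>B\<close>. The constant
  contributes \<open>B * (t - s) / t\<close> to the average and \<open>B\<close> to the limit,
  because the squared ground state integrates to 1 over the interval.\<close>

lemma average_limit_beta:
  assumes f: "continuous_on UNIV f" "\<And>z. \<bar>f z\<bar> \<le> B"
  shows "((\<lambda>t. (1 / t) * (\<integral>u\<in>{s..t}. Emu_surv M \<mu> \<kappa> W s f u t / Pmu_surv M \<mu> \<kappa> W s t \<partial>lborel))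
       \<longlongrightarrow> (\<integral>x. f x \<partial>beta_Bm M W)) at_top"
proof -
  have fm[measurable]: "f \<in> borel_measurable borel" using f(1) by (rule borel_measurable_continuous_onI)
  let ?R = "\<lambda>f t u. Emu_surv M \<mu> \<kappa> W s f u t / Pmu_surv M \<mu> \<kappa> W s t"
  let ?f = "\<lambda>z. f z + B"
  have fB: "0 \<le> ?f z" "?f z \<le> 2 * B" for z using f(2)[of z] by (auto simp: abs_le_iff)
  have "((\<lambda>t. (1 / t) * (\<integral>u\<in>{s..t}. ?R ?f t u \<partial>lborel)) \<longlongrightarrow> unit_ip (\<lambda>z. ?f z * ground z)) at_top"
    by (rule nonneg_average_limit[OF _ fB]) (intro continuous_intros f(1))
  moreover have "((\<lambda>t. B * (t - s) / t) \<longlongrightarrow> B) at_top" by real_asymp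
  ultimately have "((\<lambda>t. (1 / t) * (\<integral>u\<in>{s..t}. ?R ?f t u \<partial>lborel) - B * (t - s) / t) \<longlongrightarrow> unit_ip (\<lambda>z. ?f z * ground z) - B) at_top"
    by (rule tendsto_diff)
  moreover have "\<forall>\<^sub>F t in at_top. (1 / t) * (\<integral>u\<in>{s..t}. ?R ?f t u \<partial>lborel) - B * (t - s) / t = (1 / t) * (\<integral>u\<in>{s..t}. ?R f t u \<partial>lborel)"
    using eventually_gt_at_top[of s]
  proof eventually_elim
    case (elim t)
    have P: "0 < Pmu_surv M \<mu> \<kappa> W s t" by (rule Pmu_pos[OF elim])
    have iR: "set_integrable lborel {s..t} (?R f t)"
      using P by (intro borel_integrable_atLeastAtMost' continuous_intros Emu_continuous[OF f elim]) auto
    have iB: "set_integrable lborel {s..t} (\<lambda>_. B)"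
      by (intro borel_integrable_atLeastAtMost' continuous_intros)
    have "(\<integral>u\<in>{s..t}. ?R ?f t u \<partial>lborel) = (\<integral>u\<in>{s..t}. (?R f t u + B) \<partial>lborel)"
      by (intro set_lebesgue_integral_cong) (use P elim Emu_add_const[OF fm f(2) elim] in \<open>auto simp: add_divide_distrib\<close>)
    also have "\<dots> = (\<integral>u\<in>{s..t}. ?R f t u \<partial>lborel) + (\<integral>u\<in>{s..t}. B \<partial>lborel)"
      by (rule set_integral_add(2)[OF iR iB])
    also have "(\<integral>u\<in>{s..t}. B \<partial>lborel) = B * (t - s)"
      using elim by (simp add: set_lebesgue_integral_def)
    finally show ?case using elim s by (simp add: field_simps)
  qed
  ultimately have lim: "((\<lambda>t. (1 / t) * (\<integral>u\<in>{s..t}. ?R f t u \<partial>lborel)) \<longlongrightarrow> unit_ip (\<lambda>z. ?f z * ground z) - B) at_top"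
    by (rule Lim_transform_eventually)
  have B: "0 \<le> B" by (rule order_trans[OF abs_ge_zero f(2)[of 0]])
  have i: "integrable lborel (\<lambda>y. indicator {-1..1} y * (f y * ground y * ground y))"
  proof (rule unit_ip_integrable)
    show "\<bar>f x * ground x\<bar> \<le> B" for x using mult_mono[OF f(2)[of x] ground_bounds[of x]] B by (simp add: abs_mult)
  qed measurable
  have j: "integrable lborel (\<lambda>y. indicator {-1..1} y * (ground y * ground y))"
    by (rule unit_ip_integrable[OF ground_measurable ground_bounds])
  have "unit_ip (\<lambda>z. ?f z * ground z) =
      (\<integral>y. indicator {-1..1} y * (f y * ground y * ground y) + B * (indicator {-1..1} y * (ground y * ground y)) \<partial>lborel)"
    unfolding unit_ip_def by (intro Bochner_Integration.integral_cong refl) (simp add: algebra_simps)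
  also have "\<dots> = unit_ip (\<lambda>z. f z * ground z) + B * unit_ip ground"
    unfolding unit_ip_def by (subst Bochner_Integration.integral_add[OF i integrable_mult_right[OF j]]) simp
  finally show ?thesis using lim by (simp add: unit_ip_ground integral_beta_Bm[OF fm])
qed

end

theorem theorem5:
  fixes M :: "'a measure" and W :: "real \<Rightarrow> 'a \<Rightarrow> real"
    and \<kappa> s :: real and \<mu> :: "real measure"
  assumes BM: "std_BM M W"
    and kappa: "0 < \<kappa>" "\<kappa> < 1/2"
    and mu: "sets \<mu> = sets borel" "prob_space \<mu>" "emeasure \<mu> {-1<..<1} = 1"
    and s: "0 \<le> s"
  shows "\<forall>f :: real \<Rightarrow> real. continuous_on UNIV f \<and> bounded (range f) \<longrightarrow>
    ((\<lambda>t. (1 / t) * (\<integral>u\<in>{s..t}. Emu_surv M \<mu> \<kappa> W s f u t / Pmu_surv M \<mu> \<kappa> W s t \<partial>lborel))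
       \<longlongrightarrow> (\<integral>x. f x \<partial>beta_Bm M W)) at_top"
proof (intro allI impI, elim conjE)
  interpret moving_boundary M W \<kappa> s \<mu>
    by (intro moving_boundary.intro brownian.intro moving_boundary_axioms.intro assms)
  fix f :: "real \<Rightarrow> real" assume f: "continuous_on UNIV f" "bounded (range f)"
  from f(2)[unfolded bounded_iff] obtain B where "\<forall>y\<in>range f. norm y \<le> B" ..
  then have "\<bar>f z\<bar> \<le> B" for z by simp
  with f(1) show "((\<lambda>t. (1 / t) * (\<integral>u\<in>{s..t}. Emu_surv M \<mu> \<kappa> W s f u t / Pmu_surv M \<mu> \<kappa> W s t \<partial>lborel))
       \<longlongrightarrow> (\<integral>x. f x \<partial>beta_Bm M W)) at_top"
    by (rule average_limit_beta)
qed

end
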